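(* Let $\mathbf{k}\in\mathbb{N}^d$. The mixed multiplicity of maximal degree of $M$ of the type $\mathbf{k}$ is defined if and only if there exists a mixed multiplicity system $\mathbf{x}$ of $M$ of the type $\mathbf{k}$. In this case, for any mixed multiplicity system $\mathbf{x}$ of $M$ of the type $\mathbf{k}$, $$\chi(\mathbf{x},M)=\widetilde{e}(\mathbf{x},M)=e(M;\mathbf{k}).$$
   Context: $\mathbb{N}$ denotes the nonnegative integers and $d\ge 1$ is an integer. $(A,\mathfrak{m})$ is an Artinian local ring with infinite residue field; $S=\bigoplus_{\mathbf{n}\in\mathbb{N}^d}S_{\mathbf{n}}$ is a finitely generated standard $\mathbb{N}^d$-graded (commutative) algebra over $A$, i.e. $S$ is generated over $A$ by elements of total degree $1$; $M=\bigoplus_{\mathbf{n}\in\mathbb{N}^d}M_{\mathbf{n}}$ is a finitely generated $\mathbb{N}^d$-graded $S$-module. On $\mathbb{N}^d$, $\le$ is componentwise, and $\mathbf{h}>\mathbf{k}$ means $\mathbf{h}\ge\mathbf{k}$ and $\mathbf{h}\ne\mathbf{k}$. "For all large $\mathbf{n}$" (or $\mathbf{n}\gg\mathbf{0}$) means for all $\mathbf{n}$ with every component sufficiently large. Let $\mathbf{e}_i$ be the $i$-th unit vector of $\mathbb{N}^d$, $S_i=S_{\mathbf{e}_i}$, and $S_{++}=\bigoplus_{\mathbf{n}\ge(1,\ldots,1)}S_{\mathbf{n}}$. $\mathrm{Proj}\,S$ is the set of homogeneous prime ideals of $S$ not containing $S_{++}$; $\mathrm{Supp}_{++}M=\{P\in\mathrm{Proj}\,S: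 M_P\ne0\}$; its dimension is the supremum of lengths of chains of primes in it, with $\dim\emptyset=-\infty$. Mixed multiplicities: $\ell_A$ denotes length. For all large $\mathbf{n}$, $\ell_A[M_{\mathbf{n}}]$ equals a polynomial $P_M(\mathbf{n})$ (the Hilbert polynomial), written uniquely as $P_M(\mathbf{n})=\sum_{\mathbf{k}\in\mathbb{N}^d}e(M;\mathbf{k})\binom{\mathbf{n}+\mathbf{k}}{\mathbf{k}}$ with $e(M;\mathbf{k})\in\mathbb{Z}$, where $\binom{\mathbf{n}+\mathbf{k}}{\mathbf{k}}=\prod_{i=1}^d\binom{n_i+k_i}{k_i}$. The mixed multiplicity (of maximal degree) of $M$ of the type $\mathbf{k}$ is defined if $e(M;\mathbf{h})=0$ for all $\mathbf{h}>\mathbf{k}$, and is then the number $e(M;\mathbf{k})$. Mixed multiplicity systems: a sequence of elements of $\bigcup_{j=1}^dS_j$ consisting of $k_1$ elements of $S_1$, ..., $k_d$ elements of $S_d$ (in any order) is said to be of the type $\mathbf{k}=(k_1,\ldots,k_d)$. A sequence $\mathbf{x}$ of the type $\mathbf{k}$ is a mixed multiplicity system of $M$ of the type $\mathbf{k}$ if $\dim\mathrm{Supp}_{++}(M/\mathbf{x}M)\le0$. Let $\mathbf{x}=x_1,\ldots,x_n$ be a mixed multiplicity system of $M$. The mixed multiplicity symbol $\widetilde{e}(\mathbf{x},M)$ is defined by induction on $n$: if $n=0$, then $\ell_A[M_{\mathbf{n}}]=c$ is constant for all $\mathbf{n}\gg\mathbf{0}$ and $\widetilde{e}(\emptyset,M)=c$;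 if $n>0$, $\widetilde{e}(\mathbf{x},M)=\widetilde{e}(\mathbf{x}',M/x_1M)-\widetilde{e}(\mathbf{x}',0_M:x_1)$ with $\mathbf{x}'=x_2,\ldots,x_n$ (which is a mixed multiplicity system of both modules), where $0_M:x_1=\{m\in M:x_1m=0\}$. The Euler–Poincaré characteristic is $\chi(\mathbf{x},M)=\sum_{i=0}^n(-1)^i\ell_A[H_i(\mathbf{x},M)_{\mathbf{n}}]$ for $\mathbf{n}\gg\mathbf{0}$ (this is constant), where $H_i(\mathbf{x},M)$ is the $i$-th ($\mathbb{N}^d$-graded) Koszul homology module of $M$ with respect to $\mathbf{x}$. *)

theory Defs
  imports
    "HOL-Algebra.QuotRing"
    "HOL-Algebra.Module"
    "HOL-Algebra.Generated_Rings"
    "HOL-Analysis.Finite_Cartesian_Product"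
    "HOL-Library.Extended_Nat"
    "HOL-Library.Extended_Real"
begin

section \<open>Chains, Artinian local rings and length\<close>

text \<open>A chain \<open>C\<^sub>0 \<subset> \<dots> \<subset> C\<^sub>l\<close> has length \<open>l\<close>.\<close>

definition chain_lengths :: "'a set set \<Rightarrow> nat set" where
  "chain_lengths C = {l. \<exists>cs. length cs = Suc l \<and> set cs \<subseteq> C \<and> sorted_wrt (\<subset>) cs}"

locale artinian_ring = ring +
  assumes descending_chain_condition:
    "\<lbrakk>\<And>n. ideal (I n) R; \<And>n. I (Suc n) \<subseteq> I n\<rbrakk> \<Longrightarrow> \<exists>N. \<forall>n\<ge>N. I n = I N"

locale artinian_local_ring = cring A + artinian_ring A + maximalideal \<mm> A
  for A (structure) and \<mm> +
  assumes unique_maximal: "maximalideal \<nn> A \<Longrightarrow> \<nn> = \<mm>"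

definition module_length :: "('a, 'z) ring_scheme \<Rightarrow> ('a, 'b, 'y) module_scheme \<Rightarrow> enat" where
  "module_length R M = Sup (enat ` chain_lengths {N. submodule N R M})"


section \<open>Graded algebras and modules\<close>

text \<open>
  The exponents in \<open>\<nat>\<^sup>d\<close> are the elements of \<^typ>\<open>nat ^ 'd\<close>, with \<open>d = CARD('d)\<close>.  The library order
  on this type is the componentwise one, so that \<open>h > k\<close> means \<open>h \<ge> k\<close> and \<open>h \<noteq> k\<close>;
  \<open>1\<close> is \<open>(1, \<dots>, 1)\<close> and \<open>axis i 1\<close> is the \<open>i\<close>-th unit vector.
\<close>

definition for_large :: "(nat ^ 'd::finite \<Rightarrow> bool) \<Rightarrow> bool" where
  "for_large P \<longleftrightarrow> (\<exists>N. \<forall>n\<ge>N. P n)"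

record ('a, 'b, 'i) graded_module = "('a, 'b) module" +
  component :: "'i \<Rightarrow> 'b set"

locale graded_group = abelian_group M
  for M :: "('a, 'b, 'i, 'z) graded_module_scheme" (structure) +
  assumes component_subgroup: "additive_subgroup (component M n) M"
    and decomposition: "x \<in> carrier M \<Longrightarrow>
      \<exists>!f. (\<forall>n. f n \<in> component M n) \<and> finite {n. f n \<noteq> \<zero>} \<and> x = finsum M f {n. f n \<noteq> \<zero>}"

locale graded_algebra = algebra A S + graded_group S
  for A and S :: "('a, 's, nat ^ 'd::finite, 'z) graded_module_scheme" (structure) +
  assumes component_submodule: "submodule (component S n) A S"
    and component_mult:
      "\<lbrakk>x \<in> component S m; y \<in> component S n\<rbrakk> \<Longrightarrow> x \<otimes> y \<in> component S (m + n)"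

definition generated_subalgebra ::
    "('a, 'y) ring_scheme \<Rightarrow> ('a, 's, 'z) module_scheme \<Rightarrow> 's set \<Rightarrow> 's set" where
  "generated_subalgebra A S F = generate_ring S ((\<lambda>a. a \<odot>\<^bsub>S\<^esub> \<one>\<^bsub>S\<^esub>) ` carrier A \<union> F)"

locale standard_graded_algebra = graded_algebra +
  assumes finitely_generated:
      "\<exists>F. finite F \<and> F \<subseteq> carrier S \<and> generated_subalgebra A S F = carrier S"
    and standard: "generated_subalgebra A S (\<Union>i. component S (axis i 1)) = carrier S"

locale fg_graded_module = module S M + graded_group M
  for S :: "('a, 's, nat ^ 'd::finite, 'z) graded_module_scheme"
    and M :: "('s, 'm, nat ^ 'd, 'y) graded_module_scheme" (structure) +
  assumes component_smult:
      "\<lbrakk>x \<in> component S m; y \<in> component M n\<rbrakk> \<Longrightarrow> x \<odot> y \<in> component M (m + n)"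
    and finitely_generated:
      "\<exists>F. finite F \<and> F \<subseteq> carrier M \<and> (\<forall>N. submodule N S M \<and> F \<subseteq> N \<longrightarrow> N = carrier M)"

text \<open>The homogeneous component \<open>M\<^sub>n\<close> as a module over the base ring \<open>A\<close>, via \<open>A \<rightarrow> S\<close>.\<close>

definition component_module ::
    "('a, 's, 'z) module_scheme \<Rightarrow> ('s, 'm, 'i, 'y) graded_module_scheme \<Rightarrow> 'i \<Rightarrow> ('a, 'm) module"
  where
  "component_module S M n =
    \<lparr>carrier = component M n, mult = mult M, one = one M, zero = zero M, add = add M,
     smult = (\<lambda>a m. (a \<odot>\<^bsub>S\<^esub> \<one>\<^bsub>S\<^esub>) \<odot>\<^bsub>M\<^esub> m)\<rparr>"

text \<open>
  \<^const>\<open>the_enat\<close> is unspecified at \<open>\<infinity>\<close>, but \<open>M\<^sub>n\<close> has finite length when \<open>S\<close> is standard graded over an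
  Artinian local ring \<open>A\<close> and \<open>M\<close> is finitely generated.
\<close>

definition component_length ::
    "('a, 'x) ring_scheme \<Rightarrow> ('a, 's, 'z) module_scheme \<Rightarrow>
     ('s, 'm, 'i, 'y) graded_module_scheme \<Rightarrow> 'i \<Rightarrow> int" where
  "component_length A S M n = int (the_enat (module_length A (component_module S M n)))"


section \<open>Graded submodules and quotients\<close>

definition graded_sub ::
    "('s, 'm, 'i, 'y) graded_module_scheme \<Rightarrow> 'm set \<Rightarrow> ('s, 'm, 'i, 'y) graded_module_scheme" where
  "graded_sub M N = M\<lparr>carrier := N, component := (\<lambda>n. N \<inter> component M n)\<rparr>"

text \<open>
  The mixed multiplicity symbol is defined by a recursion that passes from \<open>M\<close> to a quotient of
  \<open>M\<close>, so a quotient must live on the same type as \<open>M\<close>.  We therefore realise \<open>M/N\<close> on a set of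
  representatives of the cosets of \<open>N\<close> rather than on the cosets themselves;
  \<open>coset_rep M N\<close> is the canonical projection \<open>M \<rightarrow> M/N\<close>.  The lemmas below confirm that this is a
  module and that \<open>coset_rep M N\<close> is a homomorphism onto it with kernel \<open>N\<close>.
\<close>

definition coset_rep :: "('s, 'm, 'y) module_scheme \<Rightarrow> 'm set \<Rightarrow> 'm \<Rightarrow> 'm" where
  "coset_rep M N m = (SOME m'. m' \<in> N +>\<^bsub>M\<^esub> m)"

definition graded_quot ::
    "('s, 'm, 'i, 'y) graded_module_scheme \<Rightarrow> 'm set \<Rightarrow> ('s, 'm, 'i, 'y) graded_module_scheme" where
  "graded_quot M N = M\<lparr>
     carrier := coset_rep M N ` carrier M,
     zero := coset_rep M N \<zero>\<^bsub>M\<^esub>,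
     add := (\<lambda>a b. coset_rep M N (a \<oplus>\<^bsub>M\<^esub> b)),
     smult := (\<lambda>s a. coset_rep M N (s \<odot>\<^bsub>M\<^esub> a)),
     component := (\<lambda>n. coset_rep M N ` component M n)\<rparr>"

context
  fixes S (structure) and M :: "('s, 'm, 'i, 'y) graded_module_scheme" and N
  assumes M: "module S M" and N: "submodule N S M"
begin

interpretation module S M by (rule M)

interpretation N: submodule N S M by (rule N)

interpretation N: abelian_subgroup N M
  by (intro abelian_subgroupI3 additive_subgroupI N.subgroup_axioms M.abelian_group_axioms)

lemma coset_rep_in_coset: "m \<in> carrier M \<Longrightarrow> coset_rep M N m \<in> N +>\<^bsub>M\<^esub> m"
  unfolding coset_rep_def by (rule someI[of _ m]) (rule N.a_rcos_self)

lemma coset_rep_closed: "m \<in> carrier M \<Longrightarrow> coset_rep M N m \<in> carrier M"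
  using coset_rep_in_coset N.a_elemrcos_carrier by blast

lemma coset_rep_eq_iff:
  assumes "m \<in> carrier M" "m' \<in> carrier M"
  shows "coset_rep M N m = coset_rep M N m' \<longleftrightarrow> m \<ominus>\<^bsub>M\<^esub> m' \<in> N"
proof -
  have "coset_rep M N m = coset_rep M N m' \<longleftrightarrow> N +>\<^bsub>M\<^esub> m = N +>\<^bsub>M\<^esub> m'"
    using assms coset_rep_in_coset N.a_repr_independence' coset_rep_def by metis
  also have "\<dots> \<longleftrightarrow> m \<in> N +>\<^bsub>M\<^esub> m'"
    using assms N.a_repr_independence' N.a_rcos_self by metis
  also have "\<dots> \<longleftrightarrow> m \<ominus>\<^bsub>M\<^esub> m' \<in> N"
    using assms N.a_rcos_module M.minus_eq by metis
  finally show ?thesis .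
qed

lemma coset_rep_kernel: "m \<in> carrier M \<Longrightarrow> coset_rep M N m = \<zero>\<^bsub>graded_quot M N\<^esub> \<longleftrightarrow> m \<in> N"
  using M.add.inv_one by (simp add: graded_quot_def coset_rep_eq_iff M.minus_eq a_inv_def)

lemma coset_rep_add:
  assumes m: "m \<in> carrier M" and m': "m' \<in> carrier M"
  shows "coset_rep M N (m \<oplus>\<^bsub>M\<^esub> m') = coset_rep M N m \<oplus>\<^bsub>graded_quot M N\<^esub> coset_rep M N m'"
proof -
  let ?q = "coset_rep M N"
  have "m \<ominus>\<^bsub>M\<^esub> ?q m \<in> N" "m' \<ominus>\<^bsub>M\<^esub> ?q m' \<in> N"
    using m m' coset_rep_closed coset_rep_in_coset coset_rep_eq_iff
      N.a_repr_independence' coset_rep_def by metis+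
  hence "(m \<ominus>\<^bsub>M\<^esub> ?q m) \<oplus>\<^bsub>M\<^esub> (m' \<ominus>\<^bsub>M\<^esub> ?q m') \<in> N" by simp
  moreover have "(m \<ominus>\<^bsub>M\<^esub> ?q m) \<oplus>\<^bsub>M\<^esub> (m' \<ominus>\<^bsub>M\<^esub> ?q m') = (m \<oplus>\<^bsub>M\<^esub> m') \<ominus>\<^bsub>M\<^esub> (?q m \<oplus>\<^bsub>M\<^esub> ?q m')"
    using m m' coset_rep_closed by (simp add: M.minus_eq M.minus_add M.a_ac)
  ultimately show ?thesis
    using m m' coset_rep_closed by (simp add: graded_quot_def coset_rep_eq_iff)
qed

lemma coset_rep_smult:
  assumes s: "s \<in> carrier S" and m: "m \<in> carrier M"
  shows "coset_rep M N (s \<odot>\<^bsub>M\<^esub> m) = s \<odot>\<^bsub>graded_quot M N\<^esub> coset_rep M N m"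
proof -
  let ?q = "coset_rep M N"
  have "m \<ominus>\<^bsub>M\<^esub> ?q m \<in> N"
    using m coset_rep_closed coset_rep_in_coset coset_rep_eq_iff
      N.a_repr_independence' coset_rep_def by metis
  hence "s \<odot>\<^bsub>M\<^esub> (m \<ominus>\<^bsub>M\<^esub> ?q m) \<in> N" using s by simp
  moreover have "s \<odot>\<^bsub>M\<^esub> (m \<ominus>\<^bsub>M\<^esub> ?q m) = (s \<odot>\<^bsub>M\<^esub> m) \<ominus>\<^bsub>M\<^esub> (s \<odot>\<^bsub>M\<^esub> ?q m)"
    using s m coset_rep_closed by (simp add: M.minus_eq smult_r_distr smult_r_minus)
  ultimately show ?thesis
    using s m coset_rep_closed by (simp add: graded_quot_def coset_rep_eq_iff)
qed

lemma module_graded_quot: "module S (graded_quot M N)"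
proof -
  let ?Q = "graded_quot M N" and ?q = "coset_rep M N"
  have carr: "carrier ?Q = ?q ` carrier M" and zero: "\<zero>\<^bsub>?Q\<^esub> = ?q \<zero>\<^bsub>M\<^esub>"
    by (simp_all add: graded_quot_def)
  note hom = coset_rep_add[symmetric] coset_rep_smult[symmetric]
  show ?thesis
  proof (rule moduleI)
    show "cring S" by (rule R.is_cring)
    show "abelian_group ?Q"
    proof (rule abelian_groupI)
      fix x assume "x \<in> carrier ?Q"
      then obtain m where m: "m \<in> carrier M" "x = ?q m" by (auto simp: carr)
      show "\<exists>y\<in>carrier ?Q. y \<oplus>\<^bsub>?Q\<^esub> x = \<zero>\<^bsub>?Q\<^esub>"
        using m by (intro bexI[of _ "?q (\<ominus>\<^bsub>M\<^esub> m)"]) (auto simp: carr zero hom M.l_neg)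
    qed (auto simp: carr zero hom M.a_ac)
  qed (auto simp: carr hom smult_l_distr smult_r_distr smult_assoc1)
qed

end

definition seq_submodule :: "('s, 'm, 'y) module_scheme \<Rightarrow> 's list \<Rightarrow> 'm set" where
  "seq_submodule M xs =
    {finsum M (\<lambda>i. (xs ! i) \<odot>\<^bsub>M\<^esub> m i) {..<length xs} | m. \<forall>i<length xs. m i \<in> carrier M}"

definition zero_colon ::
    "('s, 'm, 'i, 'y) graded_module_scheme \<Rightarrow> 's \<Rightarrow> ('s, 'm, 'i, 'y) graded_module_scheme" where
  "zero_colon M x = graded_sub M {m \<in> carrier M. x \<odot>\<^bsub>M\<^esub> m = \<zero>\<^bsub>M\<^esub>}"


section \<open>Localization, \<open>Proj\<close> and support\<close>

definition localization_rel ::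
    "('s, 'z) ring_scheme \<Rightarrow> ('s, 'm, 'y) module_scheme \<Rightarrow> 's set \<Rightarrow> (('m \<times> 's) \<times> ('m \<times> 's)) set" where
  "localization_rel S M P =
    {((m, s), (m', s')). m \<in> carrier M \<and> m' \<in> carrier M \<and>
       s \<in> carrier S - P \<and> s' \<in> carrier S - P \<and>
       (\<exists>u \<in> carrier S - P. u \<odot>\<^bsub>M\<^esub> (s' \<odot>\<^bsub>M\<^esub> m) = u \<odot>\<^bsub>M\<^esub> (s \<odot>\<^bsub>M\<^esub> m'))}"

text \<open>
  Fractions are equivalence classes of pairs, and \<open>M\<^sub>P\<close> is formed as a module over \<open>S\<close> (not \<open>S\<^sub>P\<close>).
  The fields \<^const>\<open>mult\<close> and \<^const>\<open>one\<close>, which the record for modules inherits from rings, are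
  irrelevant here and below.
\<close>

definition localization ::
    "('s, 'z) ring_scheme \<Rightarrow> ('s, 'm, 'y) module_scheme \<Rightarrow> 's set \<Rightarrow> ('s, ('m \<times> 's) set) module" where
  "localization S M P =
    (let frac = (\<lambda>m s. localization_rel S M P `` {(m, s)}) in
     \<lparr>carrier = (carrier M \<times> (carrier S - P)) // localization_rel S M P,
      mult = undefined, one = undefined,
      zero = frac \<zero>\<^bsub>M\<^esub> \<one>\<^bsub>S\<^esub>,
      add = (\<lambda>c c'. \<Union>(m, s) \<in> c. \<Union>(m', s') \<in> c'.
               frac (s' \<odot>\<^bsub>M\<^esub> m \<oplus>\<^bsub>M\<^esub> s \<odot>\<^bsub>M\<^esub> m') (s \<otimes>\<^bsub>S\<^esub> s')),
      smult = (\<lambda>r c. \<Union>(m, s) \<in> c. frac (r \<odot>\<^bsub>M\<^esub> m) s)\<rparr>)"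

definition irrelevant_ideal :: "('a, 's, nat ^ 'd::finite, 'z) graded_module_scheme \<Rightarrow> 's set" where
  "irrelevant_ideal S =
    {finsum S f F | f F. finite F \<and> (\<forall>n\<in>F. 1 \<le> n \<and> f n \<in> component S n)}"

definition homogeneous_ideal :: "'s set \<Rightarrow> ('a, 's, 'i, 'z) graded_module_scheme \<Rightarrow> bool" where
  "homogeneous_ideal I S \<longleftrightarrow> ideal I S \<and> I = Idl\<^bsub>S\<^esub> (I \<inter> (\<Union>n. component S n))"

definition Proj :: "('a, 's, nat ^ 'd::finite, 'z) graded_module_scheme \<Rightarrow> 's set set" where
  "Proj S = {P. primeideal P S \<and> homogeneous_ideal P S \<and> \<not> irrelevant_ideal S \<subseteq> P}"

definition Supp ::
    "('a, 's, nat ^ 'd::finite, 'z) graded_module_scheme \<Rightarrow> ('s, 'm, 'y) module_scheme \<Rightarrow> 's set set" where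
  "Supp S M = {P \<in> Proj S. carrier (localization S M P) \<noteq> {\<zero>\<^bsub>localization S M P\<^esub>}}"

text \<open>The supremum of the empty set of extended reals is \<open>-\<infinity>\<close>, so \<open>chain_dim {} = -\<infinity>\<close>.\<close>

definition chain_dim :: "'a set set \<Rightarrow> ereal" where
  "chain_dim C = (SUP l \<in> chain_lengths C. ereal (real l))"


section \<open>Mixed multiplicities\<close>

text \<open>
  \<open>hilbert_coeff A S M k\<close> is \<open>e(M; k)\<close>.  The coefficient family exists and is unique when \<open>S\<close> is
  standard graded over an Artinian local ring \<open>A\<close> and \<open>M\<close> is finitely generated.
\<close>

definition hilbert_coeff ::
    "('a, 'x) ring_scheme \<Rightarrow> ('a, 's, 'z) module_scheme \<Rightarrow>
     ('s, 'm, nat ^ 'd::finite, 'y) graded_module_scheme \<Rightarrow> nat ^ 'd \<Rightarrow> int" where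
  "hilbert_coeff A S M = (THE e. finite {k. e k \<noteq> 0} \<and>
     for_large (\<lambda>n. component_length A S M n =
       (\<Sum>k | e k \<noteq> 0. e k * (\<Prod>i\<in>UNIV. int ((n $ i + k $ i) choose (k $ i))))))"

definition mixed_multiplicity_defined ::
    "('a, 'x) ring_scheme \<Rightarrow> ('a, 's, 'z) module_scheme \<Rightarrow>
     ('s, 'm, nat ^ 'd::finite, 'y) graded_module_scheme \<Rightarrow> nat ^ 'd \<Rightarrow> bool" where
  "mixed_multiplicity_defined A S M k \<longleftrightarrow> (\<forall>h>k. hilbert_coeff A S M h = 0)"


section \<open>Mixed multiplicity systems and the mixed multiplicity symbol\<close>

text \<open>
  A sequence of elements of \<open>S\<^sub>1 \<union> \<dots> \<union> S\<^sub>d\<close> is a list of pairs \<open>(x, j)\<close> with \<open>x \<in> S\<^sub>j\<close>.  For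
  \<open>x \<noteq> 0\<close> the index \<open>j\<close> is determined by \<open>x\<close>; it is recorded because \<open>0\<close> lies in every \<open>S\<^sub>j\<close>,
  while both the type of the sequence and the grading of its Koszul complex depend on the index.
\<close>

definition sequence_of_type ::
    "('a, 's, nat ^ 'd::finite, 'z) graded_module_scheme \<Rightarrow> nat ^ 'd \<Rightarrow> ('s \<times> 'd) list \<Rightarrow> bool" where
  "sequence_of_type S k xs \<longleftrightarrow>
    (\<forall>(x, j) \<in> set xs. x \<in> component S (axis j 1)) \<and>
    (\<forall>j. count_list (map snd xs) j = k $ j)"

definition mixed_multiplicity_system ::
    "('a, 's, nat ^ 'd::finite, 'z) graded_module_scheme \<Rightarrow>
     ('s, 'm, nat ^ 'd, 'y) graded_module_scheme \<Rightarrow> nat ^ 'd \<Rightarrow> ('s \<times> 'd) list \<Rightarrow> bool" where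
  "mixed_multiplicity_system S M k xs \<longleftrightarrow>
    sequence_of_type S k xs \<and>
    chain_dim (Supp S (graded_quot M (seq_submodule M (map fst xs)))) \<le> 0"

primrec mixed_multiplicity_symbol ::
    "('a, 'x) ring_scheme \<Rightarrow> ('a, 's, 'z) module_scheme \<Rightarrow> ('s \<times> 'd) list \<Rightarrow>
     ('s, 'm, nat ^ 'd::finite, 'y) graded_module_scheme \<Rightarrow> int" where
  "mixed_multiplicity_symbol A S [] M = (THE c. for_large (\<lambda>n. component_length A S M n = c))"
| "mixed_multiplicity_symbol A S (x # xs) M =
     mixed_multiplicity_symbol A S xs (graded_quot M (seq_submodule M [fst x])) -
     mixed_multiplicity_symbol A S xs (zero_colon M (fst x))"


section \<open>Koszul homology\<close>

text \<open>
  An element of the \<open>i\<close>-th Koszul module \<open>K\<^sub>i(x, M)\<close> is written \<open>\<Sum>\<^sub>T f(T) e\<^sub>T\<close>, where \<open>T\<close> runs over the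
  \<open>i\<close>-element sets of positions and \<open>e\<^sub>T\<close> is the exterior product of the basis vectors \<open>e\<^sub>t\<close>, \<open>t \<in> T\<close>,
  in increasing order; it is encoded as the function \<open>f\<close>, extended by \<open>0\<close>.  The basis vector \<open>e\<^sub>t\<close>
  has the degree of \<open>x\<^sub>t\<close>, so the component of degree \<open>n\<close> at \<open>e\<^sub>T\<close> is \<open>M\<close> in degree \<open>n - deg e\<^sub>T\<close>,
  which is \<open>0\<close> unless \<open>deg e\<^sub>T \<le> n\<close>.
\<close>

definition koszul_degree :: "('s \<times> 'd) list \<Rightarrow> nat set \<Rightarrow> nat ^ 'd::finite" where
  "koszul_degree xs T = (\<Sum>t\<in>T. axis (snd (xs ! t)) 1)"

definition koszul_module ::
    "('s, 'm, nat ^ 'd::finite, 'y) graded_module_scheme \<Rightarrow> ('s \<times> 'd) list \<Rightarrow> nat \<Rightarrow>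
     ('s, nat set \<Rightarrow> 'm, nat ^ 'd) graded_module" where
  "koszul_module M xs i =
    (let K = {f. (\<forall>T. f T \<in> carrier M) \<and>
                 (\<forall>T. \<not> (T \<subseteq> {..<length xs} \<and> card T = i) \<longrightarrow> f T = \<zero>\<^bsub>M\<^esub>)} in
     \<lparr>carrier = K, mult = undefined, one = undefined,
      zero = (\<lambda>T. \<zero>\<^bsub>M\<^esub>), add = (\<lambda>f g T. f T \<oplus>\<^bsub>M\<^esub> g T),
      smult = (\<lambda>s f T. s \<odot>\<^bsub>M\<^esub> f T),
      component = (\<lambda>n. {f \<in> K. \<forall>T.
        if koszul_degree xs T \<le> n then f T \<in> component M (n - koszul_degree xs T)
        else f T = \<zero>\<^bsub>M\<^esub>})\<rparr>)"

text \<open>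
  \<open>d(e\<^sub>U) = \<Sum>\<^sub>t (-1)\<^sup>p x\<^sub>t e\<^sub>T\<close> with \<open>T = U - {t}\<close> and \<open>p\<close> the number of elements of \<open>U\<close> below \<open>t\<close>.
\<close>

definition koszul_diff ::
    "('s, 'z) ring_scheme \<Rightarrow> ('s, 'm, 'y) module_scheme \<Rightarrow> ('s \<times> 'd) list \<Rightarrow>
     (nat set \<Rightarrow> 'm) \<Rightarrow> nat set \<Rightarrow> 'm" where
  "koszul_diff S M xs f T =
    finsum M (\<lambda>t. ((\<ominus>\<^bsub>S\<^esub> \<one>\<^bsub>S\<^esub>) [^]\<^bsub>S\<^esub> card {u \<in> T. u < t} \<otimes>\<^bsub>S\<^esub> fst (xs ! t)) \<odot>\<^bsub>M\<^esub> f (insert t T))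
      ({..<length xs} - T)"

text \<open>
  For \<open>i = 0\<close> the cycles are all of \<open>K\<^sub>0\<close>, since the differential of an element of \<open>K\<^sub>0\<close> only
  involves its (zero) values at nonempty sets.
\<close>

definition koszul_homology ::
    "('s, 'z) ring_scheme \<Rightarrow> ('s, 'm, nat ^ 'd::finite, 'y) graded_module_scheme \<Rightarrow>
     ('s \<times> 'd) list \<Rightarrow> nat \<Rightarrow> ('s, nat set \<Rightarrow> 'm, nat ^ 'd) graded_module" where
  "koszul_homology S M xs i =
    graded_quot
      (graded_sub (koszul_module M xs i)
        {f \<in> carrier (koszul_module M xs i). koszul_diff S M xs f = (\<lambda>T. \<zero>\<^bsub>M\<^esub>)})
      (koszul_diff S M xs ` carrier (koszul_module M xs (Suc i)))"

definition euler_poincare ::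
    "('a, 'x) ring_scheme \<Rightarrow> ('a, 's, 'z) module_scheme \<Rightarrow> ('s \<times> 'd) list \<Rightarrow>
     ('s, 'm, nat ^ 'd::finite, 'y) graded_module_scheme \<Rightarrow> int" where
  "euler_poincare A S xs M = (THE c. for_large (\<lambda>n.
     (\<Sum>i\<le>length xs. (- 1) ^ i * component_length A S (koszul_homology S M xs i) n) = c))"

end

theory Submission
  imports Defs
begin

text \<open>
  The argument rests on the Hilbert polynomial and on its behaviour along the exact sequence
  \<open>0 \<rightarrow> (0 : x)\<^sub>n \<rightarrow> M\<^sub>n \<rightarrow> M\<^sub>n\<^sub>+\<^sub>e \<rightarrow> (M/xM)\<^sub>n\<^sub>+\<^sub>e \<rightarrow> 0\<close> of multiplication by an element \<open>x\<close> of degree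
  \<open>e = e\<^sub>i\<close>.  A difference in the \<open>i\<close>-th direction shifts the binomial coefficients of a polynomial
  by \<open>e\<^sub>i\<close>, so the sequence becomes
  \<open>e(M; h + e\<^sub>i) = e(M/xM; h) - e(0 : x; h) + e(0 : x; h + e\<^sub>i)\<close> (\<open>hilbert_coeff_exact\<close>).

  If \<open>x, x'\<close> is a mixed multiplicity system of type \<open>k\<close>, then \<open>x'\<close> is one of type \<open>k - e\<^sub>i\<close> for \<open>M/xM\<close> and
  for \<open>0 : x\<close>.  By induction the coefficients of both vanish above \<open>k - e\<^sub>i\<close>, hence those of \<open>M\<close> vanish
  above \<open>k\<close>, and at \<open>k\<close> the formula is the recursion that defines the symbol
  (\<open>mixed_multiplicity_symbol_eq\<close>).  The induction starts from the empty system: if the support has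
  no strict inclusion of primes, then the length of \<open>M\<^sub>n\<close> is eventually constant.  Conversely, over an
  infinite residue field some \<open>x \<in> S\<^sub>i\<close> annihilates no nonzero element of \<open>M\<^sub>n\<close> for large \<open>n\<close>; then
  \<open>e(M/xM; h) = e(M; h + e\<^sub>i)\<close>, and a system of \<open>M/xM\<close> together with \<open>x\<close> is a system of \<open>M\<close>
  (\<open>exists_system\<close>).  That induction starts from the fact that a strict inclusion of primes in the
  support makes the length of \<open>M\<^sub>n\<close> unbounded.

  The Euler--Poincare characteristic is an alternating sum of lengths of homology, hence of the
  lengths of the Koszul modules.  The latter is \<open>\<Sum>\<^sub>T (-1)\<^sup>c h(n - d)\<close>, where \<open>h(n)\<close> is the length of \<open>M\<^sub>n\<close>
  and the set \<open>T\<close> of positions has size \<open>c\<close> and degree \<open>d\<close>.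
  This is the iterated difference of type \<open>k\<close> of the Hilbert polynomial.  Its binomial
  coefficients are \<open>e(M; h + k)\<close>; they vanish for \<open>h \<noteq> 0\<close>, which leaves \<open>e(M; k)\<close>
  (\<open>euler_poincare_eq\<close>).

  The facts about lengths are obtained by Noetherian induction on homogeneous ideals \<open>I\<close>
  (\<open>hideal_induct\<close>), through
  \<open>0 \<rightarrow> (S/(I : a))(- deg a) \<rightarrow> S/I \<rightarrow> S/(I + aS) \<rightarrow> 0\<close>.  If \<open>I\<close> is not prime, a
  homogeneous \<open>a\<close> makes both outer ideals strictly larger than \<open>I\<close>.  If \<open>I\<close> is a prime and
  \<open>a \<in> S\<^sub>i - I\<close>, then \<open>I : a = I\<close>, and the sequence says that the difference of the length function
  of \<open>S/I\<close> in the \<open>i\<close>-th direction is the length function of \<open>S/(I + aS)\<close>.  A module \<open>M\<close> is reduced to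
  ideals by a filtration whose quotients are shifted copies of \<open>S/I\<^sub>j\<close> with \<open>Ann M \<subseteq> I\<^sub>j\<close>.

  Lengths are measured inside a fixed \<open>S\<close>-module, as lengths of chains between two of its subgroups
  that are stable under a set \<open>T\<close> of scalars.  For \<open>T\<close> the image of \<open>A\<close> this is the length over \<open>A\<close>,
  for \<open>T = S\<close> the stable subgroups are the submodules, and intermediate \<open>T\<close> occur in the proof of
  Hilbert's basis theorem.
\<close>

section \<open>Chains of sets\<close>

definition chain_len :: "'a set set \<Rightarrow> enat" where
  "chain_len C = Sup (enat ` chain_lengths C)"

lemma chain_len_ge:
  assumes "length cs = Suc l" "set cs \<subseteq> C" "sorted_wrt (\<subset>) cs"
  shows "enat l \<le> chain_len C"
  unfolding chain_len_def chain_lengths_def by (rule Sup_upper) (use assms in blast)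

lemma chain_len_le:
  assumes "\<And>l cs. length cs = Suc l \<Longrightarrow> set cs \<subseteq> C \<Longrightarrow> sorted_wrt (\<subset>) cs \<Longrightarrow> enat l \<le> e"
  shows "chain_len C \<le> e"
  unfolding chain_len_def chain_lengths_def by (rule Sup_least) (use assms in blast)

text \<open>
  An infinite supremum of chain lengths is not attained, but every finite number below the supremum
  is reached by some chain; in this form one statement covers finite and infinite lengths.
\<close>

lemma chain_len_attained:
  assumes "C \<noteq> {}" "enat n \<le> chain_len C"
  obtains cs l where "n \<le> l" "length cs = Suc l" "set cs \<subseteq> C" "sorted_wrt (\<subset>) cs"
proof -
  have "\<exists>l\<in>chain_lengths C. n \<le> l"
  proof (cases n)
    case 0
    obtain X where "X \<in> C" using assms(1) by blast
    hence "0 \<in> chain_lengths C"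
      unfolding chain_lengths_def by (auto intro!: exI[of _ "[X]"])
    thus ?thesis using 0 by auto
  next
    case (Suc m)
    show ?thesis
    proof (rule ccontr)
      assume "\<not> ?thesis"
      hence "\<forall>l\<in>chain_lengths C. l \<le> m" using Suc by auto
      hence "chain_len C \<le> enat m" unfolding chain_len_def by (auto intro!: Sup_least)
      with assms(2) Suc show False by (metis Suc_n_not_le_n enat_ord_simps(1) order_trans)
    qed
  qed
  thus ?thesis unfolding chain_lengths_def using that by blast
qed

lemma enat_add_le:
  assumes "\<And>n m. enat n \<le> a \<Longrightarrow> enat m \<le> b \<Longrightarrow> enat (n + m) \<le> (c::enat)"
  shows "a + b \<le> c"
proof (cases "a = \<infinity> \<or> b = \<infinity>")
  case True
  have "enat n \<le> c" for n
  proof (cases "a = \<infinity>")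
    case True
    thus ?thesis using assms[of n 0] by (simp add: zero_enat_def[symmetric])
  next
    case False
    hence "b = \<infinity>" using True by blast
    thus ?thesis using assms[of 0 n] by (simp add: zero_enat_def[symmetric])
  qed
  hence "c = \<infinity>" by (metis Suc_ile_eq enat_ord_simps(2) enat.exhaust order_less_irrefl)
  thus ?thesis by simp
next
  case False
  then obtain n m where "a = enat n" "b = enat m" by auto
  thus ?thesis using assms[of n m] by simp
qed

text \<open>
  At each step of a chain at least one of the two images grows, so the steps of the chain are
  distributed over a chain of images under \<open>f\<close> and a chain of images under \<open>g\<close>.
\<close>

lemma chain_split:
  fixes C :: "'a set set" and D :: "'b set set" and E :: "'c set set"
  assumes "f ` C \<subseteq> D" "g ` C \<subseteq> E"
    and mono: "\<And>X Y. X \<in> C \<Longrightarrow> Y \<in> C \<Longrightarrow> X \<subset> Y \<Longrightarrow> f X \<subseteq> f Y \<and> g X \<subseteq> g Y \<and> (f X \<noteq> f Y \<or> g X \<noteq> g Y)"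
  shows "chain_len C \<le> chain_len D + chain_len E"
proof (rule chain_len_le)
  fix l and cs :: "'a set list"
  assume cs: "length cs = Suc l" "set cs \<subseteq> C" "sorted_wrt (\<subset>) cs"
  have "\<exists>ds es. ds \<noteq> [] \<and> es \<noteq> [] \<and> set ds \<subseteq> D \<and> set es \<subseteq> E \<and> sorted_wrt (\<subset>) ds \<and>
      sorted_wrt (\<subset>) es \<and> hd ds = f (hd cs) \<and> hd es = g (hd cs) \<and> length cs + 1 \<le> length ds + length es"
    if "cs \<noteq> []" "set cs \<subseteq> C" "sorted_wrt (\<subset>) cs" for cs
    using that
  proof (induction cs)
    case (Cons x cs)
    show ?case
    proof (cases cs)
      case Nil
      thus ?thesis using Cons.prems assms(1,2) by (intro exI[of _ "[f x]"] exI[of _ "[g x]"]) auto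
    next
      case (Cons y cs')
      with Cons.IH Cons.prems obtain ds es where *: "ds \<noteq> []" "es \<noteq> []" "set ds \<subseteq> D" "set es \<subseteq> E"
        "sorted_wrt (\<subset>) ds" "sorted_wrt (\<subset>) es" "hd ds = f y" "hd es = g y"
        "length cs + 1 \<le> length ds + length es" by auto
      have xy: "x \<in> C" "y \<in> C" "x \<subset> y" using Cons Cons.prems by auto
      note m = mono[OF xy]
      have hd: "\<forall>d\<in>set ds. f y \<subseteq> d" "\<forall>d\<in>set es. g y \<subseteq> d"
        using * by (cases ds; cases es; auto)+
      define ds' where "ds' = (if f x = f y then ds else f x # ds)"
      define es' where "es' = (if g x = g y then es else g x # es)"
      have "f x \<noteq> f y \<Longrightarrow> \<forall>d\<in>set ds. f x \<subset> d" "g x \<noteq> g y \<Longrightarrow> \<forall>d\<in>set es. g x \<subset> d"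
        using m hd by blast+
      hence "sorted_wrt (\<subset>) ds'" "sorted_wrt (\<subset>) es'"
        using * unfolding ds'_def es'_def by auto
      moreover have "set ds' \<subseteq> D" "set es' \<subseteq> E" using * xy assms(1,2) unfolding ds'_def es'_def by auto
      moreover have "hd ds' = f x" "hd es' = g x" "ds' \<noteq> []" "es' \<noteq> []"
        using * unfolding ds'_def es'_def by auto
      moreover have "length (x # cs) + 1 \<le> length ds' + length es'"
        using * m unfolding ds'_def es'_def by auto
      ultimately show ?thesis by (intro exI[of _ ds'] exI[of _ es']) simp
    qed
  qed simp
  from this[of cs] cs obtain ds es where *: "ds \<noteq> []" "es \<noteq> []" "set ds \<subseteq> D" "set es \<subseteq> E"
    "sorted_wrt (\<subset>) ds" "sorted_wrt (\<subset>) es" "length cs + 1 \<le> length ds + length es" by fastforce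
  have "enat l \<le> enat (length ds - 1) + enat (length es - 1)"
    using * cs by (cases ds; cases es) auto
  also have "\<dots> \<le> chain_len D + chain_len E"
    by (intro add_mono chain_len_ge[of ds] chain_len_ge[of es]) (use * in auto)
  finally show "enat l \<le> chain_len D + chain_len E" .
qed

lemma chain_len_strict_mono:
  fixes C :: "'a set set" and D :: "'b set set"
  assumes "f ` C \<subseteq> D" "\<And>X Y. X \<in> C \<Longrightarrow> Y \<in> C \<Longrightarrow> X \<subset> Y \<Longrightarrow> f X \<subset> f Y"
  shows "chain_len C \<le> chain_len D"
proof -
  have "chain_len C \<le> chain_len D + chain_len {{} :: 'b set}"
    by (rule chain_split[of f _ _ "\<lambda>_. {}"]) (use assms in \<open>auto simp: psubset_eq\<close>)
  also have "chain_len {{} :: 'b set} \<le> 0"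
  proof (rule chain_len_le)
    fix l and cs :: "'b set list" assume "length cs = Suc l" "set cs \<subseteq> {{}}" "sorted_wrt (\<subset>) cs"
    thus "enat l \<le> 0" by (cases cs; cases "tl cs") (auto simp: zero_enat_def)
  qed
  finally show ?thesis by simp
qed

lemma chain_len_singleton: "chain_len {X} = 0"
proof -
  have "chain_len {X} \<le> 0"
  proof (rule chain_len_le)
    fix l and cs assume "length cs = Suc l" "set cs \<subseteq> {X}" "sorted_wrt (\<subset>) cs"
    thus "enat l \<le> 0" by (cases cs; cases "tl cs") (auto simp: zero_enat_def)
  qed
  thus ?thesis by simp
qed

lemma chain_append:
  assumes "D \<subseteq> C" "E \<subseteq> C" "D \<noteq> {}" "E \<noteq> {}" "\<And>X Y. X \<in> D \<Longrightarrow> Y \<in> E \<Longrightarrow> X \<subseteq> Y"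
  shows "chain_len D + chain_len E \<le> chain_len C"
proof (rule enat_add_le)
  fix n m assume "enat n \<le> chain_len D" "enat m \<le> chain_len E"
  then obtain ds l es k where ds: "n \<le> l" "length ds = Suc l" "set ds \<subseteq> D" "sorted_wrt (\<subset>) ds"
    and es: "m \<le> k" "length es = Suc k" "set es \<subseteq> E" "sorted_wrt (\<subset>) es"
    using assms(3,4) by (metis chain_len_attained)
  obtain e es' where e: "es = e # es'" using es by (cases es) auto
  have "enat (l + k) \<le> chain_len C"
  proof (rule chain_len_ge)
    show "length (ds @ es') = Suc (l + k)" using ds es e by simp
    show "set (ds @ es') \<subseteq> C" using ds es e assms by auto
    have "x \<subset> y" if "x \<in> set ds" "y \<in> set es'" for x y
    proof -
      have "x \<subseteq> e" using that ds es e assms(5)[of x e] by auto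
      moreover have "e \<subset> y" using that es e by auto
      ultimately show ?thesis by blast
    qed
    thus "sorted_wrt (\<subset>) (ds @ es')" using ds es e by (auto simp: sorted_wrt_append)
  qed
  thus "enat (n + m) \<le> chain_len C" using ds es by (meson add_mono enat_ord_simps(1) order_trans)
qed

text \<open>
  The condition is on sequences and not on the existence of maximal elements, because the proof of
  the basis theorem below compares a double sequence of sets along its diagonal.
\<close>

definition acc :: "'a set set \<Rightarrow> bool" where
  "acc C \<longleftrightarrow> (\<forall>f::nat \<Rightarrow> 'a set. (\<forall>n. f n \<in> C \<and> f n \<subseteq> f (Suc n)) \<longrightarrow> (\<exists>N. \<forall>n\<ge>N. f n = f N))"

lemma accD:
  assumes "acc C" "\<And>n. f n \<in> C" "\<And>n. f n \<subseteq> f (Suc n)"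
  obtains N where "\<And>n. n \<ge> N \<Longrightarrow> f n = f N"
  using assms unfolding acc_def by metis

text \<open>
  A failure of the induction statement could be enlarged forever, which would give a strictly
  increasing sequence.
\<close>

lemma acc_induct [consumes 2, case_names step]:
  assumes "acc C" "I \<in> C" "\<And>I. I \<in> C \<Longrightarrow> (\<And>J. J \<in> C \<Longrightarrow> I \<subset> J \<Longrightarrow> Q J) \<Longrightarrow> Q I"
  shows "Q I"
proof (rule ccontr)
  assume "\<not> Q I"
  define nxt where "nxt I = (SOME J. J \<in> C \<and> I \<subset> J \<and> \<not> Q J)" for I
  have nxt: "nxt I \<in> C \<and> I \<subset> nxt I \<and> \<not> Q (nxt I)" if "I \<in> C" "\<not> Q I" for I
    unfolding nxt_def by (rule someI_ex) (use assms(3) that in blast)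
  define f where "f n = (nxt ^^ n) I" for n
  have f: "f n \<in> C \<and> \<not> Q (f n)" for n
    by (induction n) (use nxt \<open>\<not> Q I\<close> assms(2) in \<open>auto simp: f_def\<close>)
  have "f n \<subset> f (Suc n)" for n using nxt[of "f n"] f[of n] by (auto simp: f_def)
  thus False using assms(1) f unfolding acc_def by (metis Suc_n_not_le_n le_cases psubset_eq)
qed

lemma acc_finite_len:
  assumes "chain_len C < \<infinity>"
  shows "acc C"
  unfolding acc_def
proof (intro allI impI)
  fix f :: "nat \<Rightarrow> 'a set" assume f: "\<forall>n. f n \<in> C \<and> f n \<subseteq> f (Suc n)"
  have mono: "f m \<subseteq> f n" if "m \<le> n" for m n using lift_Suc_mono_le[of f, OF _ that] f by blast
  show "\<exists>N. \<forall>n\<ge>N. f n = f N"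
  proof (rule ccontr)
    assume "\<not> ?thesis"
    hence "\<forall>N. \<exists>n>N. f N \<subset> f n" using mono by (metis le_eq_less_or_eq psubset_eq)
    then obtain g where g: "\<And>N. g N > N \<and> f N \<subset> f (g N)" by metis
    define h where "h n = f ((g ^^ n) 0)" for n
    have hs: "h n \<subset> h (Suc n)" for n using g by (simp add: h_def)
    have h: "h i \<subset> h j" if "i < j" for i j using lift_Suc_mono_less[of h, OF hs that] .
    have "enat n \<le> chain_len C" for n
      by (rule chain_len_ge[of "map h [0..<Suc n]"])
        (use f h in \<open>auto simp: sorted_wrt_map sorted_wrt_iff_nth_less h_def simp del: upt_Suc\<close>)
    hence "chain_len C = \<infinity>" by (metis Suc_ile_eq enat_ord_simps(2) enat.exhaust order_less_irrefl)
    thus False using assms by simp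
  qed
qed

lemma acc_strict_mono:
  fixes C :: "'a set set"
  assumes "acc D" "\<And>X. X \<in> C \<Longrightarrow> f X \<in> D" "\<And>X Y. X \<in> C \<Longrightarrow> Y \<in> C \<Longrightarrow> X \<subseteq> Y \<Longrightarrow> f X \<subseteq> f Y \<and> (f X = f Y \<longrightarrow> X = Y)"
  shows "acc C"
  unfolding acc_def
proof (intro allI impI)
  fix g :: "nat \<Rightarrow> 'a set" assume g: "\<forall>n. g n \<in> C \<and> g n \<subseteq> g (Suc n)"
  obtain N where N: "\<And>n. n \<ge> N \<Longrightarrow> f (g n) = f (g N)"
    using accD[OF assms(1), of "\<lambda>n. f (g n)"] g assms(2,3) by metis
  have "g N \<subseteq> g n" if "n \<ge> N" for n using lift_Suc_mono_le[of g, OF _ that] g by blast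
  thus "\<exists>N. \<forall>n\<ge>N. g n = g N" using N g assms(3) by metis
qed

section \<open>Numerical polynomials\<close>

lemma vec_le_add: "(n::nat^'d) \<le> n + m" by (simp add: less_eq_vec_def)
lemma vec_le_add2: "(n::nat^'d) \<le> m + n" by (simp add: less_eq_vec_def)
lemma vec_add_mono: "(a::nat^'d) \<le> b \<Longrightarrow> c \<le> d \<Longrightarrow> a + c \<le> b + d"
  by (simp add: less_eq_vec_def add_mono)
lemma vec_le_diff: "(a::nat^'d) \<le> n \<Longrightarrow> a + (n - a) = n"
  by (simp add: less_eq_vec_def vec_eq_iff)
lemma vec_diff_add: "(a::nat^'d) \<le> n \<Longrightarrow> n - a + a = n"
  by (simp add: less_eq_vec_def vec_eq_iff)
lemma vec_add_diff [simp]: "(n + a) - a = (n :: nat^'d)"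
  by (simp add: vec_eq_iff)

lemma vec_zero_le [simp]: "(0::nat^'d) \<le> n" by (simp add: less_eq_vec_def)

lemma for_largeI: "(\<And>n. Q n) \<Longrightarrow> for_large Q" by (simp add: for_large_def)

lemma for_large_mono: "for_large P \<Longrightarrow> (\<And>n. P n \<Longrightarrow> Q n) \<Longrightarrow> for_large Q"
  unfolding for_large_def by blast

lemma for_large_conj:
  assumes "for_large P" "for_large Q"
  shows "for_large (\<lambda>n. P n \<and> Q n)"
proof -
  obtain N N' where "\<forall>n\<ge>N. P n" "\<forall>n\<ge>N'. Q n" using assms unfolding for_large_def by blast
  thus ?thesis unfolding for_large_def
    by (intro exI[of _ "N + N'"]) (meson order_trans vec_le_add vec_le_add2)
qed

lemma for_large_mono2:
  assumes "for_large P" "for_large Q" "\<And>n. P n \<Longrightarrow> Q n \<Longrightarrow> R n"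
  shows "for_large R"
  by (rule for_large_mono[OF for_large_conj[OF assms(1,2)]]) (use assms(3) in blast)

lemma for_large_all:
  assumes "finite I" "\<And>i. i \<in> I \<Longrightarrow> for_large (P i)"
  shows "for_large (\<lambda>n. \<forall>i\<in>I. P i n)"
  using assms
proof (induction I)
  case empty
  show ?case by (simp add: for_large_def)
next
  case (insert i I)
  thus ?case using for_large_conj[of "P i" "\<lambda>n. \<forall>i\<in>I. P i n"] by simp
qed

lemma for_large_add: "for_large P \<Longrightarrow> for_large (\<lambda>n. P (n + a))"
  unfolding for_large_def by (meson order_trans vec_le_add)

lemma for_large_minus:
  assumes "for_large P" shows "for_large (\<lambda>n. a \<le> n \<and> P (n - a))"
proof -
  obtain N where N: "\<forall>n\<ge>N. P n" using assms unfolding for_large_def by blast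
  show ?thesis unfolding for_large_def
  proof (intro exI[of _ "N + a"] allI impI)
    fix n assume n: "N + a \<le> n"
    hence "N \<le> n - a" "a \<le> n" by (auto simp: less_eq_vec_def) (metis add_leD2 add_le_imp_le_diff)+
    thus "a \<le> n \<and> P (n - a)" using N by blast
  qed
qed

lemma for_large_ge: "for_large (\<lambda>n. a \<le> n)" unfolding for_large_def by blast

lemma for_large_ex: "for_large P \<Longrightarrow> \<exists>n\<ge>a. P n"
  using for_large_conj[OF _ for_large_ge[of a]] unfolding for_large_def by blast

lemma for_large_const [simp]: "for_large (\<lambda>n::nat^'d::finite. b) = b"
  using for_large_ex[of "\<lambda>n::nat^'d. b"] by (auto simp: for_large_def)

definition binom_vec :: "nat ^ 'd::finite \<Rightarrow> nat ^ 'd \<Rightarrow> int" where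
  "binom_vec k n = (\<Prod>i\<in>UNIV. int ((n $ i + k $ i) choose (k $ i)))"

lemma binom_vec_0 [simp]: "binom_vec 0 n = 1" by (simp add: binom_vec_def)

text \<open>
  Pascal's rule in the \<open>i\<close>-th factor.  This is why the Hilbert polynomial is expanded in these
  binomials: a difference acts on them by a shift of the index.
\<close>

lemma binom_vec_diff:
  fixes k n :: "nat ^ 'd::finite"
  shows
  "binom_vec k (n + axis i 1) - binom_vec k n =
    (if k $ i = 0 then 0 else binom_vec (k - axis i 1) (n + axis i 1))"
proof -
  have split: "binom_vec k n = int ((n $ i + k $ i) choose (k $ i)) *
      (\<Prod>j\<in>UNIV - {i}. int ((n $ j + k $ j) choose (k $ j)))" for k n :: "nat^'d"
    unfolding binom_vec_def by (subst prod.remove[of _ i]) auto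
  have eq: "(\<Prod>j\<in>UNIV - {i}. int (((n + axis i 1) $ j + k $ j) choose (k $ j))) =
      (\<Prod>j\<in>UNIV - {i}. int ((n $ j + k $ j) choose (k $ j)))"
    by (rule prod.cong) (auto simp: axis_def)
  have eq2: "(\<Prod>j\<in>UNIV - {i}. int (((n + axis i 1) $ j + (k - axis i 1) $ j) choose ((k - axis i 1) $ j))) =
      (\<Prod>j\<in>UNIV - {i}. int ((n $ j + k $ j) choose (k $ j)))"
    by (rule prod.cong) (auto simp: axis_def)
  show ?thesis
  proof (cases "k $ i")
    case 0
    thus ?thesis unfolding split eq by simp
  next
    case (Suc l)
    thus ?thesis unfolding split eq eq2 by (simp add: algebra_simps)
  qed
qed

definition binomial_sum :: "(nat ^ 'd::finite \<Rightarrow> int) \<Rightarrow> nat ^ 'd \<Rightarrow> int" where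
  "binomial_sum e n = (\<Sum>k | e k \<noteq> 0. e k * binom_vec k n)"

lemma binomial_sum_superset:
  "finite K \<Longrightarrow> {k. e k \<noteq> 0} \<subseteq> K \<Longrightarrow> binomial_sum e n = (\<Sum>k\<in>K. e k * binom_vec k n)"
  unfolding binomial_sum_def by (rule sum.mono_neutral_left) auto

abbreviation shift_coeff :: "nat ^ 'd::finite \<Rightarrow> (nat ^ 'd \<Rightarrow> int) \<Rightarrow> nat ^ 'd \<Rightarrow> int" where
  "shift_coeff a e \<equiv> (\<lambda>k. e (k + a))"

lemma finite_shift_coeff:
  assumes "finite {k. e k \<noteq> (0::int)}" shows "finite {k. shift_coeff a e k \<noteq> 0}"
proof -
  have "{k. shift_coeff a e k \<noteq> 0} = (\<lambda>k. k + a) -` {k. e k \<noteq> 0}" by auto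
  thus ?thesis using finite_vimageI[OF assms, of "\<lambda>k. k + a"] by (simp add: inj_def)
qed

lemma binomial_sum_diff:
  fixes e :: "nat ^ 'd::finite \<Rightarrow> int"
  assumes fin: "finite {k. e k \<noteq> 0}"
  shows "binomial_sum e (n + axis i 1) - binomial_sum e n =
    binomial_sum (shift_coeff (axis i 1) e) (n + axis i 1)"
proof -
  let ?K = "{k. e k \<noteq> 0}" and ?a = "axis i 1 :: nat^'d"
  have "binomial_sum e (n + ?a) - binomial_sum e n =
      (\<Sum>k\<in>?K. e k * (if k $ i = 0 then 0 else binom_vec (k - ?a) (n + ?a)))"
    unfolding binomial_sum_def binom_vec_diff[symmetric] by (simp add: sum_subtractf right_diff_distrib)
  also have "\<dots> = (\<Sum>k\<in>{k\<in>?K. k $ i \<noteq> 0}. e k * binom_vec (k - ?a) (n + ?a))"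
    by (rule sum.mono_neutral_cong_right) (use fin in auto)
  also have "\<dots> = (\<Sum>k | shift_coeff ?a e k \<noteq> 0. shift_coeff ?a e k * binom_vec k (n + ?a))"
  proof (rule sum.reindex_bij_witness[of _ "\<lambda>k. k + ?a" "\<lambda>k. k - ?a"])
    fix k assume "k \<in> {k\<in>?K. k $ i \<noteq> 0}"
    moreover from this have "k - ?a + ?a = k"
      by (intro vec_diff_add) (auto simp: less_eq_vec_def axis_def)
    ultimately show "k - ?a + ?a = k" "k - ?a \<in> {k. shift_coeff ?a e k \<noteq> 0}"
      "shift_coeff ?a e (k - ?a) * binom_vec (k - ?a) (n + ?a) = e k * binom_vec (k - ?a) (n + ?a)"
      by auto
  qed auto
  finally show ?thesis unfolding binomial_sum_def .
qed

text \<open>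
  The Hilbert coefficients are the only family that represents the length function in this sense;
  see \<open>represents_unique\<close> and \<open>hilbert_coeff_eq\<close> below.
\<close>

definition represents :: "(nat ^ 'd::finite \<Rightarrow> int) \<Rightarrow> (nat ^ 'd \<Rightarrow> int) \<Rightarrow> bool" where
  "represents e f \<longleftrightarrow> finite {k. e k \<noteq> 0} \<and> for_large (\<lambda>n. f n = binomial_sum e n)"

lemma represents_cong:
  "represents e f \<Longrightarrow> for_large (\<lambda>n. f n = g n) \<Longrightarrow> represents e g"
  unfolding represents_def by (auto elim: for_large_mono2)

lemma represents_zero: "represents (\<lambda>_. 0) (\<lambda>_. 0)"
  by (simp add: represents_def binomial_sum_def)

lemma represents_add:
  assumes "represents e f" "represents e' f'"
  shows "represents (\<lambda>k. e k + e' k) (\<lambda>n. f n + f' n)"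
proof -
  let ?K = "{k. e k \<noteq> 0} \<union> {k. e' k \<noteq> 0}"
  have K: "finite ?K" using assms by (auto simp: represents_def)
  have "binomial_sum (\<lambda>k. e k + e' k) n = binomial_sum e n + binomial_sum e' n" for n
    using K by (subst (1 2 3) binomial_sum_superset[OF K]) (auto simp: sum.distrib algebra_simps)
  moreover have "finite {k. e k + e' k \<noteq> 0}" by (rule finite_subset[OF _ K]) auto
  ultimately show ?thesis
    using assms unfolding represents_def by (auto elim: for_large_mono2)
qed

lemma represents_uminus:
  assumes "represents e f" shows "represents (\<lambda>k. - e k) (\<lambda>n. - f n)"
  using assms unfolding represents_def binomial_sum_def by (simp add: sum_negf)

lemma represents_diff:
  assumes "represents e f" "represents e' f'"
  shows "represents (\<lambda>k. e k - e' k) (\<lambda>n. f n - f' n)"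
  using represents_add[OF assms(1) represents_uminus[OF assms(2)]] by simp

lemma represents_const: "represents (\<lambda>k :: nat ^ 'd::finite. if k = 0 then c else 0) (\<lambda>_. c)"
proof -
  have "binomial_sum (\<lambda>k. if k = 0 then c else 0) n = c" for n :: "nat ^ 'd"
    by (subst binomial_sum_superset[of "{0}"]) auto
  moreover have "finite {k :: nat ^ 'd. (if k = 0 then c else 0) \<noteq> 0}"
    by (rule finite_subset[of _ "{0}"]) auto
  ultimately show ?thesis unfolding represents_def by simp
qed

lemma represents_step:
  assumes "represents e f"
  shows "represents (shift_coeff (axis i 1) e) (\<lambda>n. f n - f (n - axis i 1))"
  unfolding represents_def
proof
  show "finite {k. shift_coeff (axis i 1) e k \<noteq> 0}"
    using assms by (intro finite_shift_coeff) (simp add: represents_def)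
  have *: "for_large (\<lambda>n. f n = binomial_sum e n)" and fin: "finite {k. e k \<noteq> 0}"
    using assms by (auto simp: represents_def)
  show "for_large (\<lambda>n. f n - f (n - axis i 1) = binomial_sum (shift_coeff (axis i 1) e) n)"
    using for_large_conj[OF * for_large_minus[OF *, of "axis i 1"]]
  proof (rule for_large_mono)
    fix n assume n: "f n = binomial_sum e n \<and> axis i 1 \<le> n \<and> f (n - axis i 1) = binomial_sum e (n - axis i 1)"
    thus "f n - f (n - axis i 1) = binomial_sum (shift_coeff (axis i 1) e) n"
      using binomial_sum_diff[OF fin, of "n - axis i 1" i] by (simp add: vec_diff_add)
  qed
qed

lemma vec_induct [case_names zero add]:
  fixes Q :: "nat ^ 'd::finite \<Rightarrow> bool"
  assumes "Q 0" "\<And>n i. Q n \<Longrightarrow> Q (n + axis i 1)"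
  shows "Q n"
proof (induction "\<Sum>i\<in>UNIV. n $ i" arbitrary: n)
  case 0
  hence "n = 0" by (simp add: vec_eq_iff)
  thus ?case using assms(1) by simp
next
  case (Suc s)
  then obtain i where i: "n $ i \<noteq> 0" by (metis Zero_not_Suc sum.neutral)
  have n: "n - axis i 1 + axis i 1 = n"
    by (rule vec_diff_add) (use i in \<open>auto simp: less_eq_vec_def axis_def\<close>)
  have "(\<Sum>j\<in>UNIV. n $ j) = (\<Sum>j\<in>UNIV. (n - axis i 1) $ j) + (\<Sum>j\<in>UNIV. axis i 1 $ j)"
    by (subst sum.distrib[symmetric]) (metis (no_types, lifting) n vector_add_component)
  also have "(\<Sum>j\<in>UNIV. axis i (1::nat) $ j) = 1" by (simp add: axis_def)
  finally have "s = (\<Sum>j\<in>UNIV. (n - axis i 1) $ j)" using Suc(2) by simp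
  from Suc(1)[OF this] assms(2) n show ?case by metis
qed

lemma represents_shift:
  assumes "represents e f"
  shows "\<exists>g. represents (shift_coeff a e) g \<and> (for_large (\<lambda>n. f n = 0) \<longrightarrow> for_large (\<lambda>n. g n = 0))"
proof (induction a rule: vec_induct)
  case zero
  thus ?case using assms by auto
next
  case (add a i)
  then obtain g where g: "represents (shift_coeff a e) g"
      "for_large (\<lambda>n. f n = 0) \<longrightarrow> for_large (\<lambda>n. g n = 0)" by blast
  have "represents (shift_coeff (a + axis i 1) e) (\<lambda>n. g n - g (n - axis i 1))"
    using represents_step[OF g(1), of i] by (simp add: add.assoc add.commute[of a])
  moreover have "for_large (\<lambda>n. g n - g (n - axis i 1) = 0)" if "for_large (\<lambda>n. g n = 0)"
    using for_large_conj[OF that for_large_minus[OF that, of "axis i 1"]]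
    by (auto elim!: for_large_mono)
  ultimately show ?case using g(2) by blast
qed

text \<open>
  Otherwise take \<open>h\<close> of maximal total degree with \<open>e h \<noteq> 0\<close>.  The iterated difference of type \<open>h\<close>
  removes every other coefficient, and it leaves the constant \<open>e h\<close>, which is eventually \<open>0\<close>.
\<close>

lemma represents_zero_unique:
  fixes e :: "nat ^ 'd::finite \<Rightarrow> int"
  assumes "represents e f" "for_large (\<lambda>n. f n = 0)"
  shows "e = (\<lambda>_. 0)"
proof (rule ccontr)
  assume "e \<noteq> (\<lambda>_. 0)"
  hence ne: "{k. e k \<noteq> 0} \<noteq> {}" by auto
  have fin: "finite {k. e k \<noteq> 0}" using assms by (simp add: represents_def)
  let ?s = "\<lambda>k. \<Sum>i\<in>UNIV. (k :: nat^'d) $ i"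
  obtain h where h: "e h \<noteq> 0" "\<And>k. e k \<noteq> 0 \<Longrightarrow> ?s k \<le> ?s h"
  proof -
    have "Max (?s ` {k. e k \<noteq> 0}) \<in> ?s ` {k. e k \<noteq> 0}" using fin ne by (intro Max_in) auto
    then obtain h where "e h \<noteq> 0" "?s h = Max (?s ` {k. e k \<noteq> 0})" by auto
    thus ?thesis using that[of h] fin by simp
  qed
  obtain g where g: "represents (shift_coeff h e) g" "for_large (\<lambda>n. g n = 0)"
    using represents_shift[OF assms(1)] assms(2) by blast
  have "shift_coeff h e k = 0" if "k \<noteq> 0" for k
  proof (rule ccontr)
    assume "shift_coeff h e k \<noteq> 0"
    hence "?s (k + h) \<le> ?s h" using h(2) by blast
    hence "?s k = 0" by (simp add: sum.distrib)
    thus False using that by (simp add: vec_eq_iff)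
  qed
  hence "{k. shift_coeff h e k \<noteq> 0} = {0}" using h(1) by auto
  hence "binomial_sum (shift_coeff h e) n = e h" for n by (simp add: binomial_sum_def)
  hence gh: "for_large (\<lambda>n. g n = e h)" using g(1) by (simp add: represents_def)
  have "for_large (\<lambda>n::nat^'d. e h = 0)" by (rule for_large_mono2[OF g(2) gh]) simp
  thus False using h(1) by simp
qed

lemma represents_unique:
  assumes "represents e f" "represents e' f'" "for_large (\<lambda>n. f n = f' n)"
  shows "e = e'"
proof -
  have "(\<lambda>k. e k - e' k) = (\<lambda>_. 0)"
    by (rule represents_zero_unique[OF represents_diff[OF assms(1,2)]])
      (use assms(3) in \<open>auto elim: for_large_mono\<close>)
  thus ?thesis by (auto simp: fun_eq_iff)
qed

lemma eventually_constant:
  fixes f :: "nat ^ 'd::finite \<Rightarrow> 'b"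
  assumes "\<And>i. for_large (\<lambda>n. f (n + axis i 1) = f n)"
  shows "\<exists>c. for_large (\<lambda>n. f n = c)"
proof -
  have "for_large (\<lambda>n. \<forall>i\<in>UNIV. f (n + axis i 1) = f n)"
    by (rule for_large_all) (use assms in auto)
  then obtain N where N: "\<And>n i. n \<ge> N \<Longrightarrow> f (n + axis i 1) = f n" unfolding for_large_def by blast
  have "f (N + m) = f N" for m
  proof (induction m rule: vec_induct)
    case (add m i)
    thus ?case using N[of "N + m" i] by (simp add: vec_le_add add.assoc)
  qed simp
  hence "f n = f N" if "n \<ge> N" for n using vec_le_diff[OF that] by metis
  thus ?thesis unfolding for_large_def by blast
qed

text \<open>
  The differences of \<open>f\<close> in two directions commute, so by uniqueness their coefficients agree after a
  shift; hence there is one family \<open>e\<close> whose shifts they all are.  The function \<open>f\<close> and the polynomial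
  of \<open>e\<close> then have the same differences, so they differ by a constant.
\<close>

lemma represents_from_differences:
  fixes f :: "nat ^ 'd::finite \<Rightarrow> int"
  assumes "\<And>i. \<exists>c. represents c (\<lambda>n. f n - f (n - axis i 1))"
  shows "\<exists>e. represents e f"
proof -
  let ?a = "\<lambda>i. axis i 1 :: nat^'d"
  obtain c where c: "\<And>i. represents (c i) (\<lambda>n. f n - f (n - ?a i))" using assms by metis
  have comm: "shift_coeff (?a j) (c i) = shift_coeff (?a i) (c j)" for i j
  proof (rule represents_unique[OF represents_step[OF c[of i], of j] represents_step[OF c[of j], of i]])
    have "n - ?a i - ?a j = n - ?a j - ?a i" for n :: "nat^'d"
      by (simp add: vec_eq_iff add.commute)
    thus "for_large (\<lambda>n. f n - f (n - ?a i) - (f (n - ?a j) - f (n - ?a j - ?a i)) =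
        f n - f (n - ?a j) - (f (n - ?a i) - f (n - ?a i - ?a j)))" by (simp add: for_large_def)
  qed
  define e where "e k = (if k = 0 then 0 else c (SOME i. k $ i \<noteq> 0) (k - ?a (SOME i. k $ i \<noteq> 0)))" for k
  have e: "e (k + ?a i) = c i k" for k i
  proof -
    let ?k = "k + ?a i"
    define j where "j = (SOME j. ?k $ j \<noteq> 0)"
    have "?k $ i \<noteq> 0" by simp
    hence j: "?k $ j \<noteq> 0" unfolding j_def by (rule someI)
    have "?k \<noteq> 0" using \<open>?k $ i \<noteq> 0\<close> by (metis zero_index)
    hence ek: "e ?k = c j (?k - ?a j)" unfolding e_def j_def by simp
    show ?thesis
    proof (cases "j = i")
      case True thus ?thesis using ek by simp
    next
      case False
      define k' where "k' = k - ?a j"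
      have k: "k = k' + ?a j" unfolding k'_def
        by (rule vec_diff_add[symmetric]) (use j False in \<open>auto simp: less_eq_vec_def axis_def\<close>)
      have "?k - ?a j = k' + ?a i" unfolding k by (simp add: vec_eq_iff)
      hence "e ?k = shift_coeff (?a i) (c j) k'" using ek by simp
      also have "\<dots> = shift_coeff (?a j) (c i) k'" using comm by metis
      finally show ?thesis using k by simp
    qed
  qed
  have fin: "finite {k. e k \<noteq> 0}"
  proof (rule finite_subset)
    show "{k. e k \<noteq> 0} \<subseteq> {0} \<union> (\<Union>i. (\<lambda>k. k + ?a i) ` {k. c i k \<noteq> 0})"
    proof
      fix k assume k: "k \<in> {k. e k \<noteq> 0}"
      show "k \<in> {0} \<union> (\<Union>i. (\<lambda>k. k + ?a i) ` {k. c i k \<noteq> 0})"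
      proof (cases "k = 0")
        case False
        then obtain i where "k $ i \<noteq> 0" by (auto simp: vec_eq_iff)
        hence "k = k - ?a i + ?a i" by (intro vec_diff_add[symmetric]) (auto simp: less_eq_vec_def axis_def)
        thus ?thesis using k e by (metis (mono_tags, lifting) UNIV_I UN_I Un_iff imageI mem_Collect_eq)
      qed simp
    qed
    show "finite ({0} \<union> (\<Union>i. (\<lambda>k. k + ?a i) ` {k. c i k \<noteq> 0}))"
      using c by (auto simp: represents_def)
  qed
  have rep: "represents e (binomial_sum e)" using fin by (simp add: represents_def)
  have shift: "shift_coeff (?a i) e = c i" for i using e by auto
  have diff: "for_large (\<lambda>n. f n - f (n - ?a i) = binomial_sum e n - binomial_sum e (n - ?a i))" for i
    using c[of i] represents_step[OF rep, of i, unfolded shift] unfolding represents_def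
    by (auto elim: for_large_mono2)
  have "\<exists>b. for_large (\<lambda>n. f n - binomial_sum e n = b)"
  proof (rule eventually_constant)
    fix i
    show "for_large (\<lambda>n. f (n + ?a i) - binomial_sum e (n + ?a i) = f n - binomial_sum e n)"
      using for_large_add[OF diff[of i], of "?a i"] by (auto elim!: for_large_mono)
  qed
  then obtain b where b: "for_large (\<lambda>n. f n - binomial_sum e n = b)" by blast
  have "represents (\<lambda>k. e k + (if k = 0 then b else 0)) (\<lambda>n. binomial_sum e n + b)"
    by (rule represents_add[OF rep represents_const])
  hence "represents (\<lambda>k. e k + (if k = 0 then b else 0)) f"
    by (rule represents_cong) (use b in \<open>auto elim!: for_large_mono\<close>)
  thus ?thesis by blast
qed

lemma hilbert_coeff_eq:
  assumes "represents e (component_length A S M)"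
  shows "hilbert_coeff A S M = e"
proof -
  have "hilbert_coeff A S M = (THE e. represents e (component_length A S M))"
    unfolding hilbert_coeff_def represents_def binomial_sum_def binom_vec_def by simp
  also have "\<dots> = e"
  proof (rule the_equality)
    fix e' assume "represents e' (component_length A S M)"
    thus "e' = e" by (rule represents_unique[OF _ assms]) simp
  qed (rule assms)
  finally show ?thesis .
qed

section \<open>Length relative to a set of operators\<close>

text \<open>
  Submodules over \<open>S\<close>, subgroups that are modules over a subring, and submodules of a homogeneous
  component over \<open>A\<close> are all of this kind, for different sets \<open>T\<close> of scalars.
\<close>

definition stable :: "('s, 'm, 'y) module_scheme \<Rightarrow> 's set \<Rightarrow> 'm set \<Rightarrow> bool" where
  "stable M T N \<longleftrightarrow> N \<subseteq> carrier M \<and> \<zero>\<^bsub>M\<^esub> \<in> N \<and> (\<forall>x\<in>N. \<forall>y\<in>N. x \<oplus>\<^bsub>M\<^esub> y \<in> N) \<and>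
    (\<forall>x\<in>N. \<ominus>\<^bsub>M\<^esub> x \<in> N) \<and> (\<forall>t\<in>T. \<forall>x\<in>N. t \<odot>\<^bsub>M\<^esub> x \<in> N)"

definition interval_len :: "('s, 'm, 'y) module_scheme \<Rightarrow> 's set \<Rightarrow> 'm set \<Rightarrow> 'm set \<Rightarrow> enat" where
  "interval_len M T U V = chain_len {W. stable M T W \<and> U \<subseteq> W \<and> W \<subseteq> V}"

lemma stableD:
  assumes "stable M T N"
  shows "x \<in> N \<Longrightarrow> x \<in> carrier M" "\<zero>\<^bsub>M\<^esub> \<in> N" "x \<in> N \<Longrightarrow> y \<in> N \<Longrightarrow> x \<oplus>\<^bsub>M\<^esub> y \<in> N"
    "x \<in> N \<Longrightarrow> \<ominus>\<^bsub>M\<^esub> x \<in> N" "t \<in> T \<Longrightarrow> x \<in> N \<Longrightarrow> t \<odot>\<^bsub>M\<^esub> x \<in> N"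
    "N \<subseteq> carrier M" "x \<in> N \<Longrightarrow> y \<in> N \<Longrightarrow> x \<ominus>\<^bsub>M\<^esub> y \<in> N"
  using assms unfolding stable_def a_minus_def by blast+

lemma stableI:
  assumes "N \<subseteq> carrier M" "\<zero>\<^bsub>M\<^esub> \<in> N" "\<And>x y. x \<in> N \<Longrightarrow> y \<in> N \<Longrightarrow> x \<oplus>\<^bsub>M\<^esub> y \<in> N"
    "\<And>x. x \<in> N \<Longrightarrow> \<ominus>\<^bsub>M\<^esub> x \<in> N" "\<And>t x. t \<in> T \<Longrightarrow> x \<in> N \<Longrightarrow> t \<odot>\<^bsub>M\<^esub> x \<in> N"
  shows "stable M T N"
  using assms unfolding stable_def by blast

lemma stable_Int: "stable M T U \<Longrightarrow> stable M T V \<Longrightarrow> stable M T (U \<inter> V)"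
  unfolding stable_def by blast

lemma stable_antimono: "stable M T U \<Longrightarrow> T' \<subseteq> T \<Longrightarrow> stable M T' U"
  unfolding stable_def by blast

lemma interval_len_mono:
  assumes "U \<subseteq> U'" "V' \<subseteq> V"
  shows "interval_len M T U' V' \<le> interval_len M T U V"
  unfolding interval_len_def by (rule chain_len_strict_mono[of "\<lambda>x. x"]) (use assms in auto)

lemma interval_len_self [simp]: "interval_len M T U U = 0"
proof -
  have "interval_len M T U U \<le> chain_len {U}"
    unfolding interval_len_def by (rule chain_len_strict_mono[of "\<lambda>x. x"]) auto
  thus ?thesis by (simp add: chain_len_singleton)
qed

lemma interval_len_pos:
  assumes "stable M T U" "stable M T V" "U \<subset> V"
  shows "1 \<le> interval_len M T U V"
  using chain_len_ge[of "[U, V]" 1] assms unfolding interval_len_def by (auto simp: one_enat_def)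

lemma interval_len_zeroD:
  assumes "interval_len M T U V = 0" "stable M T U" "stable M T V" "U \<subseteq> V"
  shows "U = V"
  using interval_len_pos[of M T U V] assms by auto

lemma finite_chain_len:
  assumes "finite C" shows "chain_len C < \<infinity>"
proof -
  have "chain_len C \<le> enat (card C)"
  proof (rule chain_len_le)
    fix l and cs assume cs: "length cs = Suc l" "set cs \<subseteq> C" "sorted_wrt (\<subset>) cs"
    have "distinct cs" using cs(3) by (induction cs) auto
    hence "Suc l \<le> card C" using cs card_mono[OF assms cs(2)] distinct_card by metis
    thus "enat l \<le> enat (card C)" by simp
  qed
  thus ?thesis by (meson enat_ord_code(4) le_less_trans)
qed

lemma (in abelian_group) add_add_swap:
  assumes "a \<in> carrier G" "b \<in> carrier G" "c \<in> carrier G" "d \<in> carrier G"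
  shows "(a \<oplus> b) \<oplus> (c \<oplus> d) = (a \<oplus> c) \<oplus> (b \<oplus> d)"
  using assms by (simp add: a_assoc a_lcomm[of b c d])

lemma set_addI: "u \<in> U \<Longrightarrow> v \<in> V \<Longrightarrow> u \<oplus>\<^bsub>G\<^esub> v \<in> U <+>\<^bsub>G\<^esub> V"
  unfolding set_add_def' by blast

context module begin

lemma stable_sum:
  assumes "stable M T U" "stable M T V" "T \<subseteq> carrier R"
  shows "stable M T (U <+>\<^bsub>M\<^esub> V)"
proof (rule stableI)
  note U = stableD[OF assms(1)] and V = stableD[OF assms(2)]
  show "U <+>\<^bsub>M\<^esub> V \<subseteq> carrier M" unfolding set_add_def' using U(1) V(1) by auto
  show "\<zero>\<^bsub>M\<^esub> \<in> U <+>\<^bsub>M\<^esub> V"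
    using set_addI[OF U(2) V(2), of M] by simp
  fix x assume "x \<in> U <+>\<^bsub>M\<^esub> V"
  then obtain u v where x: "u \<in> U" "v \<in> V" "x = u \<oplus>\<^bsub>M\<^esub> v" unfolding set_add_def' by auto
  have uv: "u \<in> carrier M" "v \<in> carrier M" using x U V by auto
  have "\<ominus>\<^bsub>M\<^esub> x = \<ominus>\<^bsub>M\<^esub> u \<oplus>\<^bsub>M\<^esub> \<ominus>\<^bsub>M\<^esub> v" using uv x by (simp add: M.minus_add)
  thus "\<ominus>\<^bsub>M\<^esub> x \<in> U <+>\<^bsub>M\<^esub> V" using set_addI[OF U(4)[OF x(1)] V(4)[OF x(2)]] by simp
  show "t \<odot>\<^bsub>M\<^esub> x \<in> U <+>\<^bsub>M\<^esub> V" if "t \<in> T" for t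
  proof -
    have "t \<odot>\<^bsub>M\<^esub> x = t \<odot>\<^bsub>M\<^esub> u \<oplus>\<^bsub>M\<^esub> t \<odot>\<^bsub>M\<^esub> v" using uv x that assms(3) smult_r_distr by blast
    thus ?thesis using set_addI[OF U(5)[OF that x(1)] V(5)[OF that x(2)]] by simp
  qed
  fix y assume "y \<in> U <+>\<^bsub>M\<^esub> V"
  then obtain u' v' where y: "u' \<in> U" "v' \<in> V" "y = u' \<oplus>\<^bsub>M\<^esub> v'" unfolding set_add_def' by auto
  have uv': "u' \<in> carrier M" "v' \<in> carrier M" using y U V by auto
  have "x \<oplus>\<^bsub>M\<^esub> y = (u \<oplus>\<^bsub>M\<^esub> u') \<oplus>\<^bsub>M\<^esub> (v \<oplus>\<^bsub>M\<^esub> v')" unfolding x(3) y(3) using uv uv' by (rule M.add_add_swap)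
  thus "x \<oplus>\<^bsub>M\<^esub> y \<in> U <+>\<^bsub>M\<^esub> V"
    using set_addI[OF U(3)[OF x(1) y(1)] V(3)[OF x(2) y(2)]] by simp
qed

lemma set_add_subset1:
  assumes "stable M T U" "stable M T V" shows "U \<subseteq> U <+>\<^bsub>M\<^esub> V"
proof
  fix x assume x: "x \<in> U"
  have "x = x \<oplus>\<^bsub>M\<^esub> \<zero>\<^bsub>M\<^esub>" using x stableD(1)[OF assms(1)] by simp
  thus "x \<in> U <+>\<^bsub>M\<^esub> V" unfolding set_add_def' using x stableD(2)[OF assms(2)] by blast
qed

lemma set_add_subset2:
  assumes "stable M T U" "stable M T V" shows "V \<subseteq> U <+>\<^bsub>M\<^esub> V"
proof
  fix x assume x: "x \<in> V"
  have "x = \<zero>\<^bsub>M\<^esub> \<oplus>\<^bsub>M\<^esub> x" using x stableD(1)[OF assms(2)] by simp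
  thus "x \<in> U <+>\<^bsub>M\<^esub> V" unfolding set_add_def' using x stableD(2)[OF assms(1)] by blast
qed

lemma set_add_least:
  assumes "U \<subseteq> W" "V \<subseteq> W" "stable M T W" shows "U <+>\<^bsub>M\<^esub> V \<subseteq> W"
  unfolding set_add_def' using assms stableD(3)[OF assms(3)] by blast

lemma add_diff_cancel:
  assumes "x \<in> carrier M" "v \<in> carrier M" "y = x \<oplus>\<^bsub>M\<^esub> v" shows "y \<ominus>\<^bsub>M\<^esub> x = v"
proof -
  have "y \<ominus>\<^bsub>M\<^esub> x = (v \<oplus>\<^bsub>M\<^esub> x) \<oplus>\<^bsub>M\<^esub> \<ominus>\<^bsub>M\<^esub> x" unfolding assms(3) M.minus_eq using assms M.a_comm by simp
  thus ?thesis using assms by (simp add: M.a_assoc M.r_neg)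
qed

text \<open>
  For \<open>U \<subseteq> X \<subseteq> Y \<subseteq> W\<close>, the modular law gives \<open>X = Y\<close> as soon as \<open>X\<close> and \<open>Y\<close> have the same intersection
  with \<open>V\<close> and the same sum with \<open>V\<close>.  This bounds the length from above; chains below and above \<open>V\<close>
  can be concatenated, which bounds it from below.
\<close>

lemma interval_len_add:
  assumes T: "T \<subseteq> carrier R" and st: "stable M T U" "stable M T V" "stable M T W"
    and sub: "U \<subseteq> V" "V \<subseteq> W"
  shows "interval_len M T U W = interval_len M T U V + interval_len M T V W"
proof (rule antisym)
  show "interval_len M T U W \<le> interval_len M T U V + interval_len M T V W"
    unfolding interval_len_def
  proof (rule chain_split[of "\<lambda>X. X \<inter> V" _ _ "\<lambda>X. X <+>\<^bsub>M\<^esub> V"])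
    show "(\<lambda>X. X \<inter> V) ` {Wa. stable M T Wa \<and> U \<subseteq> Wa \<and> Wa \<subseteq> W} \<subseteq> {W. stable M T W \<and> U \<subseteq> W \<and> W \<subseteq> V}"
      using st sub by (auto intro: stable_Int)
    show "(\<lambda>X. X <+>\<^bsub>M\<^esub> V) ` {Wa. stable M T Wa \<and> U \<subseteq> Wa \<and> Wa \<subseteq> W} \<subseteq> {Wa. stable M T Wa \<and> V \<subseteq> Wa \<and> Wa \<subseteq> W}"
      using stable_sum[OF _ st(2) T] set_add_subset2[OF _ st(2)] set_add_least[OF _ sub(2) st(3)]
      by (simp add: image_subset_iff)
    fix X Y assume "X \<in> {Wa. stable M T Wa \<and> U \<subseteq> Wa \<and> Wa \<subseteq> W}" "Y \<in> {Wa. stable M T Wa \<and> U \<subseteq> Wa \<and> Wa \<subseteq> W}"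
      and XY: "X \<subset> Y"
    hence X: "stable M T X" and Y: "stable M T Y" by auto
    have "X <+>\<^bsub>M\<^esub> V \<subseteq> Y <+>\<^bsub>M\<^esub> V" unfolding set_add_def' using XY by blast
    moreover have "Y \<subseteq> X" if eq: "X \<inter> V = Y \<inter> V" "X <+>\<^bsub>M\<^esub> V = Y <+>\<^bsub>M\<^esub> V"
    proof
      fix y assume y: "y \<in> Y"
      hence "y \<in> X <+>\<^bsub>M\<^esub> V" using eq set_add_subset1[OF Y st(2)] by blast
      then obtain x v where xv: "x \<in> X" "v \<in> V" "y = x \<oplus>\<^bsub>M\<^esub> v" unfolding set_add_def' by auto
      have "v = y \<ominus>\<^bsub>M\<^esub> x" using add_diff_cancel[OF _ _ xv(3)] stableD(1)[OF X xv(1)] stableD(1)[OF st(2) xv(2)] by simp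
      hence "v \<in> Y" using stableD(7)[OF Y y] xv XY by blast
      hence "v \<in> X" using xv eq by blast
      thus "y \<in> X" using xv stableD(3)[OF X] by simp
    qed
    ultimately show "X \<inter> V \<subseteq> Y \<inter> V \<and> X <+>\<^bsub>M\<^esub> V \<subseteq> Y <+>\<^bsub>M\<^esub> V \<and> (X \<inter> V \<noteq> Y \<inter> V \<or> X <+>\<^bsub>M\<^esub> V \<noteq> Y <+>\<^bsub>M\<^esub> V)"
      using XY by blast
  qed
  show "interval_len M T U V + interval_len M T V W \<le> interval_len M T U W"
    unfolding interval_len_def by (rule chain_append) (use st sub in auto)
qed

end

text \<open>
  A map on a subgroup \<open>V\<close> that is linear over \<open>T\<close>: multiplication by a scalar, \<open>s \<mapsto> s z\<close>, projections
  to quotients, evaluation, and the Koszul differential are used in this role.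
\<close>

locale operator_map = M1: module R M + M2: module R M' for R (structure) and M and M' +
  fixes T f V
  assumes T: "T \<subseteq> carrier R" and V: "stable M T V"
    and f_closed: "x \<in> V \<Longrightarrow> f x \<in> carrier M'"
    and f_add: "x \<in> V \<Longrightarrow> y \<in> V \<Longrightarrow> f (x \<oplus>\<^bsub>M\<^esub> y) = f x \<oplus>\<^bsub>M'\<^esub> f y"
    and f_smult: "t \<in> T \<Longrightarrow> x \<in> V \<Longrightarrow> f (t \<odot>\<^bsub>M\<^esub> x) = t \<odot>\<^bsub>M'\<^esub> f x"
begin

lemmas V_closed = stableD(1)[OF V]

lemma f_zero: "f \<zero>\<^bsub>M\<^esub> = \<zero>\<^bsub>M'\<^esub>"
proof -
  have "f \<zero>\<^bsub>M\<^esub> \<oplus>\<^bsub>M'\<^esub> f \<zero>\<^bsub>M\<^esub> = f \<zero>\<^bsub>M\<^esub>" using f_add[of "\<zero>\<^bsub>M\<^esub>" "\<zero>\<^bsub>M\<^esub>"] stableD(2)[OF V] by simp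
  thus ?thesis using f_closed[OF stableD(2)[OF V]] M2.add.l_cancel_one by blast
qed

lemma f_minus:
  assumes "x \<in> V" shows "f (\<ominus>\<^bsub>M\<^esub> x) = \<ominus>\<^bsub>M'\<^esub> f x"
proof -
  have "f (\<ominus>\<^bsub>M\<^esub> x) \<oplus>\<^bsub>M'\<^esub> f x = \<zero>\<^bsub>M'\<^esub>"
    using f_add[of "\<ominus>\<^bsub>M\<^esub> x" x] stableD(4)[OF V assms] assms f_zero V_closed by (simp add: M1.M.l_neg)
  thus ?thesis using f_closed assms stableD(4)[OF V assms] M2.M.minus_equality by simp
qed

lemma f_diff: "x \<in> V \<Longrightarrow> y \<in> V \<Longrightarrow> f (x \<ominus>\<^bsub>M\<^esub> y) = f x \<ominus>\<^bsub>M'\<^esub> f y"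
  using f_add f_minus stableD(4)[OF V] by (simp add: a_minus_def)

lemma image_stable:
  assumes W: "stable M T W" "W \<subseteq> V" shows "stable M' T (f ` W)"
proof (rule stableI)
  note W' = stableD[OF W(1)]
  show "f ` W \<subseteq> carrier M'" using f_closed W(2) by auto
  show "\<zero>\<^bsub>M'\<^esub> \<in> f ` W" unfolding f_zero[symmetric] by (rule imageI[OF W'(2)])
  fix x assume "x \<in> f ` W"
  then obtain a where a: "a \<in> W" "x = f a" by auto
  show "\<ominus>\<^bsub>M'\<^esub> x \<in> f ` W" using a W'(4) f_minus[of a] W(2) by (metis imageI subsetD)
  show "t \<odot>\<^bsub>M'\<^esub> x \<in> f ` W" if "t \<in> T" for t using a W'(5) f_smult[of t a] W(2) that by (metis imageI subsetD)
  fix y assume "y \<in> f ` W"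
  then obtain b where b: "b \<in> W" "y = f b" by auto
  show "x \<oplus>\<^bsub>M'\<^esub> y \<in> f ` W" using a b W'(3) f_add[of a b] W(2) by (metis imageI subsetD)
qed

lemma vimage_stable:
  assumes W: "stable M' T W" shows "stable M T {x \<in> V. f x \<in> W}"
proof (rule stableI)
  note W' = stableD[OF W]
  show "{x \<in> V. f x \<in> W} \<subseteq> carrier M" using V_closed by blast
  show "\<zero>\<^bsub>M\<^esub> \<in> {x \<in> V. f x \<in> W}" using stableD(2)[OF V] W'(2) f_zero by simp
  fix x assume x: "x \<in> {x \<in> V. f x \<in> W}"
  show "\<ominus>\<^bsub>M\<^esub> x \<in> {x \<in> V. f x \<in> W}" using x stableD(4)[OF V] W'(4) f_minus by simp
  show "t \<odot>\<^bsub>M\<^esub> x \<in> {x \<in> V. f x \<in> W}" if "t \<in> T" for t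
    using x that stableD(5)[OF V] W'(5) f_smult by simp
  fix y assume y: "y \<in> {x \<in> V. f x \<in> W}"
  show "x \<oplus>\<^bsub>M\<^esub> y \<in> {x \<in> V. f x \<in> W}" using x y stableD(3)[OF V] W'(3) f_add by simp
qed

text \<open>
  \<open>f\<close> induces an isomorphism from \<open>V/U\<close> to \<open>V'/U'\<close>; image and preimage carry chains of one interval to
  chains of the other.
\<close>

lemma interval_len_iso:
  assumes st: "stable M T U" "stable M' T U'" "stable M' T V'" and sub: "U \<subseteq> V" "U' \<subseteq> V'"
    and into: "\<And>x. x \<in> V \<Longrightarrow> f x \<in> V'"
    and ker: "\<And>x. x \<in> V \<Longrightarrow> f x \<in> U' \<longleftrightarrow> x \<in> U"
    and onto: "\<And>y. y \<in> V' \<Longrightarrow> \<exists>x\<in>V. \<exists>u\<in>U'. y = f x \<oplus>\<^bsub>M'\<^esub> u"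
  shows "interval_len M T U V = interval_len M' T U' V'"
proof (rule antisym)
  note U' = stableD[OF st(2)] and V' = stableD[OF st(3)]
  let ?C = "{W. stable M T W \<and> U \<subseteq> W \<and> W \<subseteq> V}" and ?D = "{W. stable M' T W \<and> U' \<subseteq> W \<and> W \<subseteq> V'}"
  define g where "g W = {f x \<oplus>\<^bsub>M'\<^esub> u | x u. x \<in> W \<and> u \<in> U'}" for W
  have g_mem: "f x \<in> g W" if "x \<in> W" "W \<subseteq> V" for x W
  proof -
    have "f x = f x \<oplus>\<^bsub>M'\<^esub> \<zero>\<^bsub>M'\<^esub>" using that f_closed by auto
    thus ?thesis unfolding g_def using that U'(2) by blast
  qed
  show "interval_len M T U V \<le> interval_len M' T U' V'"
    unfolding interval_len_def
  proof (rule chain_len_strict_mono[of g])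
    show "g ` ?C \<subseteq> ?D"
    proof (clarify, intro conjI)
      fix W assume W: "stable M T W" "U \<subseteq> W" "W \<subseteq> V"
      note W' = stableD[OF W(1)]
      have "f ` W <+>\<^bsub>M'\<^esub> U' = g W" unfolding g_def set_add_def' by auto
      moreover have "stable M' T (f ` W)" by (rule image_stable[OF W(1,3)])
      ultimately show "stable M' T (g W)" using M2.stable_sum[OF _ st(2) T] by metis
      show "U' \<subseteq> g W"
      proof
        fix u assume u: "u \<in> U'"
        have "u = f \<zero>\<^bsub>M\<^esub> \<oplus>\<^bsub>M'\<^esub> u" using u U'(1) f_zero by simp
        thus "u \<in> g W" unfolding g_def using W'(2) u by blast
      qed
      show "g W \<subseteq> V'" unfolding g_def using W(3) into sub(2) V'(3) by blast
    qed
    fix X Y assume "X \<in> ?C" "Y \<in> ?C" and XY: "X \<subset> Y"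
    hence X: "stable M T X" "U \<subseteq> X" "X \<subseteq> V" and Y: "stable M T Y" "Y \<subseteq> V" by auto
    obtain y where y: "y \<in> Y" "y \<notin> X" using XY by blast
    have "f y \<notin> g X"
    proof
      assume "f y \<in> g X"
      then obtain x u where xu: "x \<in> X" "u \<in> U'" "f y = f x \<oplus>\<^bsub>M'\<^esub> u" unfolding g_def by auto
      have xy: "x \<in> V" "y \<in> V" using xu y X Y by auto
      have "f (y \<ominus>\<^bsub>M\<^esub> x) = u"
        using f_diff[OF xy(2,1)] M2.add_diff_cancel[OF _ _ xu(3)] f_closed xy U'(1) xu by simp
      hence "y \<ominus>\<^bsub>M\<^esub> x \<in> X" using ker[of "y \<ominus>\<^bsub>M\<^esub> x"] xu stableD(7)[OF V] xy X by auto
      hence "(y \<ominus>\<^bsub>M\<^esub> x) \<oplus>\<^bsub>M\<^esub> x \<in> X" using xu stableD(3)[OF X(1)] by blast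
      moreover have "(y \<ominus>\<^bsub>M\<^esub> x) \<oplus>\<^bsub>M\<^esub> x = y" using xy V_closed by (simp add: M1.M.minus_eq M1.M.a_assoc M1.M.l_neg)
      ultimately show False using y by simp
    qed
    thus "g X \<subset> g Y" using g_mem[OF y(1) Y(2)] XY unfolding g_def by blast
  qed
  show "interval_len M' T U' V' \<le> interval_len M T U V"
    unfolding interval_len_def
  proof (rule chain_len_strict_mono[of "\<lambda>W. {x \<in> V. f x \<in> W}"])
    show "(\<lambda>W. {x \<in> V. f x \<in> W}) ` ?D \<subseteq> ?C"
    proof (clarify, intro conjI)
      fix W assume W: "stable M' T W" "U' \<subseteq> W" "W \<subseteq> V'"
      show "stable M T {x \<in> V. f x \<in> W}" by (rule vimage_stable[OF W(1)])
      show "U \<subseteq> {x \<in> V. f x \<in> W}" using ker sub(1) W(2) by blast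
    qed auto
    fix X Y assume "X \<in> ?D" "Y \<in> ?D" and XY: "X \<subset> Y"
    hence X: "stable M' T X" "U' \<subseteq> X" "X \<subseteq> V'" and Y: "stable M' T Y" "U' \<subseteq> Y" "Y \<subseteq> V'" by auto
    obtain y where y: "y \<in> Y" "y \<notin> X" using XY by blast
    obtain x u where xu: "x \<in> V" "u \<in> U'" "y = f x \<oplus>\<^bsub>M'\<^esub> u" using onto y Y by blast
    have c: "f x \<in> carrier M'" "u \<in> carrier M'" using xu f_closed U'(1) by auto
    have "y \<ominus>\<^bsub>M'\<^esub> u = f x" using M2.add_diff_cancel[of u "f x" y] c xu M2.M.a_comm by simp
    hence "f x \<in> Y" using stableD(7)[OF Y(1) y(1), of u] xu(2) Y(2) by auto
    moreover have "f x \<notin> X" using xu y stableD(3)[OF X(1)] X(2) by auto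
    ultimately show "{x \<in> V. f x \<in> X} \<subset> {x \<in> V. f x \<in> Y}" using XY xu by blast
  qed
qed

end

context module begin

text \<open>
  Zorn's lemma: the union of a chain of stable subgroups is stable.
\<close>

lemma exists_maximal_stable_avoiding:
  assumes N: "stable M T N" "N \<subseteq> K" "v \<notin> N"
  obtains I where "stable M T I" "N \<subseteq> I" "I \<subseteq> K" "v \<notin> I"
    "\<And>W. stable M T W \<Longrightarrow> I \<subset> W \<Longrightarrow> W \<subseteq> K \<Longrightarrow> v \<in> W"
proof -
  let ?F = "{I. stable M T I \<and> N \<subseteq> I \<and> I \<subseteq> K \<and> v \<notin> I}"
  have "\<exists>I\<in>?F. \<forall>X\<in>?F. I \<subseteq> X \<longrightarrow> X = I"
  proof (rule subset_Zorn_nonempty)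
    show "?F \<noteq> {}" using N by auto
    fix C assume C: "C \<noteq> {}" "subset.chain ?F C"
    hence F: "\<And>X. X \<in> C \<Longrightarrow> X \<in> ?F" and lin: "\<And>X Y. X \<in> C \<Longrightarrow> Y \<in> C \<Longrightarrow> X \<subseteq> Y \<or> Y \<subseteq> X"
      unfolding subset.chain_def by auto
    have "stable M T (\<Union>C)"
    proof (rule stableI)
      show "\<zero>\<^bsub>M\<^esub> \<in> \<Union>C" using C(1) F stableD(2) by blast
      fix x y assume "x \<in> \<Union>C" "y \<in> \<Union>C"
      then obtain X Y where XY: "x \<in> X" "X \<in> C" "y \<in> Y" "Y \<in> C" by blast
      with lin[of X Y] obtain Z where Z: "x \<in> Z" "y \<in> Z" "Z \<in> C" by blast
      thus "x \<oplus>\<^bsub>M\<^esub> y \<in> \<Union>C" using F[OF Z(3)] stableD(3)[of M T Z x y] by blast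
    qed (use F in \<open>blast dest: stableD(1,4,5)\<close>)+
    thus "\<Union>C \<in> ?F" using C(1) F by blast
  qed
  then obtain I where I: "I \<in> ?F" and max: "\<forall>X\<in>?F. I \<subseteq> X \<longrightarrow> X = I" by blast
  show thesis by (rule that[of I]) (use I max in blast)+
qed

end

text \<open>
  The ring as a module over itself.  The grading \<open>c\<close> is a parameter, so that the same definition
  serves the ungraded ring \<open>A\<close> and the graded ring \<open>S\<close>.
\<close>

definition regular :: "('s, 'z) ring_scheme \<Rightarrow> ('i \<Rightarrow> 's set) \<Rightarrow> ('s, 's, 'i) graded_module" where
  "regular S c = \<lparr>carrier = carrier S, mult = mult S, one = one S, zero = zero S, add = add S,
     smult = mult S, component = c\<rparr>"

lemma regular_simps [simp]:
  "carrier (regular S c) = carrier S" "mult (regular S c) = mult S" "one (regular S c) = one S"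
  "zero (regular S c) = zero S" "add (regular S c) = add S" "smult (regular S c) = mult S"
  "component (regular S c) = c"
  by (simp_all add: regular_def)

lemma regular_add_simps [simp]:
  "a_inv (regular S c) = a_inv S" "finsum (regular S c) = finsum S" "a_minus (regular S c) = a_minus S"
proof -
  show inv: "a_inv (regular S c) = a_inv S" unfolding a_inv_def m_inv_def by (simp add: fun_eq_iff)
  show "finsum (regular S c) = finsum S" unfolding finsum_def finprod_def by (simp add: fun_eq_iff)
  show "a_minus (regular S c) = a_minus S" by (simp add: a_minus_def inv fun_eq_iff)
qed

lemma (in cring) module_regular: "module R (regular R c)"
proof (rule moduleI)
  show "abelian_group (regular R c)"
  proof (rule abelian_groupI)
    fix x assume "x \<in> carrier (regular R c)"
    thus "\<exists>y\<in>carrier (regular R c). y \<oplus>\<^bsub>regular R c\<^esub> x = \<zero>\<^bsub>regular R c\<^esub>"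
      by (intro bexI[of _ "\<ominus> x"]) (auto simp: l_neg)
  qed (simp_all add: a_ac)
qed (simp_all add: l_distr r_distr m_assoc is_cring)

lemma (in cring) stable_regular_iff: "stable (regular R c) (carrier R) I \<longleftrightarrow> ideal I R"
proof
  assume I: "stable (regular R c) (carrier R) I"
  note I' = stableD[OF I, simplified]
  show "ideal I R"
  proof (rule idealI)
    show "subgroup I (add_monoid R)"
      by (rule add.subgroupI) (use I' in auto)
    fix a x assume a: "a \<in> I" and x: "x \<in> carrier R"
    show "x \<otimes> a \<in> I" using I'(5) a x by blast
    thus "a \<otimes> x \<in> I" using I'(1)[OF a] x by (simp add: m_comm)
  qed (rule ring_axioms)
next
  assume "ideal I R"
  then interpret ideal I R .
  show "stable (regular R c) (carrier R) I"
  proof (rule stableI)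
    show "I \<subseteq> carrier (regular R c)" using a_subset by simp
  qed (simp_all add: I_l_closed)
qed

lemma (in module) smult_operator_map:
  assumes "y \<in> carrier R" "T \<subseteq> carrier R" "stable M T V"
  shows "operator_map R M M T (\<lambda>m. y \<odot>\<^bsub>M\<^esub> m) V"
  by (intro operator_map.intro operator_map_axioms.intro module_axioms assms(2,3))
    (use assms stableD(1)[OF assms(3)] in
      \<open>auto simp: smult_r_distr smult_assoc1[symmetric] R.m_comm subset_iff\<close>)

lemma (in module) multiples_operator_map:
  assumes "z \<in> carrier M" "T \<subseteq> carrier R" "stable (regular R c) T V"
  shows "operator_map R (regular R c) M T (\<lambda>s. s \<odot>\<^bsub>M\<^esub> z) V"
  by (intro operator_map.intro operator_map_axioms.intro module_axioms R.module_regular assms(2,3))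
    (use assms stableD(1)[OF assms(3)] in \<open>auto simp: smult_l_distr smult_assoc1 subset_iff\<close>)

section \<open>Artinian local rings have finite length\<close>

lemma (in artinian_ring) minimal_ideal:
  assumes "ideal I0 R" "Q I0"
  obtains I where "ideal I R" "Q I" "\<And>J. ideal J R \<Longrightarrow> J \<subset> I \<Longrightarrow> \<not> Q J"
proof (rule ccontr)
  assume "\<not> thesis"
  note th = that
  have ex: "\<exists>J. ideal J R \<and> J \<subset> I \<and> Q J" if "ideal I R" "Q I" for I
  proof (rule ccontr)
    assume "\<not> ?thesis"
    hence no: "\<And>J. ideal J R \<Longrightarrow> J \<subset> I \<Longrightarrow> \<not> Q J" by blast
    show False using th[OF that no] \<open>\<not> thesis\<close> by blast
  qed
  define nxt where "nxt I = (SOME J. ideal J R \<and> J \<subset> I \<and> Q J)" for I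
  have nxt: "ideal (nxt I) R \<and> nxt I \<subset> I \<and> Q (nxt I)" if "ideal I R" "Q I" for I
    unfolding nxt_def by (rule someI_ex) (rule ex[OF that])
  define f where "f n = (nxt ^^ n) I0" for n
  have f: "ideal (f n) R \<and> Q (f n)" for n
    by (induction n) (use nxt assms in \<open>auto simp: f_def\<close>)
  have less: "f (Suc n) \<subset> f n" for n using nxt[of "f n"] f[of n] by (auto simp: f_def)
  have "\<exists>N. \<forall>n\<ge>N. f n = f N"
    by (rule descending_chain_condition) (use f less in auto)
  then obtain N where N: "\<forall>n\<ge>N. f n = f N" ..
  have "f (Suc N) = f N" by (rule N[rule_format]) simp
  thus False using less[of N] by simp
qed

context artinian_local_ring begin

text \<open>
  A nonunit lies in an ideal that is maximal among those that avoid \<open>1\<close>; this is a maximal ideal,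
  so it is \<open>\<mm>\<close>.
\<close>

lemma unit_of_not_mem:
  assumes u: "u \<in> carrier A" "u \<notin> \<mm>"
  shows "u \<in> Units A"
proof (rule ccontr)
  assume nu: "u \<notin> Units A"
  let ?X = "regular A (\<lambda>_ :: nat. {})"
  interpret X: module A ?X by (rule module_regular)
  have P: "ideal (PIdl u) A" by (rule cgenideal_ideal[OF u(1)])
  have "\<one> \<notin> PIdl u"
  proof
    assume "\<one> \<in> PIdl u"
    then obtain x where "x \<in> carrier A" "\<one> = x \<otimes> u" unfolding cgenideal_def by auto
    thus False using nu u(1) m_comm unfolding Units_def by force
  qed
  then obtain I where I: "stable ?X (carrier A) I" "PIdl u \<subseteq> I" "\<one> \<notin> I"
    "\<And>W. stable ?X (carrier A) W \<Longrightarrow> I \<subset> W \<Longrightarrow> W \<subseteq> carrier A \<Longrightarrow> \<one> \<in> W"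
    using X.exists_maximal_stable_avoiding[of "carrier A" "PIdl u" "carrier A" \<one>] P
    by (metis stable_regular_iff ideal.Icarr subsetI)
  have "maximalideal I A"
  proof (rule maximalidealI)
    show "ideal I A" using I(1) stable_regular_iff by blast
    show "carrier A \<noteq> I" using I(3) by blast
    fix J assume J: "ideal J A" "I \<subseteq> J" "J \<subseteq> carrier A"
    show "J = I \<or> J = carrier A"
    proof (cases "J = I")
      case False
      hence "\<one> \<in> J" using I(4)[of J] J stable_regular_iff by blast
      thus ?thesis using J ideal.one_imp_carrier by blast
    qed simp
  qed
  hence "I = \<mm>" by (rule unique_maximal)
  thus False using u I(2) cgenideal_self[OF u(1)] by blast
qed

lemma one_minus_unit: "b \<in> \<mm> \<Longrightarrow> \<one> \<ominus> b \<in> Units A"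
proof (rule unit_of_not_mem)
  assume b: "b \<in> \<mm>"
  hence bA: "b \<in> carrier A" by (rule Icarr)
  show "\<one> \<ominus> b \<in> carrier A" using bA by simp
  show "\<one> \<ominus> b \<notin> \<mm>"
  proof
    assume "\<one> \<ominus> b \<in> \<mm>"
    hence "(\<one> \<ominus> b) \<oplus> b \<in> \<mm>" using b by simp
    moreover have "(\<one> \<ominus> b) \<oplus> b = \<one>" using bA by (simp add: minus_eq a_assoc l_neg)
    ultimately show False using I_notcarr one_imp_carrier by simp
  qed
qed

text \<open>
  This is the nilpotency part of the Akizuki--Hopkins theorem.  If \<open>J = \<mm>J \<noteq> 0\<close>, let \<open>I\<close> be minimal with
  \<open>IJ \<noteq> 0\<close> and choose \<open>a \<in> I\<close> with \<open>aJ \<noteq> 0\<close>.  Then \<open>a\<mm>J = aJ \<noteq> 0\<close>, so \<open>a\<mm> = I\<close> by minimality and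
  \<open>a = ab\<close> with \<open>b \<in> \<mm>\<close>.  As \<open>1 - b\<close> is a unit, \<open>a = 0\<close>.
\<close>

lemma ideal_eq_zero_of_maximal_mult:
  assumes J: "ideal J A" and mJ: "J \<subseteq> Idl {a \<otimes> x | a x. a \<in> \<mm> \<and> x \<in> J}"
  shows "J = {\<zero>}"
proof (rule ccontr)
  interpret J: ideal J A by (rule J)
  assume "J \<noteq> {\<zero>}"
  then obtain x0 where x0: "x0 \<in> J" "x0 \<noteq> \<zero>" using J.zero_closed by blast
  let ?Q = "\<lambda>I. \<exists>a\<in>I. \<exists>x\<in>J. a \<otimes> x \<noteq> \<zero>"
  have "?Q (carrier A)" using x0 J.Icarr by (intro bexI[of _ \<one>] bexI[of _ x0]) auto
  from minimal_ideal[OF oneideal, of ?Q, OF this] obtain I where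
    I: "ideal I A" "?Q I" "\<And>K. ideal K A \<Longrightarrow> K \<subset> I \<Longrightarrow> \<not> ?Q K" by blast
  interpret I: ideal I A by (rule I)
  obtain a x where ax: "a \<in> I" "x \<in> J" "a \<otimes> x \<noteq> \<zero>" using I(2) by blast
  have aA: "a \<in> carrier A" using ax by simp
  let ?K = "{a \<otimes> b | b. b \<in> \<mm>}"
  have K: "ideal ?K A"
  proof (rule idealI[OF ring_axioms])
    show "subgroup ?K (add_monoid A)"
    proof (rule add.subgroupI)
      show "?K \<subseteq> carrier A" using aA Icarr by auto
      show "?K \<noteq> {}" using zero_closed by blast
      fix k assume "k \<in> ?K"
      then obtain b where b: "b \<in> \<mm>" "k = a \<otimes> b" by blast
      have "\<ominus> k = a \<otimes> (\<ominus> b)" using b aA Icarr by (simp add: r_minus)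
      thus "\<ominus> k \<in> ?K" using b a_inv_closed by blast
      fix k' assume "k' \<in> ?K"
      then obtain b' where b': "b' \<in> \<mm>" "k' = a \<otimes> b'" by blast
      have "k \<oplus> k' = a \<otimes> (b \<oplus> b')" using b b' aA Icarr by (simp add: r_distr)
      thus "k \<oplus> k' \<in> ?K" using b b' a_closed by blast
    qed
    fix k y assume "k \<in> ?K" and y: "y \<in> carrier A"
    then obtain b where b: "b \<in> \<mm>" "k = a \<otimes> b" by blast
    have "y \<otimes> k = a \<otimes> (y \<otimes> b)" using b aA y Icarr by (simp add: m_lcomm)
    thus "y \<otimes> k \<in> ?K" using b y I_l_closed by blast
    thus "k \<otimes> y \<in> ?K" using b aA y Icarr by (simp add: m_comm)
  qed
  have KI: "?K \<subseteq> I" using ax I.I_r_closed Icarr by blast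
  have "?Q ?K"
  proof (rule ccontr)
    assume "\<not> ?Q ?K"
    hence 0: "\<And>b x. b \<in> \<mm> \<Longrightarrow> x \<in> J \<Longrightarrow> (a \<otimes> b) \<otimes> x = \<zero>" by blast
    let ?N = "{y \<in> carrier A. a \<otimes> y = \<zero>}"
    have "ideal ?N A"
    proof (rule idealI[OF ring_axioms])
      show "subgroup ?N (add_monoid A)"
        by (rule add.subgroupI) (use aA in \<open>auto simp: r_distr r_minus\<close>)
      fix k y assume k: "k \<in> ?N" and y: "y \<in> carrier A"
      thus "y \<otimes> k \<in> ?N" using aA by (simp add: m_lcomm[of a y k])
      thus "k \<otimes> y \<in> ?N" using k y by (simp add: m_comm)
    qed
    moreover have "{a \<otimes> x | a x. a \<in> \<mm> \<and> x \<in> J} \<subseteq> ?N"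
      using 0 Icarr aA J.Icarr by (auto simp: m_assoc)
    ultimately have "Idl {a \<otimes> x | a x. a \<in> \<mm> \<and> x \<in> J} \<subseteq> ?N" by (rule genideal_minimal)
    thus False using mJ ax by blast
  qed
  hence "?K = I" using I(3)[OF K] KI by blast
  then obtain b where b: "b \<in> \<mm>" "a = a \<otimes> b" using ax by blast
  have bA: "b \<in> carrier A" using b Icarr by simp
  have "a \<otimes> (\<one> \<ominus> b) = a \<ominus> a \<otimes> b" using aA bA by (simp add: minus_eq r_distr r_minus)
  also have "\<dots> = \<zero>" using b aA by (simp add: minus_eq r_neg)
  finally have "a \<otimes> (\<one> \<ominus> b) = \<zero>" .
  hence "a \<otimes> (\<one> \<ominus> b) \<otimes> inv (\<one> \<ominus> b) = \<zero>" using one_minus_unit[OF b(1)] by simp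
  hence "a = \<zero>" using one_minus_unit[OF b(1)] aA bA by (simp add: m_assoc)
  thus False using ax J.Icarr by simp
qed

text \<open>
  Let \<open>J\<close> be minimal with \<open>A/J\<close> of finite length.  If \<open>\<mm>J \<noteq> J\<close>, choose \<open>v \<in> J - \<mm>J\<close> and an ideal \<open>I\<close>
  that is maximal with \<open>\<mm>J \<subseteq> I \<subseteq> J\<close> and \<open>v \<notin> I\<close>.  Over the residue field every nonzero subspace of \<open>J/I\<close>
  contains \<open>v\<close>, so \<open>J/I\<close> is a line and \<open>A/I\<close> has finite length, against minimality.  Hence \<open>J = \<mm>J\<close>
  and \<open>J = 0\<close>.
\<close>

lemma ring_finite_length: "chain_len {I. ideal I A} < \<infinity>"
proof -
  let ?X = "regular A (\<lambda>_ :: nat. {})" and ?T = "carrier A"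
  interpret X: module A ?X by (rule module_regular)
  note st = stable_regular_iff[of "\<lambda>_ :: nat. {}"]
  let ?Q = "\<lambda>J. interval_len ?X ?T J ?T < \<infinity>"
  have "?Q (carrier A)" by simp
  from minimal_ideal[OF oneideal, of ?Q, OF this] obtain J where
    J: "ideal J A" "?Q J" "\<And>K. ideal K A \<Longrightarrow> K \<subset> J \<Longrightarrow> \<not> ?Q K" by blast
  interpret J: ideal J A by (rule J)
  have big: "\<not> interval_len ?X ?T K J < \<infinity>" if K: "ideal K A" "K \<subset> J" for K
  proof
    assume "interval_len ?X ?T K J < \<infinity>"
    moreover have "interval_len ?X ?T K ?T = interval_len ?X ?T K J + interval_len ?X ?T J ?T"
      by (rule X.interval_len_add) (use K J oneideal J.Icarr in \<open>auto simp: st\<close>)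
    ultimately show False using J(2) J(3)[OF K] by (simp add: plus_eq_infty_iff_enat)
  qed
  let ?mJ = "Idl {a \<otimes> x | a x. a \<in> \<mm> \<and> x \<in> J}"
  have gen: "{a \<otimes> x | a x. a \<in> \<mm> \<and> x \<in> J} \<subseteq> J" using J.I_l_closed Icarr by auto
  have mJ: "ideal ?mJ A" by (rule genideal_ideal) (use gen J.a_subset in auto)
  have mJJ: "?mJ \<subseteq> J" using gen J(1) by (intro genideal_minimal)
  have "J \<subseteq> ?mJ"
  proof (rule ccontr)
    assume "\<not> J \<subseteq> ?mJ"
    then obtain v where v: "v \<in> J" "v \<notin> ?mJ" by blast
    obtain I where I: "stable ?X ?T I" "?mJ \<subseteq> I" "I \<subseteq> J" "v \<notin> I"
      "\<And>W. stable ?X ?T W \<Longrightarrow> I \<subset> W \<Longrightarrow> W \<subseteq> J \<Longrightarrow> v \<in> W"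
      using X.exists_maximal_stable_avoiding[of ?T ?mJ J v] mJ mJJ v st by blast
    interpret I: ideal I A using I(1) st by blast
    have "W = J" if W: "stable ?X ?T W" "I \<subset> W" "W \<subseteq> J" for W
    proof
      interpret W: ideal W A using W(1) st by blast
      show "J \<subseteq> W"
      proof
        fix w assume w: "w \<in> J"
        have wA: "w \<in> carrier A" using w by simp
        show "w \<in> W"
        proof (cases "w \<in> I")
          case False
          let ?P = "PIdl w"
          have P: "ideal ?P A" "w \<in> ?P" using cgenideal_ideal cgenideal_self wA by auto
          have PJ: "?P \<subseteq> J" using cgenideal_minimal[OF J(1) w] .
          have "v \<in> I <+>\<^bsub>?X\<^esub> ?P"
          proof (rule I(5))
            show "stable ?X ?T (I <+>\<^bsub>?X\<^esub> ?P)" using X.stable_sum I(1) P st by blast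
            show "I \<subset> I <+>\<^bsub>?X\<^esub> ?P"
              using X.set_add_subset1[of ?T I ?P] X.set_add_subset2[of ?T I ?P] I(1) P st False by blast
            show "I <+>\<^bsub>?X\<^esub> ?P \<subseteq> J" using X.set_add_least[OF I(3) PJ] J(1) st by blast
          qed
          then obtain i p where ip: "i \<in> I" "p \<in> ?P" "v = i \<oplus> p" unfolding set_add_def' by auto
          then obtain a where a: "a \<in> carrier A" "p = a \<otimes> w" unfolding cgenideal_def by auto
          have "a \<notin> \<mm>"
          proof
            assume "a \<in> \<mm>"
            hence "a \<otimes> w \<in> {a \<otimes> x | a x. a \<in> \<mm> \<and> x \<in> J}" using w by blast
            moreover have "{a \<otimes> x | a x. a \<in> \<mm> \<and> x \<in> J} \<subseteq> ?mJ"
              by (rule genideal_self) (use gen J.a_subset in auto)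
            ultimately have "p \<in> I" using a I(2) by blast
            thus False using ip I(4) by simp
          qed
          hence u: "a \<in> Units A" using unit_of_not_mem a by blast
          have "v \<in> W" using I(5) W by blast
          hence "v \<ominus> i \<in> W" using ip W(2) by (auto simp: minus_eq)
          moreover have "v \<ominus> i = a \<otimes> w"
            using X.add_diff_cancel[of i p v] ip a wA I.Icarr by simp
          ultimately have "inv a \<otimes> (a \<otimes> w) \<in> W" using u W.I_l_closed by auto
          thus ?thesis using u wA a by (simp flip: m_assoc)
        qed (use W(2) in auto)
      qed
    qed (use W in auto)
    hence sub: "{W. stable ?X ?T W \<and> I \<subseteq> W \<and> W \<subseteq> J} \<subseteq> {I, J}" by blast
    have "interval_len ?X ?T I J < \<infinity>"
      unfolding interval_len_def by (rule finite_chain_len) (rule finite_subset[OF sub], simp)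
    thus False using big[of I] I v st by blast
  qed
  hence "J = {\<zero>}" by (rule ideal_eq_zero_of_maximal_mult[OF J(1)])
  hence "interval_len ?X ?T {\<zero>} ?T < \<infinity>" using J(2) by simp
  moreover have "chain_len {I. ideal I A} \<le> interval_len ?X ?T {\<zero>} ?T"
    unfolding interval_len_def
    by (rule chain_len_strict_mono[of "\<lambda>x. x"])
      (auto simp: st ideal.Icarr additive_subgroup.zero_closed ideal.axioms(1))
  ultimately show ?thesis by (rule le_less_trans[rotated])
qed

end

section \<open>Homogeneous components\<close>

definition hcomp :: "('s, 'm, 'i, 'y) graded_module_scheme \<Rightarrow> 'm \<Rightarrow> 'i \<Rightarrow> 'm" where
  "hcomp M x = (THE f. (\<forall>n. f n \<in> component M n) \<and> finite {n. f n \<noteq> \<zero>\<^bsub>M\<^esub>} \<and>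
     x = finsum M f {n. f n \<noteq> \<zero>\<^bsub>M\<^esub>})"

context graded_group begin

lemma component_props:
  "component M n \<subseteq> carrier M" "\<zero> \<in> component M n"
  "x \<in> component M n \<Longrightarrow> y \<in> component M n \<Longrightarrow> x \<oplus> y \<in> component M n"
  "x \<in> component M n \<Longrightarrow> \<ominus> x \<in> component M n"
proof -
  interpret C: additive_subgroup "component M n" M by (rule component_subgroup)
  show "component M n \<subseteq> carrier M" by (rule C.a_subset)
  show "\<zero> \<in> component M n" by (rule C.zero_closed)
  show "x \<in> component M n \<Longrightarrow> y \<in> component M n \<Longrightarrow> x \<oplus> y \<in> component M n" by (rule C.a_closed)
  show "x \<in> component M n \<Longrightarrow> \<ominus> x \<in> component M n"
    using subgroup.m_inv_closed[OF C.a_subgroup] by (simp add: a_inv_def)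
qed

lemma component_closed: "x \<in> component M n \<Longrightarrow> x \<in> carrier M" using component_props(1) by blast

lemma hcomp_spec:
  assumes "x \<in> carrier M"
  shows "hcomp M x n \<in> component M n" "finite {n. hcomp M x n \<noteq> \<zero>}"
    "x = finsum M (hcomp M x) {n. hcomp M x n \<noteq> \<zero>}"
  using theI'[OF decomposition[OF assms]] unfolding hcomp_def by auto

lemma hcomp_closed [simp]: "x \<in> carrier M \<Longrightarrow> hcomp M x n \<in> carrier M"
  using hcomp_spec(1) component_props(1) by blast

lemma hcomp_eqI:
  assumes "finite F" "\<And>n. n \<in> F \<Longrightarrow> f n \<in> component M n" "x = finsum M f F"
  shows "hcomp M x n = (if n \<in> F then f n else \<zero>)"
proof -
  let ?g = "\<lambda>n. if n \<in> F then f n else \<zero>"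
  have fc: "f \<in> F \<rightarrow> carrier M" using assms(2) component_closed by blast
  have x: "x \<in> carrier M" using assms(3) fc by (simp add: finsum_closed)
  have fin: "finite {n. ?g n \<noteq> \<zero>}" by (rule finite_subset[OF _ assms(1)]) auto
  have "x = finsum M ?g {n. ?g n \<noteq> \<zero>}"
    unfolding assms(3)
    by (rule add.finprod_mono_neutral_cong_right) (use assms(1) fc in auto)
  moreover have "\<forall>n. ?g n \<in> component M n" using assms(2) component_props(2) by auto
  ultimately have "hcomp M x = ?g"
    unfolding hcomp_def by (intro the1_equality[OF decomposition[OF x]] conjI fin)
  thus ?thesis by simp
qed

lemma hcomp_sum:
  assumes "x \<in> carrier M" "finite F" "{n. hcomp M x n \<noteq> \<zero>} \<subseteq> F"
  shows "x = finsum M (hcomp M x) F"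
proof -
  have "finsum M (hcomp M x) {n. hcomp M x n \<noteq> \<zero>} = finsum M (hcomp M x) F"
    by (rule add.finprod_mono_neutral_cong_left) (use assms in auto)
  thus ?thesis using hcomp_spec(3)[OF assms(1)] by simp
qed

lemma hcomp_component:
  assumes "x \<in> component M n" shows "hcomp M x m = (if m = n then x else \<zero>)"
proof -
  have "x = finsum M (\<lambda>_. x) {n}" using component_closed[OF assms] by simp
  from hcomp_eqI[OF _ _ this, of m] assms show ?thesis by simp
qed

lemma hcomp_zero [simp]: "hcomp M \<zero> n = \<zero>"
  using hcomp_component[OF component_props(2)] by simp

lemma hcomp_add:
  assumes "x \<in> carrier M" "y \<in> carrier M"
  shows "hcomp M (x \<oplus> y) n = hcomp M x n \<oplus> hcomp M y n"
proof -
  let ?F = "{n. hcomp M x n \<noteq> \<zero>} \<union> {n. hcomp M y n \<noteq> \<zero>}"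
  have F: "finite ?F" using hcomp_spec assms by auto
  have "x \<oplus> y = finsum M (hcomp M x) ?F \<oplus> finsum M (hcomp M y) ?F"
    using hcomp_sum[OF assms(1) F] hcomp_sum[OF assms(2) F] by auto
  also have "\<dots> = finsum M (\<lambda>n. hcomp M x n \<oplus> hcomp M y n) ?F"
    by (rule finsum_addf[symmetric]) (use assms in auto)
  finally have "x \<oplus> y = finsum M (\<lambda>n. hcomp M x n \<oplus> hcomp M y n) ?F" .
  from hcomp_eqI[OF F _ this, of n] show ?thesis
    using hcomp_spec(1) assms component_props(3) by auto
qed

lemma hcomp_minus:
  assumes "x \<in> carrier M" shows "hcomp M (\<ominus> x) n = \<ominus> hcomp M x n"
proof -
  have "hcomp M (\<ominus> x) n \<oplus> hcomp M x n = \<zero>"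
    using hcomp_add[of "\<ominus> x" x n] assms by (simp add: l_neg)
  thus ?thesis using assms minus_equality by simp
qed

lemma hcomp_finsum:
  assumes "finite F" "\<And>i. i \<in> F \<Longrightarrow> f i \<in> carrier M"
  shows "hcomp M (finsum M f F) n = finsum M (\<lambda>i. hcomp M (f i) n) F"
  using assms
proof (induction F)
  case (insert i F)
  thus ?case by (simp add: hcomp_add Pi_def finsum_closed)
qed simp

lemma graded_induct [consumes 1, case_names component add]:
  assumes x: "x \<in> carrier M" and comp: "\<And>n x. x \<in> component M n \<Longrightarrow> Q x"
    and add: "\<And>x y. x \<in> carrier M \<Longrightarrow> y \<in> carrier M \<Longrightarrow> Q x \<Longrightarrow> Q y \<Longrightarrow> Q (x \<oplus> y)"
  shows "Q x"
proof -
  have "Q (finsum M (hcomp M x) F)" if "finite F" for F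
    using that
  proof (induction F)
    case empty
    show ?case using comp[OF component_props(2)] by simp
  next
    case (insert n F)
    have "Q (hcomp M x n \<oplus> finsum M (hcomp M x) F)"
      by (rule add) (use x insert comp hcomp_spec in \<open>auto intro!: finsum_closed\<close>)
    thus ?case using insert x by (simp add: Pi_def)
  qed
  thus ?thesis using hcomp_spec[OF x] by metis
qed

end

definition homogeneous :: "('s, 'm, 'i, 'y) graded_module_scheme \<Rightarrow> 'm set \<Rightarrow> bool" where
  "homogeneous M N \<longleftrightarrow> (\<forall>x\<in>N. \<forall>n. hcomp M x n \<in> N)"

lemma homogeneousD: "homogeneous M N \<Longrightarrow> x \<in> N \<Longrightarrow> hcomp M x n \<in> N"
  by (auto simp: homogeneous_def)

locale graded_mod = module S M + graded_group M + SG: graded_group S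
  for S :: "('a, 's, nat ^ 'd::finite, 'z) graded_module_scheme"
    and M :: "('s, 'm, nat ^ 'd, 'y) graded_module_scheme" (structure) +
  assumes smult_component:
      "s \<in> component S m \<Longrightarrow> x \<in> component M n \<Longrightarrow> s \<odot> x \<in> component M (m + n)"
    and mult_component:
      "s \<in> component S m \<Longrightarrow> t \<in> component S n \<Longrightarrow> s \<otimes>\<^bsub>S\<^esub> t \<in> component S (m + n)"
begin

lemma hcomp_smult:
  assumes s: "s \<in> component S p" and x: "x \<in> carrier M"
  shows "hcomp M (s \<odot> x) n = (if p \<le> n then s \<odot> hcomp M x (n - p) else \<zero>)"
proof -
  have sS: "s \<in> carrier S" using s SG.component_closed by blast
  let ?F = "{n. hcomp M x n \<noteq> \<zero>}" let ?G = "(\<lambda>q. q + p) ` ?F"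
  have F: "finite ?F" using hcomp_spec(2)[OF x] .
  have "s \<odot> x = s \<odot> finsum M (hcomp M x) ?F" using hcomp_spec(3)[OF x] by simp
  also have "\<dots> = finsum M (\<lambda>q. s \<odot> hcomp M x q) ?F"
    by (rule finsum_smult_ldistr) (use F sS x in auto)
  also have "\<dots> = finsum M (\<lambda>q. s \<odot> hcomp M x (q + p - p)) ?F" by simp
  also have "\<dots> = finsum M (\<lambda>n. s \<odot> hcomp M x (n - p)) ?G"
    by (rule finsum_reindex[symmetric]) (use sS x in \<open>auto simp: inj_on_def\<close>)
  finally have eq: "s \<odot> x = finsum M (\<lambda>n. s \<odot> hcomp M x (n - p)) ?G" .
  have "hcomp M (s \<odot> x) n = (if n \<in> ?G then s \<odot> hcomp M x (n - p) else \<zero>)"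
  proof (rule hcomp_eqI[OF _ _ eq])
    fix n assume "n \<in> ?G"
    then obtain q where q: "n = q + p" by auto
    show "s \<odot> hcomp M x (n - p) \<in> component M n"
      using smult_component[OF s hcomp_spec(1)[OF x, of q]] by (simp add: q add.commute)
  qed (use F in simp)
  moreover have "s \<odot> hcomp M x (n - p) = \<zero>" if "p \<le> n" "n \<notin> ?G"
  proof -
    have "n - p \<notin> ?F" using that vec_diff_add[OF that(1)] by (metis imageI)
    thus ?thesis using sS by simp
  qed
  ultimately show ?thesis using vec_le_add2[of p] by auto
qed

text \<open>
  The component of a product in degree \<open>n\<close> is the sum of the products of components in degrees \<open>p\<close>
  and \<open>n - p\<close>.  Only membership of such sums in subgroups is used, so the convolution formula is
  stated in this form.
\<close>

lemma hcomp_smult_mem: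
  assumes s: "s \<in> carrier S" and x: "x \<in> carrier M"
    and N: "\<zero> \<in> N" "\<And>a b. a \<in> N \<Longrightarrow> b \<in> N \<Longrightarrow> a \<oplus> b \<in> N"
    and mem: "\<And>p. p \<le> n \<Longrightarrow> hcomp S s p \<odot> hcomp M x (n - p) \<in> N"
  shows "hcomp M (s \<odot> x) n \<in> N"
proof -
  have "hcomp M (finsum S (hcomp S s) F \<odot> x) n \<in> N" if "finite F" for F
    using that
  proof (induction F)
    case empty
    show ?case using x N by simp
  next
    case (insert p F)
    have c: "finsum S (hcomp S s) F \<in> carrier S" "hcomp S s p \<in> carrier S"
      using s by (auto intro!: R.finsum_closed)
    have "finsum S (hcomp S s) (insert p F) \<odot> x = hcomp S s p \<odot> x \<oplus> finsum S (hcomp S s) F \<odot> x"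
      using insert s x c by (simp add: smult_l_distr)
    hence "hcomp M (finsum S (hcomp S s) (insert p F) \<odot> x) n =
        hcomp M (hcomp S s p \<odot> x) n \<oplus> hcomp M (finsum S (hcomp S s) F \<odot> x) n"
      using c x by (simp add: hcomp_add)
    moreover have "hcomp M (hcomp S s p \<odot> x) n \<in> N"
      using hcomp_smult[OF SG.hcomp_spec(1)[OF s] x, of p n] mem N(1) by auto
    ultimately show ?case using insert.IH N(2) by simp
  qed
  thus ?thesis using SG.hcomp_spec[OF s] by metis
qed

lemma graded_mod_regular: "graded_mod S (regular S (component S))"
proof -
  let ?X = "regular S (component S)"
  interpret X: module S ?X by (rule R.module_regular)
  show ?thesis
  proof (rule graded_mod.intro)
    show "module S ?X" by (rule X.module_axioms)
    show "graded_group S" by (rule SG.graded_group_axioms)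
    show "graded_group ?X"
    proof (rule graded_group.intro)
      show "abelian_group ?X" by (rule X.M.abelian_group_axioms)
      show "graded_group_axioms ?X"
      proof (rule graded_group_axioms.intro)
        fix n :: "nat ^ 'd"
        show "additive_subgroup (component ?X n) ?X"
        proof (rule additive_subgroupI)
          show "subgroup (component ?X n) (add_monoid ?X)"
            by (rule X.M.add.subgroupI) (use SG.component_props(1,3,4) SG.component_props(2)[of n] in auto)
        qed
      qed (use SG.decomposition in simp)
    qed
    show "graded_mod_axioms S ?X" by standard (use mult_component in auto)
  qed
qed

lemma hcomp_regular: "hcomp (regular S (component S)) = hcomp S"
  unfolding hcomp_def by (rule ext) simp

lemma stable_of_homogeneous_smult:
  assumes N: "N \<subseteq> carrier M" "\<zero> \<in> N" "\<And>a b. a \<in> N \<Longrightarrow> b \<in> N \<Longrightarrow> a \<oplus> b \<in> N" "\<And>a. a \<in> N \<Longrightarrow> \<ominus> a \<in> N"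
    and smult: "\<And>s p x. s \<in> component S p \<Longrightarrow> x \<in> N \<Longrightarrow> s \<odot> x \<in> N"
  shows "stable M (carrier S) N"
proof (rule stableI)
  fix s x assume s: "s \<in> carrier S" and x: "x \<in> N"
  have xM: "x \<in> carrier M" using x N by blast
  show "s \<odot> x \<in> N" using s
  proof (induction s rule: SG.graded_induct)
    case (component n s) thus ?case using smult x by blast
  next
    case (add s t) thus ?case using xM N(3) by (simp add: smult_l_distr)
  qed
qed (use N in auto)

end

locale std_mod = graded_mod S M + AL: artinian_local_ring A \<mm> + SA: standard_graded_algebra A S
  for A :: "('a, 'x) ring_scheme" and \<mm> and S :: "('a, 's, nat ^ 'd::finite, 'z) graded_module_scheme"
    and M :: "('s, 'm, nat ^ 'd, 'y) graded_module_scheme" (structure)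

definition scalars :: "('a, 'x) ring_scheme \<Rightarrow> ('a, 's, 'z) module_scheme \<Rightarrow> 's set" where
  "scalars A S = (\<lambda>a. a \<odot>\<^bsub>S\<^esub> \<one>\<^bsub>S\<^esub>) ` carrier A"

text \<open>
  The inverse in the \<open>A\<close>-module \<open>M\<^sub>n\<close> is defined relative to the carrier \<open>M\<^sub>n\<close>; once it is identified with
  the inverse in \<open>M\<close>, both sides speak of the same chains.
\<close>

lemma module_length_stable:
  assumes M: "module S M" and C: "stable M (scalars A S) (component M n)"
  shows "module_length A (component_module S M n) = interval_len M (scalars A S) {\<zero>\<^bsub>M\<^esub>} (component M n)"
proof -
  interpret module S M by (rule M)
  let ?X = "component_module S M n"
  note C' = stableD[OF C]
  have simps: "carrier ?X = component M n" "add ?X = add M" "zero ?X = zero M"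
    "smult ?X = (\<lambda>a m. (a \<odot>\<^bsub>S\<^esub> \<one>\<^bsub>S\<^esub>) \<odot>\<^bsub>M\<^esub> m)" by (simp_all add: component_module_def)
  have inv: "m_inv (add_monoid ?X) x = \<ominus>\<^bsub>M\<^esub> x" if x: "x \<in> component M n" for x
    unfolding m_inv_def
  proof (rule the_equality)
    show "\<ominus>\<^bsub>M\<^esub> x \<in> carrier (add_monoid ?X) \<and> x \<otimes>\<^bsub>add_monoid ?X\<^esub> \<ominus>\<^bsub>M\<^esub> x = \<one>\<^bsub>add_monoid ?X\<^esub> \<and>
        \<ominus>\<^bsub>M\<^esub> x \<otimes>\<^bsub>add_monoid ?X\<^esub> x = \<one>\<^bsub>add_monoid ?X\<^esub>"
      using x C'(1,4) by (auto simp: simps M.r_neg M.l_neg)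
    fix y assume "y \<in> carrier (add_monoid ?X) \<and> x \<otimes>\<^bsub>add_monoid ?X\<^esub> y = \<one>\<^bsub>add_monoid ?X\<^esub> \<and>
        y \<otimes>\<^bsub>add_monoid ?X\<^esub> x = \<one>\<^bsub>add_monoid ?X\<^esub>"
    thus "y = \<ominus>\<^bsub>M\<^esub> x" using M.minus_equality[of y x] x C'(1) by (auto simp: simps)
  qed
  have "submodule N A ?X \<longleftrightarrow> stable M (scalars A S) N \<and> {\<zero>\<^bsub>M\<^esub>} \<subseteq> N \<and> N \<subseteq> component M n" for N
  proof
    assume N: "submodule N A ?X"
    interpret N: submodule N A ?X by (rule N)
    have sub: "N \<subseteq> component M n" using N.subset by (simp add: simps)
    have "stable M (scalars A S) N"
    proof (rule stableI)
      show "N \<subseteq> carrier M" using sub C'(1) by blast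
      show "\<zero>\<^bsub>M\<^esub> \<in> N" using N.one_closed by (simp add: simps)
      show "x \<oplus>\<^bsub>M\<^esub> y \<in> N" if "x \<in> N" "y \<in> N" for x y using N.m_closed[OF that] by (simp add: simps)
      show "\<ominus>\<^bsub>M\<^esub> x \<in> N" if "x \<in> N" for x
        using N.m_inv_closed[OF that] unfolding inv[OF subsetD[OF sub that]] .
      show "t \<odot>\<^bsub>M\<^esub> x \<in> N" if "t \<in> scalars A S" "x \<in> N" for t x
        using N.smult_closed[of _ x] that by (auto simp: simps scalars_def)
    qed
    thus "stable M (scalars A S) N \<and> {\<zero>\<^bsub>M\<^esub>} \<subseteq> N \<and> N \<subseteq> component M n" using sub stableD(2) by blast
  next
    assume N: "stable M (scalars A S) N \<and> {\<zero>\<^bsub>M\<^esub>} \<subseteq> N \<and> N \<subseteq> component M n"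
    hence N': "stable M (scalars A S) N" and sub: "N \<subseteq> component M n" by auto
    show "submodule N A ?X"
    proof (intro submodule.intro subgroup.intro submodule_axioms.intro)
      show "N \<subseteq> carrier (add_monoid ?X)" using sub by (simp add: simps)
      show "x \<otimes>\<^bsub>add_monoid ?X\<^esub> y \<in> N" if "x \<in> N" "y \<in> N" for x y
        using stableD(3)[OF N' that] by (simp add: simps)
      show "\<one>\<^bsub>add_monoid ?X\<^esub> \<in> N" using stableD(2)[OF N'] by (simp add: simps)
      show "inv\<^bsub>add_monoid ?X\<^esub> x \<in> N" if "x \<in> N" for x
        unfolding inv[OF subsetD[OF sub that]] by (rule stableD(4)[OF N' that])
      show "a \<odot>\<^bsub>?X\<^esub> x \<in> N" if "a \<in> carrier A" "x \<in> N" for a x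
        using stableD(5)[OF N' _ that(2), of "a \<odot>\<^bsub>S\<^esub> \<one>\<^bsub>S\<^esub>"] that(1) by (simp add: simps scalars_def)
    qed
  qed
  thus ?thesis unfolding module_length_def interval_len_def chain_len_def by simp
qed

section \<open>Noetherian modules\<close>

lemma (in module) submodule_iff_stable: "submodule N R M \<longleftrightarrow> stable M (carrier R) N"
proof
  assume N: "submodule N R M"
  note N' = submoduleE[OF N]
  show "stable M (carrier R) N"
  proof (rule stableI)
    obtain x where "x \<in> N" using N'(2) by blast
    thus "\<zero>\<^bsub>M\<^esub> \<in> N" using N'(4)[of \<zero> x] N'(1) by auto
  qed (use N' in auto)
next
  assume "stable M (carrier R) N"
  thus "submodule N R M" by (intro submoduleI) (auto dest: stableD)
qed

context module begin

lemma stable_zero: "T \<subseteq> carrier R \<Longrightarrow> stable M T {\<zero>\<^bsub>M\<^esub>}"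
  by (rule stableI) auto

lemma stable_carrier: "T \<subseteq> carrier R \<Longrightarrow> stable M T (carrier M)"
  by (rule stableI) auto

text \<open>
  Hilbert's basis theorem for \<open>U[y] = \<Sum>\<^sub>n y\<^sup>n U\<close>, inside a given module instead of a polynomial module.
  With \<open>V\<^sub>n = U + yU + \<dots> + y\<^sup>n\<^sup>-\<^sup>1 U\<close>, the set \<open>L\<^sub>n(I)\<close> of leading coefficients of the elements
  \<open>v + y\<^sup>n u \<in> I\<close> with \<open>v \<in> V\<^sub>n\<close> increases with \<open>n\<close> and with \<open>I\<close>, and ideals \<open>I \<subseteq> J\<close> with the same \<open>L\<^sub>n\<close> for
  all \<open>n\<close> are equal.
\<close>

lemma acc_adjoin:
  assumes T: "T \<subseteq> carrier R" and y: "y \<in> carrier R" and U: "stable M T U"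
    and acc: "acc {N. stable M T N \<and> N \<subseteq> U}"
  obtains U' where "stable M (insert y T) U'" "U \<subseteq> U'" "acc {N. stable M (insert y T) N \<and> N \<subseteq> U'}"
proof -
  define P where "P n = (\<lambda>u. (y [^] (n::nat)) \<odot>\<^bsub>M\<^esub> u) ` U" for n
  define V where "V = rec_nat {\<zero>\<^bsub>M\<^esub>} (\<lambda>n W. W <+>\<^bsub>M\<^esub> P n)"
  have V0: "V 0 = {\<zero>\<^bsub>M\<^esub>}" and VS: "V (Suc n) = V n <+>\<^bsub>M\<^esub> P n" for n by (simp_all add: V_def)
  note U' = stableD[OF U]
  have yn: "y [^] (n::nat) \<in> carrier R" for n using y by simp
  have P: "stable M T (P n)" for n
    unfolding P_def by (rule operator_map.image_stable[OF smult_operator_map[OF yn T U] U subset_refl])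
  have V: "stable M T (V n)" for n
    by (induction n) (use stable_zero[OF T] stable_sum[OF _ P T] in \<open>auto simp: V0 VS\<close>)
  have Vmono: "V n \<subseteq> V (Suc n)" for n using set_add_subset1[OF V P] by (simp add: VS)
  have Vle: "V m \<subseteq> V n" if "m \<le> n" for m n using lift_Suc_mono_le[of V, OF Vmono that] .
  have PV: "P n \<subseteq> V (Suc n)" for n using set_add_subset2[OF V P] by (simp add: VS)
  have yP: "y \<odot>\<^bsub>M\<^esub> a \<in> P (Suc n)" if "a \<in> P n" for a n
  proof -
    obtain u where u: "u \<in> U" "a = (y [^] n) \<odot>\<^bsub>M\<^esub> u" using \<open>a \<in> P n\<close> unfolding P_def by auto
    have "y \<odot>\<^bsub>M\<^esub> a = (y \<otimes> y [^] n) \<odot>\<^bsub>M\<^esub> u" using u U'(1) y by (simp add: smult_assoc1)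
    also have "y \<otimes> y [^] n = y [^] Suc n" using y by (simp add: R.m_comm)
    finally show ?thesis unfolding P_def using u by blast
  qed
  have yV: "y \<odot>\<^bsub>M\<^esub> v \<in> V (Suc n)" if "v \<in> V n" for v n
    using that
  proof (induction n arbitrary: v)
    case 0
    hence "y \<odot>\<^bsub>M\<^esub> v = \<zero>\<^bsub>M\<^esub>" using y by (simp add: V0)
    thus ?case using stableD(2)[OF V] by simp
  next
    case (Suc n)
    then obtain w p where wp: "w \<in> V n" "p \<in> P n" "v = w \<oplus>\<^bsub>M\<^esub> p" unfolding VS set_add_def' by auto
    have c: "w \<in> carrier M" "p \<in> carrier M" using wp stableD(1)[OF V] stableD(1)[OF P] by auto
    have "y \<odot>\<^bsub>M\<^esub> v = y \<odot>\<^bsub>M\<^esub> w \<oplus>\<^bsub>M\<^esub> y \<odot>\<^bsub>M\<^esub> p" using wp c y by (simp add: smult_r_distr)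
    also have "\<dots> \<in> V (Suc n) <+>\<^bsub>M\<^esub> P (Suc n)" using Suc.IH[OF wp(1)] yP[OF wp(2)] by (rule set_addI)
    finally show ?case by (simp add: VS[of "Suc n"])
  qed
  define W where "W = (\<Union>n. V n)"
  have W: "stable M (insert y T) W"
  proof (rule stableI)
    show "W \<subseteq> carrier M" unfolding W_def using stableD(6)[OF V] by blast
    show "\<zero>\<^bsub>M\<^esub> \<in> W" unfolding W_def using stableD(2)[OF V] by blast
    fix a assume "a \<in> W"
    then obtain n where n: "a \<in> V n" unfolding W_def by blast
    show "\<ominus>\<^bsub>M\<^esub> a \<in> W" unfolding W_def using stableD(4)[OF V n] by blast
    show "t \<odot>\<^bsub>M\<^esub> a \<in> W" if "t \<in> insert y T" for t
      using that yV[OF n] stableD(5)[OF V _ n] unfolding W_def by blast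
    fix b assume "b \<in> W"
    then obtain m where m: "b \<in> V m" unfolding W_def by blast
    have "a \<in> V (max n m)" "b \<in> V (max n m)" using n m Vle[of n "max n m"] Vle[of m "max n m"] by auto
    thus "a \<oplus>\<^bsub>M\<^esub> b \<in> W" unfolding W_def using stableD(3)[OF V] by blast
  qed
  have UW: "U \<subseteq> W"
  proof
    fix u assume u: "u \<in> U"
    have "(y [^] (0::nat)) \<odot>\<^bsub>M\<^esub> u \<in> P 0" unfolding P_def using u by blast
    hence "u \<in> P 0" using U'(1)[OF u] by simp
    thus "u \<in> W" using PV[of 0] unfolding W_def by blast
  qed
  define L where "L n I = {u \<in> U. \<exists>v\<in>V n. v \<oplus>\<^bsub>M\<^esub> (y [^] n) \<odot>\<^bsub>M\<^esub> u \<in> I}" for n I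
  have L_mono: "L n I \<subseteq> L n J" if "I \<subseteq> J" for n I J using that unfolding L_def by blast
  have L_stable: "stable M T (L n I)" if I: "stable M (insert y T) I" for n I
  proof (rule stableI)
    note I' = stableD[OF I] and Vn = stableD[OF V[of n]]
    show "L n I \<subseteq> carrier M" unfolding L_def using U'(1) by blast
    have "\<zero>\<^bsub>M\<^esub> \<oplus>\<^bsub>M\<^esub> (y [^] n) \<odot>\<^bsub>M\<^esub> \<zero>\<^bsub>M\<^esub> \<in> I" using I'(2) yn by simp
    thus "\<zero>\<^bsub>M\<^esub> \<in> L n I" unfolding L_def using U'(2) Vn(2) by blast
    fix u assume "u \<in> L n I"
    then obtain v where uv: "u \<in> U" "v \<in> V n" "v \<oplus>\<^bsub>M\<^esub> (y [^] n) \<odot>\<^bsub>M\<^esub> u \<in> I" unfolding L_def by blast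
    have c: "u \<in> carrier M" "v \<in> carrier M" using uv U'(1) Vn(1) by auto
    have "\<ominus>\<^bsub>M\<^esub> (v \<oplus>\<^bsub>M\<^esub> (y [^] n) \<odot>\<^bsub>M\<^esub> u) = \<ominus>\<^bsub>M\<^esub> v \<oplus>\<^bsub>M\<^esub> (y [^] n) \<odot>\<^bsub>M\<^esub> (\<ominus>\<^bsub>M\<^esub> u)"
      using c yn by (simp add: M.minus_add smult_r_minus)
    hence "\<ominus>\<^bsub>M\<^esub> v \<oplus>\<^bsub>M\<^esub> (y [^] n) \<odot>\<^bsub>M\<^esub> (\<ominus>\<^bsub>M\<^esub> u) \<in> I" using I'(4)[OF uv(3)] by simp
    thus "\<ominus>\<^bsub>M\<^esub> u \<in> L n I" unfolding L_def using U'(4)[OF uv(1)] Vn(4)[OF uv(2)] by blast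
    show "t \<odot>\<^bsub>M\<^esub> u \<in> L n I" if t: "t \<in> T" for t
    proof -
      have tR: "t \<in> carrier R" using t T by blast
      have "t \<odot>\<^bsub>M\<^esub> ((y [^] n) \<odot>\<^bsub>M\<^esub> u) = (y [^] n) \<odot>\<^bsub>M\<^esub> (t \<odot>\<^bsub>M\<^esub> u)"
        using c yn[of n] tR R.m_comm[OF tR yn[of n]] by (metis smult_assoc1)
      hence "t \<odot>\<^bsub>M\<^esub> (v \<oplus>\<^bsub>M\<^esub> (y [^] n) \<odot>\<^bsub>M\<^esub> u) = t \<odot>\<^bsub>M\<^esub> v \<oplus>\<^bsub>M\<^esub> (y [^] n) \<odot>\<^bsub>M\<^esub> (t \<odot>\<^bsub>M\<^esub> u)"
        using c yn tR by (simp add: smult_r_distr)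
      hence "t \<odot>\<^bsub>M\<^esub> v \<oplus>\<^bsub>M\<^esub> (y [^] n) \<odot>\<^bsub>M\<^esub> (t \<odot>\<^bsub>M\<^esub> u) \<in> I" using I'(5)[OF _ uv(3), of t] t by simp
      thus ?thesis unfolding L_def using U'(5)[OF t uv(1)] Vn(5)[OF t uv(2)] by blast
    qed
    fix u' assume "u' \<in> L n I"
    then obtain v' where uv': "u' \<in> U" "v' \<in> V n" "v' \<oplus>\<^bsub>M\<^esub> (y [^] n) \<odot>\<^bsub>M\<^esub> u' \<in> I" unfolding L_def by blast
    have c': "u' \<in> carrier M" "v' \<in> carrier M" using uv' U'(1) Vn(1) by auto
    have "(v \<oplus>\<^bsub>M\<^esub> (y [^] n) \<odot>\<^bsub>M\<^esub> u) \<oplus>\<^bsub>M\<^esub> (v' \<oplus>\<^bsub>M\<^esub> (y [^] n) \<odot>\<^bsub>M\<^esub> u') =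
        (v \<oplus>\<^bsub>M\<^esub> v') \<oplus>\<^bsub>M\<^esub> (y [^] n) \<odot>\<^bsub>M\<^esub> (u \<oplus>\<^bsub>M\<^esub> u')"
      using c c' yn by (simp add: smult_r_distr M.add_add_swap)
    hence "(v \<oplus>\<^bsub>M\<^esub> v') \<oplus>\<^bsub>M\<^esub> (y [^] n) \<odot>\<^bsub>M\<^esub> (u \<oplus>\<^bsub>M\<^esub> u') \<in> I" using I'(3)[OF uv(3) uv'(3)] by simp
    thus "u \<oplus>\<^bsub>M\<^esub> u' \<in> L n I" unfolding L_def using U'(3)[OF uv(1) uv'(1)] Vn(3)[OF uv(2) uv'(2)] by blast
  qed
  have L_Suc: "L n I \<subseteq> L (Suc n) I" if I: "stable M (insert y T) I" for n I
  proof
    fix u assume "u \<in> L n I"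
    then obtain v where uv: "u \<in> U" "v \<in> V n" "v \<oplus>\<^bsub>M\<^esub> (y [^] n) \<odot>\<^bsub>M\<^esub> u \<in> I" unfolding L_def by blast
    have c: "u \<in> carrier M" "v \<in> carrier M" using uv U'(1) stableD(1)[OF V] by auto
    have "y [^] Suc n = y \<otimes> y [^] n" using y by (simp add: R.m_comm)
    hence "y \<odot>\<^bsub>M\<^esub> (v \<oplus>\<^bsub>M\<^esub> (y [^] n) \<odot>\<^bsub>M\<^esub> u) = y \<odot>\<^bsub>M\<^esub> v \<oplus>\<^bsub>M\<^esub> (y [^] Suc n) \<odot>\<^bsub>M\<^esub> u"
      using c yn y by (simp add: smult_r_distr smult_assoc1 del: R.nat_pow_Suc)
    hence "y \<odot>\<^bsub>M\<^esub> v \<oplus>\<^bsub>M\<^esub> (y [^] Suc n) \<odot>\<^bsub>M\<^esub> u \<in> I" using stableD(5)[OF I _ uv(3), of y] by simp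
    thus "u \<in> L (Suc n) I" unfolding L_def using uv(1) yV[OF uv(2)] by blast
  qed
  have L_le: "L m I \<subseteq> L n I" if "stable M (insert y T) I" "m \<le> n" for m n I
    using lift_Suc_mono_le[of "\<lambda>n. L n I", OF L_Suc[OF that(1)] that(2)] .
  have L_eq: "J \<subseteq> I" if I: "stable M (insert y T) I" and J: "stable M (insert y T) J"
    and sub: "I \<subseteq> J" "J \<subseteq> W" and eq: "\<And>n. L n I = L n J" for I J
  proof -
    have "J \<inter> V n \<subseteq> I" for n
    proof (induction n)
      case 0
      show ?case using stableD(2)[OF I] by (auto simp: V0)
    next
      case (Suc n)
      show ?case
      proof
        fix f assume f: "f \<in> J \<inter> V (Suc n)"
        then obtain v p where vp: "v \<in> V n" "p \<in> P n" "f = v \<oplus>\<^bsub>M\<^esub> p" unfolding VS set_add_def' by auto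
        then obtain u where u: "u \<in> U" "p = (y [^] n) \<odot>\<^bsub>M\<^esub> u" unfolding P_def by auto
        have "u \<in> L n J" unfolding L_def using u vp f by blast
        hence "u \<in> L n I" using eq by blast
        then obtain w where w: "w \<in> V n" "w \<oplus>\<^bsub>M\<^esub> p \<in> I" unfolding L_def u(2) by blast
        have c: "v \<in> carrier M" "w \<in> carrier M" "p \<in> carrier M"
          using vp w stableD(1)[OF V] stableD(1)[OF P] by auto
        have d: "f \<ominus>\<^bsub>M\<^esub> (w \<oplus>\<^bsub>M\<^esub> p) = v \<ominus>\<^bsub>M\<^esub> w"
        proof -
          have "f \<ominus>\<^bsub>M\<^esub> (w \<oplus>\<^bsub>M\<^esub> p) = (v \<oplus>\<^bsub>M\<^esub> p) \<oplus>\<^bsub>M\<^esub> (\<ominus>\<^bsub>M\<^esub> w \<oplus>\<^bsub>M\<^esub> \<ominus>\<^bsub>M\<^esub> p)"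
            using c vp(3) by (simp add: M.minus_eq M.minus_add)
          also have "\<dots> = (v \<oplus>\<^bsub>M\<^esub> \<ominus>\<^bsub>M\<^esub> w) \<oplus>\<^bsub>M\<^esub> (p \<oplus>\<^bsub>M\<^esub> \<ominus>\<^bsub>M\<^esub> p)" by (rule M.add_add_swap) (use c in auto)
          finally show ?thesis using c by (simp add: M.r_neg M.minus_eq)
        qed
        have "v \<ominus>\<^bsub>M\<^esub> w \<in> J" using stableD(7)[OF J, of f "w \<oplus>\<^bsub>M\<^esub> p"] f w(2) sub(1) d by auto
        moreover have "v \<ominus>\<^bsub>M\<^esub> w \<in> V n" by (rule stableD(7)[OF V vp(1) w(1)])
        ultimately have "v \<ominus>\<^bsub>M\<^esub> w \<in> I" using Suc.IH by blast
        hence "(v \<ominus>\<^bsub>M\<^esub> w) \<oplus>\<^bsub>M\<^esub> (w \<oplus>\<^bsub>M\<^esub> p) \<in> I" using w(2) stableD(3)[OF I] by blast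
        moreover have "(v \<ominus>\<^bsub>M\<^esub> w) \<oplus>\<^bsub>M\<^esub> (w \<oplus>\<^bsub>M\<^esub> p) = f"
          unfolding vp(3) M.minus_eq using c by (simp add: M.a_assoc M.r_neg1 M.r_neg2)
        ultimately show "f \<in> I" by simp
      qed
    qed
    thus ?thesis using sub(2) unfolding W_def by blast
  qed
  have "acc {N. stable M (insert y T) N \<and> N \<subseteq> W}"
    unfolding acc_def
  proof (intro allI impI)
    fix F :: "nat \<Rightarrow> 'c set"
    assume F: "\<forall>n. F n \<in> {N. stable M (insert y T) N \<and> N \<subseteq> W} \<and> F n \<subseteq> F (Suc n)"
    have Fst: "stable M (insert y T) (F n)" and FW: "F n \<subseteq> W" for n using F by auto
    have Fle: "F m \<subseteq> F n" if "m \<le> n" for m n using lift_Suc_mono_le[of F, OF _ that] F by blast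
    have LU: "L n I \<subseteq> U" for n I unfolding L_def by blast
    \<comment> \<open>The diagonal bounds all \<open>L\<^sub>n(F\<^sub>j)\<close> with \<open>n \<ge> N\<close>; the finitely many rows below \<open>N\<close> stabilise separately.\<close>
    obtain N where N: "\<And>n. n \<ge> N \<Longrightarrow> L n (F n) = L N (F N)"
    proof (rule accD[OF acc, of "\<lambda>n. L n (F n)"])
      show "L n (F n) \<in> {N. stable M T N \<and> N \<subseteq> U}" for n using L_stable[OF Fst] LU by blast
      show "L n (F n) \<subseteq> L (Suc n) (F (Suc n))" for n
        using L_Suc[OF Fst, of n n] L_mono[OF Fle[of n "Suc n"], of "Suc n"] by simp
    qed blast
    have "\<exists>K. \<forall>j\<ge>K. L n (F j) = L n (F K)" for n
    proof (rule accD[OF acc, of "\<lambda>j. L n (F j)"])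
      show "L n (F j) \<in> {N. stable M T N \<and> N \<subseteq> U}" for j using L_stable[OF Fst] LU by blast
      show "L n (F j) \<subseteq> L n (F (Suc j))" for j by (rule L_mono[OF Fle]) simp
    qed blast
    then obtain K where K: "\<And>n j. j \<ge> K n \<Longrightarrow> L n (F j) = L n (F (K n))" by metis
    define k where "k = N + (\<Sum>n<N. K n)"
    have kN: "N \<le> k" by (simp add: k_def)
    have kK: "K n \<le> k" if "n < N" for n
      using member_le_sum[of n "{..<N}" K] that by (simp add: k_def)
    have "F j = F k" if "j \<ge> k" for j
    proof
      show "F k \<subseteq> F j" using Fle that .
      show "F j \<subseteq> F k"
      proof (rule L_eq[OF Fst Fst Fle[OF that] FW])
        fix n
        show "L n (F k) = L n (F j)"
        proof (cases "n < N")
          case True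
          have "L n (F k) = L n (F (K n))" "L n (F j) = L n (F (K n))"
            using K[OF kK[OF True]] K[of n j] kK[OF True] that by auto
          thus ?thesis by simp
        next
          case False
          have "L n (F j) \<subseteq> L (max n j) (F j)" by (rule L_le[OF Fst]) simp
          also have "\<dots> \<subseteq> L (max n j) (F (max n j))" by (rule L_mono[OF Fle]) simp
          also have "\<dots> = L N (F N)" by (rule N) (use False in simp)
          also have "\<dots> \<subseteq> L N (F k)" by (rule L_mono[OF Fle[OF kN]])
          also have "\<dots> \<subseteq> L n (F k)" by (rule L_le[OF Fst]) (use False in simp)
          finally have "L n (F j) \<subseteq> L n (F k)" .
          thus ?thesis using L_mono[OF Fle[OF that], of n] by blast
        qed
      qed
    qed
    thus "\<exists>N. \<forall>n\<ge>N. F n = F N" by blast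
  qed
  from that[OF W UW this] show thesis .
qed

text \<open>
  A finitely generated submodule of \<open>N\<close> that differs from \<open>N\<close> can be enlarged by one generator.
\<close>

lemma finitely_generated_of_acc:
  assumes acc: "acc {N. stable M (carrier R) N}" and N: "stable M (carrier R) N"
  obtains F where "finite F" "F \<subseteq> N" "\<And>N'. stable M (carrier R) N' \<Longrightarrow> F \<subseteq> N' \<Longrightarrow> N \<subseteq> N'"
proof -
  define fg where "fg N0 = (\<exists>F. finite F \<and> F \<subseteq> N0 \<and> (\<forall>N'. stable M (carrier R) N' \<longrightarrow> F \<subseteq> N' \<longrightarrow> N0 \<subseteq> N'))" for N0
  have "N0 \<subseteq> N \<longrightarrow> fg N0 \<longrightarrow> fg N" if "N0 \<in> {N. stable M (carrier R) N}" for N0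
    using acc that
  proof (induction N0 rule: acc_induct)
    case (step N0)
    show ?case
    proof (intro impI)
      assume sub: "N0 \<subseteq> N" and "fg N0"
      then obtain F where F: "finite F" "F \<subseteq> N0" "\<forall>N'. stable M (carrier R) N' \<longrightarrow> F \<subseteq> N' \<longrightarrow> N0 \<subseteq> N'"
        unfolding fg_def by blast
      show "fg N"
      proof (cases "N0 = N")
        case False
        then obtain z where z: "z \<in> N" "z \<notin> N0" using sub by blast
        define N1 where "N1 = \<Inter>{N'. stable M (carrier R) N' \<and> insert z N0 \<subseteq> N'}"
        have N1N: "N1 \<subseteq> N" unfolding N1_def using N z sub by blast
        have N1s: "stable M (carrier R) N1"
        proof (rule stableI)
          show "N1 \<subseteq> carrier M" using N1N stableD(6)[OF N] by blast
        qed (auto simp: N1_def dest: stableD)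
        have zN: "insert z N0 \<subseteq> N1" unfolding N1_def by blast
        have "fg N1" unfolding fg_def
        proof (intro exI[of _ "insert z F"] conjI allI impI)
          show "insert z F \<subseteq> N1" using F zN by blast
          fix N' assume N': "stable M (carrier R) N'" "insert z F \<subseteq> N'"
          hence "insert z N0 \<subseteq> N'" using F by blast
          thus "N1 \<subseteq> N'" unfolding N1_def using N' by blast
        qed (use F in simp)
        thus ?thesis using step.IH[of N1] N1s N1N zN z by blast
      qed (use \<open>fg N0\<close> in simp)
    qed
  qed
  moreover have "stable M (carrier R) {\<zero>\<^bsub>M\<^esub>}" by (rule stable_zero) simp
  moreover have "fg {\<zero>\<^bsub>M\<^esub>}" unfolding fg_def by (rule exI[of _ "{}"]) (auto dest: stableD(2))
  ultimately have "fg N" using stableD(2)[OF N] by auto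
  thus thesis unfolding fg_def using that by blast
qed

end

section \<open>Standard graded algebras over an Artinian local ring\<close>

context std_mod begin

abbreviation "A1 \<equiv> scalars A S"

text \<open>
  The component of \<open>1\<close> in degree \<open>0\<close> is an identity element, as is seen by comparing degrees in \<open>x = x 1\<close>
  for homogeneous \<open>x\<close>.
\<close>

lemma one_component: "\<one>\<^bsub>S\<^esub> \<in> component S 0"
proof -
  interpret X: graded_mod S "regular S (component S)" by (rule graded_mod_regular)
  let ?e = "hcomp S \<one>\<^bsub>S\<^esub> 0"
  have "x \<otimes>\<^bsub>S\<^esub> ?e = x" if "x \<in> carrier S" for x
    using that
  proof (induction x rule: SG.graded_induct)
    case (component n x)
    have xS: "x \<in> carrier S" using component SG.component_closed by blast
    have "hcomp S (x \<otimes>\<^bsub>S\<^esub> \<one>\<^bsub>S\<^esub>) n = x \<otimes>\<^bsub>S\<^esub> hcomp S \<one>\<^bsub>S\<^esub> (n - n)"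
      using X.hcomp_smult[OF component, of "\<one>\<^bsub>S\<^esub>" n] by (simp add: hcomp_regular)
    moreover have "n - n = 0" by (simp add: vec_eq_iff)
    ultimately show ?case using SG.hcomp_component[OF component, of n] xS by simp
  next
    case (add x y)
    thus ?case by (simp add: R.l_distr)
  qed
  from this[of "\<one>\<^bsub>S\<^esub>"] have "?e = \<one>\<^bsub>S\<^esub>" by simp
  thus ?thesis using SG.hcomp_spec(1)[of "\<one>\<^bsub>S\<^esub>" 0] by simp
qed

lemma scalar_closed: "a \<in> carrier A \<Longrightarrow> a \<odot>\<^bsub>S\<^esub> \<one>\<^bsub>S\<^esub> \<in> carrier S" by (simp add: SA.smult_closed)

lemma scalars_subset: "A1 \<subseteq> carrier S" unfolding scalars_def using scalar_closed by auto

lemma scalars_component: "A1 \<subseteq> component S 0"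
proof
  fix t assume "t \<in> A1"
  then obtain a where a: "a \<in> carrier A" "t = a \<odot>\<^bsub>S\<^esub> \<one>\<^bsub>S\<^esub>" unfolding scalars_def by auto
  thus "t \<in> component S 0" using submodule.smult_closed[OF SA.component_submodule a(1) one_component] by simp
qed

lemma scalar_mult:
  "a \<in> carrier A \<Longrightarrow> b \<in> carrier A \<Longrightarrow>
    (a \<odot>\<^bsub>S\<^esub> \<one>\<^bsub>S\<^esub>) \<otimes>\<^bsub>S\<^esub> (b \<odot>\<^bsub>S\<^esub> \<one>\<^bsub>S\<^esub>) = (a \<otimes>\<^bsub>A\<^esub> b) \<odot>\<^bsub>S\<^esub> \<one>\<^bsub>S\<^esub>"
  using scalar_closed by (simp add: SA.smult_assoc2 SA.smult_assoc1)

lemma scalar_add: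
  "a \<in> carrier A \<Longrightarrow> b \<in> carrier A \<Longrightarrow>
    (a \<odot>\<^bsub>S\<^esub> \<one>\<^bsub>S\<^esub>) \<oplus>\<^bsub>S\<^esub> (b \<odot>\<^bsub>S\<^esub> \<one>\<^bsub>S\<^esub>) = (a \<oplus>\<^bsub>A\<^esub> b) \<odot>\<^bsub>S\<^esub> \<one>\<^bsub>S\<^esub>"
  by (simp add: SA.smult_l_distr)

lemma scalar_minus:
  "a \<in> carrier A \<Longrightarrow> \<ominus>\<^bsub>S\<^esub> (a \<odot>\<^bsub>S\<^esub> \<one>\<^bsub>S\<^esub>) = (\<ominus>\<^bsub>A\<^esub> a) \<odot>\<^bsub>S\<^esub> \<one>\<^bsub>S\<^esub>"
  by (simp add: SA.smult_l_minus)

lemma scalars_closed: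
  "s \<in> A1 \<Longrightarrow> t \<in> A1 \<Longrightarrow> s \<oplus>\<^bsub>S\<^esub> t \<in> A1" "s \<in> A1 \<Longrightarrow> t \<in> A1 \<Longrightarrow> s \<otimes>\<^bsub>S\<^esub> t \<in> A1"
  "s \<in> A1 \<Longrightarrow> \<ominus>\<^bsub>S\<^esub> s \<in> A1" "\<zero>\<^bsub>S\<^esub> \<in> A1" "\<one>\<^bsub>S\<^esub> \<in> A1"
proof -
  show "\<zero>\<^bsub>S\<^esub> \<in> A1" unfolding scalars_def by (rule image_eqI[of _ _ "\<zero>\<^bsub>A\<^esub>"]) auto
  show "\<one>\<^bsub>S\<^esub> \<in> A1" unfolding scalars_def by (rule image_eqI[of _ _ "\<one>\<^bsub>A\<^esub>"]) auto
qed (auto simp: scalars_def scalar_add scalar_mult scalar_minus)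

lemma generator_induct [consumes 1, case_names scalar gen minus add mult]:
  assumes x: "x \<in> carrier S"
    and "\<And>x. x \<in> A1 \<Longrightarrow> Q x" "\<And>i x. x \<in> component S (axis i 1) \<Longrightarrow> Q x"
    and "\<And>x. x \<in> carrier S \<Longrightarrow> Q x \<Longrightarrow> Q (\<ominus>\<^bsub>S\<^esub> x)"
    and "\<And>x y. x \<in> carrier S \<Longrightarrow> y \<in> carrier S \<Longrightarrow> Q x \<Longrightarrow> Q y \<Longrightarrow> Q (x \<oplus>\<^bsub>S\<^esub> y)"
    and "\<And>x y. x \<in> carrier S \<Longrightarrow> y \<in> carrier S \<Longrightarrow> Q x \<Longrightarrow> Q y \<Longrightarrow> Q (x \<otimes>\<^bsub>S\<^esub> y)"
  shows "Q x"
proof -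
  let ?H = "A1 \<union> (\<Union>i. component S (axis i 1))"
  have H: "?H \<subseteq> carrier S" using scalars_subset SG.component_props(1) by blast
  have gen: "generate_ring S ?H = carrier S"
    using SA.standard unfolding generated_subalgebra_def scalars_def by simp
  have "x \<in> generate_ring S ?H" using x gen by simp
  thus ?thesis
  proof (induction rule: generate_ring.induct)
    case one
    show ?case using assms(2)[OF scalars_closed(5)] .
  qed (use assms(2-) gen in auto)
qed

text \<open>
  The elements whose component in degree \<open>0\<close> is a scalar form a subring that contains the
  generators.
\<close>

lemma component_zero_scalar:
  assumes "x \<in> component S 0" shows "x \<in> A1"
proof -
  interpret X: graded_mod S "regular S (component S)" by (rule graded_mod_regular)
  note A1_closed = scalars_closed(1,2,3) and A1_zero = scalars_closed(4)
  have "hcomp S x 0 \<in> A1" if "x \<in> carrier S" for x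
    using that
  proof (induction x rule: generator_induct)
    case (scalar x)
    thus ?case using SG.hcomp_component[of x 0 0] scalars_component by auto
  next
    case (gen i x)
    have "(0::nat^'d) \<noteq> axis i 1" by (metis axis_eq_0_iff zero_neq_one)
    thus ?case using SG.hcomp_component[OF gen, of 0] A1_zero by simp
  next
    case (mult x y)
    have "hcomp (regular S (component S)) (x \<odot>\<^bsub>regular S (component S)\<^esub> y) 0 \<in> A1"
    proof (rule X.hcomp_smult_mem)
      fix p :: "nat^'d" assume "p \<le> 0"
      hence "p = 0" by (simp add: less_eq_vec_def vec_eq_iff)
      thus "hcomp S x p \<odot>\<^bsub>regular S (component S)\<^esub> hcomp (regular S (component S)) y (0 - p) \<in> A1"
        using mult A1_closed(2) by (simp add: hcomp_regular)
    qed (use mult A1_zero A1_closed in auto)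
    thus ?case by (simp add: hcomp_regular)
  qed (use A1_closed in \<open>auto simp: SG.hcomp_add SG.hcomp_minus\<close>)
  from this[of x] assms show ?thesis using SG.hcomp_component[OF assms, of 0] SG.component_closed by simp
qed

text \<open>
  The elements whose components in all degrees \<open>n\<close> with \<open>n\<^sub>i > 0\<close> lie in \<open>J\<close> form a subring that
  contains the generators: if \<open>p + q = n\<close>, then \<open>p\<^sub>i > 0\<close> or \<open>q\<^sub>i > 0\<close>.
\<close>

lemma component_subset_ideal:
  assumes J: "ideal J S" and i: "component S (axis i 1) \<subseteq> J" and n: "n $ i \<noteq> 0"
  shows "component S n \<subseteq> J"
proof
  interpret X: graded_mod S "regular S (component S)" by (rule graded_mod_regular)
  interpret J: ideal J S by (rule J)
  have *: "\<forall>n. n $ i \<noteq> 0 \<longrightarrow> hcomp S x n \<in> J" if "x \<in> carrier S" for x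
    using that
  proof (induction x rule: generator_induct)
    case (scalar x)
    hence "x \<in> component S 0" using scalars_component by blast
    thus ?case using SG.hcomp_component[of x 0] by (auto simp: vec_eq_iff)
  next
    case (gen j x)
    show ?case
    proof (intro allI impI)
      fix n :: "nat ^ 'd" assume n: "n $ i \<noteq> 0"
      show "hcomp S x n \<in> J"
      proof (cases "n = axis j 1")
        case True
        hence "j = i" using n by (auto simp: axis_def split: if_splits)
        thus ?thesis using True SG.hcomp_component[OF gen, of n] i gen by auto
      next
        case False
        thus ?thesis using SG.hcomp_component[OF gen, of n] by simp
      qed
    qed
  next
    case (mult x y)
    show ?case
    proof (intro allI impI)
      fix n :: "nat ^ 'd" assume n: "n $ i \<noteq> 0"
      have "hcomp (regular S (component S)) (x \<odot>\<^bsub>regular S (component S)\<^esub> y) n \<in> J"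
      proof (rule X.hcomp_smult_mem)
        fix p :: "nat^'d" assume "p \<le> n"
        have "p $ i \<noteq> 0 \<or> (n - p) $ i \<noteq> 0" using n by auto
        thus "hcomp S x p \<odot>\<^bsub>regular S (component S)\<^esub> hcomp (regular S (component S)) y (n - p) \<in> J"
          using mult J.I_l_closed J.I_r_closed by (auto simp: hcomp_regular)
      qed (use mult in auto)
      thus "hcomp S (x \<otimes>\<^bsub>S\<^esub> y) n \<in> J" by (simp add: hcomp_regular)
    qed
  qed (auto simp: SG.hcomp_add SG.hcomp_minus)
  fix x assume x: "x \<in> component S n"
  have "hcomp S x n \<in> J" using * n SG.component_closed[OF x] by blast
  thus "x \<in> J" using SG.hcomp_component[OF x, of n] by simp
qed

lemma component_stable: "stable M A1 (component M n)"
proof (rule stableI)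
  fix t x assume "t \<in> A1" "x \<in> component M n"
  thus "t \<odot> x \<in> component M n" using smult_component[of t 0 x n] scalars_component by auto
qed (use component_props in auto)

lemma cyclic_stable:
  assumes z: "z \<in> carrier M" shows "stable M A1 ((\<lambda>t. t \<odot> z) ` A1)"
proof -
  have A1: "stable (regular S (component S)) A1 A1"
    by (rule stableI) (use scalars_closed scalars_subset in auto)
  show ?thesis by (rule operator_map.image_stable[OF multiples_operator_map[OF z scalars_subset A1] A1 subset_refl])
qed

text \<open>
  \<open>(U + Az)/U\<close> is a quotient of \<open>A\<close>: an intermediate subgroup \<open>W\<close> is determined by the ideal
  \<open>{a. a z \<in> W}\<close>.
\<close>

lemma interval_len_adjoin:
  assumes U: "stable M A1 U" and z: "z \<in> carrier M"
  shows "interval_len M A1 U (U <+>\<^bsub>M\<^esub> (\<lambda>t. t \<odot> z) ` A1) < \<infinity>"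
proof -
  let ?I = "\<lambda>W. {a \<in> carrier A. (a \<odot>\<^bsub>S\<^esub> \<one>\<^bsub>S\<^esub>) \<odot> z \<in> W}"
  have "interval_len M A1 U (U <+>\<^bsub>M\<^esub> (\<lambda>t. t \<odot> z) ` A1) \<le> chain_len {I. ideal I A}"
    unfolding interval_len_def
  proof (rule chain_len_strict_mono[of ?I])
    have "ideal (?I W) A" if W: "stable M A1 W" for W
    proof (rule idealI[OF AL.ring_axioms])
      note W' = stableD[OF W]
      show "subgroup (?I W) (add_monoid A)"
      proof (rule AL.add.subgroupI)
        have "\<zero>\<^bsub>A\<^esub> \<in> ?I W" using W'(2) z by simp
        thus "?I W \<noteq> {}" by blast
        fix a assume a: "a \<in> ?I W"
        have "\<ominus> ((a \<odot>\<^bsub>S\<^esub> \<one>\<^bsub>S\<^esub>) \<odot> z) = ((\<ominus>\<^bsub>A\<^esub> a) \<odot>\<^bsub>S\<^esub> \<one>\<^bsub>S\<^esub>) \<odot> z"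
          using a z scalar_closed smult_l_minus[of "a \<odot>\<^bsub>S\<^esub> \<one>\<^bsub>S\<^esub>" z] by (simp add: scalar_minus)
        thus "\<ominus>\<^bsub>A\<^esub> a \<in> ?I W" using W'(4)[of "(a \<odot>\<^bsub>S\<^esub> \<one>\<^bsub>S\<^esub>) \<odot> z"] a by simp
        fix b assume b: "b \<in> ?I W"
        have "((a \<odot>\<^bsub>S\<^esub> \<one>\<^bsub>S\<^esub>) \<odot> z) \<oplus> ((b \<odot>\<^bsub>S\<^esub> \<one>\<^bsub>S\<^esub>) \<odot> z) = ((a \<oplus>\<^bsub>A\<^esub> b) \<odot>\<^bsub>S\<^esub> \<one>\<^bsub>S\<^esub>) \<odot> z"
          using a b z scalar_closed by (simp add: smult_l_distr[symmetric] scalar_add)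
        thus "a \<oplus>\<^bsub>A\<^esub> b \<in> ?I W" using W'(3)[of "(a \<odot>\<^bsub>S\<^esub> \<one>\<^bsub>S\<^esub>) \<odot> z" "(b \<odot>\<^bsub>S\<^esub> \<one>\<^bsub>S\<^esub>) \<odot> z"] a b by simp
      qed auto
      fix a b assume a: "a \<in> ?I W" and b: "b \<in> carrier A"
      have "(b \<odot>\<^bsub>S\<^esub> \<one>\<^bsub>S\<^esub>) \<odot> ((a \<odot>\<^bsub>S\<^esub> \<one>\<^bsub>S\<^esub>) \<odot> z) = ((b \<otimes>\<^bsub>A\<^esub> a) \<odot>\<^bsub>S\<^esub> \<one>\<^bsub>S\<^esub>) \<odot> z"
        using a b z scalar_closed by (simp add: smult_assoc1[symmetric] scalar_mult)
      moreover have "b \<odot>\<^bsub>S\<^esub> \<one>\<^bsub>S\<^esub> \<in> A1" unfolding scalars_def using b by blast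
      ultimately show "b \<otimes>\<^bsub>A\<^esub> a \<in> ?I W" using W'(5)[of "b \<odot>\<^bsub>S\<^esub> \<one>\<^bsub>S\<^esub>" "(a \<odot>\<^bsub>S\<^esub> \<one>\<^bsub>S\<^esub>) \<odot> z"] a b by simp
      thus "a \<otimes>\<^bsub>A\<^esub> b \<in> ?I W" using a b AL.m_comm[of a b] by simp
    qed
    thus "?I ` {W. stable M A1 W \<and> U \<subseteq> W \<and> W \<subseteq> U <+>\<^bsub>M\<^esub> (\<lambda>t. t \<odot> z) ` A1} \<subseteq> {I. ideal I A}" by blast
    fix X Y assume "X \<in> {W. stable M A1 W \<and> U \<subseteq> W \<and> W \<subseteq> U <+>\<^bsub>M\<^esub> (\<lambda>t. t \<odot> z) ` A1}"
      "Y \<in> {W. stable M A1 W \<and> U \<subseteq> W \<and> W \<subseteq> U <+>\<^bsub>M\<^esub> (\<lambda>t. t \<odot> z) ` A1}" and XY: "X \<subset> Y"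
    hence X: "stable M A1 X" "U \<subseteq> X" and Y: "stable M A1 Y" "Y \<subseteq> U <+>\<^bsub>M\<^esub> (\<lambda>t. t \<odot> z) ` A1" by auto
    obtain w where w: "w \<in> Y" "w \<notin> X" using XY by blast
    then obtain u a where ua: "u \<in> U" "a \<in> carrier A" "w = u \<oplus> (a \<odot>\<^bsub>S\<^esub> \<one>\<^bsub>S\<^esub>) \<odot> z"
      using Y(2) unfolding set_add_def' scalars_def by auto
    have "w \<ominus> u = (a \<odot>\<^bsub>S\<^esub> \<one>\<^bsub>S\<^esub>) \<odot> z"
      by (rule add_diff_cancel[OF _ _ ua(3)]) (use ua z scalar_closed stableD(1)[OF U] in auto)
    moreover have "w \<ominus> u \<in> Y" by (rule stableD(7)[OF Y(1) w(1)]) (use ua X XY in auto)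
    ultimately have "a \<in> ?I Y" using ua by simp
    moreover have "a \<notin> ?I X" using ua w(2) X stableD(3)[OF X(1)] by auto
    ultimately show "?I X \<subset> ?I Y" using XY by blast
  qed
  thus ?thesis using AL.ring_finite_length by (rule le_less_trans)
qed

lemma finite_set_in_finite_length:
  assumes "finite F" "F \<subseteq> carrier M"
  shows "\<exists>U. stable M A1 U \<and> F \<subseteq> U \<and> interval_len M A1 {\<zero>} U < \<infinity>"
  using assms
proof (induction F)
  case empty
  have "stable M A1 {\<zero>}" by (rule stable_zero[OF scalars_subset])
  thus ?case by (intro exI[of _ "{\<zero>}"]) simp
next
  case (insert z F)
  then obtain U where U: "stable M A1 U" "F \<subseteq> U" "interval_len M A1 {\<zero>} U < \<infinity>" by blast
  let ?Z = "(\<lambda>t. t \<odot> z) ` A1" let ?W = "U <+>\<^bsub>M\<^esub> ?Z"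
  have z: "z \<in> carrier M" using insert by simp
  have Z: "stable M A1 ?Z" by (rule cyclic_stable[OF z])
  have W: "stable M A1 ?W" by (rule stable_sum[OF U(1) Z scalars_subset])
  have UW: "U \<subseteq> ?W" by (rule set_add_subset1[OF U(1) Z])
  have "z = (\<one>\<^bsub>A\<^esub> \<odot>\<^bsub>S\<^esub> \<one>\<^bsub>S\<^esub>) \<odot> z" using z by simp
  hence "z \<in> ?Z" unfolding scalars_def by blast
  hence "z \<in> ?W" using set_add_subset2[OF U(1) Z] by blast
  moreover have "interval_len M A1 {\<zero>} ?W = interval_len M A1 {\<zero>} U + interval_len M A1 U ?W"
    by (rule interval_len_add[OF scalars_subset stable_zero[OF scalars_subset] U(1) W])
      (use UW stableD(2)[OF U(1)] in auto)
  ultimately show ?case using U W UW interval_len_adjoin[OF U(1) z]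
    by (intro exI[of _ ?W]) (auto simp: plus_eq_infty_iff_enat)
qed

text \<open>
  Start from the \<open>A\<close>-span of a finite set of generators of \<open>M\<close>, which has finite length, and adjoin the
  finitely many algebra generators of \<open>S\<close> one after the other.  A subgroup that is stable under the
  scalars and under these generators is an \<open>S\<close>-submodule, so the process ends with \<open>M\<close> itself.
\<close>

lemma acc_of_finitely_generated:
  assumes fg: "finite F" "F \<subseteq> carrier M" "\<And>N. stable M (carrier S) N \<Longrightarrow> F \<subseteq> N \<Longrightarrow> N = carrier M"
  shows "acc {N. stable M (carrier S) N}"
proof -
  obtain G where G: "finite G" "G \<subseteq> carrier S" "generated_subalgebra A S G = carrier S"
    using SA.finitely_generated by blast
  have "\<exists>U. stable M (A1 \<union> G') U \<and> F \<subseteq> U \<and> acc {N. stable M (A1 \<union> G') N \<and> N \<subseteq> U}"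
    if "finite G'" "G' \<subseteq> carrier S" for G'
    using that
  proof (induction G')
    case empty
    obtain U where U: "stable M A1 U" "F \<subseteq> U" "interval_len M A1 {\<zero>} U < \<infinity>"
      using finite_set_in_finite_length[OF fg(1,2)] by blast
    have "{N. stable M A1 N \<and> N \<subseteq> U} = {N. stable M A1 N \<and> {\<zero>} \<subseteq> N \<and> N \<subseteq> U}"
      by (auto dest: stableD(2))
    hence "acc {N. stable M A1 N \<and> N \<subseteq> U}" using acc_finite_len U(3) unfolding interval_len_def by metis
    thus ?case using U by auto
  next
    case (insert y G')
    then obtain U where U: "stable M (A1 \<union> G') U" "F \<subseteq> U" "acc {N. stable M (A1 \<union> G') N \<and> N \<subseteq> U}" by auto
    have T: "A1 \<union> G' \<subseteq> carrier S" "y \<in> carrier S" using scalars_subset insert by auto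
    obtain U' where "stable M (insert y (A1 \<union> G')) U'" "U \<subseteq> U'"
      "acc {N. stable M (insert y (A1 \<union> G')) N \<and> N \<subseteq> U'}" by (rule acc_adjoin[OF T U(1,3)])
    thus ?case using U(2) by (intro exI[of _ U']) auto
  qed
  from this[OF G(1,2)] obtain U where U: "stable M (A1 \<union> G) U" "F \<subseteq> U" "acc {N. stable M (A1 \<union> G) N \<and> N \<subseteq> U}"
    by blast
  note U' = stableD[OF U(1)]
  have "\<forall>x\<in>U. s \<odot> x \<in> U" if "s \<in> generate_ring S (A1 \<union> G)" for s
    using that
  proof (induction rule: generate_ring.induct)
    case one
    show ?case using U'(1) by auto
  next
    case (incl h)
    thus ?case using U'(5) by blast
  next
    case (a_inv h)
    moreover have "h \<in> carrier S"
      using a_inv(1) scalars_subset G(2) R.generate_ring_in_carrier[of "A1 \<union> G" h] by auto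
    ultimately show ?case using U'(1,4) by (auto simp: smult_l_minus)
  next
    case (eng_add h1 h2)
    moreover have "h1 \<in> carrier S" "h2 \<in> carrier S"
      using eng_add(1,2) scalars_subset G(2) R.generate_ring_in_carrier[of "A1 \<union> G"] by auto
    ultimately show ?case using U'(1,3) by (auto simp: smult_l_distr)
  next
    case (eng_mult h1 h2)
    moreover have "h1 \<in> carrier S" "h2 \<in> carrier S"
      using eng_mult(1,2) scalars_subset G(2) R.generate_ring_in_carrier[of "A1 \<union> G"] by auto
    ultimately show ?case using U'(1) by (auto simp: smult_assoc1)
  qed
  moreover have "generate_ring S (A1 \<union> G) = carrier S"
    using G(3) unfolding generated_subalgebra_def scalars_def .
  ultimately have "stable M (carrier S) U" using U' by (intro stableI) auto
  hence "U = carrier M" using fg(3) U(2) by blast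
  hence sub: "stable M (carrier S) N \<Longrightarrow> stable M (A1 \<union> G) N \<and> N \<subseteq> U" for N
    using stable_antimono[of M "carrier S" N "A1 \<union> G"] scalars_subset G(2) by (auto dest: stableD(1))
  show ?thesis by (rule acc_strict_mono[OF U(3), of _ "\<lambda>x. x"]) (use sub in auto)
qed

text \<open>
  An \<open>A\<close>-submodule \<open>U\<close> of \<open>M\<^sub>n\<close> is recovered from the \<open>S\<close>-submodule of all \<open>x\<close> with \<open>x\<^sub>n \<in> U\<close> that have no
  component in a degree outside \<open>{n..}\<close>.  It is a submodule because \<open>S\<^sub>0\<close> consists of scalars and an
  element of another degree moves only components outside \<open>{n..}\<close>, which are \<open>0\<close>, into degree \<open>n\<close>.
\<close>

lemma component_acc:
  assumes acc: "acc {N. stable M (carrier S) N}"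
  shows "acc {U. stable M A1 U \<and> U \<subseteq> component M n}"
proof (rule acc_strict_mono[OF acc, of _ "\<lambda>U. {x \<in> carrier M. hcomp M x n \<in> U \<and> (\<forall>m. \<not> n \<le> m \<longrightarrow> hcomp M x m = \<zero>)}"])
  fix U assume "U \<in> {U. stable M A1 U \<and> U \<subseteq> component M n}"
  hence U: "stable M A1 U" "U \<subseteq> component M n" by auto
  note U' = stableD[OF U(1)]
  let ?N = "{x \<in> carrier M. hcomp M x n \<in> U \<and> (\<forall>m. \<not> n \<le> m \<longrightarrow> hcomp M x m = \<zero>)}"
  have "stable M (carrier S) ?N"
  proof (rule stable_of_homogeneous_smult)
    show "\<zero> \<in> ?N" using U'(2) by simp
    show "\<ominus> x \<in> ?N" if "x \<in> ?N" for x using that U'(4) by (auto simp: hcomp_minus)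
    show "x \<oplus> y \<in> ?N" if "x \<in> ?N" "y \<in> ?N" for x y using that U'(3) by (auto simp: hcomp_add)
    fix s p x assume s: "s \<in> component S p" and x: "x \<in> ?N"
    have xM: "x \<in> carrier M" and sS: "s \<in> carrier S" using x s SG.component_closed by auto
    have "hcomp M (s \<odot> x) n \<in> U"
    proof (cases "p = 0")
      case True
      hence "s \<in> A1" using s component_zero_scalar by blast
      moreover have "n - 0 = n" by (simp add: vec_eq_iff)
      ultimately show ?thesis using hcomp_smult[OF s xM, of n] True U'(5) x by auto
    next
      case False
      show ?thesis
      proof (cases "p \<le> n")
        case True
        have "\<not> n \<le> n - p"
        proof
          assume le: "n \<le> n - p"
          have "p $ i = 0" for i
            using le True unfolding less_eq_vec_def by (auto dest!: spec[of _ i])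
          thus False using False by (simp add: vec_eq_iff)
        qed
        hence "hcomp M x (n - p) = \<zero>" using x by blast
        thus ?thesis using hcomp_smult[OF s xM, of n] sS U'(2) by simp
      next
        case False
        thus ?thesis using hcomp_smult[OF s xM, of n] U'(2) by simp
      qed
    qed
    moreover have "hcomp M (s \<odot> x) m = \<zero>" if m: "\<not> n \<le> m" for m
    proof -
      have "\<not> n \<le> m - p" using m unfolding less_eq_vec_def by (metis diff_le_self le_trans vector_minus_component)
      thus ?thesis using hcomp_smult[OF s xM, of m] x sS by auto
    qed
    ultimately show "s \<odot> x \<in> ?N" using sS xM by blast
  qed auto
  thus "?N \<in> {N. stable M (carrier S) N}" by blast
next
  let ?N = "\<lambda>U. {x \<in> carrier M. hcomp M x n \<in> U \<and> (\<forall>m. \<not> n \<le> m \<longrightarrow> hcomp M x m = \<zero>)}"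
  fix U V assume UV: "U \<in> {U. stable M A1 U \<and> U \<subseteq> component M n}" "V \<in> {U. stable M A1 U \<and> U \<subseteq> component M n}"
    and sub: "U \<subseteq> V"
  have mem: "x \<in> ?N U \<longleftrightarrow> x \<in> U" if "x \<in> component M n" for x U
    using hcomp_component[OF that] component_closed[OF that] by auto
  have N_Int: "?N U \<inter> component M n = U" if "U \<subseteq> component M n" for U
  proof (rule Set.set_eqI)
    fix x
    show "x \<in> ?N U \<inter> component M n \<longleftrightarrow> x \<in> U"
    proof (cases "x \<in> component M n")
      case True
      thus ?thesis using mem[OF True, of U] by (simp only: Int_iff simp_thms)
    next
      case False
      thus ?thesis using that by auto
    qed
  qed
  have "U = V" if eq: "?N U = ?N V"
  proof -
    have "U = ?N U \<inter> component M n" using N_Int UV(1) by simp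
    also have "\<dots> = V" unfolding eq using N_Int UV(2) by simp
    finally show ?thesis .
  qed
  moreover have "?N U \<subseteq> ?N V" using sub by auto
  ultimately show "?N U \<subseteq> ?N V \<and> (?N U = ?N V \<longrightarrow> U = V)" by simp
qed

text \<open>
  Among the submodules of \<open>M\<^sub>n\<close> of finite length a maximal one exists, and it is \<open>M\<^sub>n\<close>, since adjoining
  one element preserves finite length.
\<close>

lemma component_finite_length:
  assumes acc: "acc {N. stable M (carrier S) N}"
  shows "interval_len M A1 {\<zero>} (component M n) < \<infinity>"
proof -
  have z0: "stable M A1 {\<zero>}" by (rule stable_zero[OF scalars_subset])
  have "interval_len M A1 {\<zero>} U < \<infinity> \<longrightarrow> interval_len M A1 {\<zero>} (component M n) < \<infinity>"
    if "U \<in> {U. stable M A1 U \<and> U \<subseteq> component M n}" for U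
    using component_acc[OF acc, of n] that
  proof (induction U rule: acc_induct)
    case (step U)
    hence U: "stable M A1 U" "U \<subseteq> component M n" by auto
    show ?case
    proof (cases "U = component M n")
      case False
      then obtain z where z: "z \<in> component M n" "z \<notin> U" using U by blast
      have zM: "z \<in> carrier M" using z component_closed by blast
      let ?Z = "(\<lambda>t. t \<odot> z) ` A1" let ?W = "U <+>\<^bsub>M\<^esub> ?Z"
      have Z: "stable M A1 ?Z" by (rule cyclic_stable[OF zM])
      have W: "stable M A1 ?W" by (rule stable_sum[OF U(1) Z scalars_subset])
      have UW: "U \<subseteq> ?W" by (rule set_add_subset1[OF U(1) Z])
      have "z = (\<one>\<^bsub>A\<^esub> \<odot>\<^bsub>S\<^esub> \<one>\<^bsub>S\<^esub>) \<odot> z" using zM by simp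
      hence "z \<in> ?Z" unfolding scalars_def by blast
      hence zW: "z \<in> ?W" using set_add_subset2[OF U(1) Z] by blast
      have "?Z \<subseteq> component M n" using stableD(5)[OF component_stable] z(1) by blast
      hence Wn: "?W \<subseteq> component M n" using set_add_least[OF U(2) _ component_stable] by blast
      have "interval_len M A1 {\<zero>} ?W = interval_len M A1 {\<zero>} U + interval_len M A1 U ?W"
        by (rule interval_len_add[OF scalars_subset z0 U(1) W]) (use UW stableD(2)[OF U(1)] in auto)
      hence "interval_len M A1 {\<zero>} U < \<infinity> \<longrightarrow> interval_len M A1 {\<zero>} ?W < \<infinity>"
        using interval_len_adjoin[OF U(1) zM] by (auto simp: plus_eq_infty_iff_enat)
      thus ?thesis using step.IH[of ?W] W Wn UW zW z by blast
    qed simp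
  qed
  from this[of "{\<zero>}"] z0 component_props(2) show ?thesis by simp
qed

end

section \<open>Adjoining a homogeneous element\<close>

text \<open>
  The length of \<open>(S/I)\<^sub>n\<close> over \<open>A\<close>.
\<close>

definition ideal_len :: "('a, 'x) ring_scheme \<Rightarrow> ('a, 's, nat ^ 'd::finite, 'z) graded_module_scheme \<Rightarrow>
    's set \<Rightarrow> nat ^ 'd \<Rightarrow> enat" where
  "ideal_len A S I n = interval_len (regular S (component S)) (scalars A S) (I \<inter> component S n) (component S n)"

text \<open>
  The length function of the shifted module \<open>N(-a)\<close>, if \<open>f\<close> is that of \<open>N\<close>.
\<close>

definition shift :: "nat ^ 'd::finite \<Rightarrow> (nat ^ 'd \<Rightarrow> enat) \<Rightarrow> nat ^ 'd \<Rightarrow> enat" where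
  "shift a f n = (if a \<le> n then f (n - a) else 0)"

definition colon :: "('s, 'z) ring_scheme \<Rightarrow> ('s, 'm, 'y) module_scheme \<Rightarrow> 'm set \<Rightarrow> 'm \<Rightarrow> 's set" where
  "colon S M N z = {s \<in> carrier S. s \<odot>\<^bsub>M\<^esub> z \<in> N}"

definition adjoin :: "('s, 'z) ring_scheme \<Rightarrow> ('s, 'm, 'y) module_scheme \<Rightarrow> 'm set \<Rightarrow> 'm \<Rightarrow> 'm set" where
  "adjoin S M N z = N <+>\<^bsub>M\<^esub> (\<lambda>s. s \<odot>\<^bsub>M\<^esub> z) ` carrier S"

context module begin

lemma ideal_multiples_stable:
  assumes K: "ideal K R" and z: "z \<in> carrier M"
  shows "stable M (carrier R) ((\<lambda>p. p \<odot>\<^bsub>M\<^esub> z) ` K)"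
proof -
  have K': "stable (regular R (\<lambda>_ :: nat. {})) (carrier R) K" using K R.stable_regular_iff by blast
  show ?thesis
    by (rule operator_map.image_stable[OF multiples_operator_map[OF z subset_refl K'] K' subset_refl])
qed

lemma adjoin_props:
  assumes N: "stable M (carrier R) N" and z: "z \<in> carrier M"
  shows "stable M (carrier R) (adjoin R M N z)" "N \<subseteq> adjoin R M N z" "z \<in> adjoin R M N z"
    "\<And>W. stable M (carrier R) W \<Longrightarrow> N \<subseteq> W \<Longrightarrow> z \<in> W \<Longrightarrow> adjoin R M N z \<subseteq> W"
    "ideal (colon R M N z) R"
proof -
  note Z = ideal_multiples_stable[OF R.oneideal z]
  show "stable M (carrier R) (adjoin R M N z)" unfolding adjoin_def by (rule stable_sum[OF N Z]) simp
  show "N \<subseteq> adjoin R M N z" unfolding adjoin_def by (rule set_add_subset1[OF N Z])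
  have "z \<in> (\<lambda>s. s \<odot>\<^bsub>M\<^esub> z) ` carrier R" by (rule image_eqI[of _ _ \<one>]) (use z in auto)
  thus "z \<in> adjoin R M N z" unfolding adjoin_def using set_add_subset2[OF N Z] by blast
  show "adjoin R M N z \<subseteq> W" if "stable M (carrier R) W" "N \<subseteq> W" "z \<in> W" for W
    unfolding adjoin_def by (rule set_add_least) (use that stableD(5)[OF that(1)] in auto)
  let ?X = "regular R (\<lambda>_ :: nat. {})"
  have "stable ?X (carrier R) (carrier R)" using R.oneideal R.stable_regular_iff by blast
  from operator_map.vimage_stable[OF multiples_operator_map[OF z subset_refl this] N]
  show "ideal (colon R M N z) R" unfolding colon_def R.stable_regular_iff .
qed

end

context std_mod begin

lemma hcomp_smult_homogeneous:
  assumes z: "z \<in> component M a" and s: "s \<in> carrier S"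
  shows "hcomp M (s \<odot> z) n = (if a \<le> n then hcomp S s (n - a) \<odot> z else \<zero>)"
proof -
  have zM: "z \<in> carrier M" using component_closed[OF z] .
  show ?thesis using s
  proof (induction s rule: SG.graded_induct)
    case (component p s)
    have sS: "s \<in> carrier S" using SG.component_closed[OF component] .
    have "n = p + a \<longleftrightarrow> a \<le> n \<and> n - a = p" using vec_diff_add[of a n] vec_le_add2[of a p] vec_add_diff[of p a] by metis
    thus ?case using hcomp_component[OF smult_component[OF component z], of n]
        SG.hcomp_component[OF component, of "n - a"] zM by auto
  next
    case (add s t)
    have "hcomp M ((s \<oplus>\<^bsub>S\<^esub> t) \<odot> z) n = hcomp M (s \<odot> z) n \<oplus> hcomp M (t \<odot> z) n"
      using add(1,2) zM by (simp add: smult_l_distr hcomp_add)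
    thus ?case using add zM by (auto simp: SG.hcomp_add smult_l_distr)
  qed
qed

lemma homogeneous_zero: "homogeneous M {\<zero>}" by (simp add: homogeneous_def)

lemma colon_homogeneous:
  assumes N: "stable M (carrier S) N" "homogeneous M N" and z: "z \<in> component M a"
  shows "homogeneous S (colon S M N z)"
  unfolding homogeneous_def
proof (intro ballI allI)
  fix s n assume s: "s \<in> colon S M N z"
  have "hcomp M (s \<odot> z) (n + a) \<in> N" using s homogeneousD[OF N(2)] by (simp add: colon_def)
  moreover have "hcomp M (s \<odot> z) (n + a) = hcomp S s n \<odot> z"
    using hcomp_smult_homogeneous[OF z, of s "n + a"] s vec_le_add2[of a n] by (simp add: colon_def)
  ultimately show "hcomp S s n \<in> colon S M N z" using s by (simp add: colon_def)
qed

lemma adjoin_homogeneous: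
  assumes N: "stable M (carrier S) N" "homogeneous M N" and z: "z \<in> component M a"
  shows "homogeneous M (adjoin S M N z)"
  unfolding homogeneous_def
proof (intro ballI allI)
  have zM: "z \<in> carrier M" using component_closed[OF z] .
  fix y n assume "y \<in> adjoin S M N z"
  then obtain x s where xs: "x \<in> N" "s \<in> carrier S" "y = x \<oplus> s \<odot> z" unfolding adjoin_def set_add_def' by auto
  have x: "x \<in> carrier M" using stableD(1)[OF N(1)] xs by blast
  have eq: "hcomp M y n = hcomp M x n \<oplus> hcomp M (s \<odot> z) n" using xs x zM by (simp add: hcomp_add)
  have "hcomp M (s \<odot> z) n \<in> (\<lambda>s. s \<odot> z) ` carrier S"
  proof (cases "a \<le> n")
    case True
    thus ?thesis using hcomp_smult_homogeneous[OF z xs(2), of n] xs(2) by auto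
  next
    case False
    have "\<zero> = \<zero>\<^bsub>S\<^esub> \<odot> z" using zM by simp
    thus ?thesis using hcomp_smult_homogeneous[OF z xs(2), of n] False by auto
  qed
  thus "hcomp M y n \<in> adjoin S M N z" unfolding eq adjoin_def
    using homogeneousD[OF N(2) xs(1)] by (intro set_addI)
qed

lemma component_decomp:
  assumes N: "stable M (carrier S) N" "homogeneous M N" and z: "z \<in> component M a"
    and y: "y \<in> adjoin S M N z \<inter> component M n"
  shows "if a \<le> n then \<exists>x\<in>N \<inter> component M n. \<exists>s\<in>component S (n - a). y = x \<oplus> s \<odot> z else y \<in> N"
proof -
  have zM: "z \<in> carrier M" using component_closed[OF z] .
  obtain x s where xs: "x \<in> N" "s \<in> carrier S" "y = x \<oplus> s \<odot> z" using y unfolding adjoin_def set_add_def' by auto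
  have x: "x \<in> carrier M" using stableD(1)[OF N(1)] xs by blast
  have "y = hcomp M y n" using y hcomp_component[of y n n] by simp
  also have "\<dots> = hcomp M x n \<oplus> hcomp M (s \<odot> z) n" using xs x zM by (simp add: hcomp_add)
  finally have eq: "y = hcomp M x n \<oplus> hcomp M (s \<odot> z) n" .
  have xn: "hcomp M x n \<in> N \<inter> component M n" using homogeneousD[OF N(2) xs(1)] hcomp_spec(1)[OF x] by blast
  show ?thesis
  proof (cases "a \<le> n")
    case True
    hence "y = hcomp M x n \<oplus> hcomp S s (n - a) \<odot> z"
      using eq hcomp_smult_homogeneous[OF z xs(2), of n] by simp
    thus ?thesis using True xn SG.hcomp_spec(1)[OF xs(2), of "n - a"] by auto
  next
    case False
    hence "y = hcomp M x n" using eq hcomp_smult_homogeneous[OF z xs(2), of n] x by simp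
    thus ?thesis using False xn by auto
  qed
qed

text \<open>
  \<open>s \<mapsto> s z\<close> induces an isomorphism from \<open>S/(N : z)\<close>, shifted by the degree of \<open>z\<close>, to \<open>(N + Sz)/N\<close>.
\<close>

lemma interval_len_adjoin_homogeneous:
  assumes N: "stable M (carrier S) N" "homogeneous M N" and z: "z \<in> component M a"
  shows "interval_len M A1 (N \<inter> component M n) (adjoin S M N z \<inter> component M n) =
    shift a (ideal_len A S (colon S M N z)) n"
proof (cases "a \<le> n")
  case True
  have zM: "z \<in> carrier M" using component_closed[OF z] .
  note adj = adjoin_props[OF N(1) zM]
  interpret X: graded_mod S "regular S (component S)" by (rule graded_mod_regular)
  interpret XM: std_mod A \<mm> S "regular S (component S)"
    by (intro std_mod.intro X.graded_mod_axioms AL.artinian_local_ring_axioms SA.standard_graded_algebra_axioms)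
  let ?f = "\<lambda>s. s \<odot> z" let ?C = "component S (n - a)"
  have C: "stable (regular S (component S)) A1 ?C" using XM.component_stable by simp
  interpret f: operator_map S "regular S (component S)" M A1 ?f ?C
    by (rule multiples_operator_map[OF zM scalars_subset C])
  have "stable M A1 (N \<inter> component M n)" "stable M A1 (adjoin S M N z \<inter> component M n)"
    using N(1) adj(1) scalars_subset stable_antimono component_stable stable_Int by blast+
  moreover have "stable (regular S (component S)) A1 (colon S M N z \<inter> ?C)"
    using adj(5) R.stable_regular_iff stable_antimono[OF _ scalars_subset] XM.component_stable stable_Int
    by (metis regular_simps(7))
  ultimately have "interval_len (regular S (component S)) A1 (colon S M N z \<inter> ?C) ?C =
      interval_len M A1 (N \<inter> component M n) (adjoin S M N z \<inter> component M n)"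
  proof (intro f.interval_len_iso)
    show "N \<inter> component M n \<subseteq> adjoin S M N z \<inter> component M n" using adj(2) by blast
    fix s assume s: "s \<in> ?C"
    have sS: "s \<in> carrier S" using SG.component_closed[OF s] .
    have szn: "s \<odot> z \<in> component M n" using smult_component[OF s z] vec_diff_add[OF True] by simp
    have "s \<odot> z \<in> adjoin S M N z" using stableD(5)[OF adj(1) sS adj(3)] .
    thus "s \<odot> z \<in> adjoin S M N z \<inter> component M n" using szn by blast
    show "s \<odot> z \<in> N \<inter> component M n \<longleftrightarrow> s \<in> colon S M N z \<inter> ?C"
      using szn s sS by (auto simp: colon_def)
  next
    fix y assume y: "y \<in> adjoin S M N z \<inter> component M n"
    obtain x s where xs: "x \<in> N \<inter> component M n" "s \<in> ?C" "y = x \<oplus> s \<odot> z"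
      using component_decomp[OF N z y] True by auto
    have "y = s \<odot> z \<oplus> x" using xs zM component_closed SG.component_closed by (auto intro!: a_comm)
    thus "\<exists>s\<in>?C. \<exists>u\<in>N \<inter> component M n. y = s \<odot> z \<oplus> u" using xs by blast
  qed auto
  thus ?thesis using True by (simp add: shift_def ideal_len_def)
next
  case False
  have zM: "z \<in> carrier M" using component_closed[OF z] .
  have "adjoin S M N z \<inter> component M n = N \<inter> component M n"
    using component_decomp[OF N z, of _ n] False adjoin_props(2)[OF N(1) zM] by auto
  thus ?thesis using False by (simp add: shift_def)
qed

end

section \<open>Homogeneous ideals\<close>

text \<open>
  The results on graded modules, applied to \<open>S\<close> as a module over itself.
\<close>

locale std_alg = std_mod A \<mm> S "regular S (component S)"
  for A :: "('a, 'x) ring_scheme" and \<mm> and S :: "('a, 's, nat ^ 'd::finite, 'z) graded_module_scheme"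

sublocale std_mod \<subseteq> alg: std_alg A \<mm> S
proof -
  interpret X: graded_mod S "regular S (component S)" by (rule graded_mod_regular)
  show "std_alg A \<mm> S"
    by (intro std_alg.intro std_mod.intro X.graded_mod_axioms AL.artinian_local_ring_axioms
        SA.standard_graded_algebra_axioms)
qed

text \<open>
  An integral weight that tells the elements of a finite set of degrees apart.  Coordinates are
  added one at a time: with \<open>B\<close> larger than all values of the new coordinate, the weight
  \<open>p\<^sub>j + B w(p)\<close> determines \<open>p\<^sub>j\<close> and \<open>w(p)\<close>, as in base \<open>B\<close>.
\<close>

lemma separating_weight:
  fixes F :: "(nat ^ 'd::finite) set"
  assumes F: "finite F"
  shows "\<exists>c :: 'd \<Rightarrow> nat. inj_on (\<lambda>p. \<Sum>i\<in>UNIV. c i * p $ i) F"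
proof -
  have "\<exists>c. \<forall>p\<in>F. \<forall>q\<in>F. (\<Sum>i\<in>D. c i * p $ i) = (\<Sum>i\<in>D. c i * q $ i) \<longrightarrow> (\<forall>i\<in>D. p $ i = q $ i)"
    if "finite D" for D :: "'d set"
    using that
  proof (induction D)
    case (insert j D)
    then obtain c where c: "\<And>p q. p \<in> F \<Longrightarrow> q \<in> F \<Longrightarrow> (\<Sum>i\<in>D. c i * p $ i) = (\<Sum>i\<in>D. c i * q $ i) \<Longrightarrow>
        (\<forall>i\<in>D. p $ i = q $ i)" by blast
    define B where "B = Suc (\<Sum>p\<in>F. p $ j)"
    have B: "p $ j < B" if "p \<in> F" for p
      using member_le_sum[OF that, of "\<lambda>p. p $ j"] F by (simp add: B_def)
    define c' where "c' i = (if i = j then 1 else c i * B)" for i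
    have eq: "(\<Sum>i\<in>insert j D. c' i * p $ i) = p $ j + B * (\<Sum>i\<in>D. c i * p $ i)" for p :: "nat ^ 'd"
    proof -
      have "(\<Sum>i\<in>D. c' i * p $ i) = (\<Sum>i\<in>D. B * (c i * p $ i))"
        by (rule sum.cong) (use insert in \<open>auto simp: c'_def\<close>)
      thus ?thesis using insert by (simp add: c'_def sum_distrib_left)
    qed
    show ?case
    proof (intro exI[of _ c'] ballI impI)
      fix p q i assume pq: "p \<in> F" "q \<in> F" and e: "(\<Sum>i\<in>insert j D. c' i * p $ i) = (\<Sum>i\<in>insert j D. c' i * q $ i)"
        and i: "i \<in> insert j D"
      have e': "p $ j + B * (\<Sum>i\<in>D. c i * p $ i) = q $ j + B * (\<Sum>i\<in>D. c i * q $ i)" using e unfolding eq .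
      have j: "p $ j = q $ j"
      proof -
        have "p $ j = (p $ j + B * (\<Sum>i\<in>D. c i * p $ i)) mod B" using B[OF pq(1)] by simp
        also have "\<dots> = (q $ j + B * (\<Sum>i\<in>D. c i * q $ i)) mod B" by (simp only: e')
        also have "\<dots> = q $ j" using B[OF pq(2)] by simp
        finally show ?thesis .
      qed
      have "0 < B" by (simp add: B_def)
      hence "(\<Sum>i\<in>D. c i * p $ i) = (\<Sum>i\<in>D. c i * q $ i)" using e' j by simp
      thus "p $ i = q $ i" using c[OF pq] j i by blast
    qed
  qed simp
  from this[of UNIV] obtain c where c: "\<And>p q. p \<in> F \<Longrightarrow> q \<in> F \<Longrightarrow>
      (\<Sum>i\<in>UNIV. c i * p $ i) = (\<Sum>i\<in>UNIV. c i * q $ i) \<Longrightarrow> \<forall>i\<in>UNIV. p $ i = q $ i"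
    using finite[of UNIV] by blast
  have "inj_on (\<lambda>p. \<Sum>i\<in>UNIV. c i * p $ i) F"
  proof (rule inj_onI)
    fix p q assume "p \<in> F" "q \<in> F" "(\<Sum>i\<in>UNIV. c i * p $ i) = (\<Sum>i\<in>UNIV. c i * q $ i)"
    from c[OF this] show "p = q" by (simp add: vec_eq_iff)
  qed
  thus ?thesis by blast
qed

context std_alg begin

abbreviation "XS \<equiv> regular S (component S)"

lemma ideal_stable: "ideal I S \<longleftrightarrow> stable XS (carrier S) I" using R.stable_regular_iff by blast

lemma hcomp_XS [simp]: "hcomp XS = hcomp S" by (rule hcomp_regular)

lemma homogeneous_XS [simp]: "homogeneous XS I = homogeneous S I" by (simp add: homogeneous_def)

text \<open>
  Let \<open>x, y \<notin> I\<close> with \<open>xy \<in> I\<close>.  Order degrees by a weight, and let \<open>x\<^sub>p\<close> and \<open>y\<^sub>q\<close> be the components outside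
  \<open>I\<close> of largest weight.  In degree \<open>p + q\<close> every other product of components has a factor in \<open>I\<close>, so
  \<open>x\<^sub>p y\<^sub>q \<in> I\<close>.
\<close>

lemma primeideal_of_homogeneous:
  assumes I: "ideal I S" "homogeneous S I" "I \<noteq> carrier S"
    and prime: "\<And>p q a b. a \<in> component S p \<Longrightarrow> b \<in> component S q \<Longrightarrow> a \<otimes>\<^bsub>S\<^esub> b \<in> I \<Longrightarrow> a \<in> I \<or> b \<in> I"
  shows "primeideal I S"
proof (rule primeidealI[OF I(1) R.is_cring])
  interpret I: ideal I S by (rule I)
  show "carrier S \<noteq> I" using I(3) by simp
  fix x y assume x: "x \<in> carrier S" and y: "y \<in> carrier S" and xy: "x \<otimes>\<^bsub>S\<^esub> y \<in> I"
  define supp where "supp x = {p. hcomp S x p \<notin> I}" for x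
  have fin: "finite (supp x)" if "x \<in> carrier S" for x
    by (rule finite_subset[OF _ SG.hcomp_spec(2)[OF that]]) (auto simp: supp_def)
  have ne: "supp x \<noteq> {}" if "x \<in> carrier S" "x \<notin> I" for x
  proof
    assume "supp x = {}"
    hence c: "hcomp S x p \<in> I" for p by (auto simp: supp_def)
    have "finsum S (hcomp S x) F \<in> I" if "finite F" for F
      using that
    proof (induction F)
      case (insert p F)
      thus ?case using c \<open>x \<in> carrier S\<close> by (simp add: Pi_def)
    qed simp
    hence "x \<in> I" using SG.hcomp_spec[OF \<open>x \<in> carrier S\<close>] by metis
    thus False using \<open>x \<notin> I\<close> by blast
  qed
  show "x \<in> I \<or> y \<in> I"
  proof (rule ccontr)
    assume "\<not> ?thesis"
    hence xI: "x \<notin> I" and yI: "y \<notin> I" by auto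
    obtain c :: "'d \<Rightarrow> nat" where c: "inj_on (\<lambda>p. \<Sum>i\<in>UNIV. c i * p $ i) (supp x \<union> supp y)"
      using separating_weight[of "supp x \<union> supp y"] fin x y by blast
    define w where "w p = (\<Sum>i\<in>UNIV. c i * p $ i)" for p :: "nat ^ 'd"
    have w_add: "w (p + q) = w p + w q" for p q by (simp add: w_def sum.distrib algebra_simps)
    have "Max (w ` supp x) \<in> w ` supp x" "Max (w ` supp y) \<in> w ` supp y"
      using fin ne x y xI yI by (auto intro!: Max_in)
    then obtain p q where p: "p \<in> supp x" "w p = Max (w ` supp x)" and q: "q \<in> supp y" "w q = Max (w ` supp y)"
      by auto
    have pmax: "w p' \<le> w p" if "p' \<in> supp x" for p' using that fin[OF x] p(2) by simp
    have qmax: "w q' \<le> w q" if "q' \<in> supp y" for q' using that fin[OF y] q(2) by simp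
    \<comment> \<open>Removing \<open>x\<^sub>p\<close> from \<open>x\<close> isolates the leading product from the other products in degree \<open>p + q\<close>.\<close>
    define x' where "x' = x \<ominus>\<^bsub>S\<^esub> hcomp S x p"
    have xp: "hcomp S x p \<in> component S p" using SG.hcomp_spec(1)[OF x] .
    have c1: "hcomp S x p \<in> carrier S" "x' \<in> carrier S" using x by (auto simp: x'_def)
    have x'comp: "hcomp S x' p' = (if p' = p then \<zero>\<^bsub>S\<^esub> else hcomp S x p')" for p'
      using x c1 SG.hcomp_component[OF xp, of p']
      by (simp add: x'_def a_minus_def SG.hcomp_add SG.hcomp_minus R.r_neg)
    have "hcomp XS (x' \<odot>\<^bsub>XS\<^esub> y) (p + q) \<in> I"
    proof (rule hcomp_smult_mem)
      fix p' assume le: "p' \<le> p + q"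
      have "hcomp S x' p' \<otimes>\<^bsub>S\<^esub> hcomp S y (p + q - p') \<in> I"
      proof (cases "p' = p \<or> hcomp S x p' \<in> I \<or> hcomp S y (p + q - p') \<in> I")
        case True
        have "hcomp S x' p' \<in> I \<or> hcomp S y (p + q - p') \<in> I" using True by (auto simp: x'comp)
        thus ?thesis using I.I_l_closed I.I_r_closed c1 y by auto
      next
        case False
        hence m: "p' \<in> supp x" "p + q - p' \<in> supp y" "p' \<noteq> p" by (auto simp: supp_def)
        have "w p' \<noteq> w p" using inj_onD[OF c, of p' p] m p(1) unfolding w_def by blast
        hence "w p' < w p" using pmax[OF m(1)] by simp
        moreover have "w p' + w (p + q - p') = w p + w q"
          using vec_le_diff[OF le] w_add by metis
        ultimately show ?thesis using qmax[OF m(2)] by simp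
      qed
      thus "hcomp S x' p' \<odot>\<^bsub>XS\<^esub> hcomp XS y (p + q - p') \<in> I" by simp
    qed (use c1 y in auto)
    hence 1: "hcomp S (x' \<otimes>\<^bsub>S\<^esub> y) (p + q) \<in> I" by simp
    have 2: "hcomp S (x \<otimes>\<^bsub>S\<^esub> y) (p + q) \<in> I" using homogeneousD[OF I(2) xy] .
    have "hcomp XS (hcomp S x p \<odot>\<^bsub>XS\<^esub> y) (p + q) = hcomp S x p \<otimes>\<^bsub>S\<^esub> hcomp S y q"
    proof -
      have "p + q - p = q" by (simp add: add.commute[of p q])
      thus ?thesis using hcomp_smult[OF xp, of y "p + q"] y vec_le_add[of p q] by simp
    qed
    hence 3: "hcomp S (hcomp S x p \<otimes>\<^bsub>S\<^esub> y) (p + q) = hcomp S x p \<otimes>\<^bsub>S\<^esub> hcomp S y q" by simp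
    have "x = x' \<oplus>\<^bsub>S\<^esub> hcomp S x p" using x c1 by (simp add: x'_def a_minus_def R.a_assoc R.l_neg)
    hence "x \<otimes>\<^bsub>S\<^esub> y = x' \<otimes>\<^bsub>S\<^esub> y \<oplus>\<^bsub>S\<^esub> hcomp S x p \<otimes>\<^bsub>S\<^esub> y" using c1 y by (metis R.l_distr)
    hence "hcomp S (x \<otimes>\<^bsub>S\<^esub> y) (p + q) = hcomp S (x' \<otimes>\<^bsub>S\<^esub> y) (p + q) \<oplus>\<^bsub>S\<^esub> hcomp S x p \<otimes>\<^bsub>S\<^esub> hcomp S y q"
      using c1 y 3 by (simp add: SG.hcomp_add)
    moreover have "hcomp S x p \<otimes>\<^bsub>S\<^esub> hcomp S y q \<in> carrier S" "hcomp S (x' \<otimes>\<^bsub>S\<^esub> y) (p + q) \<in> carrier S" using c1 y x by auto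
    ultimately have "hcomp S x p \<otimes>\<^bsub>S\<^esub> hcomp S y q = hcomp S (x \<otimes>\<^bsub>S\<^esub> y) (p + q) \<ominus>\<^bsub>S\<^esub> hcomp S (x' \<otimes>\<^bsub>S\<^esub> y) (p + q)"
      using add_diff_cancel[of "hcomp S (x' \<otimes>\<^bsub>S\<^esub> y) (p + q)" "hcomp S x p \<otimes>\<^bsub>S\<^esub> hcomp S y q"] by simp
    hence "hcomp S x p \<otimes>\<^bsub>S\<^esub> hcomp S y q \<in> I" using 1 2 by (simp add: a_minus_def)
    hence "hcomp S x p \<in> I \<or> hcomp S y q \<in> I" using prime[OF xp SG.hcomp_spec(1)[OF y]] by blast
    thus False using p(1) q(1) by (auto simp: supp_def)
  qed
qed

lemma acc_ideals: "acc {I. ideal I S}"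
proof -
  have "acc {N. stable XS (carrier S) N}"
  proof (rule acc_of_finitely_generated[of "{\<one>\<^bsub>S\<^esub>}"])
    fix N assume N: "stable XS (carrier S) N" "{\<one>\<^bsub>S\<^esub>} \<subseteq> N"
    hence "ideal N S" using ideal_stable by blast
    thus "N = carrier XS" using N ideal.one_imp_carrier by fastforce
  qed auto
  thus ?thesis using ideal_stable by simp
qed

definition hideal :: "'s set \<Rightarrow> bool" where "hideal I \<longleftrightarrow> ideal I S \<and> homogeneous S I"

lemma hideal_adjoin:
  assumes I: "hideal I" and a: "a \<in> component S p"
  shows "hideal (adjoin S XS I a)" "hideal (colon S XS I a)" "I \<subseteq> adjoin S XS I a" "a \<in> adjoin S XS I a"
    "I \<subseteq> colon S XS I a" "s \<in> colon S XS I a \<longleftrightarrow> s \<in> carrier S \<and> s \<otimes>\<^bsub>S\<^esub> a \<in> I"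
    "\<And>J. ideal J S \<Longrightarrow> I \<subseteq> J \<Longrightarrow> a \<in> J \<Longrightarrow> adjoin S XS I a \<subseteq> J"
proof -
  have st: "stable XS (carrier S) I" "homogeneous XS I" using I ideal_stable by (auto simp: hideal_def)
  have aS: "a \<in> carrier XS" "a \<in> component XS p" "a \<in> carrier S" using a SG.component_closed by auto
  note * = adjoin_props[OF st(1) aS(1)]
  show "hideal (adjoin S XS I a)" using *(1) adjoin_homogeneous[OF st aS(2)] ideal_stable by (simp add: hideal_def)
  show "hideal (colon S XS I a)" using *(5) colon_homogeneous[OF st aS(2)] by (simp add: hideal_def)
  show "I \<subseteq> adjoin S XS I a" "a \<in> adjoin S XS I a" by (rule *)+
  show iff: "s \<in> colon S XS I a \<longleftrightarrow> s \<in> carrier S \<and> s \<otimes>\<^bsub>S\<^esub> a \<in> I" for s by (simp add: colon_def)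
  show "I \<subseteq> colon S XS I a"
    using I iff aS(3) ideal.I_r_closed[of I S] ideal.Icarr[of I S] by (auto simp: hideal_def)
  show "\<And>J. ideal J S \<Longrightarrow> I \<subseteq> J \<Longrightarrow> a \<in> J \<Longrightarrow> adjoin S XS I a \<subseteq> J" using *(4) ideal_stable by blast
qed

text \<open>
  If \<open>I\<close> is not prime, there are homogeneous \<open>a, b \<notin> I\<close> with \<open>ab \<in> I\<close>; then \<open>I + aS\<close> contains \<open>a\<close> and
  \<open>I : a\<close> contains \<open>b\<close>, so both are strictly larger than \<open>I\<close>.
\<close>

lemma hideal_induct [consumes 1, case_names whole prime split]:
  assumes I: "hideal I"
    and whole: "Q (carrier S)"
    and prime: "\<And>P. primeideal P S \<Longrightarrow> hideal P \<Longrightarrow> (\<And>J. hideal J \<Longrightarrow> P \<subset> J \<Longrightarrow> Q J) \<Longrightarrow> Q P"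
    and split: "\<And>I p a. hideal I \<Longrightarrow> a \<in> component S p \<Longrightarrow> Q (adjoin S XS I a) \<Longrightarrow> Q (colon S XS I a) \<Longrightarrow> Q I"
  shows "Q I"
proof -
  have "acc {I. hideal I}"
    by (rule acc_strict_mono[OF acc_ideals, of _ "\<lambda>x. x"]) (auto simp: hideal_def)
  moreover have "I \<in> {I. hideal I}" using I by simp
  ultimately show ?thesis
  proof (induction I rule: acc_induct)
    case (step I)
    hence hI: "hideal I" by simp
    consider "I = carrier S" | "primeideal I S" | "I \<noteq> carrier S" "\<not> primeideal I S" by blast
    thus ?case
    proof cases
      case 1
      thus ?thesis using whole by simp
    next
      case 2
      thus ?thesis using prime[OF 2 hI] step.IH by simp
    next
      case 3
      then obtain p q a b where ab: "a \<in> component S p" "b \<in> component S q" "a \<otimes>\<^bsub>S\<^esub> b \<in> I" "a \<notin> I" "b \<notin> I"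
        using primeideal_of_homogeneous[of I] hI unfolding hideal_def by blast
      note * = hideal_adjoin[OF hI ab(1)]
      have "b \<otimes>\<^bsub>S\<^esub> a \<in> I" using ab R.m_comm[of a b] SG.component_closed by auto
      hence "b \<in> colon S XS I a" using *(6) ab SG.component_closed by blast
      thus ?thesis using split[OF hI ab(1)] step.IH *(1-5) ab by blast
    qed
  qed
qed

lemma ideal_len_split:
  assumes I: "hideal I" and a: "a \<in> component S p"
  shows "ideal_len A S I n = ideal_len A S (adjoin S XS I a) n + shift p (ideal_len A S (colon S XS I a)) n"
proof -
  have st: "stable XS (carrier S) I" "homogeneous XS I" using I ideal_stable by (auto simp: hideal_def)
  note * = hideal_adjoin[OF I a]
  have a': "a \<in> component XS p" using a by simp
  have st': "stable XS (carrier S) (adjoin S XS I a)" using *(1) ideal_stable by (auto simp: hideal_def)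
  have "interval_len XS A1 (I \<inter> component S n) (component S n) =
      interval_len XS A1 (I \<inter> component S n) (adjoin S XS I a \<inter> component S n) +
      interval_len XS A1 (adjoin S XS I a \<inter> component S n) (component S n)"
    by (rule interval_len_add[OF scalars_subset])
      (use st(1) st' stable_antimono[OF _ scalars_subset] component_stable *(3) in \<open>auto intro!: stable_Int\<close>)
  thus ?thesis using interval_len_adjoin_homogeneous[OF st a', of n]
    by (simp add: ideal_len_def add.commute)
qed

lemma ideal_len_finite: "ideal_len A S I n < \<infinity>"
proof -
  have "ideal_len A S (I \<union> {\<zero>\<^bsub>S\<^esub>}) n \<le> interval_len XS A1 {\<zero>\<^bsub>XS\<^esub>} (component XS n)"
    unfolding ideal_len_def by (rule interval_len_mono) (use SG.component_props(2) in auto)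
  moreover have "interval_len XS A1 {\<zero>\<^bsub>XS\<^esub>} (component XS n) < \<infinity>"
    by (rule component_finite_length) (use acc_ideals ideal_stable in simp)
  moreover have "ideal_len A S I n \<le> ideal_len A S (I \<union> {\<zero>\<^bsub>S\<^esub>}) n"
    unfolding ideal_len_def interval_len_def
    by (rule chain_len_strict_mono[of "\<lambda>x. x"]) (auto dest: stableD(2))
  ultimately show ?thesis by (meson le_less_trans)
qed

lemma ideal_len_antimono: "I \<subseteq> J \<Longrightarrow> ideal_len A S J n \<le> ideal_len A S I n"
  unfolding ideal_len_def by (rule interval_len_mono) auto

lemma ideal_len_zero: "component S n \<subseteq> I \<Longrightarrow> ideal_len A S I n = 0"
  unfolding ideal_len_def by (simp add: Int_absorb1)

lemma ideal_len_zeroD: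
  assumes "ideal I S" "ideal_len A S I n = 0" shows "component S n \<subseteq> I"
proof -
  have "I \<inter> component S n = component S n"
  proof (rule interval_len_zeroD)
    show "interval_len XS A1 (I \<inter> component S n) (component S n) = 0" using assms(2) by (simp add: ideal_len_def)
    show "stable XS A1 (I \<inter> component S n)"
      using assms(1) ideal_stable stable_antimono[OF _ scalars_subset] component_stable by (auto intro!: stable_Int)
    show "stable XS A1 (component S n)" using component_stable by simp
  qed auto
  thus ?thesis by blast
qed

end

section \<open>The primes of \<open>Proj S\<close>\<close>

context std_alg begin

lemma finsum_mem_ideal:
  assumes "ideal I S" "finite F" "\<And>n. n \<in> F \<Longrightarrow> f n \<in> I"
  shows "finsum S f F \<in> I"
proof -
  interpret ideal I S by (rule assms(1))
  show ?thesis using assms(2,3)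
  proof (induction F)
    case (insert p F)
    thus ?case by (simp add: Pi_def)
  qed simp
qed

lemma homogeneous_ideal_iff: "homogeneous_ideal P S \<longleftrightarrow> hideal P"
proof
  assume P: "homogeneous_ideal P S"
  hence id: "ideal P S" and gen: "P = Idl\<^bsub>S\<^esub> (P \<inter> (\<Union>n. component S n))"
    unfolding homogeneous_ideal_def by auto
  interpret P: ideal P S by (rule id)
  let ?J = "{x \<in> P. \<forall>n. hcomp S x n \<in> P}"
  have "ideal ?J S"
  proof (rule idealI[OF R.ring_axioms])
    show "subgroup ?J (add_monoid S)"
    proof (rule R.add.subgroupI)
      show "?J \<subseteq> carrier S" by auto
      have "\<zero>\<^bsub>S\<^esub> \<in> ?J" by simp
      thus "?J \<noteq> {}" by blast
      show "\<ominus>\<^bsub>S\<^esub> x \<in> ?J" if "x \<in> ?J" for x using that by (auto simp: SG.hcomp_minus)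
      show "x \<oplus>\<^bsub>S\<^esub> y \<in> ?J" if "x \<in> ?J" "y \<in> ?J" for x y using that by (auto simp: SG.hcomp_add)
    qed
    fix x s assume x: "x \<in> ?J" and s: "s \<in> carrier S"
    have "hcomp XS (s \<odot>\<^bsub>XS\<^esub> x) n \<in> P" for n
    proof (rule hcomp_smult_mem)
      fix p assume "p \<le> n"
      show "hcomp S s p \<odot>\<^bsub>XS\<^esub> hcomp XS x (n - p) \<in> P" using x s P.I_l_closed by simp
    qed (use x s in auto)
    thus sx: "s \<otimes>\<^bsub>S\<^esub> x \<in> ?J" using x s P.I_l_closed by simp
    show "x \<otimes>\<^bsub>S\<^esub> s \<in> ?J" using sx x s R.m_comm[of x s] by auto
  qed
  moreover have "P \<inter> (\<Union>n. component S n) \<subseteq> ?J"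
  proof
    fix x assume "x \<in> P \<inter> (\<Union>n. component S n)"
    then obtain m where m: "x \<in> P" "x \<in> component S m" by blast
    thus "x \<in> ?J" using SG.hcomp_component[OF m(2)] by simp
  qed
  ultimately have le: "Idl\<^bsub>S\<^esub> (P \<inter> (\<Union>n. component S n)) \<subseteq> ?J" by (rule R.genideal_minimal)
  note gen
  also note le
  finally have "P \<subseteq> ?J" .
  thus "hideal P" unfolding hideal_def homogeneous_def using id by blast
next
  assume P: "hideal P"
  hence id: "ideal P S" and hom: "homogeneous S P" by (auto simp: hideal_def)
  interpret P: ideal P S by (rule id)
  let ?G = "P \<inter> (\<Union>n. component S n)"
  have G: "?G \<subseteq> carrier S" by auto
  have "P \<subseteq> Idl\<^bsub>S\<^esub> ?G"
  proof
    fix x assume x: "x \<in> P"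
    hence xS: "x \<in> carrier S" by simp
    have "hcomp S x n \<in> Idl\<^bsub>S\<^esub> ?G" for n
      using homogeneousD[OF hom x] SG.hcomp_spec(1)[OF xS] R.genideal_self[OF G] by blast
    hence "finsum S (hcomp S x) {n. hcomp S x n \<noteq> \<zero>\<^bsub>S\<^esub>} \<in> Idl\<^bsub>S\<^esub> ?G"
      by (intro finsum_mem_ideal R.genideal_ideal[OF G] SG.hcomp_spec(2)[OF xS])
    thus "x \<in> Idl\<^bsub>S\<^esub> ?G" using SG.hcomp_spec(3)[OF xS] by simp
  qed
  moreover have "Idl\<^bsub>S\<^esub> ?G \<subseteq> P" by (rule R.genideal_minimal[OF id]) blast
  ultimately show "homogeneous_ideal P S" unfolding homogeneous_ideal_def using id by blast
qed

lemma vec_one_le: "(1::nat^'e::finite) \<le> n \<longleftrightarrow> (\<forall>i. n $ i \<noteq> 0)"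
  by (auto simp: less_eq_vec_def Suc_le_eq)

text \<open>
  Elements of the \<open>S\<^sub>i\<close> outside a prime \<open>P\<close> have products outside \<open>P\<close>, in every degree.
\<close>

lemma component_not_subset:
  assumes P: "primeideal P S" and i: "\<And>i. \<not> component S (axis i 1) \<subseteq> P"
  shows "\<not> component S n \<subseteq> P"
proof (induction n rule: vec_induct)
  case zero
  interpret P: primeideal P S by (rule P)
  have "\<one>\<^bsub>S\<^esub> \<notin> P" using P.I_notcarr P.one_imp_carrier by auto
  thus ?case using one_component by blast
next
  case (add n i)
  interpret P: primeideal P S by (rule P)
  obtain x y where "x \<in> component S n" "x \<notin> P" "y \<in> component S (axis i 1)" "y \<notin> P"
    using add i by blast
  moreover from this have "x \<otimes>\<^bsub>S\<^esub> y \<notin> P" using P.I_prime SG.component_closed by blast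
  ultimately show ?case using mult_component by blast
qed

text \<open>
  A prime \<open>P\<close> contains \<open>S\<^sub>+\<^sub>+\<close> if and only if it contains some \<open>S\<^sub>i\<close>: otherwise there is an element of
  degree \<open>(1, \<dots>, 1)\<close> outside \<open>P\<close>.
\<close>

lemma Proj_iff:
  "P \<in> Proj S \<longleftrightarrow> primeideal P S \<and> hideal P \<and> (\<forall>i. \<not> component S (axis i 1) \<subseteq> P)"
proof -
  have "irrelevant_ideal S \<subseteq> P \<longleftrightarrow> (\<exists>i. component S (axis i 1) \<subseteq> P)" if P: "primeideal P S" "hideal P"
  proof
    assume "\<exists>i. component S (axis i 1) \<subseteq> P"
    then obtain i where i: "component S (axis i 1) \<subseteq> P" by blast
    have id: "ideal P S" using P by (simp add: hideal_def)
    show "irrelevant_ideal S \<subseteq> P"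
    proof
      fix x assume "x \<in> irrelevant_ideal S"
      then obtain f F where fF: "x = finsum S f F" "finite F" "\<forall>n\<in>F. 1 \<le> n \<and> f n \<in> component S n"
        unfolding irrelevant_ideal_def by blast
      have "f n \<in> P" if "n \<in> F" for n
        using component_subset_ideal[OF id i, of n] fF(3) that vec_one_le[of n] by blast
      thus "x \<in> P" unfolding fF(1) by (intro finsum_mem_ideal[OF id fF(2)])
    qed
  next
    assume irr: "irrelevant_ideal S \<subseteq> P"
    show "\<exists>i. component S (axis i 1) \<subseteq> P"
    proof (rule ccontr)
      assume "\<not> ?thesis"
      hence "\<not> component S 1 \<subseteq> P" using component_not_subset[OF P(1)] by blast
      then obtain x where x: "x \<in> component S 1" "x \<notin> P" by blast
      have "x = finsum S (\<lambda>_. x) {1::nat^'d}" using SG.component_closed[OF x(1)] by simp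
      hence "x \<in> irrelevant_ideal S" unfolding irrelevant_ideal_def
        using x(1) by (intro CollectI exI[of _ "\<lambda>_. x"] exI[of _ "{1}"]) auto
      thus False using irr x by blast
    qed
  qed
  thus ?thesis unfolding Proj_def using homogeneous_ideal_iff by blast
qed

lemma ProjD:
  assumes "P \<in> Proj S"
  shows "primeideal P S" "hideal P" "\<not> component S n \<subseteq> P" "ideal P S"
proof -
  show "primeideal P S" "hideal P" using assms Proj_iff by auto
  thus "ideal P S" by (simp add: hideal_def)
  have "\<And>i. \<not> component S (axis i 1) \<subseteq> P" using assms Proj_iff by blast
  thus "\<not> component S n \<subseteq> P" by (rule component_not_subset[OF \<open>primeideal P S\<close>])
qed

lemma not_Proj_ideal_len:
  assumes P: "primeideal P S" "hideal P" "P \<notin> Proj S"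
  shows "\<exists>i. \<forall>n. n $ i \<noteq> 0 \<longrightarrow> component S n \<subseteq> P"
proof -
  obtain i where "component S (axis i 1) \<subseteq> P" using assms Proj_iff by blast
  thus ?thesis using component_subset_ideal[of P i] P(2) by (auto simp: hideal_def)
qed

lemma colon_prime:
  assumes P: "primeideal P S" and a: "a \<in> component S p" "a \<notin> P"
  shows "colon S XS P a = P"
proof -
  interpret P: primeideal P S by (rule P)
  have "a \<in> carrier S" using a SG.component_closed by blast
  thus ?thesis using P.I_prime a(2) P.I_r_closed by (auto simp: colon_def)
qed

lemma ideal_len_prime:
  assumes P: "primeideal P S" "hideal P" and a: "a \<in> component S p" "a \<notin> P"
  shows "ideal_len A S P n = ideal_len A S (adjoin S XS P a) n + shift p (ideal_len A S P) n"
  using ideal_len_split[OF P(2) a(1)] colon_prime[OF P(1) a] by simp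

lemma adjoin_psubset:
  assumes "hideal P" "a \<in> component S p" "a \<notin> P" shows "P \<subset> adjoin S XS P a"
  using hideal_adjoin[OF assms(1,2)] assms(3) by blast

end

section \<open>Devissage for length functions\<close>

text \<open>
  The closure properties under which a property of length functions passes through extensions and
  shifts.
\<close>

definition additive_class :: "((nat ^ 'd::finite \<Rightarrow> enat) \<Rightarrow> bool) \<Rightarrow> bool" where
  "additive_class \<Psi> \<longleftrightarrow> \<Psi> (\<lambda>_. 0) \<and> (\<forall>f g. \<Psi> f \<longrightarrow> \<Psi> g \<longrightarrow> \<Psi> (\<lambda>n. f n + g n)) \<and> (\<forall>a f. \<Psi> f \<longrightarrow> \<Psi> (shift a f))"

context std_alg begin

lemma ideal_len_devissage:
  assumes \<Psi>: "additive_class \<Psi>"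
    and prime: "\<And>P. primeideal P S \<Longrightarrow> hideal P \<Longrightarrow> I0 \<subseteq> P \<Longrightarrow>
      (\<And>J. hideal J \<Longrightarrow> P \<subset> J \<Longrightarrow> \<Psi> (ideal_len A S J)) \<Longrightarrow> \<Psi> (ideal_len A S P)"
    and I: "hideal I" "I0 \<subseteq> I"
  shows "\<Psi> (ideal_len A S I)"
proof -
  have "I0 \<subseteq> I \<longrightarrow> \<Psi> (ideal_len A S I)" using I(1)
  proof (induction I rule: hideal_induct)
    case whole
    have "ideal_len A S (carrier S) = (\<lambda>_. 0)"
      by (rule ext) (rule ideal_len_zero, use SG.component_closed in auto)
    thus ?case using \<Psi> by (simp add: additive_class_def)
  next
    case (prime P)
    thus ?case using assms(2)[of P] by blast
  next
    case (split I p a)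
    show ?case
    proof
      assume I0: "I0 \<subseteq> I"
      have "ideal_len A S I = (\<lambda>n. ideal_len A S (adjoin S XS I a) n + shift p (ideal_len A S (colon S XS I a)) n)"
        by (rule ext) (rule ideal_len_split[OF split(1,2)])
      moreover have "\<Psi> (ideal_len A S (adjoin S XS I a))" "\<Psi> (ideal_len A S (colon S XS I a))"
        using split hideal_adjoin(3,5)[OF split(1,2)] I0 by blast+
      ultimately show "\<Psi> (ideal_len A S I)" using \<Psi> by (simp add: additive_class_def)
    qed
  qed
  thus ?thesis using I(2) by blast
qed

definition finite_and_eventually :: "((nat ^ 'd \<Rightarrow> int) \<Rightarrow> bool) \<Rightarrow> (nat ^ 'd \<Rightarrow> enat) \<Rightarrow> bool" where
  "finite_and_eventually E f \<longleftrightarrow> (\<forall>n. f n < \<infinity>) \<and> E (\<lambda>n. int (the_enat (f n)))"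

lemma the_enat_zero [simp]: "the_enat 0 = 0" by (simp add: zero_enat_def)

lemma the_enat_add: "a < \<infinity> \<Longrightarrow> b < \<infinity> \<Longrightarrow> the_enat (a + b) = the_enat a + the_enat b"
  by (cases a; cases b) auto

lemma finite_and_eventually_additive:
  assumes zero: "E (\<lambda>_. 0)" and add: "\<And>f g. E f \<Longrightarrow> E g \<Longrightarrow> E (\<lambda>n. f n + g n)"
    and sh: "\<And>a f. E f \<Longrightarrow> E (\<lambda>n. if a \<le> n then f (n - a) else 0)"
  shows "additive_class (finite_and_eventually E)"
  unfolding additive_class_def
proof (intro conjI allI impI)
  show "finite_and_eventually E (\<lambda>_. 0)" using zero by (simp add: finite_and_eventually_def)
  fix f assume f: "finite_and_eventually E f"
  show "finite_and_eventually E (\<lambda>n. f n + g n)" if "finite_and_eventually E g" for g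
    using f that add[of "\<lambda>n. int (the_enat (f n))" "\<lambda>n. int (the_enat (g n))"]
    by (auto simp: finite_and_eventually_def the_enat_add plus_eq_infty_iff_enat)
  fix a
  have fin: "shift a f n < \<infinity>" for n
    by (cases "a \<le> n") (use f in \<open>auto simp: shift_def finite_and_eventually_def zero_enat_def\<close>)
  have "(\<lambda>n. int (the_enat (shift a f n))) = (\<lambda>n. if a \<le> n then int (the_enat (f (n - a))) else 0)"
    by (rule ext) (simp add: shift_def)
  thus "finite_and_eventually E (shift a f)"
    using f sh[of "\<lambda>n. int (the_enat (f n))" a] fin by (simp add: finite_and_eventually_def)
qed

lemma represents_translate:
  fixes f :: "nat ^ 'd \<Rightarrow> int"
  assumes "represents e f"
  shows "\<exists>e'. represents e' (\<lambda>n. if a \<le> n then f (n - a) else 0)"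
proof -
  have "\<exists>e'. represents e' (\<lambda>n. f (n - a))"
  proof (induction a rule: vec_induct)
    case zero
    have "n - 0 = n" for n :: "nat ^ 'd" by (simp add: vec_eq_iff)
    thus ?case using assms by auto
  next
    case (add a i)
    then obtain e' where e': "represents e' (\<lambda>n. f (n - a))" by blast
    have "represents (\<lambda>k. e' k - shift_coeff (axis i 1) e' k) (\<lambda>n. f (n - a) - (f (n - a) - f (n - axis i 1 - a)))"
      by (rule represents_diff[OF e' represents_step[OF e', of i]])
    moreover have "n - axis i 1 - a = n - (a + axis i 1)" for n :: "nat ^ 'd" by (simp add: vec_eq_iff add.commute)
    ultimately show ?case by auto
  qed
  then obtain e' where "represents e' (\<lambda>n. f (n - a))" by blast
  hence "represents e' (\<lambda>n. if a \<le> n then f (n - a) else 0)"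
    by (rule represents_cong) (rule for_large_mono[OF for_large_ge[of a]], simp)
  thus ?thesis by blast
qed

lemma polynomial_class: "additive_class (finite_and_eventually (\<lambda>f. \<exists>e. represents e f))"
  by (rule finite_and_eventually_additive) (use represents_zero represents_add represents_translate in blast)+

lemma constant_class: "additive_class (finite_and_eventually (\<lambda>f. \<exists>c. for_large (\<lambda>n. f n = c)))"
proof (rule finite_and_eventually_additive)
  fix f g :: "nat ^ 'd \<Rightarrow> int" assume "\<exists>c. for_large (\<lambda>n. f n = c)" "\<exists>c. for_large (\<lambda>n. g n = c)"
  then obtain c c' where "for_large (\<lambda>n. f n = c)" "for_large (\<lambda>n. g n = c')" by blast
  hence "for_large (\<lambda>n. f n + g n = c + c')" by (rule for_large_mono2) simp
  thus "\<exists>c. for_large (\<lambda>n. f n + g n = c)" by blast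
next
  fix a and f :: "nat ^ 'd \<Rightarrow> int" assume "\<exists>c. for_large (\<lambda>n. f n = c)"
  then obtain c where "for_large (\<lambda>n. f n = c)" by blast
  from for_large_minus[OF this, of a] have "for_large (\<lambda>n. (if a \<le> n then f (n - a) else 0) = c)"
    by (rule for_large_mono) simp
  thus "\<exists>c. for_large (\<lambda>n. (if a \<le> n then f (n - a) else 0) = c)" by blast
qed (auto simp: for_large_def)

lemma zero_class: "additive_class (\<lambda>f :: nat ^ 'd \<Rightarrow> enat. for_large (\<lambda>n. f n = 0))"
  unfolding additive_class_def
proof (intro conjI allI impI)
  fix f g :: "nat ^ 'd \<Rightarrow> enat" assume "for_large (\<lambda>n. f n = 0)" "for_large (\<lambda>n. g n = 0)"
  thus "for_large (\<lambda>n. f n + g n = 0)" by (rule for_large_mono2) simp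
next
  fix a and f :: "nat ^ 'd \<Rightarrow> enat" assume "for_large (\<lambda>n. f n = 0)"
  from for_large_minus[OF this, of a] show "for_large (\<lambda>n. shift a f n = 0)"
    by (rule for_large_mono) (simp add: shift_def)
qed (simp add: for_large_def)

lemma for_large_coord: "for_large (\<lambda>n. n $ i \<noteq> 0)"
  by (rule for_large_mono[OF for_large_ge[of 1]]) (simp add: vec_one_le)

lemma not_Proj_zero:
  assumes P: "primeideal P S" "hideal P" "P \<notin> Proj S"
  shows "for_large (\<lambda>n. ideal_len A S P n = 0)"
proof -
  obtain i where i: "\<forall>n. n $ i \<noteq> 0 \<longrightarrow> component S n \<subseteq> P" using not_Proj_ideal_len[OF P] by blast
  show ?thesis by (rule for_large_mono[OF for_large_coord[of i]]) (rule ideal_len_zero, use i in blast)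
qed

text \<open>
  For \<open>P \<in> Proj S\<close> all differences of the length function are length functions of larger ideals,
  hence polynomial by induction.  A prime outside \<open>Proj S\<close> contains all \<open>S\<^sub>n\<close> with large \<open>n\<close>.
\<close>

lemma ideal_len_polynomial:
  assumes "hideal I"
  shows "finite_and_eventually (\<lambda>f. \<exists>e. represents e f) (ideal_len A S I)"
proof (rule ideal_len_devissage[OF polynomial_class, of "{}"])
  fix P assume P: "primeideal P S" "hideal P"
    and IH: "\<And>J. hideal J \<Longrightarrow> P \<subset> J \<Longrightarrow> finite_and_eventually (\<lambda>f. \<exists>e. represents e f) (ideal_len A S J)"
  let ?f = "\<lambda>n. int (the_enat (ideal_len A S P n))"
  have "\<exists>e. represents e ?f"
  proof (cases "P \<in> Proj S")
    case True
    show ?thesis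
    proof (rule represents_from_differences)
      fix i
      obtain y where y: "y \<in> component S (axis i 1)" "y \<notin> P" using ProjD(3)[OF True] by blast
      let ?J = "adjoin S XS P y"
      obtain e where e: "represents e (\<lambda>n. int (the_enat (ideal_len A S ?J n)))"
        using IH[of ?J] hideal_adjoin(1)[OF P(2) y(1)] adjoin_psubset[OF P(2) y]
        by (auto simp: finite_and_eventually_def)
      have "represents e (\<lambda>n. ?f n - ?f (n - axis i 1))"
      proof (rule represents_cong[OF e], rule for_large_mono[OF for_large_ge[of "axis i 1"]])
        fix n :: "nat ^ 'd" assume "axis i 1 \<le> n"
        hence "ideal_len A S P n = ideal_len A S ?J n + ideal_len A S P (n - axis i 1)"
          using ideal_len_prime[OF P y, of n] by (simp add: shift_def)
        thus "int (the_enat (ideal_len A S ?J n)) = ?f n - ?f (n - axis i 1)"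
          using ideal_len_finite by (simp add: the_enat_add)
      qed
      thus "\<exists>e. represents e (\<lambda>n. ?f n - ?f (n - axis i 1))" by blast
    qed
  next
    case False
    have "represents (\<lambda>_. 0) ?f"
      by (rule represents_cong[OF represents_zero], rule for_large_mono[OF not_Proj_zero[OF P False]]) simp
    thus ?thesis by blast
  qed
  thus "finite_and_eventually (\<lambda>f. \<exists>e. represents e f) (ideal_len A S P)"
    using ideal_len_finite by (simp add: finite_and_eventually_def)
qed (use assms in auto)

lemma ideal_len_eventually_zero:
  assumes no: "\<And>P. P \<in> Proj S \<Longrightarrow> \<not> I \<subseteq> P" and I: "hideal I"
  shows "for_large (\<lambda>n. ideal_len A S I n = 0)"
proof (rule ideal_len_devissage[OF zero_class, of I])
  fix P assume P: "primeideal P S" "hideal P" "I \<subseteq> P"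
  show "for_large (\<lambda>n. ideal_len A S P n = 0)" using not_Proj_zero[OF P(1,2)] no P(3) by blast
qed (use I in auto)

definition no_chain_above :: "'s set \<Rightarrow> bool" where
  "no_chain_above I \<longleftrightarrow> (\<forall>P\<in>Proj S. \<forall>Q\<in>Proj S. I \<subseteq> P \<longrightarrow> \<not> P \<subset> Q)"

text \<open>
  A prime \<open>P \<in> Proj S\<close> above \<open>I0\<close> is maximal in \<open>Proj S\<close>, so no element of \<open>Proj S\<close> contains \<open>P + yS\<close> for
  \<open>y \<in> S\<^sub>i - P\<close>.  The difference in direction \<open>i\<close> of the length function of \<open>S/P\<close> is therefore
  eventually \<open>0\<close>.
\<close>

lemma ideal_len_eventually_constant:
  assumes no: "no_chain_above I0" and I: "hideal I" "I0 \<subseteq> I"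
  shows "finite_and_eventually (\<lambda>f. \<exists>c. for_large (\<lambda>n. f n = c)) (ideal_len A S I)"
proof (rule ideal_len_devissage[OF constant_class _ I])
  fix P assume P: "primeideal P S" "hideal P" "I0 \<subseteq> P"
  have "\<exists>c. for_large (\<lambda>n. ideal_len A S P n = c)"
  proof (cases "P \<in> Proj S")
    case True
    show ?thesis
    proof (rule eventually_constant)
      fix i
      obtain y where y: "y \<in> component S (axis i 1)" "y \<notin> P" using ProjD(3)[OF True] by blast
      let ?J = "adjoin S XS P y"
      have "\<not> ?J \<subseteq> Q" if "Q \<in> Proj S" for Q
        using no that True P(3) adjoin_psubset[OF P(2) y] unfolding no_chain_above_def by blast
      hence "for_large (\<lambda>n. ideal_len A S ?J n = 0)"
        using hideal_adjoin(1)[OF P(2) y(1)] by (intro ideal_len_eventually_zero)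
      from for_large_add[OF this, of "axis i 1"]
      show "for_large (\<lambda>n. ideal_len A S P (n + axis i 1) = ideal_len A S P n)"
      proof (rule for_large_mono)
        fix n assume 0: "ideal_len A S ?J (n + axis i 1) = 0"
        show "ideal_len A S P (n + axis i 1) = ideal_len A S P n"
          using ideal_len_prime[OF P(1,2) y, of "n + axis i 1"] 0 vec_le_add2[of "axis i 1" n]
          by (simp add: shift_def)
      qed
    qed
  next
    case False
    thus ?thesis using not_Proj_zero[OF P(1,2)] by blast
  qed
  then obtain c where "for_large (\<lambda>n. ideal_len A S P n = c)" by blast
  hence "for_large (\<lambda>n. int (the_enat (ideal_len A S P n)) = int (the_enat c))" by (rule for_large_mono) simp
  thus "finite_and_eventually (\<lambda>f. \<exists>c. for_large (\<lambda>n. f n = c)) (ideal_len A S P)"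
    using ideal_len_finite unfolding finite_and_eventually_def by blast
qed

text \<open>
  For a homogeneous \<open>z \<in> Q - P\<close> of degree \<open>b\<close>, the module \<open>S/P\<close> has the shifted copy \<open>z(S/P)\<close> of itself
  as a submodule, and the quotient maps onto \<open>S/Q\<close>, which is nonzero in every degree.  So the length
  grows by at least \<open>1\<close> from \<open>n\<close> to \<open>n + b\<close>.
\<close>

lemma ideal_len_unbounded:
  assumes PQ: "P \<in> Proj S" "Q \<in> Proj S" "P \<subset> Q"
  obtains b where "\<And>m t. enat t \<le> ideal_len A S P (m + ((\<lambda>n. n + b) ^^ t) 0)"
proof -
  note P = ProjD[OF PQ(1)] and Q = ProjD[OF PQ(2)]
  obtain x where x: "x \<in> Q" "x \<notin> P" using PQ(3) by blast
  have xS: "x \<in> carrier S" using ideal.Icarr[OF Q(4) x(1)] .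
  obtain b where b: "hcomp S x b \<notin> P"
  proof (rule ccontr)
    assume "\<not> thesis"
    hence "\<And>n. hcomp S x n \<in> P" using that by blast
    hence "finsum S (hcomp S x) {n. hcomp S x n \<noteq> \<zero>\<^bsub>S\<^esub>} \<in> P"
      by (intro finsum_mem_ideal[OF P(4)] SG.hcomp_spec(2)[OF xS])
    thus False using x(2) SG.hcomp_spec(3)[OF xS] by simp
  qed
  let ?z = "hcomp S x b"
  have z: "?z \<in> component S b" "?z \<in> Q"
    using SG.hcomp_spec(1)[OF xS] Q(2) x(1) by (auto simp: hideal_def homogeneousD)
  have JQ: "adjoin S XS P ?z \<subseteq> Q" by (rule hideal_adjoin(7)[OF P(2) z(1) Q(4)]) (use PQ(3) z in auto)
  have one: "1 \<le> ideal_len A S (adjoin S XS P ?z) n" for n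
  proof -
    have "ideal_len A S Q n \<noteq> 0" using ideal_len_zeroD[OF Q(4)] Q(3) by blast
    hence "1 \<le> ideal_len A S Q n" by (simp add: one_eSuc ileI1)
    thus ?thesis using ideal_len_antimono[OF JQ, of n] by (rule order_trans)
  qed
  have step: "1 + ideal_len A S P n \<le> ideal_len A S P (n + b)" for n
    using ideal_len_prime[OF P(1,2) z(1) b, of "n + b"] one[of "n + b"] vec_le_add2[of b n]
    by (simp add: shift_def add_right_mono)
  have "enat t \<le> ideal_len A S P (m + ((\<lambda>n. n + b) ^^ t) 0)" for m t
  proof (induction t)
    case 0
    show ?case by (simp flip: zero_enat_def)
  next
    case (Suc t)
    have "enat (Suc t) = 1 + enat t" by (simp add: one_enat_def)
    also have "\<dots> \<le> 1 + ideal_len A S P (m + ((\<lambda>n. n + b) ^^ t) 0)" using Suc by (rule add_left_mono)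
    also have "\<dots> \<le> ideal_len A S P (m + ((\<lambda>n. n + b) ^^ t) 0 + b)" by (rule step)
    finally show ?case by (simp add: add.assoc)
  qed
  thus thesis by (rule that)
qed

definition avoids :: "'s \<Rightarrow> 's set set \<Rightarrow> bool" where "avoids x PP \<longleftrightarrow> (\<forall>P\<in>PP. x \<notin> P)"

text \<open>
  For a prime in \<open>Proj S\<close> it suffices to avoid the prime, and modulo any other prime the components
  of large degree vanish; the extension of \<open>S/(I + aS)\<close> by a shift of \<open>S/(I : a)\<close> needs the primes of
  both.
\<close>

lemma eventually_regular_ideal:
  assumes "hideal I"
  shows "\<exists>PP. finite PP \<and> PP \<subseteq> Proj S \<and> (\<forall>x p. x \<in> component S p \<longrightarrow> avoids x PP \<longrightarrow>
    for_large (\<lambda>n. \<forall>s\<in>component S n. x \<otimes>\<^bsub>S\<^esub> s \<in> I \<longrightarrow> s \<in> I))"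
  using assms
proof (induction I rule: hideal_induct)
  case whole
  show ?case
  proof (intro exI[of _ "{}"] conjI allI impI)
    fix x
    have "\<forall>s\<in>component S n. x \<otimes>\<^bsub>S\<^esub> s \<in> carrier S \<longrightarrow> s \<in> carrier S" for n
      using SG.component_closed by blast
    thus "for_large (\<lambda>n. \<forall>s\<in>component S n. x \<otimes>\<^bsub>S\<^esub> s \<in> carrier S \<longrightarrow> s \<in> carrier S)"
      by (rule for_largeI)
  qed simp_all
next
  case (prime P)
  show ?case
  proof (cases "P \<in> Proj S")
    case True
    interpret P: primeideal P S by (rule prime)
    show ?thesis
    proof (intro exI[of _ "{P}"] conjI allI impI)
      fix x p assume x: "x \<in> component S p" "avoids x {P}"
      have "\<forall>s\<in>component S n. x \<otimes>\<^bsub>S\<^esub> s \<in> P \<longrightarrow> s \<in> P" for n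
        using P.I_prime[of x] SG.component_closed x unfolding avoids_def by blast
      thus "for_large (\<lambda>n. \<forall>s\<in>component S n. x \<otimes>\<^bsub>S\<^esub> s \<in> P \<longrightarrow> s \<in> P)"
        by (rule for_largeI)
    qed (use True in simp_all)
  next
    case False
    obtain i where i: "\<forall>n. n $ i \<noteq> 0 \<longrightarrow> component S n \<subseteq> P" using not_Proj_ideal_len[OF prime(1,2) False] by blast
    show ?thesis
    proof (intro exI[of _ "{}"] conjI allI impI)
      fix x
      show "for_large (\<lambda>n. \<forall>s\<in>component S n. x \<otimes>\<^bsub>S\<^esub> s \<in> P \<longrightarrow> s \<in> P)"
        by (rule for_large_mono[OF for_large_coord[of i]]) (use i in blast)
    qed simp_all
  qed
next
  case (split I p a)
  let ?J = "adjoin S XS I a" and ?K = "colon S XS I a"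
  from split(3) obtain PP1 where 1: "finite PP1" "PP1 \<subseteq> Proj S"
    "\<And>x q. x \<in> component S q \<Longrightarrow> avoids x PP1 \<Longrightarrow> for_large (\<lambda>n. \<forall>s\<in>component S n. x \<otimes>\<^bsub>S\<^esub> s \<in> ?J \<longrightarrow> s \<in> ?J)" by auto
  from split(4) obtain PP2 where 2: "finite PP2" "PP2 \<subseteq> Proj S"
    "\<And>x q. x \<in> component S q \<Longrightarrow> avoids x PP2 \<Longrightarrow> for_large (\<lambda>n. \<forall>s\<in>component S n. x \<otimes>\<^bsub>S\<^esub> s \<in> ?K \<longrightarrow> s \<in> ?K)" by auto
  note adj = hideal_adjoin[OF split(1,2)]
  have st: "stable XS (carrier S) I" "homogeneous XS I" using split(1) ideal_stable by (auto simp: hideal_def)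
  interpret I: ideal I S using split(1) by (simp add: hideal_def)
  have aS: "a \<in> carrier S" using split(2) SG.component_closed by blast
  show ?case
  proof (intro exI[of _ "PP1 \<union> PP2"] conjI allI impI)
    fix x q assume x: "x \<in> component S q" and av: "avoids x (PP1 \<union> PP2)"
    have xS: "x \<in> carrier S" using x SG.component_closed by blast
    have av': "avoids x PP1" "avoids x PP2" using av by (auto simp: avoids_def)
    show "for_large (\<lambda>n. \<forall>s\<in>component S n. x \<otimes>\<^bsub>S\<^esub> s \<in> I \<longrightarrow> s \<in> I)"
      using 1(3)[OF x av'(1)] for_large_minus[OF 2(3)[OF x av'(2)], of p]
    proof (rule for_large_mono2)
      fix n assume n1: "\<forall>s\<in>component S n. x \<otimes>\<^bsub>S\<^esub> s \<in> ?J \<longrightarrow> s \<in> ?J"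
        and n2: "p \<le> n \<and> (\<forall>s\<in>component S (n - p). x \<otimes>\<^bsub>S\<^esub> s \<in> ?K \<longrightarrow> s \<in> ?K)"
      show "\<forall>s\<in>component S n. x \<otimes>\<^bsub>S\<^esub> s \<in> I \<longrightarrow> s \<in> I"
      proof (intro ballI impI)
        fix s assume s: "s \<in> component S n" and xs: "x \<otimes>\<^bsub>S\<^esub> s \<in> I"
        have "s \<in> ?J \<inter> component XS n" using n1 s xs adj(3) by auto
        then obtain t c where tc: "t \<in> I" "c \<in> component S (n - p)" "s = t \<oplus>\<^bsub>S\<^esub> c \<otimes>\<^bsub>S\<^esub> a"
          using component_decomp[OF st, of a p s n] split(2) n2 by auto
        have cS: "c \<in> carrier S" using tc SG.component_closed by blast
        have tS: "t \<in> carrier S" using tc by simp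
        have "x \<otimes>\<^bsub>S\<^esub> s = x \<otimes>\<^bsub>S\<^esub> t \<oplus>\<^bsub>S\<^esub> (x \<otimes>\<^bsub>S\<^esub> c) \<otimes>\<^bsub>S\<^esub> a" using tc cS aS xS by (simp add: R.r_distr R.m_assoc)
        hence "x \<otimes>\<^bsub>S\<^esub> s \<ominus>\<^bsub>S\<^esub> x \<otimes>\<^bsub>S\<^esub> t = (x \<otimes>\<^bsub>S\<^esub> c) \<otimes>\<^bsub>S\<^esub> a"
          using add_diff_cancel[of "x \<otimes>\<^bsub>S\<^esub> t" "(x \<otimes>\<^bsub>S\<^esub> c) \<otimes>\<^bsub>S\<^esub> a" "x \<otimes>\<^bsub>S\<^esub> s"] tS cS aS xS by simp
        moreover have "x \<otimes>\<^bsub>S\<^esub> s \<ominus>\<^bsub>S\<^esub> x \<otimes>\<^bsub>S\<^esub> t \<in> I" using xs I.I_l_closed[OF tc(1) xS] by (simp add: a_minus_def)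
        ultimately have "x \<otimes>\<^bsub>S\<^esub> c \<in> ?K" using adj(6) xS cS by simp
        hence "c \<otimes>\<^bsub>S\<^esub> a \<in> I" using n2 tc(2) adj(6) by blast
        thus "s \<in> I" using tc by simp
      qed
    qed
  qed (use 1 2 in auto)
qed

end

section \<open>Finitely generated graded modules\<close>

text \<open>
  Prime avoidance inside \<open>S\<^sub>i\<close>.  If \<open>x\<close> avoids all primes but \<open>P\<close>, take \<open>y \<in> S\<^sub>i - P\<close>.  The elements
  \<open>y + ax\<close> with \<open>a \<in> A\<close> lie outside \<open>P\<close>, and another prime contains \<open>y + ax\<close> for at most one residue
  class of \<open>a\<close>: the difference of two such elements is a unit multiple of \<open>x\<close>.  There are infinitely
  many residue classes.
\<close>

lemma (in std_alg) exists_avoiding: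
  assumes inf: "infinite (carrier (A Quot \<mm>))" and PP: "finite PP" "PP \<subseteq> Proj S"
  shows "\<exists>x\<in>component S (axis i 1). avoids x PP"
  using PP
proof (induction PP)
  case empty
  show ?case using SG.component_props(2) by (auto simp: avoids_def)
next
  case (insert P PP)
  then obtain x where x: "x \<in> component S (axis i 1)" "avoids x PP" by auto
  have PP: "P \<in> Proj S" "\<And>Q. Q \<in> PP \<Longrightarrow> Q \<in> Proj S" using insert by auto
  show ?case
  proof (cases "x \<in> P")
    case False
    thus ?thesis using x by (intro bexI[of _ x]) (auto simp: avoids_def)
  next
    case True
    interpret P: ideal P S using ProjD(4)[OF PP(1)] .
    obtain y where y: "y \<in> component S (axis i 1)" "y \<notin> P" using ProjD(3)[OF PP(1)] by blast
    have xy: "x \<in> carrier S" "y \<in> carrier S" using x y SG.component_closed by auto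
    let ?s = "\<lambda>a. a \<odot>\<^bsub>S\<^esub> \<one>\<^bsub>S\<^esub>" let ?v = "\<lambda>a. y \<oplus>\<^bsub>S\<^esub> ?s a \<otimes>\<^bsub>S\<^esub> x"
    have vS: "?v a \<in> component S (axis i 1)" if "a \<in> carrier A" for a
    proof -
      have "?s a \<in> A1" unfolding scalars_def using that by blast
      hence "?s a \<otimes>\<^bsub>S\<^esub> x \<in> component S (axis i 1)"
        using mult_component[of "?s a" 0 x "axis i 1"] scalars_component x(1) by auto
      thus ?thesis using SG.component_props(3) y(1) by blast
    qed
    have vP: "?v a \<notin> P" if "a \<in> carrier A" for a
    proof
      assume "?v a \<in> P"
      moreover have "?s a \<otimes>\<^bsub>S\<^esub> x \<in> P" using P.I_l_closed[OF True scalar_closed[OF that]] .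
      ultimately have "?v a \<ominus>\<^bsub>S\<^esub> ?s a \<otimes>\<^bsub>S\<^esub> x \<in> P" by (simp add: a_minus_def)
      moreover have "?v a \<ominus>\<^bsub>S\<^esub> ?s a \<otimes>\<^bsub>S\<^esub> x = y"
        using xy scalar_closed[OF that] by (simp add: a_minus_def R.a_assoc R.r_neg)
      ultimately show False using y(2) by simp
    qed
    have "\<exists>a\<in>carrier A. \<forall>Q\<in>PP. ?v a \<notin> Q"
    proof (rule ccontr)
      assume "\<not> ?thesis"
      hence bad: "\<exists>Q\<in>PP. ?v a \<in> Q" if "a \<in> carrier A" for a using that by blast
      define rep where "rep C = (SOME a. a \<in> carrier A \<and> C = \<mm> +>\<^bsub>A\<^esub> a)" for C
      have rep: "rep C \<in> carrier A \<and> C = \<mm> +>\<^bsub>A\<^esub> rep C" if "C \<in> carrier (A Quot \<mm>)" for C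
        unfolding rep_def by (rule someI_ex) (use that in \<open>auto simp: FactRing_def A_RCOSETS_def'\<close>)
      define g where "g C = (SOME Q. Q \<in> PP \<and> ?v (rep C) \<in> Q)" for C
      have g: "g C \<in> PP \<and> ?v (rep C) \<in> g C" if "C \<in> carrier (A Quot \<mm>)" for C
        unfolding g_def by (rule someI_ex) (use bad rep[OF that] in blast)
      have "inj_on g (carrier (A Quot \<mm>))"
      proof (rule inj_onI)
        fix C D assume C: "C \<in> carrier (A Quot \<mm>)" and D: "D \<in> carrier (A Quot \<mm>)" and eq: "g C = g D"
        let ?a = "rep C" and ?b = "rep D" and ?Q = "g C"
        have a: "?a \<in> carrier A" and b: "?b \<in> carrier A" using rep C D by auto
        interpret Q: ideal ?Q S using ProjD(4) PP(2) g[OF C] by blast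
        have v: "?v ?a \<in> ?Q" "?v ?b \<in> ?Q" using g[OF C] g[OF D] eq by simp_all
        have 1: "?v ?a \<ominus>\<^bsub>S\<^esub> ?v ?b \<in> ?Q" unfolding a_minus_def by (intro Q.a_closed Q.a_inv_closed v)
        have 2: "?v ?a \<ominus>\<^bsub>S\<^esub> ?v ?b = ?s (?a \<ominus>\<^bsub>A\<^esub> ?b) \<otimes>\<^bsub>S\<^esub> x"
        proof -
          have sa: "?s ?a \<in> carrier S" "?s ?b \<in> carrier S" using scalar_closed a b by auto
          have "?v ?a \<ominus>\<^bsub>S\<^esub> ?v ?b = (y \<oplus>\<^bsub>S\<^esub> ?s ?a \<otimes>\<^bsub>S\<^esub> x) \<oplus>\<^bsub>S\<^esub> (\<ominus>\<^bsub>S\<^esub> y \<oplus>\<^bsub>S\<^esub> \<ominus>\<^bsub>S\<^esub> (?s ?b \<otimes>\<^bsub>S\<^esub> x))"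
            using sa xy by (simp add: a_minus_def R.minus_add)
          also have "\<dots> = (y \<oplus>\<^bsub>S\<^esub> \<ominus>\<^bsub>S\<^esub> y) \<oplus>\<^bsub>S\<^esub> (?s ?a \<otimes>\<^bsub>S\<^esub> x \<oplus>\<^bsub>S\<^esub> \<ominus>\<^bsub>S\<^esub> (?s ?b \<otimes>\<^bsub>S\<^esub> x))"
            by (rule R.add_add_swap) (use sa xy in auto)
          also have "\<dots> = (?s ?a \<oplus>\<^bsub>S\<^esub> \<ominus>\<^bsub>S\<^esub> ?s ?b) \<otimes>\<^bsub>S\<^esub> x"
            using sa xy by (simp add: R.r_neg R.l_distr R.l_minus)
          also have "?s ?a \<oplus>\<^bsub>S\<^esub> \<ominus>\<^bsub>S\<^esub> ?s ?b = ?s (?a \<ominus>\<^bsub>A\<^esub> ?b)"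
            using a b by (simp add: scalar_minus scalar_add a_minus_def)
          finally show ?thesis .
        qed
        have "?a \<ominus>\<^bsub>A\<^esub> ?b \<in> \<mm>"
        proof (rule ccontr)
          let ?c = "?a \<ominus>\<^bsub>A\<^esub> ?b"
          assume "?c \<notin> \<mm>"
          hence u: "?c \<in> Units A" using AL.unit_of_not_mem a b by simp
          have c: "?c \<in> carrier A" "inv\<^bsub>A\<^esub> ?c \<in> carrier A" using a b u by auto
          have "?s (inv\<^bsub>A\<^esub> ?c) \<otimes>\<^bsub>S\<^esub> (?s ?c \<otimes>\<^bsub>S\<^esub> x) \<in> ?Q"
            by (rule Q.I_l_closed) (use 1 2 c scalar_closed in auto)
          moreover have "?s (inv\<^bsub>A\<^esub> ?c) \<otimes>\<^bsub>S\<^esub> (?s ?c \<otimes>\<^bsub>S\<^esub> x) = ?s (inv\<^bsub>A\<^esub> ?c \<otimes>\<^bsub>A\<^esub> ?c) \<otimes>\<^bsub>S\<^esub> x"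
            using c xy scalar_closed by (simp add: R.m_assoc[symmetric] scalar_mult)
          moreover have "\<dots> = x" using u xy by simp
          ultimately have "x \<in> ?Q" by simp
          thus False using x(2) g[OF C] by (auto simp: avoids_def)
        qed
        hence "\<mm> +>\<^bsub>A\<^esub> ?a = \<mm> +>\<^bsub>A\<^esub> ?b" using AL.quotient_eq_iff_same_a_r_cos[OF AL.is_ideal a b] by blast
        thus "C = D" using rep[OF C] rep[OF D] by simp
      qed
      moreover have "g ` carrier (A Quot \<mm>) \<subseteq> PP" using g by auto
      ultimately show False using inf insert(1) finite_subset finite_imageD by metis
    qed
    then obtain a where "a \<in> carrier A" "\<forall>Q\<in>PP. ?v a \<notin> Q" by blast
    thus ?thesis using vS vP by (intro bexI[of _ "?v a"]) (auto simp: avoids_def)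
  qed
qed

definition annihilator :: "('s, 'z) ring_scheme \<Rightarrow> ('s, 'm, 'y) module_scheme \<Rightarrow> 's set" where
  "annihilator S M = {s \<in> carrier S. \<forall>m\<in>carrier M. s \<odot>\<^bsub>M\<^esub> m = \<zero>\<^bsub>M\<^esub>}"

locale fg_std_mod = std_mod A \<mm> S M
  for A :: "('a, 'x) ring_scheme" and \<mm> and S :: "('a, 's, nat ^ 'd::finite, 'z) graded_module_scheme"
    and M :: "('s, 'm, nat ^ 'd, 'y) graded_module_scheme" (structure) +
  assumes fg: "\<exists>F. finite F \<and> F \<subseteq> carrier M \<and> (\<forall>N. stable M (carrier S) N \<longrightarrow> F \<subseteq> N \<longrightarrow> N = carrier M)"
begin

lemma acc_submodules: "acc {N. stable M (carrier S) N}"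
  using fg acc_of_finitely_generated by blast

lemma stable_A1: "stable M (carrier S) N \<Longrightarrow> stable M A1 N"
  using stable_antimono[OF _ scalars_subset] .

definition clen :: "nat ^ 'd \<Rightarrow> enat" where "clen n = interval_len M A1 {\<zero>} (component M n)"

lemma clen_finite: "clen n < \<infinity>"
  unfolding clen_def by (rule component_finite_length[OF acc_submodules])

lemma component_length_eq: "component_length A S M n = int (the_enat (clen n))"
  unfolding component_length_def clen_def module_length_stable[OF module_axioms component_stable] ..

text \<open>
  \<open>M\<close> is obtained from \<open>0\<close> by adjoining homogeneous generators one after the other.
\<close>

lemma graded_filtration_induct [case_names zero adjoin]:
  assumes zero: "Q {\<zero>}"
    and adj: "\<And>N z a. stable M (carrier S) N \<Longrightarrow> homogeneous M N \<Longrightarrow> z \<in> component M a \<Longrightarrow> Q N \<Longrightarrow>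
      Q (adjoin S M N z)"
  shows "Q (carrier M)"
proof -
  obtain F where F: "finite F" "F \<subseteq> carrier M" "\<forall>N. stable M (carrier S) N \<longrightarrow> F \<subseteq> N \<longrightarrow> N = carrier M"
    using fg by blast
  define H where "H = (\<Union>x\<in>F. hcomp M x ` {n. hcomp M x n \<noteq> \<zero>})"
  have H: "finite H" unfolding H_def using F hcomp_spec(2) by blast
  have Hhom: "H \<subseteq> (\<Union>n. component M n)" unfolding H_def using F(2) hcomp_spec(1) by blast
  have "\<exists>N. stable M (carrier S) N \<and> homogeneous M N \<and> H' \<subseteq> N \<and> Q N"
    if "finite H'" "H' \<subseteq> (\<Union>n. component M n)" for H'
    using that
  proof (induction H')
    case empty
    thus ?case using zero stable_zero[of "carrier S"] homogeneous_zero by blast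
  next
    case (insert z H')
    then obtain N a where N: "stable M (carrier S) N" "homogeneous M N" "H' \<subseteq> N" "Q N" and z: "z \<in> component M a"
      by auto
    note * = adjoin_props[OF N(1) component_closed[OF z]]
    show ?case using *(1-3) N(3) adjoin_homogeneous[OF N(1,2) z] adj[OF N(1,2) z N(4)]
      by (intro exI[of _ "adjoin S M N z"]) blast
  qed
  from this[OF H Hhom] obtain N where N: "stable M (carrier S) N" "H \<subseteq> N" "Q N" by blast
  have "F \<subseteq> N"
  proof
    fix x assume x: "x \<in> F"
    hence xM: "x \<in> carrier M" using F by blast
    have c: "hcomp M x n \<in> N" for n
      using N(2) x stableD(2)[OF N(1)] unfolding H_def by (cases "hcomp M x n = \<zero>") auto
    have "finsum M (hcomp M x) G \<in> N" if "finite G" for G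
      using that
    proof (induction G)
      case empty thus ?case using stableD(2)[OF N(1)] by simp
    next
      case (insert p G)
      thus ?case using c xM stableD(3)[OF N(1)] by (simp add: Pi_def)
    qed
    thus "x \<in> N" using hcomp_spec[OF xM] by metis
  qed
  hence "N = carrier M" using F(3) N(1) by blast
  thus ?thesis using N(3) by simp
qed

lemma interval_len_adjoin_step:
  assumes N: "stable M (carrier S) N" "homogeneous M N" and z: "z \<in> component M a"
  shows "interval_len M A1 {\<zero>} (adjoin S M N z \<inter> component M n) =
    interval_len M A1 {\<zero>} (N \<inter> component M n) + shift a (ideal_len A S (colon S M N z)) n"
proof -
  note * = adjoin_props[OF N(1) component_closed[OF z]]
  have "interval_len M A1 {\<zero>} (adjoin S M N z \<inter> component M n) =
      interval_len M A1 {\<zero>} (N \<inter> component M n) +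
      interval_len M A1 (N \<inter> component M n) (adjoin S M N z \<inter> component M n)"
  proof (rule interval_len_add[OF scalars_subset])
    show "stable M A1 {\<zero>}" by (rule stable_zero[OF scalars_subset])
    show "stable M A1 (N \<inter> component M n)" by (rule stable_Int[OF stable_A1[OF N(1)] component_stable])
    show "stable M A1 (adjoin S M N z \<inter> component M n)" by (rule stable_Int[OF stable_A1[OF *(1)] component_stable])
    show "{\<zero>} \<subseteq> N \<inter> component M n" using stableD(2)[OF N(1)] component_props(2) by blast
    show "N \<inter> component M n \<subseteq> adjoin S M N z \<inter> component M n" using *(2) by blast
  qed
  thus ?thesis using interval_len_adjoin_homogeneous[OF N z] by simp
qed

lemma annihilator_colon:
  assumes "stable M (carrier S) N" "z \<in> carrier M"
  shows "annihilator S M \<subseteq> colon S M N z"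
  using assms stableD(2) by (auto simp: annihilator_def colon_def)

lemma colon_hideal:
  assumes "stable M (carrier S) N" "homogeneous M N" "z \<in> component M a"
  shows "alg.hideal (colon S M N z)"
  using adjoin_props(5)[OF assms(1) component_closed[OF assms(3)]] colon_homogeneous[OF assms]
  by (simp add: alg.hideal_def)

lemma carrier_Int_component: "carrier M \<inter> component M n = component M n"
  using component_closed by blast

lemma zero_Int_component: "{\<zero>} \<inter> component M n = {\<zero>}"
  using component_props(2) by blast

lemma clen_devissage:
  assumes \<Psi>: "additive_class \<Psi>"
    and ideals: "\<And>I. alg.hideal I \<Longrightarrow> annihilator S M \<subseteq> I \<Longrightarrow> \<Psi> (ideal_len A S I)"
  shows "\<Psi> clen"
proof -
  have "\<Psi> (\<lambda>n. interval_len M A1 {\<zero>} (carrier M \<inter> component M n))"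
  proof (rule graded_filtration_induct)
    show "\<Psi> (\<lambda>n. interval_len M A1 {\<zero>} ({\<zero>} \<inter> component M n))"
      using \<Psi> by (simp add: additive_class_def zero_Int_component)
    fix N z a assume N: "stable M (carrier S) N" "homogeneous M N" and z: "z \<in> component M a"
      and IH: "\<Psi> (\<lambda>n. interval_len M A1 {\<zero>} (N \<inter> component M n))"
    have "\<Psi> (ideal_len A S (colon S M N z))"
      by (rule ideals[OF colon_hideal[OF N z] annihilator_colon[OF N(1) component_closed[OF z]]])
    thus "\<Psi> (\<lambda>n. interval_len M A1 {\<zero>} (adjoin S M N z \<inter> component M n))"
      unfolding interval_len_adjoin_step[OF N z] using \<Psi> IH by (simp add: additive_class_def)
  qed
  thus ?thesis by (simp add: carrier_Int_component clen_def[abs_def])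
qed

lemma hilbert_polynomial: "\<exists>e. represents e (component_length A S M)"
proof -
  have "alg.finite_and_eventually (\<lambda>f. \<exists>e. represents e f) clen"
    by (rule clen_devissage[OF alg.polynomial_class]) (rule alg.ideal_len_polynomial)
  thus ?thesis unfolding alg.finite_and_eventually_def component_length_eq[abs_def] by blast
qed

lemma represents_hilbert_coeff: "represents (hilbert_coeff A S M) (component_length A S M)"
  using hilbert_polynomial hilbert_coeff_eq by metis

lemma eventually_constant_of_no_chain:
  assumes "alg.no_chain_above (annihilator S M)"
  shows "\<exists>c. for_large (\<lambda>n. component_length A S M n = c)"
proof -
  have "alg.finite_and_eventually (\<lambda>f. \<exists>c. for_large (\<lambda>n. f n = c)) clen"
    by (rule clen_devissage[OF alg.constant_class]) (rule alg.ideal_len_eventually_constant[OF assms])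
  thus ?thesis unfolding alg.finite_and_eventually_def component_length_eq[abs_def] by blast
qed

text \<open>
  In the filtration of \<open>M\<close> by homogeneous generators with quotients \<open>S/I\<^sub>j\<close>, some \<open>I\<^sub>j\<close> lies in \<open>P\<close>:
  otherwise a product of elements of the \<open>I\<^sub>j\<close> outside \<open>P\<close> would annihilate \<open>M\<close>.
\<close>

lemma prime_above_annihilator:
  assumes P: "primeideal P S" "annihilator S M \<subseteq> P"
  obtains a where "\<And>n. shift a (ideal_len A S P) n \<le> clen n"
proof -
  interpret P: primeideal P S by (rule P(1))
  have "(\<exists>s\<in>carrier S - P. \<forall>m\<in>carrier M. s \<odot> m = \<zero>) \<or>
      (\<exists>a. \<forall>n. shift a (ideal_len A S P) n \<le> interval_len M A1 {\<zero>} (carrier M \<inter> component M n))"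
  proof (rule graded_filtration_induct)
    have "\<one>\<^bsub>S\<^esub> \<in> carrier S - P" using P.one_imp_carrier P.I_notcarr by auto
    thus "(\<exists>s\<in>carrier S - P. \<forall>m\<in>{\<zero>}. s \<odot> m = \<zero>) \<or>
      (\<exists>a. \<forall>n. shift a (ideal_len A S P) n \<le> interval_len M A1 {\<zero>} ({\<zero>} \<inter> component M n))" by auto
    fix N z a assume N: "stable M (carrier S) N" "homogeneous M N" and z: "z \<in> component M a"
      and IH: "(\<exists>s\<in>carrier S - P. \<forall>m\<in>N. s \<odot> m = \<zero>) \<or>
        (\<exists>a. \<forall>n. shift a (ideal_len A S P) n \<le> interval_len M A1 {\<zero>} (N \<inter> component M n))"
    have zM: "z \<in> carrier M" using component_closed[OF z] .
    note step = interval_len_adjoin_step[OF N z]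
    let ?I = "colon S M N z"
    show "(\<exists>s\<in>carrier S - P. \<forall>m\<in>adjoin S M N z. s \<odot> m = \<zero>) \<or>
        (\<exists>a. \<forall>n. shift a (ideal_len A S P) n \<le> interval_len M A1 {\<zero>} (adjoin S M N z \<inter> component M n))"
    proof (cases "?I \<subseteq> P")
      case True
      have "shift a (ideal_len A S P) n \<le> shift a (ideal_len A S ?I) n" for n
        using alg.ideal_len_antimono[OF True] by (simp add: shift_def)
      hence "shift a (ideal_len A S P) n \<le> interval_len M A1 {\<zero>} (adjoin S M N z \<inter> component M n)" for n
        unfolding step by (rule order_trans) simp
      thus ?thesis by blast
    next
      case False
      then obtain t where t: "t \<in> carrier S" "t \<odot> z \<in> N" "t \<notin> P" by (auto simp: colon_def)
      from IH show ?thesis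
      proof
        assume "\<exists>s\<in>carrier S - P. \<forall>m\<in>N. s \<odot> m = \<zero>"
        then obtain s where s: "s \<in> carrier S" "s \<notin> P" "\<forall>m\<in>N. s \<odot> m = \<zero>" by blast
        have "s \<otimes>\<^bsub>S\<^esub> t \<in> carrier S - P" using s t P.I_prime by blast
        moreover have "(s \<otimes>\<^bsub>S\<^esub> t) \<odot> m = \<zero>" if m: "m \<in> adjoin S M N z" for m
        proof -
          obtain x r where xr: "x \<in> N" "r \<in> carrier S" "m = x \<oplus> r \<odot> z"
            using m unfolding adjoin_def set_add_def' by auto
          have xM: "x \<in> carrier M" using stableD(1)[OF N(1) xr(1)] .
          have "t \<odot> (r \<odot> z) = r \<odot> (t \<odot> z)"
            using t(1) xr(2) zM by (simp add: smult_assoc1[symmetric] R.m_comm)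
          hence "t \<odot> m \<in> N"
            using xr t xM zM stableD(3,5)[OF N(1)] by (simp add: smult_r_distr)
          thus ?thesis using s t xr xM zM by (simp add: smult_assoc1)
        qed
        ultimately show ?thesis by blast
      next
        assume "\<exists>a. \<forall>n. shift a (ideal_len A S P) n \<le> interval_len M A1 {\<zero>} (N \<inter> component M n)"
        then obtain b where "\<And>n. shift b (ideal_len A S P) n \<le> interval_len M A1 {\<zero>} (N \<inter> component M n)" by blast
        hence "shift b (ideal_len A S P) n \<le> interval_len M A1 {\<zero>} (adjoin S M N z \<inter> component M n)" for n
          unfolding step by (rule order_trans) simp
        thus ?thesis by blast
      qed
    qed
  qed
  moreover have "\<not> (\<exists>s\<in>carrier S - P. \<forall>m\<in>carrier M. s \<odot> m = \<zero>)" using P(2) by (auto simp: annihilator_def)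
  ultimately show thesis using that by (auto simp: carrier_Int_component clen_def)
qed

lemma no_chain_of_eventually_constant:
  assumes c: "for_large (\<lambda>n. component_length A S M n = c)"
  shows "alg.no_chain_above (annihilator S M)"
  unfolding alg.no_chain_above_def
proof (intro ballI impI notI)
  fix P Q assume PQ: "P \<in> Proj S" "Q \<in> Proj S" "P \<subset> Q" and ann: "annihilator S M \<subseteq> P"
  obtain b where b: "\<And>m t. enat t \<le> ideal_len A S P (m + ((\<lambda>n. n + b) ^^ t) 0)"
    using alg.ideal_len_unbounded[OF PQ] by blast
  obtain a where a: "\<And>n. shift a (ideal_len A S P) n \<le> clen n"
    using prime_above_annihilator[OF alg.ProjD(1)[OF PQ(1)] ann] by blast
  obtain N where N: "\<forall>n\<ge>N. component_length A S M n = c" using c unfolding for_large_def by blast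
  define t where "t = Suc (nat c)"
  define m where "m = N + ((\<lambda>n. n + b) ^^ t) 0"
  have "enat t \<le> ideal_len A S P m" unfolding m_def by (rule b)
  also have "\<dots> = shift a (ideal_len A S P) (m + a)" using vec_le_add2[of a m] by (simp add: shift_def)
  also have "\<dots> \<le> clen (m + a)" by (rule a)
  finally have le: "enat t \<le> clen (m + a)" .
  have "N \<le> m + a" unfolding m_def by (metis vec_le_add add.assoc)
  hence "int (the_enat (clen (m + a))) = c" using N component_length_eq by simp
  moreover obtain k where "clen (m + a) = enat k" using clen_finite[of "m + a"] by auto
  ultimately show False using le by (simp add: t_def)
qed

text \<open>
  An element that is regular in large degrees on \<open>N\<close> and on \<open>S/(N : z)\<close> is so on \<open>N + Sz\<close>.
\<close>

lemma eventually_regular: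
  "\<exists>PP. finite PP \<and> PP \<subseteq> Proj S \<and> (\<forall>x p. x \<in> component S p \<longrightarrow> alg.avoids x PP \<longrightarrow>
    for_large (\<lambda>n. \<forall>m\<in>component M n. x \<odot> m = \<zero> \<longrightarrow> m = \<zero>))"
proof -
  have "\<exists>PP. finite PP \<and> PP \<subseteq> Proj S \<and> (\<forall>x p. x \<in> component S p \<longrightarrow> alg.avoids x PP \<longrightarrow>
    for_large (\<lambda>n. \<forall>m\<in>carrier M \<inter> component M n. x \<odot> m = \<zero> \<longrightarrow> m = \<zero>))"
  proof (rule graded_filtration_induct)
    show "\<exists>PP. finite PP \<and> PP \<subseteq> Proj S \<and> (\<forall>x p. x \<in> component S p \<longrightarrow> alg.avoids x PP \<longrightarrow>
      for_large (\<lambda>n. \<forall>m\<in>{\<zero>} \<inter> component M n. x \<odot> m = \<zero> \<longrightarrow> m = \<zero>))"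
    proof (intro exI[of _ "{}"] conjI allI impI)
      show "for_large (\<lambda>n. \<forall>m\<in>{\<zero>} \<inter> component M n. x \<odot> m = \<zero> \<longrightarrow> m = \<zero>)" for x
        by (rule for_largeI) blast
    qed simp_all
    fix N z a assume N: "stable M (carrier S) N" "homogeneous M N" and z: "z \<in> component M a"
      and IH: "\<exists>PP. finite PP \<and> PP \<subseteq> Proj S \<and> (\<forall>x p. x \<in> component S p \<longrightarrow> alg.avoids x PP \<longrightarrow>
        for_large (\<lambda>n. \<forall>m\<in>N \<inter> component M n. x \<odot> m = \<zero> \<longrightarrow> m = \<zero>))"
    have zM: "z \<in> carrier M" using component_closed[OF z] .
    let ?I = "colon S M N z"
    obtain PP1 where 1: "finite PP1" "PP1 \<subseteq> Proj S"
      "\<And>x p. x \<in> component S p \<Longrightarrow> alg.avoids x PP1 \<Longrightarrow>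
        for_large (\<lambda>n. \<forall>m\<in>N \<inter> component M n. x \<odot> m = \<zero> \<longrightarrow> m = \<zero>)" using IH by auto
    obtain PP2 where 2: "finite PP2" "PP2 \<subseteq> Proj S"
      "\<And>x p. x \<in> component S p \<Longrightarrow> alg.avoids x PP2 \<Longrightarrow>
        for_large (\<lambda>n. \<forall>s\<in>component S n. x \<otimes>\<^bsub>S\<^esub> s \<in> ?I \<longrightarrow> s \<in> ?I)"
      using alg.eventually_regular_ideal[OF colon_hideal[OF N z]] by auto
    show "\<exists>PP. finite PP \<and> PP \<subseteq> Proj S \<and> (\<forall>x p. x \<in> component S p \<longrightarrow> alg.avoids x PP \<longrightarrow>
      for_large (\<lambda>n. \<forall>m\<in>adjoin S M N z \<inter> component M n. x \<odot> m = \<zero> \<longrightarrow> m = \<zero>))"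
    proof (intro exI[of _ "PP1 \<union> PP2"] conjI allI impI)
      fix x p assume x: "x \<in> component S p" and av: "alg.avoids x (PP1 \<union> PP2)"
      have xS: "x \<in> carrier S" using SG.component_closed[OF x] .
      have av': "alg.avoids x PP1" "alg.avoids x PP2" using av by (auto simp: alg.avoids_def)
      show "for_large (\<lambda>n. \<forall>m\<in>adjoin S M N z \<inter> component M n. x \<odot> m = \<zero> \<longrightarrow> m = \<zero>)"
        using 1(3)[OF x av'(1)] for_large_minus[OF 2(3)[OF x av'(2)], of a]
      proof (rule for_large_mono2)
        fix n assume n1: "\<forall>m\<in>N \<inter> component M n. x \<odot> m = \<zero> \<longrightarrow> m = \<zero>"
          and n2: "a \<le> n \<and> (\<forall>s\<in>component S (n - a). x \<otimes>\<^bsub>S\<^esub> s \<in> ?I \<longrightarrow> s \<in> ?I)"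
        show "\<forall>m\<in>adjoin S M N z \<inter> component M n. x \<odot> m = \<zero> \<longrightarrow> m = \<zero>"
        proof (intro ballI impI)
          fix m assume m: "m \<in> adjoin S M N z \<inter> component M n" and xm: "x \<odot> m = \<zero>"
          obtain y s where ys: "y \<in> N" "s \<in> component S (n - a)" "m = y \<oplus> s \<odot> z"
            using component_decomp[OF N z m] n2 by auto
          have c: "y \<in> carrier M" "s \<in> carrier S" using ys stableD(1)[OF N(1)] SG.component_closed by auto
          have "\<zero> = x \<odot> y \<oplus> (x \<otimes>\<^bsub>S\<^esub> s) \<odot> z"
            using xm ys c xS zM by (simp add: smult_r_distr smult_assoc1)
          hence "\<zero> \<ominus> x \<odot> y = (x \<otimes>\<^bsub>S\<^esub> s) \<odot> z" using add_diff_cancel[of "x \<odot> y" "(x \<otimes>\<^bsub>S\<^esub> s) \<odot> z" \<zero>] c xS zM by simp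
          moreover have "\<zero> \<ominus> x \<odot> y \<in> N"
            by (rule stableD(7)[OF N(1) stableD(2)[OF N(1)] stableD(5)[OF N(1) xS ys(1)]])
          ultimately have "x \<otimes>\<^bsub>S\<^esub> s \<in> ?I" using c xS by (simp add: colon_def)
          hence "s \<in> ?I" using n2 ys(2) by blast
          hence "m \<in> N" using ys stableD(3)[OF N(1)] by (simp add: colon_def)
          thus "m = \<zero>" using n1 m xm by blast
        qed
      qed
    qed (use 1 2 in auto)
  qed
  thus ?thesis unfolding carrier_Int_component .
qed

end

section \<open>Graded submodules and quotients\<close>

lemma graded_quot_simps [simp]:
  "carrier (graded_quot M N) = coset_rep M N ` carrier M"
  "component (graded_quot M N) n = coset_rep M N ` component M n"
  by (simp_all add: graded_quot_def)

lemma coset_rep_operator_map: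
  assumes M: "module S M" and N: "submodule N S M" and T: "T \<subseteq> carrier S" and V: "stable M T V"
  shows "operator_map S M (graded_quot M N) T (coset_rep M N) V"
  by (intro operator_map.intro operator_map_axioms.intro M module_graded_quot[OF M N] T V)
    (use stableD(1)[OF V] coset_rep_add[OF M N] coset_rep_smult[OF M N] T in auto)

lemma coset_rep_image_stable:
  assumes M: "module S M" and N: "submodule N S M" and T: "T \<subseteq> carrier S" and V: "stable M T V"
  shows "stable (graded_quot M N) T (coset_rep M N ` V)"
  by (rule operator_map.image_stable[OF coset_rep_operator_map[OF assms] V subset_refl])

lemma interval_len_quot:
  assumes M: "module S M" and N: "submodule N S M" and T: "T \<subseteq> carrier S" and V: "stable M T V"
  shows "interval_len (graded_quot M N) T {\<zero>\<^bsub>graded_quot M N\<^esub>} (coset_rep M N ` V) = interval_len M T (N \<inter> V) V"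
proof -
  interpret f: operator_map S M "graded_quot M N" T "coset_rep M N" V
    by (rule coset_rep_operator_map[OF assms])
  have NT: "stable M T N"
    using N T stable_antimono module.submodule_iff_stable[OF M] by blast
  have qV: "stable (graded_quot M N) T (coset_rep M N ` V)" by (rule coset_rep_image_stable[OF assms])
  have "interval_len M T (N \<inter> V) V = interval_len (graded_quot M N) T {\<zero>\<^bsub>graded_quot M N\<^esub>} (coset_rep M N ` V)"
  proof (rule f.interval_len_iso[OF stable_Int[OF NT V] f.M2.stable_zero[OF T] qV])
    show "{\<zero>\<^bsub>graded_quot M N\<^esub>} \<subseteq> coset_rep M N ` V" using stableD(2)[OF qV] by blast
    show "coset_rep M N x \<in> {\<zero>\<^bsub>graded_quot M N\<^esub>} \<longleftrightarrow> x \<in> N \<inter> V" if "x \<in> V" for x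
      using coset_rep_kernel[OF M N stableD(1)[OF V that]] that by blast
    fix y assume y: "y \<in> coset_rep M N ` V"
    have "y = y \<oplus>\<^bsub>graded_quot M N\<^esub> \<zero>\<^bsub>graded_quot M N\<^esub>" using stableD(1)[OF qV y] by simp
    thus "\<exists>x\<in>V. \<exists>u\<in>{\<zero>\<^bsub>graded_quot M N\<^esub>}. y = coset_rep M N x \<oplus>\<^bsub>graded_quot M N\<^esub> u" using y by blast
  qed auto
  thus ?thesis by simp
qed

lemma graded_sub_simps [simp]:
  "carrier (graded_sub M N) = N" "component (graded_sub M N) n = N \<inter> component M n"
  "add (graded_sub M N) = add M" "zero (graded_sub M N) = zero M" "smult (graded_sub M N) = smult M"
  by (simp_all add: graded_sub_def)

lemma module_graded_sub:
  assumes M: "module S M" and N: "submodule N S M"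
  shows "module S (graded_sub M N)"
proof -
  interpret module S M by (rule M)
  have st: "stable M (carrier S) N" using N submodule_iff_stable by blast
  note N' = stableD[OF st]
  show ?thesis
  proof (rule moduleI)
    show "abelian_group (graded_sub M N)"
    proof (rule abelian_groupI)
      fix x assume "x \<in> carrier (graded_sub M N)"
      thus "\<exists>y\<in>carrier (graded_sub M N). y \<oplus>\<^bsub>graded_sub M N\<^esub> x = \<zero>\<^bsub>graded_sub M N\<^esub>"
        using N'(1,4) by (intro bexI[of _ "\<ominus>\<^bsub>M\<^esub> x"]) (auto simp: M.l_neg)
    qed (use N'(1-3) in \<open>auto simp: M.a_ac\<close>)
  qed (use N'(1,5) R.is_cring in \<open>auto simp: smult_l_distr smult_r_distr smult_assoc1\<close>)
qed

lemma graded_sub_inv: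
  assumes M: "module S M" and N: "submodule N S M" and x: "x \<in> N"
  shows "\<ominus>\<^bsub>graded_sub M N\<^esub> x = \<ominus>\<^bsub>M\<^esub> x"
proof -
  interpret module S M by (rule M)
  interpret N: module S "graded_sub M N" by (rule module_graded_sub[OF M N])
  have st: "stable M (carrier S) N" using N submodule_iff_stable by blast
  have "\<ominus>\<^bsub>M\<^esub> x \<oplus>\<^bsub>graded_sub M N\<^esub> x = \<zero>\<^bsub>graded_sub M N\<^esub>" using x stableD(1)[OF st] by (simp add: M.l_neg)
  thus ?thesis using N.M.minus_equality[of "\<ominus>\<^bsub>M\<^esub> x" x] x stableD(4)[OF st] by simp
qed

lemma stable_graded_sub_iff:
  assumes M: "module S M" and N: "submodule N S M" and W: "W \<subseteq> N"
  shows "stable (graded_sub M N) T W \<longleftrightarrow> stable M T W"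
proof -
  have "N \<subseteq> carrier M" using N module.submodule_iff_stable[OF M] stableD(6) by blast
  hence "W \<subseteq> carrier M" using W by blast
  moreover have "(\<forall>x\<in>W. \<ominus>\<^bsub>graded_sub M N\<^esub> x \<in> W) \<longleftrightarrow> (\<forall>x\<in>W. \<ominus>\<^bsub>M\<^esub> x \<in> W)"
    using graded_sub_inv[OF M N subsetD[OF W]] by simp
  ultimately show ?thesis using W unfolding stable_def by simp
qed

lemma interval_len_sub:
  assumes M: "module S M" and N: "submodule N S M" and V: "V \<subseteq> N"
  shows "interval_len (graded_sub M N) T U V = interval_len M T U V"
proof -
  have "{W. stable (graded_sub M N) T W \<and> U \<subseteq> W \<and> W \<subseteq> V} = {W. stable M T W \<and> U \<subseteq> W \<and> W \<subseteq> V}"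
    using stable_graded_sub_iff[OF M N] V by blast
  thus ?thesis by (simp add: interval_len_def)
qed

context std_mod begin

lemma fg_std_modI:
  assumes "module S Q" "graded_group Q"
    "\<And>s m x n. s \<in> component S m \<Longrightarrow> x \<in> component Q n \<Longrightarrow> s \<odot>\<^bsub>Q\<^esub> x \<in> component Q (m + n)"
    "\<exists>F. finite F \<and> F \<subseteq> carrier Q \<and> (\<forall>N. stable Q (carrier S) N \<longrightarrow> F \<subseteq> N \<longrightarrow> N = carrier Q)"
  shows "fg_std_mod A \<mm> S Q"
  by (intro fg_std_mod.intro std_mod.intro graded_mod.intro graded_mod_axioms.intro fg_std_mod_axioms.intro
      AL.artinian_local_ring_axioms SA.standard_graded_algebra_axioms SG.graded_group_axioms)
    (use assms mult_component in auto)

end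

context fg_std_mod begin

text \<open>
  The uniqueness of the decomposition in \<open>M/N\<close> is the homogeneity of \<open>N\<close>: representatives of two
  decompositions differ by an element of \<open>N\<close>, hence so do their components.
\<close>

lemma fg_std_mod_quot:
  assumes N: "stable M (carrier S) N" and hom: "homogeneous M N"
  shows "fg_std_mod A \<mm> S (graded_quot M N)"
proof -
  let ?Q = "graded_quot M N" and ?q = "coset_rep M N"
  have sub: "submodule N S M" using N submodule_iff_stable by blast
  note mod = module_axioms
  interpret Q: module S ?Q by (rule module_graded_quot[OF mod sub])
  interpret f: operator_map S M ?Q "carrier S" ?q "carrier M"
    by (rule coset_rep_operator_map[OF mod sub subset_refl stable_carrier]) simp
  have q_sum: "?q (finsum M g F) = finsum ?Q (\<lambda>n. ?q (g n)) F" if "finite F" "\<And>n. n \<in> F \<Longrightarrow> g n \<in> carrier M"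
    for g :: "nat ^ 'd \<Rightarrow> 'm" and F
    using that
  proof (induction F)
    case empty
    show ?case using f.f_zero by simp
  next
    case (insert n F)
    have "?q (finsum M g (insert n F)) = ?q (g n) \<oplus>\<^bsub>?Q\<^esub> ?q (finsum M g F)"
      using insert f.f_add[of "g n" "finsum M g F"] by (simp add: Pi_def finsum_closed)
    also have "\<dots> = finsum ?Q (\<lambda>n. ?q (g n)) (insert n F)"
      using insert f.f_closed by (subst Q.M.finsum_insert) auto
    finally show ?case .
  qed
  have comp_stable: "stable ?Q {} (component ?Q n)" for n
    unfolding graded_quot_simps
    by (rule coset_rep_image_stable[OF mod sub]) (use stable_antimono[OF component_stable] in auto)
  have "graded_group ?Q"
  proof (rule graded_group.intro[OF Q.M.abelian_group_axioms], rule graded_group_axioms.intro)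
    fix n :: "nat ^ 'd"
    show "additive_subgroup (component ?Q n) ?Q"
    proof (rule additive_subgroupI)
      show "subgroup (component ?Q n) (add_monoid ?Q)"
        by (rule Q.M.add.subgroupI) (use stableD[OF comp_stable[of n]] in \<open>auto simp del: graded_quot_simps\<close>)
    qed
  next
    fix y assume "y \<in> carrier ?Q"
    then obtain x where x: "x \<in> carrier M" "y = ?q x" by auto
    let ?P = "\<lambda>f. (\<forall>n. f n \<in> component ?Q n) \<and> finite {n. f n \<noteq> \<zero>\<^bsub>?Q\<^esub>} \<and> y = finsum ?Q f {n. f n \<noteq> \<zero>\<^bsub>?Q\<^esub>}"
    let ?f = "\<lambda>n. ?q (hcomp M x n)"
    let ?F = "{n. hcomp M x n \<noteq> \<zero>}"
    have sub': "{n. ?f n \<noteq> \<zero>\<^bsub>?Q\<^esub>} \<subseteq> ?F" using f.f_zero by auto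
    show "\<exists>!f. ?P f"
    proof (rule ex1I[of _ ?f])
      have fin: "finite ?F" by (rule hcomp_spec(2)[OF x(1)])
      have "y = finsum ?Q ?f ?F" using x(2) q_sum[OF fin, of "hcomp M x"] hcomp_spec(3)[OF x(1)] x(1) by simp
      also have "\<dots> = finsum ?Q ?f {n. ?f n \<noteq> \<zero>\<^bsub>?Q\<^esub>}"
        by (rule Q.M.add.finprod_mono_neutral_cong_right) (use fin sub' f.f_closed x(1) in auto)
      finally show "?P ?f" using finite_subset[OF sub' fin] hcomp_spec(1)[OF x(1)] by auto
      fix f assume f: "?P f"
      let ?G = "{n. f n \<noteq> \<zero>\<^bsub>?Q\<^esub>}"
      have "\<exists>m\<in>component M n. f n = ?q m" for n using f by auto
      then obtain g where g: "\<And>n. g n \<in> component M n" "\<And>n. f n = ?q (g n)" by metis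
      let ?x = "finsum M g ?G"
      have gM: "\<And>n. g n \<in> carrier M" using g(1) component_closed by blast
      have xM: "?x \<in> carrier M" using gM by (simp add: finsum_closed)
      have "?q ?x = finsum ?Q (\<lambda>n. ?q (g n)) ?G" by (rule q_sum) (use f gM in auto)
      also have "(\<lambda>n. ?q (g n)) = f" by (rule ext) (rule g(2)[symmetric])
      finally have "?q ?x = finsum ?Q f ?G" .
      hence "?q ?x = ?q x" using f x(2) by simp
      hence d: "?x \<ominus> x \<in> N" using coset_rep_eq_iff[OF mod sub xM x(1)] by simp
      show "f = ?f"
      proof
        fix n
        have "hcomp M (?x \<ominus> x) n \<in> N" by (rule homogeneousD[OF hom d])
        hence dn: "hcomp M ?x n \<ominus> hcomp M x n \<in> N" using xM x(1) by (simp add: a_minus_def hcomp_add hcomp_minus)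
        have "hcomp M ?x n = (if n \<in> ?G then g n else \<zero>)"
          by (rule hcomp_eqI) (use f g(1) in auto)
        hence "f n = ?q (hcomp M ?x n)" using g(2) f.f_zero by auto
        also have "\<dots> = ?f n" using coset_rep_eq_iff[OF mod sub] dn xM x(1) by simp
        finally show "f n = ?f n" .
      qed
    qed
  qed
  moreover have "s \<odot>\<^bsub>?Q\<^esub> y \<in> component ?Q (m + n)" if "s \<in> component S m" "y \<in> component ?Q n" for s m y n
  proof -
    obtain x where x: "x \<in> component M n" "y = ?q x" using \<open>y \<in> component ?Q n\<close> by auto
    have "s \<odot>\<^bsub>?Q\<^esub> y = ?q (s \<odot> x)"
      using f.f_smult[of s x] SG.component_closed[OF that(1)] component_closed[OF x(1)] x(2) by simp
    thus ?thesis using smult_component[OF that(1) x(1)] by simp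
  qed
  moreover have "\<exists>F. finite F \<and> F \<subseteq> carrier ?Q \<and> (\<forall>N'. stable ?Q (carrier S) N' \<longrightarrow> F \<subseteq> N' \<longrightarrow> N' = carrier ?Q)"
  proof -
    obtain F where F: "finite F" "F \<subseteq> carrier M" "\<forall>N. stable M (carrier S) N \<longrightarrow> F \<subseteq> N \<longrightarrow> N = carrier M"
      using fg by blast
    show ?thesis
    proof (intro exI[of _ "?q ` F"] conjI allI impI)
      fix N' assume N': "stable ?Q (carrier S) N'" "?q ` F \<subseteq> N'"
      note st = stableD[OF N'(1)]
      have "stable M (carrier S) {x \<in> carrier M. ?q x \<in> N'}" by (rule f.vimage_stable[OF N'(1)])
      moreover have "F \<subseteq> {x \<in> carrier M. ?q x \<in> N'}" using F(2) N'(2) by blast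
      ultimately have "{x \<in> carrier M. ?q x \<in> N'} = carrier M" using F(3) by blast
      hence "carrier ?Q \<subseteq> N'" by auto
      thus "N' = carrier ?Q" using st(6) by blast
    qed (use F in auto)
  qed
  ultimately show ?thesis by (intro fg_std_modI Q.module_axioms)
qed

lemma fg_std_mod_sub:
  assumes N: "stable M (carrier S) N" and hom: "homogeneous M N"
  shows "fg_std_mod A \<mm> S (graded_sub M N)"
proof -
  let ?Q = "graded_sub M N"
  have sub: "submodule N S M" using N submodule_iff_stable by blast
  note mod = module_axioms and N' = stableD[OF N]
  interpret Q: module S ?Q by (rule module_graded_sub[OF mod sub])
  have sum: "finsum ?Q g F = finsum M g F" if "finite F" "\<And>n. n \<in> F \<Longrightarrow> g n \<in> N" for g :: "nat ^ 'd \<Rightarrow> 'm" and F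
    using that
  proof (induction F)
    case (insert n F)
    have "finsum ?Q g (insert n F) = g n \<oplus>\<^bsub>?Q\<^esub> finsum ?Q g F"
      by (rule Q.M.finsum_insert) (use insert in auto)
    also have "\<dots> = g n \<oplus> finsum M g F" using insert by simp
    also have "\<dots> = finsum M g (insert n F)" by (rule finsum_insert[symmetric]) (use insert N'(1) in auto)
    finally show ?case .
  qed simp
  note inv = graded_sub_inv[OF mod sub]
  have "graded_group ?Q"
  proof (rule graded_group.intro[OF Q.M.abelian_group_axioms], rule graded_group_axioms.intro)
    fix n :: "nat ^ 'd"
    show "additive_subgroup (component ?Q n) ?Q"
    proof (rule additive_subgroupI)
      show "subgroup (component ?Q n) (add_monoid ?Q)"
      proof (rule Q.M.add.subgroupI)
        have "\<zero> \<in> component ?Q n" using N'(2) component_props(2) by simp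
        thus "component ?Q n \<noteq> {}" by blast
        show "\<ominus>\<^bsub>?Q\<^esub> x \<in> component ?Q n" if "x \<in> component ?Q n" for x
          using that inv N'(4) component_props(4) by simp
        show "x \<oplus>\<^bsub>?Q\<^esub> y \<in> component ?Q n" if "x \<in> component ?Q n" "y \<in> component ?Q n" for x y
          using that N'(3) component_props(3) by simp
      qed auto
    qed
  next
    fix x assume "x \<in> carrier ?Q"
    hence x: "x \<in> N" by simp
    have xM: "x \<in> carrier M" using N'(1)[OF x] .
    have hN: "hcomp M x n \<in> N" for n using homogeneousD[OF hom x] .
    show "\<exists>!f. (\<forall>n. f n \<in> component ?Q n) \<and> finite {n. f n \<noteq> \<zero>\<^bsub>?Q\<^esub>} \<and> x = finsum ?Q f {n. f n \<noteq> \<zero>\<^bsub>?Q\<^esub>}"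
    proof (rule ex1I[of _ "hcomp M x"])
      show "(\<forall>n. hcomp M x n \<in> component ?Q n) \<and> finite {n. hcomp M x n \<noteq> \<zero>\<^bsub>?Q\<^esub>} \<and>
          x = finsum ?Q (hcomp M x) {n. hcomp M x n \<noteq> \<zero>\<^bsub>?Q\<^esub>}"
        using hcomp_spec[OF xM] hN sum[of "{n. hcomp M x n \<noteq> \<zero>}" "hcomp M x"] by simp
      fix f assume f: "(\<forall>n. f n \<in> component ?Q n) \<and> finite {n. f n \<noteq> \<zero>\<^bsub>?Q\<^esub>} \<and> x = finsum ?Q f {n. f n \<noteq> \<zero>\<^bsub>?Q\<^esub>}"
      hence "finsum ?Q f {n. f n \<noteq> \<zero>} = finsum M f {n. f n \<noteq> \<zero>}" by (intro sum) auto
      hence "(\<forall>n. f n \<in> component M n) \<and> finite {n. f n \<noteq> \<zero>} \<and> x = finsum M f {n. f n \<noteq> \<zero>}" using f by simp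
      thus "f = hcomp M x" unfolding hcomp_def by (intro the1_equality[symmetric] decomposition[OF xM])
    qed
  qed
  moreover have "s \<odot>\<^bsub>?Q\<^esub> y \<in> component ?Q (m + n)" if "s \<in> component S m" "y \<in> component ?Q n" for s m y n
    using that smult_component N'(5) SG.component_closed by auto
  moreover have "\<exists>F. finite F \<and> F \<subseteq> carrier ?Q \<and> (\<forall>N'. stable ?Q (carrier S) N' \<longrightarrow> F \<subseteq> N' \<longrightarrow> N' = carrier ?Q)"
  proof -
    obtain F where F: "finite F" "F \<subseteq> N" "\<And>N'. stable M (carrier S) N' \<Longrightarrow> F \<subseteq> N' \<Longrightarrow> N \<subseteq> N'"
      using finitely_generated_of_acc[OF acc_submodules N] by blast
    show ?thesis
    proof (intro exI[of _ F] conjI allI impI)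
      fix W assume W: "stable ?Q (carrier S) W" "F \<subseteq> W"
      note W' = stableD[OF W(1)]
      have WN: "W \<subseteq> N" using W'(6) by simp
      have "stable M (carrier S) W" using W(1) stable_graded_sub_iff[OF mod sub WN] by blast
      hence "N \<subseteq> W" using F(3) W(2) by blast
      thus "W = carrier ?Q" using WN by auto
    qed (use F in auto)
  qed
  ultimately show ?thesis by (intro fg_std_modI Q.module_axioms)
qed

end

section \<open>The exact sequence of multiplication by a homogeneous element\<close>

lemma (in module) seq_submodule_single:
  assumes "x \<in> carrier R" shows "seq_submodule M [x] = (\<lambda>m. x \<odot>\<^bsub>M\<^esub> m) ` carrier M"
proof -
  have eq: "{..<length [x]} = {0}" by auto
  have sum: "finsum M (\<lambda>i. ([x] ! i) \<odot>\<^bsub>M\<^esub> m i) {..<length [x]} = x \<odot>\<^bsub>M\<^esub> m 0" if "m 0 \<in> carrier M" for m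
    unfolding eq using that assms by simp
  show ?thesis
  proof (intro equalityI subsetI)
    fix y assume "y \<in> seq_submodule M [x]"
    then obtain m where m: "y = finsum M (\<lambda>i. ([x] ! i) \<odot>\<^bsub>M\<^esub> m i) {..<length [x]}"
      "\<forall>i<length [x]. m i \<in> carrier M" unfolding seq_submodule_def by blast
    have m0: "m 0 \<in> carrier M" using m(2) by simp
    show "y \<in> (\<lambda>m. x \<odot>\<^bsub>M\<^esub> m) ` carrier M" unfolding m(1) sum[of m, OF m0] using m0 by (rule imageI)
  next
    fix y assume "y \<in> (\<lambda>m. x \<odot>\<^bsub>M\<^esub> m) ` carrier M"
    then obtain m where m: "m \<in> carrier M" "y = x \<odot>\<^bsub>M\<^esub> m" by blast
    have "y = finsum M (\<lambda>i. ([x] ! i) \<odot>\<^bsub>M\<^esub> m) {..<length [x]}" using sum[of "\<lambda>_. m"] m by (simp only:)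
    thus "y \<in> seq_submodule M [x]" unfolding seq_submodule_def
      by (intro CollectI exI[of _ "\<lambda>_. m"]) (use m in simp)
  qed
qed

lemma (in module) seq_submodule_stable:
  assumes ys: "set ys \<subseteq> carrier R" shows "stable M (carrier R) (seq_submodule M ys)"
proof -
  let ?I = "{..<length ys}"
  have y: "ys ! i \<in> carrier R" if "i \<in> ?I" for i using that ys by auto
  have sm: "t \<odot>\<^bsub>M\<^esub> x \<in> seq_submodule M ys" if t: "t \<in> carrier R" and x: "x \<in> seq_submodule M ys" for t x
  proof -
    obtain m where m: "x = finsum M (\<lambda>i. (ys ! i) \<odot>\<^bsub>M\<^esub> m i) ?I" "\<forall>i<length ys. m i \<in> carrier M"
      using x unfolding seq_submodule_def by blast
    have "t \<odot>\<^bsub>M\<^esub> x = finsum M (\<lambda>i. t \<odot>\<^bsub>M\<^esub> ((ys ! i) \<odot>\<^bsub>M\<^esub> m i)) ?I"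
      unfolding m(1) by (rule finsum_smult_ldistr) (use t y m in auto)
    also have "\<dots> = finsum M (\<lambda>i. (ys ! i) \<odot>\<^bsub>M\<^esub> (t \<odot>\<^bsub>M\<^esub> m i)) ?I"
      by (rule M.finsum_cong') (use t y m in \<open>auto simp: smult_assoc1[symmetric] R.m_comm\<close>)
    finally show ?thesis unfolding seq_submodule_def using t m(2)
      by (intro CollectI exI[of _ "\<lambda>i. t \<odot>\<^bsub>M\<^esub> m i"]) auto
  qed
  show ?thesis
  proof (rule stableI)
    show sub: "seq_submodule M ys \<subseteq> carrier M"
      unfolding seq_submodule_def using y by (auto intro!: M.finsum_closed)
    have "finsum M (\<lambda>i. (ys ! i) \<odot>\<^bsub>M\<^esub> \<zero>\<^bsub>M\<^esub>) ?I = finsum M (\<lambda>i. \<zero>\<^bsub>M\<^esub>) ?I"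
      by (rule M.finsum_cong') (use y in auto)
    hence "\<zero>\<^bsub>M\<^esub> = finsum M (\<lambda>i. (ys ! i) \<odot>\<^bsub>M\<^esub> \<zero>\<^bsub>M\<^esub>) ?I" by simp
    thus "\<zero>\<^bsub>M\<^esub> \<in> seq_submodule M ys" unfolding seq_submodule_def
      by (intro CollectI exI[of _ "\<lambda>_. \<zero>\<^bsub>M\<^esub>"]) auto
    show "t \<odot>\<^bsub>M\<^esub> x \<in> seq_submodule M ys" if "t \<in> carrier R" "x \<in> seq_submodule M ys" for t x by (rule sm[OF that])
    fix x assume x: "x \<in> seq_submodule M ys"
    have "\<ominus>\<^bsub>M\<^esub> x = (\<ominus> \<one>) \<odot>\<^bsub>M\<^esub> x" using x sub by (auto simp: smult_l_minus)
    thus "\<ominus>\<^bsub>M\<^esub> x \<in> seq_submodule M ys" using sm[of "\<ominus> \<one>" x] x by simp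
    fix x' assume x': "x' \<in> seq_submodule M ys"
    obtain m where m: "x = finsum M (\<lambda>i. (ys ! i) \<odot>\<^bsub>M\<^esub> m i) ?I" "\<forall>i<length ys. m i \<in> carrier M"
      using x unfolding seq_submodule_def by blast
    obtain m' where m': "x' = finsum M (\<lambda>i. (ys ! i) \<odot>\<^bsub>M\<^esub> m' i) ?I" "\<forall>i<length ys. m' i \<in> carrier M"
      using x' unfolding seq_submodule_def by blast
    have "x \<oplus>\<^bsub>M\<^esub> x' = finsum M (\<lambda>i. (ys ! i) \<odot>\<^bsub>M\<^esub> m i \<oplus>\<^bsub>M\<^esub> (ys ! i) \<odot>\<^bsub>M\<^esub> m' i) ?I"
      unfolding m(1) m'(1) by (rule M.finsum_addf[symmetric]) (use y m m' in auto)
    also have "\<dots> = finsum M (\<lambda>i. (ys ! i) \<odot>\<^bsub>M\<^esub> (m i \<oplus>\<^bsub>M\<^esub> m' i)) ?I"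
      by (rule M.finsum_cong') (use y m m' in \<open>auto simp: smult_r_distr\<close>)
    finally show "x \<oplus>\<^bsub>M\<^esub> x' \<in> seq_submodule M ys" unfolding seq_submodule_def using m(2) m'(2)
      by (intro CollectI exI[of _ "\<lambda>i. m i \<oplus>\<^bsub>M\<^esub> m' i"]) auto
  qed
qed

lemma (in module) seq_submodule_mem:
  assumes ys: "set ys \<subseteq> carrier R" "x \<in> set ys" and m: "m \<in> carrier M"
  shows "x \<odot>\<^bsub>M\<^esub> m \<in> seq_submodule M ys"
proof -
  obtain j where j: "j < length ys" "ys ! j = x" using ys(2) by (auto simp: in_set_conv_nth)
  let ?m = "\<lambda>i. if i = j then m else \<zero>\<^bsub>M\<^esub>"
  have y: "ys ! i \<in> carrier R" if "i < length ys" for i using that ys by auto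
  have "finsum M (\<lambda>i. (ys ! i) \<odot>\<^bsub>M\<^esub> ?m i) {..<length ys} =
      finsum M (\<lambda>i. if j = i then (ys ! i) \<odot>\<^bsub>M\<^esub> m else \<zero>\<^bsub>M\<^esub>) {..<length ys}"
    by (rule M.finsum_cong') (use y m in auto)
  also have "\<dots> = x \<odot>\<^bsub>M\<^esub> m" using M.finsum_singleton[of j "{..<length ys}" "\<lambda>i. (ys ! i) \<odot>\<^bsub>M\<^esub> m"] j y m by auto
  finally have "x \<odot>\<^bsub>M\<^esub> m = finsum M (\<lambda>i. (ys ! i) \<odot>\<^bsub>M\<^esub> ?m i) {..<length ys}" by simp
  thus ?thesis unfolding seq_submodule_def using m by (intro CollectI exI[of _ ?m]) auto
qed

context fg_std_mod begin

definition kernel_of :: "'s \<Rightarrow> 'm set" where "kernel_of x = {m \<in> carrier M. x \<odot> m = \<zero>}"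

lemma zero_colon_eq: "zero_colon M x = graded_sub M (kernel_of x)"
  by (simp add: zero_colon_def kernel_of_def)

lemma kernel_of_stable:
  assumes "x \<in> carrier S" shows "stable M (carrier S) (kernel_of x)"
  using operator_map.vimage_stable[OF smult_operator_map[OF assms subset_refl stable_carrier] stable_zero]
  by (simp add: kernel_of_def)

lemma kernel_of_homogeneous:
  assumes x: "x \<in> component S p" shows "homogeneous M (kernel_of x)"
  unfolding homogeneous_def
proof (intro ballI allI)
  fix m n assume m: "m \<in> kernel_of x"
  hence mM: "m \<in> carrier M" by (simp add: kernel_of_def)
  have "hcomp M (x \<odot> m) (n + p) = x \<odot> hcomp M m n"
    using hcomp_smult[OF x mM, of "n + p"] vec_le_add2[of p n] by simp
  thus "hcomp M m n \<in> kernel_of x" using m mM by (simp add: kernel_of_def)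
qed

lemma image_homogeneous:
  assumes x: "x \<in> component S p" shows "homogeneous M (seq_submodule M [x])"
proof -
  have xS: "x \<in> carrier S" using SG.component_closed[OF x] .
  have "hcomp M (x \<odot> m) n \<in> (\<lambda>m. x \<odot> m) ` carrier M" if m: "m \<in> carrier M" for m n
  proof (cases "p \<le> n")
    case True
    thus ?thesis using hcomp_smult[OF x m, of n] m by simp
  next
    case False
    have "\<zero> = x \<odot> \<zero>" using xS by simp
    thus ?thesis using hcomp_smult[OF x m, of n] False by auto
  qed
  thus ?thesis unfolding homogeneous_def seq_submodule_single[OF xS] by blast
qed

lemma fg_quot: "x \<in> component S p \<Longrightarrow> fg_std_mod A \<mm> S (graded_quot M (seq_submodule M [x]))"
  by (rule fg_std_mod_quot[OF seq_submodule_stable image_homogeneous]) (auto dest: SG.component_closed)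

lemma fg_zero_colon: "x \<in> component S p \<Longrightarrow> fg_std_mod A \<mm> S (zero_colon M x)"
  unfolding zero_colon_eq
  by (rule fg_std_mod_sub[OF kernel_of_stable kernel_of_homogeneous]) (auto dest: SG.component_closed)

lemma component_length_quot:
  assumes x: "x \<in> component S p"
  shows "component_length A S (graded_quot M (seq_submodule M [x])) n =
    int (the_enat (interval_len M A1 (seq_submodule M [x] \<inter> component M n) (component M n)))"
proof -
  interpret Q: fg_std_mod A \<mm> S "graded_quot M (seq_submodule M [x])" by (rule fg_quot[OF x])
  have N: "submodule (seq_submodule M [x]) S M"
    using seq_submodule_stable[of "[x]"] submodule_iff_stable SG.component_closed[OF x] by simp
  show ?thesis unfolding Q.component_length_eq Q.clen_def graded_quot_simps
    by (subst interval_len_quot[OF module_axioms N scalars_subset component_stable]) simp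
qed

lemma component_length_zero_colon:
  assumes x: "x \<in> component S p"
  shows "component_length A S (zero_colon M x) n =
    int (the_enat (interval_len M A1 {\<zero>} (kernel_of x \<inter> component M n)))"
proof -
  interpret K: fg_std_mod A \<mm> S "zero_colon M x" by (rule fg_zero_colon[OF x])
  have st: "stable M (carrier S) (kernel_of x)" using kernel_of_stable SG.component_closed[OF x] by blast
  hence N: "submodule (kernel_of x) S M" using submodule_iff_stable by blast
  have "K.clen n = interval_len (graded_sub M (kernel_of x)) A1 {\<zero>} (kernel_of x \<inter> component M n)"
    unfolding K.clen_def by (simp add: zero_colon_eq)
  also have "\<dots> = interval_len M A1 {\<zero>} (kernel_of x \<inter> component M n)"
    by (rule interval_len_sub[OF module_axioms N]) blast
  finally show ?thesis unfolding K.component_length_eq by simp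
qed

text \<open>
  Multiplication by \<open>x\<close> identifies \<open>M\<^sub>n/(0 : x)\<^sub>n\<close> with \<open>(xM)\<^sub>n\<^sub>+\<^sub>p\<close>.
\<close>

lemma component_length_exact:
  assumes x: "x \<in> component S p"
  shows "component_length A S M (n + p) - component_length A S M n =
    component_length A S (graded_quot M (seq_submodule M [x])) (n + p) - component_length A S (zero_colon M x) n"
proof -
  have xS: "x \<in> carrier S" using SG.component_closed[OF x] .
  let ?N = "seq_submodule M [x]" let ?K = "kernel_of x"
  note N_eq = seq_submodule_single[OF xS]
  have Nst: "stable M (carrier S) ?N" using seq_submodule_stable[of "[x]"] xS by simp
  have Kst: "stable M (carrier S) ?K" by (rule kernel_of_stable[OF xS])
  have st: "stable M A1 (?N \<inter> component M m)" "stable M A1 (?K \<inter> component M m)" "stable M A1 {\<zero>}" for m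
    using stable_Int[OF stable_A1[OF Nst] component_stable] stable_Int[OF stable_A1[OF Kst] component_stable]
      stable_zero[OF scalars_subset] by auto
  interpret f: operator_map S M M A1 "\<lambda>m. x \<odot> m" "component M n"
    by (rule smult_operator_map[OF xS scalars_subset component_stable])
  have iso: "interval_len M A1 (?K \<inter> component M n) (component M n) = interval_len M A1 {\<zero>} (?N \<inter> component M (n + p))"
  proof (rule f.interval_len_iso[OF st(2,3,1)])
    show "{\<zero>} \<subseteq> ?N \<inter> component M (n + p)" using stableD(2)[OF st(1)] by blast
    fix m assume m: "m \<in> component M n"
    have mM: "m \<in> carrier M" using component_closed[OF m] .
    show "x \<odot> m \<in> ?N \<inter> component M (n + p)" unfolding N_eq
      using smult_component[OF x m] mM by (simp add: add.commute)
    show "x \<odot> m \<in> {\<zero>} \<longleftrightarrow> m \<in> ?K \<inter> component M n" using m mM by (simp add: kernel_of_def)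
  next
    fix y assume y: "y \<in> ?N \<inter> component M (n + p)"
    then obtain m where m: "m \<in> carrier M" "y = x \<odot> m" unfolding N_eq by blast
    have "y = hcomp M y (n + p)" using y hcomp_component[of y "n + p" "n + p"] by simp
    also have "\<dots> = x \<odot> hcomp M m n" using hcomp_smult[OF x m(1), of "n + p"] vec_le_add2[of p n] m(2) by simp
    finally have "y = x \<odot> hcomp M m n \<oplus> \<zero>" using m(1) xS by simp
    thus "\<exists>m\<in>component M n. \<exists>u\<in>{\<zero>}. y = x \<odot> m \<oplus> u" using hcomp_spec(1)[OF m(1)] by blast
  qed auto
  have 1: "clen (n + p) = interval_len M A1 {\<zero>} (?N \<inter> component M (n + p)) +
      interval_len M A1 (?N \<inter> component M (n + p)) (component M (n + p))"
    unfolding clen_def by (rule interval_len_add[OF scalars_subset st(3) st(1) component_stable])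
      (use stableD(2)[OF st(1)] in auto)
  have 2: "clen n = interval_len M A1 {\<zero>} (?K \<inter> component M n) + interval_len M A1 (?K \<inter> component M n) (component M n)"
    unfolding clen_def by (rule interval_len_add[OF scalars_subset st(3) st(2) component_stable])
      (use stableD(2)[OF st(2)] in auto)
  have "interval_len M A1 {\<zero>} (?N \<inter> component M (n + p)) < \<infinity>"
    "interval_len M A1 (?N \<inter> component M (n + p)) (component M (n + p)) < \<infinity>"
    "interval_len M A1 {\<zero>} (?K \<inter> component M n) < \<infinity>"
    using clen_finite[of "n + p"] clen_finite[of n] unfolding 1 2 by (auto simp: plus_eq_infty_iff_enat)
  thus ?thesis
    unfolding component_length_quot[OF x] component_length_zero_colon[OF x] component_length_eq 1 2 iso
    by (auto simp: alg.the_enat_add)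
qed

text \<open>
  The submodule \<open>0 : x\<close> enters in degree \<open>n - e\<^sub>i\<close>.  Rewriting its contribution in degree \<open>n\<close> produces
  the correction by the coefficient at \<open>h + e\<^sub>i\<close>.
\<close>

lemma hilbert_coeff_exact:
  assumes x: "x \<in> component S (axis i 1)"
  shows "hilbert_coeff A S M (h + axis i 1) =
    hilbert_coeff A S (graded_quot M (seq_submodule M [x])) h - hilbert_coeff A S (zero_colon M x) h +
    hilbert_coeff A S (zero_colon M x) (h + axis i 1)"
proof -
  let ?e = "axis i 1 :: nat ^ 'd" and ?Q = "graded_quot M (seq_submodule M [x])" and ?K = "zero_colon M x"
  interpret Q: fg_std_mod A \<mm> S ?Q by (rule fg_quot[OF x])
  interpret K: fg_std_mod A \<mm> S ?K by (rule fg_zero_colon[OF x])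
  let ?r = "component_length A S ?K" and ?q = "component_length A S ?Q" and ?f = "component_length A S M"
  note rP = represents_step[OF represents_hilbert_coeff, of i]
  note rQ = Q.represents_hilbert_coeff and rK = K.represents_hilbert_coeff
  have "represents (\<lambda>h. hilbert_coeff A S ?Q h - hilbert_coeff A S ?K h + shift_coeff ?e (hilbert_coeff A S ?K) h)
      (\<lambda>n. ?q n - ?r n + (?r n - ?r (n - ?e)))"
    by (rule represents_add[OF represents_diff[OF rQ rK] represents_step[OF rK]])
  note rep = this
  have "for_large (\<lambda>n. ?f n - ?f (n - ?e) = ?q n - ?r n + (?r n - ?r (n - ?e)))"
  proof (rule for_large_mono[OF for_large_ge[of ?e]])
    fix n assume "?e \<le> n"
    thus "?f n - ?f (n - ?e) = ?q n - ?r n + (?r n - ?r (n - ?e))"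
      using component_length_exact[OF x, of "n - ?e"] vec_diff_add[of ?e n] by simp
  qed
  from fun_cong[OF represents_unique[OF rP rep this], of h] show ?thesis by simp
qed

end

section \<open>The support of a quotient\<close>

text \<open>
  If every element is annihilated by some scalar outside \<open>P\<close>, all fractions are equivalent.
  Otherwise \<open>m/1\<close> is not equivalent to \<open>0/1\<close> for a suitable \<open>m\<close>.
\<close>

lemma localization_nonzero_iff:
  assumes M: "module S M" and P: "primeideal P S"
  shows "carrier (localization S M P) \<noteq> {\<zero>\<^bsub>localization S M P\<^esub>} \<longleftrightarrow>
    (\<exists>m\<in>carrier M. \<forall>u\<in>carrier S - P. u \<odot>\<^bsub>M\<^esub> m \<noteq> \<zero>\<^bsub>M\<^esub>)"
proof -
  interpret module S M by (rule M)
  interpret P: primeideal P S by (rule P)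
  let ?r = "localization_rel S M P" let ?D = "carrier M \<times> (carrier S - P)"
  have carr: "carrier (localization S M P) = ?D // ?r" and zero: "\<zero>\<^bsub>localization S M P\<^esub> = ?r `` {(\<zero>\<^bsub>M\<^esub>, \<one>\<^bsub>S\<^esub>)}"
    by (simp_all add: localization_def Let_def)
  have one: "\<one>\<^bsub>S\<^esub> \<in> carrier S - P" using P.one_imp_carrier P.I_notcarr by auto
  have prod: "u \<otimes>\<^bsub>S\<^esub> v \<in> carrier S - P" if "u \<in> carrier S - P" "v \<in> carrier S - P" for u v
    using that P.I_prime by blast
  show ?thesis
  proof
    assume ne: "carrier (localization S M P) \<noteq> {\<zero>\<^bsub>localization S M P\<^esub>}"
    show "\<exists>m\<in>carrier M. \<forall>u\<in>carrier S - P. u \<odot>\<^bsub>M\<^esub> m \<noteq> \<zero>\<^bsub>M\<^esub>"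
    proof (rule ccontr)
      assume "\<not> ?thesis"
      hence kill: "\<And>m. m \<in> carrier M \<Longrightarrow> \<exists>u\<in>carrier S - P. u \<odot>\<^bsub>M\<^esub> m = \<zero>\<^bsub>M\<^esub>" by blast
      have cls: "?r `` {(m, s)} = ?D" if ms: "m \<in> carrier M" "s \<in> carrier S - P" for m s
      proof
        show "?r `` {(m, s)} \<subseteq> ?D" unfolding localization_rel_def by auto
        show "?D \<subseteq> ?r `` {(m, s)}"
        proof
          fix z assume "z \<in> ?D"
          then obtain m' s' where z: "z = (m', s')" "m' \<in> carrier M" "s' \<in> carrier S - P" by auto
          obtain u where u: "u \<in> carrier S - P" "u \<odot>\<^bsub>M\<^esub> m = \<zero>\<^bsub>M\<^esub>" using kill[OF ms(1)] by blast
          obtain v where v: "v \<in> carrier S - P" "v \<odot>\<^bsub>M\<^esub> m' = \<zero>\<^bsub>M\<^esub>" using kill[OF z(2)] by blast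
          have c: "u \<in> carrier S" "v \<in> carrier S" "s \<in> carrier S" "s' \<in> carrier S" using u v ms z by auto
          have "(u \<otimes>\<^bsub>S\<^esub> v) \<odot>\<^bsub>M\<^esub> (s' \<odot>\<^bsub>M\<^esub> m) = (v \<otimes>\<^bsub>S\<^esub> s') \<odot>\<^bsub>M\<^esub> (u \<odot>\<^bsub>M\<^esub> m)"
            using c ms by (simp add: smult_assoc1[symmetric] R.m_ac)
          hence 1: "(u \<otimes>\<^bsub>S\<^esub> v) \<odot>\<^bsub>M\<^esub> (s' \<odot>\<^bsub>M\<^esub> m) = \<zero>\<^bsub>M\<^esub>" using u c by simp
          have "(u \<otimes>\<^bsub>S\<^esub> v) \<odot>\<^bsub>M\<^esub> (s \<odot>\<^bsub>M\<^esub> m') = (u \<otimes>\<^bsub>S\<^esub> s) \<odot>\<^bsub>M\<^esub> (v \<odot>\<^bsub>M\<^esub> m')"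
            using c z by (simp add: smult_assoc1[symmetric] R.m_ac)
          hence 2: "(u \<otimes>\<^bsub>S\<^esub> v) \<odot>\<^bsub>M\<^esub> (s \<odot>\<^bsub>M\<^esub> m') = \<zero>\<^bsub>M\<^esub>" using v c by simp
          show "z \<in> ?r `` {(m, s)}" unfolding localization_rel_def z(1)
            using ms z(2,3) prod[OF u(1) v(1)] 1 2 by (auto intro!: bexI[of _ "u \<otimes>\<^bsub>S\<^esub> v"])
        qed
      qed
      have "?D // ?r = {?D}"
      proof
        show "?D // ?r \<subseteq> {?D}" unfolding quotient_def using cls by auto
        have "?r `` {(\<zero>\<^bsub>M\<^esub>, \<one>\<^bsub>S\<^esub>)} \<in> ?D // ?r" by (rule quotientI) (use one in auto)
        thus "{?D} \<subseteq> ?D // ?r" using cls[of "\<zero>\<^bsub>M\<^esub>" "\<one>\<^bsub>S\<^esub>"] one by simp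
      qed
      thus False using ne cls[of "\<zero>\<^bsub>M\<^esub>" "\<one>\<^bsub>S\<^esub>"] one unfolding carr zero by simp
    qed
  next
    assume "\<exists>m\<in>carrier M. \<forall>u\<in>carrier S - P. u \<odot>\<^bsub>M\<^esub> m \<noteq> \<zero>\<^bsub>M\<^esub>"
    then obtain m where m: "m \<in> carrier M" "\<forall>u\<in>carrier S - P. u \<odot>\<^bsub>M\<^esub> m \<noteq> \<zero>\<^bsub>M\<^esub>" by blast
    show "carrier (localization S M P) \<noteq> {\<zero>\<^bsub>localization S M P\<^esub>}"
    proof
      assume eq: "carrier (localization S M P) = {\<zero>\<^bsub>localization S M P\<^esub>}"
      have "?r `` {(m, \<one>\<^bsub>S\<^esub>)} \<in> ?D // ?r" by (rule quotientI) (use m one in auto)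
      hence "?r `` {(m, \<one>\<^bsub>S\<^esub>)} = ?r `` {(\<zero>\<^bsub>M\<^esub>, \<one>\<^bsub>S\<^esub>)}" using eq unfolding carr zero by simp
      moreover have "(\<zero>\<^bsub>M\<^esub>, \<one>\<^bsub>S\<^esub>) \<in> ?r `` {(\<zero>\<^bsub>M\<^esub>, \<one>\<^bsub>S\<^esub>)}"
        unfolding localization_rel_def using one by auto
      ultimately have "((m, \<one>\<^bsub>S\<^esub>), (\<zero>\<^bsub>M\<^esub>, \<one>\<^bsub>S\<^esub>)) \<in> ?r" by blast
      then obtain u where "u \<in> carrier S - P" "u \<odot>\<^bsub>M\<^esub> (\<one>\<^bsub>S\<^esub> \<odot>\<^bsub>M\<^esub> m) = u \<odot>\<^bsub>M\<^esub> (\<one>\<^bsub>S\<^esub> \<odot>\<^bsub>M\<^esub> \<zero>\<^bsub>M\<^esub>)"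
        unfolding localization_rel_def by auto
      thus False using m by auto
    qed
  qed
qed

text \<open>
  Linear combinations of the \<open>zs\<close> with coefficients in \<open>K\<close>.  The recursion eliminates one generator
  at a time in Nakayama's lemma.
\<close>

primrec lin :: "('s, 'm, 'y) module_scheme \<Rightarrow> 's set \<Rightarrow> 'm list \<Rightarrow> 'm set" where
  "lin M K [] = {\<zero>\<^bsub>M\<^esub>}"
| "lin M K (z # zs) = (\<lambda>p. p \<odot>\<^bsub>M\<^esub> z) ` K <+>\<^bsub>M\<^esub> lin M K zs"

context module begin

lemma lin_stable:
  assumes K: "ideal K R" and zs: "set zs \<subseteq> carrier M"
  shows "stable M (carrier R) (lin M K zs)"
  using zs
proof (induction zs)
  case Nil
  show ?case using stable_zero[of "carrier R"] by simp
next
  case (Cons z zs)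
  thus ?case using stable_sum[OF ideal_multiples_stable[OF K, of z]] by simp
qed

lemma lin_generators:
  assumes zs: "set zs \<subseteq> carrier M" shows "set zs \<subseteq> lin M (carrier R) zs"
  using zs
proof (induction zs)
  case (Cons z zs)
  have st: "stable M (carrier R) ((\<lambda>p. p \<odot>\<^bsub>M\<^esub> z) ` carrier R)" "stable M (carrier R) (lin M (carrier R) zs)"
    using ideal_multiples_stable[OF R.oneideal, of z] lin_stable[OF R.oneideal, of zs] Cons.prems by auto
  have "z \<in> (\<lambda>p. p \<odot>\<^bsub>M\<^esub> z) ` carrier R" by (rule image_eqI[of _ _ \<one>]) (use Cons.prems in auto)
  thus ?case using set_add_subset1[OF st] set_add_subset2[OF st] Cons by auto
qed simp

lemma lin_smult:
  assumes K: "ideal K R" and x: "x \<in> K" and zs: "set zs \<subseteq> carrier M" and m: "m \<in> lin M (carrier R) zs"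
  shows "x \<odot>\<^bsub>M\<^esub> m \<in> lin M K zs"
  using zs m
proof (induction zs arbitrary: m)
  case Nil
  interpret K: ideal K R by (rule K)
  show ?case using Nil x by simp
next
  case (Cons z zs)
  interpret K: ideal K R by (rule K)
  obtain s w where sw: "s \<in> carrier R" "w \<in> lin M (carrier R) zs" "m = s \<odot>\<^bsub>M\<^esub> z \<oplus>\<^bsub>M\<^esub> w"
    using Cons.prems(2) unfolding lin.simps set_add_def' by auto
  have c: "z \<in> carrier M" "w \<in> carrier M" "x \<in> carrier R"
    using Cons.prems(1) sw(2) stableD(1)[OF lin_stable[OF R.oneideal]] x by auto
  have "x \<odot>\<^bsub>M\<^esub> m = (x \<otimes> s) \<odot>\<^bsub>M\<^esub> z \<oplus>\<^bsub>M\<^esub> x \<odot>\<^bsub>M\<^esub> w" using sw c by (simp add: smult_r_distr smult_assoc1)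
  moreover have "(x \<otimes> s) \<odot>\<^bsub>M\<^esub> z \<in> (\<lambda>p. p \<odot>\<^bsub>M\<^esub> z) ` K" using K.I_r_closed[OF x sw(1)] by blast
  moreover have "x \<odot>\<^bsub>M\<^esub> w \<in> lin M K zs" using Cons.IH[OF _ sw(2)] Cons.prems(1) by simp
  ultimately show ?case by (simp add: set_addI)
qed

text \<open>
  Nakayama's lemma by elimination.  From \<open>u z = p z + w\<close> with \<open>p \<in> P\<close> one gets \<open>(u - p) z = w\<close> in the span
  of the remaining generators, and \<open>u - p\<close> is still outside \<open>P\<close>.  After multiplication by \<open>u - p\<close> the
  hypothesis holds for the remaining generators.
\<close>

lemma nakayama:
  assumes P: "primeideal P R" and zs: "set zs \<subseteq> carrier M" and u: "u \<in> carrier R - P"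
    and into: "\<And>z. z \<in> set zs \<Longrightarrow> u \<odot>\<^bsub>M\<^esub> z \<in> lin M P zs"
  shows "\<exists>v\<in>carrier R - P. \<forall>z\<in>set zs. v \<odot>\<^bsub>M\<^esub> z = \<zero>\<^bsub>M\<^esub>"
  using zs u into
proof (induction zs arbitrary: u)
  case Nil
  thus ?case by auto
next
  case (Cons z zs)
  interpret P: primeideal P R by (rule P)
  have idP: "ideal P R" by (rule P.is_ideal)
  have st: "stable M (carrier R) (lin M P zs)" by (rule lin_stable[OF idP]) (use Cons.prems(1) in simp)
  have zM: "z \<in> carrier M" using Cons.prems(1) by simp
  obtain p w where pw: "p \<in> P" "w \<in> lin M P zs" "u \<odot>\<^bsub>M\<^esub> z = p \<odot>\<^bsub>M\<^esub> z \<oplus>\<^bsub>M\<^esub> w"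
    using Cons.prems(3)[of z] unfolding lin.simps set_add_def' by auto
  define v where "v = u \<ominus> p"
  have uR: "u \<in> carrier R" and pR: "p \<in> carrier R" and wM: "w \<in> carrier M"
    using Cons.prems(2) pw stableD(1)[OF st] by auto
  have vR: "v \<in> carrier R" using uR pR by (simp add: v_def)
  have vP: "v \<notin> P"
  proof
    assume "v \<in> P"
    hence "v \<oplus> p \<in> P" using pw(1) by simp
    moreover have "v \<oplus> p = u" using uR pR by (simp add: v_def a_minus_def R.a_assoc R.l_neg)
    ultimately show False using Cons.prems(2) by simp
  qed
  have "v \<odot>\<^bsub>M\<^esub> z = u \<odot>\<^bsub>M\<^esub> z \<ominus>\<^bsub>M\<^esub> p \<odot>\<^bsub>M\<^esub> z"
    using uR pR zM by (simp add: v_def a_minus_def smult_l_distr smult_l_minus)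
  also have "\<dots> = w" by (rule add_diff_cancel[OF _ wM pw(3)]) (use pR zM in simp)
  finally have vz: "v \<odot>\<^bsub>M\<^esub> z = w" .
  have "(v \<otimes> u) \<odot>\<^bsub>M\<^esub> z' \<in> lin M P zs" if z': "z' \<in> set zs" for z'
  proof -
    obtain q w' where qw: "q \<in> P" "w' \<in> lin M P zs" "u \<odot>\<^bsub>M\<^esub> z' = q \<odot>\<^bsub>M\<^esub> z \<oplus>\<^bsub>M\<^esub> w'"
      using Cons.prems(3)[of z'] z' unfolding lin.simps set_add_def' by auto
    have c: "q \<in> carrier R" "w' \<in> carrier M" "z' \<in> carrier M" using qw stableD(1)[OF st] z' Cons.prems(1) by auto
    have "(v \<otimes> u) \<odot>\<^bsub>M\<^esub> z' = v \<odot>\<^bsub>M\<^esub> (q \<odot>\<^bsub>M\<^esub> z) \<oplus>\<^bsub>M\<^esub> v \<odot>\<^bsub>M\<^esub> w'"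
      using vR uR c zM qw(3) by (simp add: smult_assoc1 smult_r_distr)
    also have "v \<odot>\<^bsub>M\<^esub> (q \<odot>\<^bsub>M\<^esub> z) = q \<odot>\<^bsub>M\<^esub> w"
      using vR c zM vz by (simp add: smult_assoc1[symmetric] R.m_comm) (simp add: smult_assoc1)
    finally show ?thesis using stableD(3)[OF st] stableD(5)[OF st] qw pw vR c by simp
  qed
  moreover have "v \<otimes> u \<in> carrier R - P" using P.I_prime vP vR Cons.prems(2) by blast
  ultimately obtain v' where v': "v' \<in> carrier R - P" "\<forall>z\<in>set zs. v' \<odot>\<^bsub>M\<^esub> z = \<zero>\<^bsub>M\<^esub>"
    using Cons.IH[of "v \<otimes> u"] Cons.prems(1) by auto
  have kill: "v' \<odot>\<^bsub>M\<^esub> y = \<zero>\<^bsub>M\<^esub>" if "y \<in> lin M P ys" "set ys \<subseteq> set zs" for y ys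
    using that
  proof (induction ys arbitrary: y)
    case Nil
    thus ?case using v'(1) by simp
  next
    case (Cons a ys)
    obtain q w' where qw: "q \<in> P" "w' \<in> lin M P ys" "y = q \<odot>\<^bsub>M\<^esub> a \<oplus>\<^bsub>M\<^esub> w'"
      using Cons.prems(1) unfolding lin.simps set_add_def' by auto
    have ysM: "set ys \<subseteq> carrier M" "a \<in> carrier M" using Cons.prems(2) \<open>set (z # zs) \<subseteq> carrier M\<close> by auto
    have c: "q \<in> carrier R" "w' \<in> carrier M" "v' \<in> carrier R"
      using qw stableD(1)[OF lin_stable[OF idP ysM(1)]] v'(1) by auto
    have "v' \<odot>\<^bsub>M\<^esub> (q \<odot>\<^bsub>M\<^esub> a) = q \<odot>\<^bsub>M\<^esub> (v' \<odot>\<^bsub>M\<^esub> a)"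
      using c ysM by (simp add: smult_assoc1[symmetric] R.m_comm)
    hence "v' \<odot>\<^bsub>M\<^esub> (q \<odot>\<^bsub>M\<^esub> a) = \<zero>\<^bsub>M\<^esub>" using v'(2) Cons.prems(2) c by simp
    moreover have "v' \<odot>\<^bsub>M\<^esub> w' = \<zero>\<^bsub>M\<^esub>" using Cons.IH[OF qw(2)] Cons.prems(2) by simp
    ultimately show ?case using qw(3) c ysM by (simp add: smult_r_distr)
  qed
  have v'R: "v' \<in> carrier R" using v'(1) by simp
  have "(v' \<otimes> v) \<odot>\<^bsub>M\<^esub> z = \<zero>\<^bsub>M\<^esub>" using kill[OF pw(2)] vz v'R vR zM by (simp add: smult_assoc1)
  moreover have "(v' \<otimes> v) \<odot>\<^bsub>M\<^esub> z' = \<zero>\<^bsub>M\<^esub>" if "z' \<in> set zs" for z'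
  proof -
    have "z' \<in> carrier M" using that Cons.prems(1) by auto
    hence "(v' \<otimes> v) \<odot>\<^bsub>M\<^esub> z' = v \<odot>\<^bsub>M\<^esub> (v' \<odot>\<^bsub>M\<^esub> z')" using v'R vR by (simp add: smult_assoc1[symmetric] R.m_comm)
    thus ?thesis using v'(2) that vR by simp
  qed
  moreover have "v' \<otimes> v \<in> carrier R - P" using P.I_prime vP vR v'(1) by blast
  ultimately show ?case by (intro bexI[of _ "v' \<otimes> v"]) auto
qed

end

context fg_std_mod begin

text \<open>
  If \<open>P\<close> contains the sequence and \<open>(M/yM)\<^sub>P = 0\<close>, then some \<open>u \<notin> P\<close> maps \<open>M\<close> into \<open>PM\<close>, and Nakayama's
  lemma gives an element outside \<open>P\<close> that annihilates \<open>M\<close>.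
\<close>

lemma Supp_quot:
  assumes ys: "set ys \<subseteq> carrier S"
  shows "Supp S (graded_quot M (seq_submodule M ys)) = {P \<in> Proj S. annihilator S M \<subseteq> P \<and> set ys \<subseteq> P}"
proof -
  let ?N = "seq_submodule M ys" let ?Q = "graded_quot M ?N" and ?q = "coset_rep M ?N"
  have Nst: "stable M (carrier S) ?N" by (rule seq_submodule_stable[OF ys])
  have sub: "submodule ?N S M" using Nst submodule_iff_stable by blast
  have mod: "module S ?Q" by (rule module_graded_quot[OF module_axioms sub])
  have loc: "P \<in> Supp S ?Q \<longleftrightarrow> P \<in> Proj S \<and> (\<exists>m\<in>carrier M. \<forall>u\<in>carrier S - P. u \<odot> m \<notin> ?N)" for P
  proof (cases "P \<in> Proj S")
    case True
    have "(u \<odot>\<^bsub>?Q\<^esub> ?q m = \<zero>\<^bsub>?Q\<^esub>) \<longleftrightarrow> u \<odot> m \<in> ?N" if "m \<in> carrier M" "u \<in> carrier S" for m u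
      using coset_rep_smult[OF module_axioms sub that(2,1)] coset_rep_kernel[OF module_axioms sub, of "u \<odot> m"] that by simp
    thus ?thesis using True localization_nonzero_iff[OF mod alg.ProjD(1)[OF True]] unfolding Supp_def by auto
  qed (auto simp: Supp_def)
  show ?thesis
  proof (intro equalityI subsetI)
    fix P assume "P \<in> Supp S ?Q"
    then obtain m where P: "P \<in> Proj S" and m: "m \<in> carrier M" "\<And>u. u \<in> carrier S - P \<Longrightarrow> u \<odot> m \<notin> ?N"
      using loc by blast
    have "annihilator S M \<subseteq> P"
    proof
      fix s assume s: "s \<in> annihilator S M"
      hence "s \<in> carrier S" "s \<odot> m \<in> ?N" using m(1) stableD(2)[OF Nst] by (auto simp: annihilator_def)
      thus "s \<in> P" using m(2) by blast
    qed
    moreover have "set ys \<subseteq> P"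
    proof
      fix x assume x: "x \<in> set ys"
      have "x \<odot> m \<in> ?N" by (rule seq_submodule_mem[OF ys x m(1)])
      thus "x \<in> P" using m(2) ys x by blast
    qed
    ultimately show "P \<in> {P \<in> Proj S. annihilator S M \<subseteq> P \<and> set ys \<subseteq> P}" using P by blast
  next
    fix P assume "P \<in> {P \<in> Proj S. annihilator S M \<subseteq> P \<and> set ys \<subseteq> P}"
    hence P: "P \<in> Proj S" "annihilator S M \<subseteq> P" "set ys \<subseteq> P" by auto
    interpret P: primeideal P S by (rule alg.ProjD(1)[OF P(1)])
    show "P \<in> Supp S ?Q"
    proof (rule ccontr)
      assume "P \<notin> Supp S ?Q"
      hence ex: "\<And>m. m \<in> carrier M \<Longrightarrow> \<exists>u\<in>carrier S - P. u \<odot> m \<in> ?N" using loc P(1) by blast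
      obtain F where F: "finite F" "F \<subseteq> carrier M" "\<forall>N. stable M (carrier S) N \<longrightarrow> F \<subseteq> N \<longrightarrow> N = carrier M"
        using fg by blast
      obtain zs where zs: "set zs = F" using finite_list[OF F(1)] by blast
      have zsM: "set zs \<subseteq> carrier M" using zs F by simp
      have linM: "lin M (carrier S) zs = carrier M"
        using F(3) lin_stable[OF R.oneideal zsM] lin_generators[OF zsM] zs by blast
      have "\<exists>u\<in>carrier S - P. \<forall>z\<in>F'. u \<odot> z \<in> ?N" if "finite F'" "F' \<subseteq> carrier M" for F'
        using that
      proof (induction F')
        case empty
        have "\<one>\<^bsub>S\<^esub> \<in> carrier S - P" using P.one_imp_carrier P.I_notcarr by auto
        thus ?case by blast
      next
        case (insert z F')
        then obtain u where u: "u \<in> carrier S - P" "\<forall>z\<in>F'. u \<odot> z \<in> ?N" by auto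
        obtain v where v: "v \<in> carrier S - P" "v \<odot> z \<in> ?N" using ex[of z] insert by auto
        have uv: "u \<otimes>\<^bsub>S\<^esub> v \<in> carrier S - P" using u v P.I_prime by blast
        have "(u \<otimes>\<^bsub>S\<^esub> v) \<odot> z \<in> ?N" using u v insert stableD(5)[OF Nst] by (simp add: smult_assoc1)
        moreover have "(u \<otimes>\<^bsub>S\<^esub> v) \<odot> z' \<in> ?N" if "z' \<in> F'" for z'
        proof -
          have "z' \<in> carrier M" using that insert by auto
          hence "(u \<otimes>\<^bsub>S\<^esub> v) \<odot> z' = v \<odot> (u \<odot> z')" using u v by (simp add: smult_assoc1[symmetric] R.m_comm)
          thus ?thesis using u(2) that v stableD(5)[OF Nst] by simp
        qed
        ultimately show ?case using uv by blast
      qed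
      from this[OF F(1,2)] obtain u where u: "u \<in> carrier S - P" "\<forall>z\<in>F. u \<odot> z \<in> ?N" by blast
      have linP: "stable M (carrier S) (lin M P zs)" by (rule lin_stable[OF P.is_ideal zsM])
      have "?N \<subseteq> lin M P zs"
      proof
        fix x assume "x \<in> ?N"
        then obtain m where m: "x = finsum M (\<lambda>i. (ys ! i) \<odot> m i) {..<length ys}" "\<forall>i<length ys. m i \<in> carrier M"
          unfolding seq_submodule_def by blast
        have t: "(ys ! i) \<odot> m i \<in> lin M P zs" if "i < length ys" for i
          using lin_smult[OF P.is_ideal _ zsM, of "ys ! i" "m i"] subsetD[OF P(3) nth_mem[OF that]] m(2) that linM
          by simp
        have "finsum M (\<lambda>i. (ys ! i) \<odot> m i) I \<in> lin M P zs" if "finite I" "I \<subseteq> {..<length ys}" for I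
          using that
        proof (induction I)
          case empty
          show ?case using stableD(2)[OF linP] by simp
        next
          case (insert i I)
          have "finsum M (\<lambda>i. (ys ! i) \<odot> m i) (insert i I) = (ys ! i) \<odot> m i \<oplus> finsum M (\<lambda>i. (ys ! i) \<odot> m i) I"
            by (rule finsum_insert) (use insert t stableD(1)[OF linP] in auto)
          thus ?case using insert t stableD(3)[OF linP] by simp
        qed
        thus "x \<in> lin M P zs" using m(1) by simp
      qed
      then obtain v where v: "v \<in> carrier S - P" "\<forall>z\<in>set zs. v \<odot> z = \<zero>"
        using nakayama[OF alg.ProjD(1)[OF P(1)] zsM u(1)] u(2) zs by blast
      have "F \<subseteq> kernel_of v" using v(2) zs F(2) by (auto simp: kernel_of_def)
      hence "kernel_of v = carrier M" using F(3) kernel_of_stable[of v] v(1) by blast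
      hence "v \<in> annihilator S M" using v(1) by (auto simp: annihilator_def kernel_of_def)
      thus False using P(2) v(1) by blast
    qed
  qed
qed

lemma chain_dim_le_zero_iff: "chain_dim C \<le> 0 \<longleftrightarrow> (\<forall>P\<in>C. \<forall>Q\<in>C. \<not> P \<subset> Q)"
proof
  assume le: "chain_dim C \<le> 0"
  show "\<forall>P\<in>C. \<forall>Q\<in>C. \<not> P \<subset> Q"
  proof (intro ballI notI)
    fix P Q assume "P \<in> C" "Q \<in> C" "P \<subset> Q"
    hence "1 \<in> chain_lengths C" unfolding chain_lengths_def by (auto intro!: exI[of _ "[P, Q]"])
    hence "ereal (real 1) \<le> chain_dim C" unfolding chain_dim_def by (rule SUP_upper)
    hence "ereal (real 1) \<le> 0" using le by (rule order_trans)
    thus False by simp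
  qed
next
  assume no: "\<forall>P\<in>C. \<forall>Q\<in>C. \<not> P \<subset> Q"
  have "l = 0" if l: "l \<in> chain_lengths C" for l
  proof (rule ccontr)
    assume "l \<noteq> 0"
    obtain cs where cs: "length cs = Suc l" "set cs \<subseteq> C" "sorted_wrt (\<subset>) cs"
      using l unfolding chain_lengths_def by blast
    then obtain a b ds where "cs = a # b # ds" using \<open>l \<noteq> 0\<close> by (cases cs; cases "tl cs") auto
    thus False using cs no by auto
  qed
  thus "chain_dim C \<le> 0" unfolding chain_dim_def by (auto intro!: SUP_least)
qed

lemma sequence_closed: "sequence_of_type S k xs \<Longrightarrow> set (map fst xs) \<subseteq> carrier S"
  unfolding sequence_of_type_def using SG.component_closed by fastforce

lemma mixed_multiplicity_system_iff:
  "mixed_multiplicity_system S M k xs \<longleftrightarrow>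
    sequence_of_type S k xs \<and> alg.no_chain_above (annihilator S M \<union> fst ` set xs)"
proof (cases "sequence_of_type S k xs")
  case True
  show ?thesis
    unfolding mixed_multiplicity_system_def chain_dim_le_zero_iff Supp_quot[OF sequence_closed[OF True]]
      alg.no_chain_above_def set_map using True by blast
qed (simp add: mixed_multiplicity_system_def)

lemma annihilator_quot:
  assumes x: "x \<in> carrier S"
  shows "annihilator S M \<union> {x} \<subseteq> annihilator S (graded_quot M (seq_submodule M [x]))"
proof
  let ?N = "seq_submodule M [x]"
  fix s assume s: "s \<in> annihilator S M \<union> {x}"
  have st: "stable M (carrier S) ?N" using seq_submodule_stable[of "[x]"] x by simp
  have sub: "submodule ?N S M" using st submodule_iff_stable by blast
  have sS: "s \<in> carrier S" using s x by (auto simp: annihilator_def)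
  have sm: "s \<odot> m \<in> ?N" if "m \<in> carrier M" for m
    using s that stableD(2)[OF st] seq_submodule_mem[of "[x]" x m] x by (auto simp: annihilator_def)
  have "s \<odot>\<^bsub>graded_quot M ?N\<^esub> y = \<zero>\<^bsub>graded_quot M ?N\<^esub>" if y: "y \<in> carrier (graded_quot M ?N)" for y
  proof -
    obtain m where m: "m \<in> carrier M" "y = coset_rep M ?N m" using y by auto
    have "s \<odot>\<^bsub>graded_quot M ?N\<^esub> y = coset_rep M ?N (s \<odot> m)"
      using coset_rep_smult[OF module_axioms sub sS m(1)] m(2) by simp
    thus ?thesis using coset_rep_kernel[OF module_axioms sub, of "s \<odot> m"] sm[OF m(1)] sS m(1) by simp
  qed
  thus "s \<in> annihilator S (graded_quot M ?N)" using sS by (auto simp: annihilator_def)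
qed

lemma annihilator_zero_colon:
  assumes x: "x \<in> carrier S"
  shows "annihilator S M \<union> {x} \<subseteq> annihilator S (zero_colon M x)"
  using x by (auto simp: annihilator_def zero_colon_eq kernel_of_def)

text \<open>
  The hypotheses put \<open>P\<close> in the support of \<open>M/xM\<close>, and a prime in the support of a module contains
  its annihilator.
\<close>

lemma annihilator_quot_prime:
  assumes P: "P \<in> Proj S" "annihilator S M \<subseteq> P" "x \<in> P" and x: "x \<in> component S p"
  shows "annihilator S (graded_quot M (seq_submodule M [x])) \<subseteq> P"
proof -
  have xS: "x \<in> carrier S" using SG.component_closed[OF x] .
  let ?N = "seq_submodule M [x]"
  have st: "stable M (carrier S) ?N" using seq_submodule_stable[of "[x]"] xS by simp
  have sub: "submodule ?N S M" using st submodule_iff_stable by blast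
  have mod: "module S (graded_quot M ?N)" by (rule module_graded_quot[OF module_axioms sub])
  have "P \<in> Supp S (graded_quot M ?N)" using Supp_quot[of "[x]"] P xS by simp
  then obtain y where "y \<in> carrier (graded_quot M ?N)"
    "\<forall>u\<in>carrier S - P. u \<odot>\<^bsub>graded_quot M ?N\<^esub> y \<noteq> \<zero>\<^bsub>graded_quot M ?N\<^esub>"
    using localization_nonzero_iff[OF mod alg.ProjD(1)[OF P(1)]] unfolding Supp_def by auto
  thus ?thesis by (auto simp: annihilator_def)
qed

end

section \<open>Mixed multiplicities and mixed multiplicity systems\<close>

context std_alg begin

lemma no_chain_above_mono:
  assumes "I \<subseteq> J" "no_chain_above I" shows "no_chain_above J"
  unfolding no_chain_above_def
proof (intro ballI impI)
  fix P Q assume "P \<in> Proj S" "Q \<in> Proj S" "J \<subseteq> P"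
  thus "\<not> P \<subset> Q" using assms(2)[unfolded no_chain_above_def] subset_trans[OF assms(1), of P] by simp
qed

lemma sequence_Cons:
  assumes "sequence_of_type S k ((x, j) # xs)"
  shows "x \<in> component S (axis j 1)" "sequence_of_type S (k - axis j 1) xs" "k - axis j 1 + axis j 1 = k"
proof -
  have cnt: "count_list (map snd ((x, j) # xs)) i = k $ i" for i
    using assms unfolding sequence_of_type_def by blast
  show "x \<in> component S (axis j 1)" using assms unfolding sequence_of_type_def by auto
  have "k $ j \<noteq> 0" using cnt[of j] by simp
  thus "k - axis j 1 + axis j 1 = k" by (intro vec_diff_add) (auto simp: less_eq_vec_def axis_def)
  have "count_list (map snd xs) i = (k - axis j 1) $ i" for i
    using cnt[of i] by (auto simp: axis_def split: if_splits)
  thus "sequence_of_type S (k - axis j 1) xs" using assms unfolding sequence_of_type_def by auto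
qed

lemma sequence_ConsI:
  assumes "x \<in> component S (axis j 1)" "sequence_of_type S k xs"
  shows "sequence_of_type S (k + axis j 1) ((x, j) # xs)"
  using assms unfolding sequence_of_type_def by (auto simp: axis_def)

end

lemma eventually_constant_hilbert:
  assumes "for_large (\<lambda>n. component_length A S M n = c)"
  shows "hilbert_coeff A S M = (\<lambda>k. if k = 0 then c else 0)"
  by (rule hilbert_coeff_eq, rule represents_cong[OF represents_const[of c]])
    (use assms in \<open>auto elim: for_large_mono\<close>)

lemma vec_less_add: "(h::nat^'d::finite) > k \<Longrightarrow> h + a > k + a"
  by (simp add: less_le vec_add_mono)

text \<open>
  Induction on the system.  The annihilators of \<open>M/xM\<close> and of \<open>0 : x\<close> contain \<open>Ann M\<close> and \<open>x\<close>, so the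
  remaining sequence is a system of both, of type \<open>k - e\<^sub>j\<close>.  In the formula for \<open>e(M; k)\<close> the
  correction term is the coefficient of \<open>0 : x\<close> at \<open>k > k - e\<^sub>j\<close>, which vanishes by induction.
\<close>

lemma mixed_multiplicity_symbol_eq:
  assumes "fg_std_mod A \<mm> S M" "sequence_of_type S k xs"
    "std_alg.no_chain_above S (annihilator S M \<union> fst ` set xs)"
  shows "(\<forall>h>k. hilbert_coeff A S M h = 0) \<and> mixed_multiplicity_symbol A S xs M = hilbert_coeff A S M k"
  using assms
proof (induction xs arbitrary: M k)
  case Nil
  interpret fg_std_mod A \<mm> S M by (rule Nil.prems)
  have k: "k = 0" using Nil.prems(2) by (simp add: sequence_of_type_def vec_eq_iff)
  obtain c where c: "for_large (\<lambda>n. component_length A S M n = c)"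
    using eventually_constant_of_no_chain Nil.prems(3) by auto
  have "mixed_multiplicity_symbol A S [] M = c"
    unfolding mixed_multiplicity_symbol.simps
  proof (rule the_equality)
    show "for_large (\<lambda>n. component_length A S M n = c)" by (rule c)
    fix c' assume "for_large (\<lambda>n. component_length A S M n = c')"
    from c this have "for_large (\<lambda>n::nat^'d. c' = c)" by (rule for_large_mono2) simp
    thus "c' = c" by simp
  qed
  thus ?case using eventually_constant_hilbert[OF c] k by auto
next
  case (Cons xj xs)
  obtain x j where xj: "xj = (x, j)" by force
  interpret fg_std_mod A \<mm> S M by (rule Cons.prems)
  note seq = alg.sequence_Cons[OF Cons.prems(2)[unfolded xj]]
  let ?e = "axis j 1 :: nat ^ 'd" and ?Q = "graded_quot M (seq_submodule M [x])" and ?K = "zero_colon M x"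
  let ?k = "k - ?e"
  note x = seq(1)
  have xS: "x \<in> carrier S" using SG.component_closed[OF x] .
  have ann: "alg.no_chain_above (annihilator S M \<union> fst ` set (xj # xs))" by (rule Cons.prems(3))
  have Q: "(\<forall>h>?k. hilbert_coeff A S ?Q h = 0) \<and> mixed_multiplicity_symbol A S xs ?Q = hilbert_coeff A S ?Q ?k"
    by (rule Cons.IH[OF fg_quot[OF x] seq(2)], rule alg.no_chain_above_mono[OF _ ann])
      (use annihilator_quot[OF xS] xj in auto)
  have K: "(\<forall>h>?k. hilbert_coeff A S ?K h = 0) \<and> mixed_multiplicity_symbol A S xs ?K = hilbert_coeff A S ?K ?k"
    by (rule Cons.IH[OF fg_zero_colon[OF x] seq(2)], rule alg.no_chain_above_mono[OF _ ann])
      (use annihilator_zero_colon[OF xS] xj in auto)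
  have k: "?k + ?e = k" by (rule seq(3))
  have kk: "k > ?k"
  proof -
    have "?k \<noteq> k"
    proof
      assume "?k = k"
      hence "?k $ j = ?k $ j + 1" using k by (metis axis_nth vector_add_component)
      thus False by simp
    qed
    moreover have "?k \<le> k" using k vec_le_add by metis
    ultimately show ?thesis by simp
  qed
  have "hilbert_coeff A S M h = 0" if h: "h > k" for h
  proof -
    have "?e \<le> h" using k h vec_le_add2[of ?e ?k] by (metis less_imp_le order_trans)
    hence h': "h - ?e + ?e = h" by (rule vec_diff_add)
    have "h - ?e > ?k"
    proof -
      have "?k \<le> h - ?e" using less_imp_le[OF h] unfolding less_eq_vec_def by (simp add: diff_le_mono)
      moreover have "?k \<noteq> h - ?e"
      proof
        assume eq: "?k = h - ?e"
        have "h = k" using h' k unfolding eq by simp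
        thus False using h by simp
      qed
      ultimately show ?thesis by simp
    qed
    thus ?thesis using hilbert_coeff_exact[OF x, of "h - ?e"] h' Q K order.strict_trans[OF kk h] by simp
  qed
  moreover have "hilbert_coeff A S M k = mixed_multiplicity_symbol A S (xj # xs) M"
    using hilbert_coeff_exact[OF x, of ?k] k Q K kk xj by simp
  ultimately show ?case by simp
qed

text \<open>
  For an element \<open>x\<close> that is regular on \<open>M\<close> in large degrees, the coefficients of \<open>0 : x\<close> vanish, and
  those of \<open>M/xM\<close> are the shifted coefficients of \<open>M\<close>.
\<close>

lemma exists_system:
  assumes "infinite (carrier (A Quot \<mm>))" "fg_std_mod A \<mm> S M" "mixed_multiplicity_defined A S M k"
  shows "\<exists>xs. sequence_of_type S k xs \<and> std_alg.no_chain_above S (annihilator S M \<union> fst ` set xs)"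
  using assms
proof (induction k arbitrary: M rule: vec_induct)
  case zero
  interpret fg_std_mod A \<mm> S M by (rule zero.prems)
  have 0: "hilbert_coeff A S M h = 0" if "h \<noteq> 0" for h
    using zero.prems(3) that unfolding mixed_multiplicity_defined_def by (simp add: less_le)
  have "{h. hilbert_coeff A S M h \<noteq> 0} \<subseteq> {0}" using 0 by auto
  hence "binomial_sum (hilbert_coeff A S M) n = hilbert_coeff A S M 0" for n
    by (subst binomial_sum_superset[of "{0}"]) auto
  hence "for_large (\<lambda>n. component_length A S M n = hilbert_coeff A S M 0)"
    using represents_hilbert_coeff by (simp add: represents_def)
  hence "alg.no_chain_above (annihilator S M)" by (rule no_chain_of_eventually_constant)
  thus ?case by (intro exI[of _ "[]"]) (simp add: sequence_of_type_def)
next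
  case (add k i)
  interpret fg_std_mod A \<mm> S M by (rule add.prems)
  let ?e = "axis i 1 :: nat ^ 'd"
  obtain PP where PP: "finite PP" "PP \<subseteq> Proj S" "\<And>x p. x \<in> component S p \<Longrightarrow> alg.avoids x PP \<Longrightarrow>
      for_large (\<lambda>n. \<forall>m\<in>component M n. x \<odot>\<^bsub>M\<^esub> m = \<zero>\<^bsub>M\<^esub> \<longrightarrow> m = \<zero>\<^bsub>M\<^esub>)"
    using eventually_regular by auto
  obtain x where x: "x \<in> component S ?e" "alg.avoids x PP"
    using alg.exists_avoiding[OF add.prems(1) PP(1,2)] by blast
  have xS: "x \<in> carrier S" using SG.component_closed[OF x(1)] .
  let ?Q = "graded_quot M (seq_submodule M [x])" and ?K = "zero_colon M x"
  have "for_large (\<lambda>n. component_length A S ?K n = 0)"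
    using PP(3)[OF x]
  proof (rule for_large_mono)
    fix n assume "\<forall>m\<in>component M n. x \<odot>\<^bsub>M\<^esub> m = \<zero>\<^bsub>M\<^esub> \<longrightarrow> m = \<zero>\<^bsub>M\<^esub>"
    hence "kernel_of x \<inter> component M n = {\<zero>\<^bsub>M\<^esub>}"
      using stableD(2)[OF kernel_of_stable[OF xS]] component_props(2) by (auto simp: kernel_of_def)
    thus "component_length A S ?K n = 0" unfolding component_length_zero_colon[OF x(1)] by simp
  qed
  hence "hilbert_coeff A S ?K = (\<lambda>k. 0)" using eventually_constant_hilbert by fastforce
  hence eq: "hilbert_coeff A S M (h + ?e) = hilbert_coeff A S ?Q h" for h
    using hilbert_coeff_exact[OF x(1), of h] by simp
  have "mixed_multiplicity_defined A S ?Q k"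
    using add.prems(3) vec_less_add[of k] unfolding mixed_multiplicity_defined_def eq[symmetric] by blast
  from add.IH[OF add.prems(1) fg_quot[OF x(1)] this] obtain xs where
    xs: "sequence_of_type S k xs" "alg.no_chain_above (annihilator S ?Q \<union> fst ` set xs)" by blast
  have "alg.no_chain_above (annihilator S M \<union> fst ` set ((x, i) # xs))"
    unfolding alg.no_chain_above_def
  proof (intro ballI impI)
    fix P Q assume PQ: "P \<in> Proj S" "Q \<in> Proj S" and sub: "annihilator S M \<union> fst ` set ((x, i) # xs) \<subseteq> P"
    have "annihilator S ?Q \<subseteq> P" by (rule annihilator_quot_prime[OF PQ(1) _ _ x(1)]) (use sub in auto)
    thus "\<not> P \<subset> Q" using xs(2) PQ sub unfolding alg.no_chain_above_def by auto
  qed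
  thus ?case using alg.sequence_ConsI[OF x(1) xs(1)] by blast
qed

section \<open>The Koszul complex\<close>

lemma (in abelian_group) alternating_double_sum:
  assumes "finite D" "\<And>t u. t \<in> D \<Longrightarrow> u \<in> D \<Longrightarrow> g t u \<in> carrier G"
    "\<And>t u. t \<in> D \<Longrightarrow> u \<in> D \<Longrightarrow> t \<noteq> u \<Longrightarrow> g t u = \<ominus> g u t"
  shows "(\<Oplus>t\<in>D. \<Oplus>u\<in>D - {t}. g t u) = \<zero>"
  using assms
proof (induction D)
  case (insert a D)
  have cl: "g t u \<in> carrier G" if "t \<in> insert a D" "u \<in> insert a D" for t u using insert.prems(1) that by blast
  have inner: "(\<Oplus>u\<in>insert a D - {t}. g t u) = g t a \<oplus> (\<Oplus>u\<in>D - {t}. g t u)" if t: "t \<in> D" for t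
  proof -
    have "insert a D - {t} = insert a (D - {t})" using t insert.hyps by auto
    thus ?thesis using finsum_insert[of "D - {t}" a "g t"] insert.hyps cl t by auto
  qed
  have a: "insert a D - {a} = D" using insert.hyps by auto
  have "(\<Oplus>t\<in>insert a D. \<Oplus>u\<in>insert a D - {t}. g t u) =
      (\<Oplus>u\<in>D. g a u) \<oplus> (\<Oplus>t\<in>D. \<Oplus>u\<in>insert a D - {t}. g t u)"
    using finsum_insert[of D a "\<lambda>t. \<Oplus>u\<in>insert a D - {t}. g t u"] insert.hyps cl a
    by (auto intro!: finsum_closed)
  also have "(\<Oplus>t\<in>D. \<Oplus>u\<in>insert a D - {t}. g t u) = (\<Oplus>t\<in>D. g t a \<oplus> (\<Oplus>u\<in>D - {t}. g t u))"
    by (rule finsum_cong') (use inner cl in \<open>auto intro!: finsum_closed\<close>)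
  also have "\<dots> = (\<Oplus>t\<in>D. g t a) \<oplus> (\<Oplus>t\<in>D. \<Oplus>u\<in>D - {t}. g t u)"
    by (rule finsum_addf) (use cl in \<open>auto intro!: finsum_closed\<close>)
  also have "(\<Oplus>t\<in>D. \<Oplus>u\<in>D - {t}. g t u) = \<zero>"
    by (rule insert.IH) (use insert.prems in blast)+
  also have "(\<Oplus>t\<in>D. g t a) \<oplus> \<zero> = (\<Oplus>t\<in>D. g t a)" using cl by (auto intro!: finsum_closed)
  also have "(\<Oplus>u\<in>D. g a u) \<oplus> (\<Oplus>t\<in>D. g t a) = (\<Oplus>t\<in>D. g a t \<oplus> g t a)"
    by (rule finsum_addf[symmetric]) (use cl in auto)
  also have "\<dots> = (\<Oplus>t\<in>D. \<zero>)"
  proof (rule finsum_cong')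
    fix t assume t: "t \<in> D"
    have "g t a = \<ominus> g a t" using insert.prems(2)[of t a] t insert.hyps by auto
    thus "g a t \<oplus> g t a = \<zero>" using cl[of a t] t by (simp add: r_neg)
  qed auto
  finally show ?case by simp
qed simp

lemma koszul_simps:
  "carrier (koszul_module M xs i) = {f. (\<forall>T. f T \<in> carrier M) \<and>
     (\<forall>T. \<not> (T \<subseteq> {..<length xs} \<and> card T = i) \<longrightarrow> f T = \<zero>\<^bsub>M\<^esub>)}"
  "zero (koszul_module M xs i) = (\<lambda>T. \<zero>\<^bsub>M\<^esub>)"
  "add (koszul_module M xs i) = (\<lambda>f g T. f T \<oplus>\<^bsub>M\<^esub> g T)"
  "smult (koszul_module M xs i) = (\<lambda>s f T. s \<odot>\<^bsub>M\<^esub> f T)"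
  "component (koszul_module M xs i) n = {f \<in> carrier (koszul_module M xs i). \<forall>T.
        if koszul_degree xs T \<le> n then f T \<in> component M (n - koszul_degree xs T) else f T = \<zero>\<^bsub>M\<^esub>}"
  by (simp_all add: koszul_module_def Let_def)

lemma koszul_degree_insert:
  "finite T \<Longrightarrow> t \<notin> T \<Longrightarrow> koszul_degree xs (insert t T) = koszul_degree xs T + axis (snd (xs ! t)) 1"
  by (simp add: koszul_degree_def add.commute)

locale koszul = fg_std_mod A \<mm> S M
  for A :: "('a, 'x) ring_scheme" and \<mm> and S :: "('a, 's, nat ^ 'd::finite, 'z) graded_module_scheme"
    and M :: "('s, 'm, nat ^ 'd, 'y) graded_module_scheme" (structure) +
  fixes xs :: "('s \<times> 'd) list"
  assumes xs: "(x, j) \<in> set xs \<Longrightarrow> x \<in> component S (axis j 1)"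
begin

abbreviation "D \<equiv> {..<length xs}"
abbreviation "K i \<equiv> koszul_module M xs i"
abbreviation "d \<equiv> koszul_diff S M xs"
abbreviation "kdeg \<equiv> koszul_degree xs"

definition coef :: "nat set \<Rightarrow> nat \<Rightarrow> 's" where
  "coef T t = (\<ominus>\<^bsub>S\<^esub> \<one>\<^bsub>S\<^esub>) [^]\<^bsub>S\<^esub> card {u \<in> T. u < t} \<otimes>\<^bsub>S\<^esub> fst (xs ! t)"

lemma d_eq: "d f T = (\<Oplus>t\<in>D - T. coef T t \<odot> f (insert t T))"
  by (simp add: koszul_diff_def coef_def)

lemma nth_component: "t < length xs \<Longrightarrow> fst (xs ! t) \<in> component S (axis (snd (xs ! t)) 1)"
  using xs[of "fst (xs ! t)" "snd (xs ! t)"] by simp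

lemma sign_component: "(\<ominus>\<^bsub>S\<^esub> \<one>\<^bsub>S\<^esub>) [^]\<^bsub>S\<^esub> (p::nat) \<in> component S 0"
proof (induction p)
  case 0
  show ?case using one_component by simp
next
  case (Suc p)
  show ?case using mult_component[OF Suc SG.component_props(4)[OF one_component]] by simp
qed

lemma coef_component: "t < length xs \<Longrightarrow> coef T t \<in> component S (axis (snd (xs ! t)) 1)"
  using mult_component[OF sign_component nth_component] by (simp add: coef_def)

lemma coef_closed: "t < length xs \<Longrightarrow> coef T t \<in> carrier S"
  using SG.component_closed[OF coef_component] .

lemma K_carrierD: "f \<in> carrier (K i) \<Longrightarrow> f T \<in> carrier M"
  "f \<in> carrier (K i) \<Longrightarrow> \<not> (T \<subseteq> D \<and> card T = i) \<Longrightarrow> f T = \<zero>"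
  by (auto simp: koszul_simps)

lemma K_carrierI: "(\<And>T. f T \<in> carrier M) \<Longrightarrow> (\<And>T. \<not> (T \<subseteq> D \<and> card T = i) \<Longrightarrow> f T = \<zero>) \<Longrightarrow> f \<in> carrier (K i)"
  by (auto simp: koszul_simps)

lemma K_module: "module S (K i)"
proof (rule moduleI)
  show "cring S" by (rule R.is_cring)
  show "abelian_group (K i)"
  proof (rule abelian_groupI)
    fix f assume f: "f \<in> carrier (K i)"
    have "(\<lambda>T. \<ominus> f T) \<in> carrier (K i)" using f by (auto simp: koszul_simps)
    moreover have "(\<lambda>T. \<ominus> f T) \<oplus>\<^bsub>K i\<^esub> f = \<zero>\<^bsub>K i\<^esub>"
      using K_carrierD(1)[OF f] by (auto simp: koszul_simps(2,3) l_neg)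
    ultimately show "\<exists>g\<in>carrier (K i). g \<oplus>\<^bsub>K i\<^esub> f = \<zero>\<^bsub>K i\<^esub>" by blast
  qed (auto simp: koszul_simps a_ac)
qed (auto simp: koszul_simps smult_l_distr smult_r_distr smult_assoc1)

lemma K_inv: "f \<in> carrier (K i) \<Longrightarrow> \<ominus>\<^bsub>K i\<^esub> f = (\<lambda>T. \<ominus> f T)"
proof -
  assume f: "f \<in> carrier (K i)"
  interpret K: module S "K i" by (rule K_module)
  have "(\<lambda>T. \<ominus> f T) \<in> carrier (K i)" using f by (auto simp: koszul_simps)
  moreover have "(\<lambda>T. \<ominus> f T) \<oplus>\<^bsub>K i\<^esub> f = \<zero>\<^bsub>K i\<^esub>"
    using K_carrierD(1)[OF f] by (auto simp: koszul_simps(2,3) l_neg)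
  ultimately show ?thesis using K.M.minus_equality f by simp
qed

lemma term_closed: "f \<in> carrier (K i) \<Longrightarrow> t \<in> D - T \<Longrightarrow> coef T t \<odot> f (insert t T) \<in> carrier M"
  using coef_closed K_carrierD(1) by auto

lemma d_value_closed: "f \<in> carrier (K i) \<Longrightarrow> d f T \<in> carrier M"
  unfolding d_eq by (rule finsum_closed) (use term_closed in blast)

lemma d_closed:
  assumes f: "f \<in> carrier (K (Suc i))" shows "d f \<in> carrier (K i)"
proof (rule K_carrierI)
  show "d f T \<in> carrier M" for T by (rule d_value_closed[OF f])
  fix T assume T: "\<not> (T \<subseteq> D \<and> card T = i)"
  have z: "coef T t \<odot> f (insert t T) = \<zero>" if t: "t \<in> D - T" for t
  proof -
    have "\<not> (insert t T \<subseteq> D \<and> card (insert t T) = Suc i)"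
    proof
      assume a: "insert t T \<subseteq> D \<and> card (insert t T) = Suc i"
      hence "finite T" using finite_subset[of T D] by auto
      thus False using a T t by (simp add: card_insert_if)
    qed
    hence "f (insert t T) = \<zero>" by (rule K_carrierD(2)[OF f])
    thus ?thesis using coef_closed t by simp
  qed
  have "d f T = (\<Oplus>t\<in>D - T. \<zero>)" unfolding d_eq by (rule finsum_cong') (use z in auto)
  thus "d f T = \<zero>" by simp
qed

lemma d_zero_level: "f \<in> carrier (K 0) \<Longrightarrow> d f = (\<lambda>T. \<zero>)"
proof
  fix T assume f: "f \<in> carrier (K 0)"
  have z: "coef T t \<odot> f (insert t T) = \<zero>" if t: "t \<in> D - T" for t
  proof -
    have "\<not> (insert t T \<subseteq> D \<and> card (insert t T) = 0)"
      by (metis card_0_eq finite_lessThan finite_subset insert_not_empty)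
    hence "f (insert t T) = \<zero>" by (rule K_carrierD(2)[OF f])
    thus ?thesis using coef_closed t by simp
  qed
  have "d f T = (\<Oplus>t\<in>D - T. \<zero>)" unfolding d_eq by (rule finsum_cong') (use z in auto)
  thus "d f T = \<zero>" by simp
qed

lemma d_add:
  assumes f: "f \<in> carrier (K i)" and g: "g \<in> carrier (K i)"
  shows "d (f \<oplus>\<^bsub>K i\<^esub> g) = (\<lambda>T. d f T \<oplus> d g T)"
proof
  fix T
  have "d (f \<oplus>\<^bsub>K i\<^esub> g) T = (\<Oplus>t\<in>D - T. coef T t \<odot> f (insert t T) \<oplus> coef T t \<odot> g (insert t T))"
    unfolding d_eq koszul_simps(3)
    by (rule finsum_cong') (use coef_closed K_carrierD(1)[OF f] K_carrierD(1)[OF g] in \<open>auto simp: smult_r_distr\<close>)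
  also have "\<dots> = d f T \<oplus> d g T" unfolding d_eq
    by (rule finsum_addf) (use term_closed[OF f] term_closed[OF g] in auto)
  finally show "d (f \<oplus>\<^bsub>K i\<^esub> g) T = d f T \<oplus> d g T" .
qed

lemma d_smult:
  assumes f: "f \<in> carrier (K i)" and s: "s \<in> carrier S"
  shows "d (s \<odot>\<^bsub>K i\<^esub> f) = (\<lambda>T. s \<odot> d f T)"
proof
  fix T
  have "s \<odot> d f T = (\<Oplus>t\<in>D - T. s \<odot> (coef T t \<odot> f (insert t T)))" unfolding d_eq
    by (rule finsum_smult_ldistr) (use s term_closed[OF f] in auto)
  also have "\<dots> = d (s \<odot>\<^bsub>K i\<^esub> f) T" unfolding d_eq koszul_simps(4)
    by (rule finsum_cong')
      (use coef_closed K_carrierD(1)[OF f] s in \<open>auto simp: smult_assoc1[symmetric] R.m_comm\<close>)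
  finally show "d (s \<odot>\<^bsub>K i\<^esub> f) T = s \<odot> d f T" by simp
qed

text \<open>
  Removing two positions in either order gives opposite signs: one of them is counted below the
  other one in exactly one of the two orders.
\<close>

lemma coef_swap:
  assumes tu: "t \<in> D" "u \<in> D" "t < u" and T: "finite T" "t \<notin> T" "u \<notin> T"
  shows "coef T t \<otimes>\<^bsub>S\<^esub> coef (insert t T) u = \<ominus>\<^bsub>S\<^esub> (coef T u \<otimes>\<^bsub>S\<^esub> coef (insert u T) t)"
proof -
  let ?e = "\<ominus>\<^bsub>S\<^esub> \<one>\<^bsub>S\<^esub>" let ?a = "card {v \<in> T. v < t}" and ?b = "card {v \<in> T. v < u}"
  let ?x = "fst (xs ! t)" and ?y = "fst (xs ! u)"
  have 1: "{v \<in> insert t T. v < u} = insert t {v \<in> T. v < u}" using tu by auto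
  have 2: "{v \<in> insert u T. v < t} = {v \<in> T. v < t}" using tu by auto
  have c1: "card {v \<in> insert t T. v < u} = Suc ?b" unfolding 1 using T by simp
  have cl: "?x \<in> carrier S" "?y \<in> carrier S" "?e [^]\<^bsub>S\<^esub> ?a \<in> carrier S" "?e [^]\<^bsub>S\<^esub> ?b \<in> carrier S"
    using SG.component_closed[OF nth_component[of t]] SG.component_closed[OF nth_component[of u]] tu(1,2) by auto
  have "coef T t \<otimes>\<^bsub>S\<^esub> coef (insert t T) u = (?e [^]\<^bsub>S\<^esub> ?a \<otimes>\<^bsub>S\<^esub> ?x) \<otimes>\<^bsub>S\<^esub> ((?e [^]\<^bsub>S\<^esub> ?b \<otimes>\<^bsub>S\<^esub> ?e) \<otimes>\<^bsub>S\<^esub> ?y)"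
    unfolding coef_def c1 by simp
  also have "\<dots> = \<ominus>\<^bsub>S\<^esub> ((?e [^]\<^bsub>S\<^esub> ?b \<otimes>\<^bsub>S\<^esub> ?y) \<otimes>\<^bsub>S\<^esub> (?e [^]\<^bsub>S\<^esub> ?a \<otimes>\<^bsub>S\<^esub> ?x))"
    using cl by (simp add: R.r_minus R.l_minus R.m_comm R.m_assoc R.m_lcomm)
  also have "\<dots> = \<ominus>\<^bsub>S\<^esub> (coef T u \<otimes>\<^bsub>S\<^esub> coef (insert u T) t)" unfolding coef_def 2 ..
  finally show ?thesis .
qed

lemma d_d:
  assumes f: "f \<in> carrier (K i)" shows "d (d f) = (\<lambda>T. \<zero>)"
proof
  fix T
  show "d (d f) T = \<zero>"
  proof (cases "finite T")
    case False
    have "f (insert u (insert t T)) = \<zero>" for t u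
      using K_carrierD(2)[OF f, of "insert u (insert t T)"] False finite_subset[of "insert u (insert t T)" D] by auto
    hence "d f (insert t T) = \<zero>" if "t \<in> D" for t
    proof -
      have "d f (insert t T) = (\<Oplus>u\<in>D - insert t T. \<zero>)" unfolding d_eq
        by (rule finsum_cong') (use \<open>\<And>t u. f (insert u (insert t T)) = \<zero>\<close> coef_closed in auto)
      thus ?thesis by simp
    qed
    hence "d (d f) T = (\<Oplus>t\<in>D - T. \<zero>)" unfolding d_eq[of "d f"]
      by (intro finsum_cong') (use coef_closed in auto)
    thus ?thesis by simp
  next
    case True
    define g where "g t u = (coef T t \<otimes>\<^bsub>S\<^esub> coef (insert t T) u) \<odot> f (insert u (insert t T))" for t u
    have gc: "g t u \<in> carrier M" if "t \<in> D - T" "u \<in> D - T" for t u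
      using that coef_closed K_carrierD(1)[OF f] by (auto simp: g_def)
    have inner: "coef T t \<odot> d f (insert t T) = (\<Oplus>u\<in>(D - T) - {t}. g t u)" if t: "t \<in> D - T" for t
    proof -
      have eq: "D - insert t T = (D - T) - {t}" by auto
      have "coef T t \<odot> d f (insert t T) = (\<Oplus>u\<in>D - insert t T. coef T t \<odot> (coef (insert t T) u \<odot> f (insert u (insert t T))))"
        unfolding d_eq by (rule finsum_smult_ldistr) (use t coef_closed term_closed[OF f] in auto)
      also have "\<dots> = (\<Oplus>u\<in>D - insert t T. g t u)"
        by (rule finsum_cong') (use t gc coef_closed K_carrierD(1)[OF f] in \<open>auto simp: g_def smult_assoc1\<close>)
      finally show ?thesis unfolding eq .
    qed
    have anti: "g t u = \<ominus> g u t" if tu: "t \<in> D - T" "u \<in> D - T" "t \<noteq> u" for t u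
    proof -
      have *: "g t u = \<ominus> g u t" if "t \<in> D - T" "u \<in> D - T" "t < u" for t u
      proof -
        have c: "coef T u \<otimes>\<^bsub>S\<^esub> coef (insert u T) t \<in> carrier S" using that coef_closed by simp
        have "insert u (insert t T) = insert t (insert u T)" by auto
        thus ?thesis unfolding g_def using coef_swap[of t u T] that True
            smult_l_minus[OF c K_carrierD(1)[OF f]] by simp
      qed
      show ?thesis
      proof (cases "t < u")
        case False
        hence "g u t = \<ominus> g t u" using *[of u t] tu by simp
        thus ?thesis using gc tu by simp
      qed (use * tu in blast)
    qed
    have "d (d f) T = (\<Oplus>t\<in>D - T. \<Oplus>u\<in>(D - T) - {t}. g t u)" unfolding d_eq[of "d f"]
      by (rule finsum_cong') (use inner gc in \<open>auto intro!: finsum_closed\<close>)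
    also have "\<dots> = \<zero>"
    proof (rule alternating_double_sum)
      show "finite (D - T)" by simp
      show "g t u \<in> carrier M" if "t \<in> D - T" "u \<in> D - T" for t u by (rule gc[OF that])
      show "g t u = \<ominus> g u t" if "t \<in> D - T" "u \<in> D - T" "t \<noteq> u" for t u by (rule anti[OF that])
    qed
    finally show ?thesis .
  qed
qed

definition Z :: "nat \<Rightarrow> (nat set \<Rightarrow> 'm) set" where "Z i = {f \<in> carrier (K i). d f = (\<lambda>T. \<zero>)}"
definition B :: "nat \<Rightarrow> (nat set \<Rightarrow> 'm) set" where "B i = d ` carrier (K (Suc i))"

lemma Z_stable: "stable (K i) (carrier S) (Z i)"
proof (rule stableI)
  interpret K: module S "K i" by (rule K_module)
  show "Z i \<subseteq> carrier (K i)" by (auto simp: Z_def)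
  have sm: "s \<odot>\<^bsub>K i\<^esub> f \<in> Z i" if "s \<in> carrier S" "f \<in> Z i" for s f
    using that d_smult[of f i s] by (auto simp: Z_def)
  have "d \<zero>\<^bsub>K i\<^esub> = (\<lambda>T. \<zero>)"
  proof
    fix T
    have "d \<zero>\<^bsub>K i\<^esub> T = (\<Oplus>t\<in>D - T. \<zero>)" unfolding d_eq koszul_simps(2)
      by (rule finsum_cong') (use coef_closed in auto)
    thus "d \<zero>\<^bsub>K i\<^esub> T = \<zero>" by simp
  qed
  thus "\<zero>\<^bsub>K i\<^esub> \<in> Z i" by (simp add: Z_def)
  fix f assume f: "f \<in> Z i"
  have "\<ominus>\<^bsub>K i\<^esub> f = (\<ominus>\<^bsub>S\<^esub> \<one>\<^bsub>S\<^esub>) \<odot>\<^bsub>K i\<^esub> f" using f by (simp add: K.smult_l_minus Z_def)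
  thus "\<ominus>\<^bsub>K i\<^esub> f \<in> Z i" using sm f by simp
  show "s \<odot>\<^bsub>K i\<^esub> f \<in> Z i" if "s \<in> carrier S" for s by (rule sm[OF that f])
  fix g assume g: "g \<in> Z i"
  show "f \<oplus>\<^bsub>K i\<^esub> g \<in> Z i" using f g d_add[of f i g] by (auto simp: Z_def)
qed

lemma d_operator_map:
  assumes T: "T \<subseteq> carrier S" and V: "stable (K (Suc i)) T V"
  shows "operator_map S (K (Suc i)) (K i) T d V"
proof (intro operator_map.intro operator_map_axioms.intro K_module T V)
  note V' = stableD(1)[OF V]
  fix f assume f: "f \<in> V"
  show "d f \<in> carrier (K i)" by (rule d_closed[OF V'[OF f]])
  show "d (t \<odot>\<^bsub>K (Suc i)\<^esub> f) = t \<odot>\<^bsub>K i\<^esub> d f" if "t \<in> T" for t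
    using d_smult[OF V'[OF f]] that T by (auto simp: koszul_simps(4))
  fix g assume g: "g \<in> V"
  show "d (f \<oplus>\<^bsub>K (Suc i)\<^esub> g) = d f \<oplus>\<^bsub>K i\<^esub> d g"
    using d_add[OF V'[OF f] V'[OF g]] by (simp add: koszul_simps(3))
qed

lemma d_image_stable:
  assumes "T \<subseteq> carrier S" "stable (K (Suc i)) T V" shows "stable (K i) T (d ` V)"
  by (rule operator_map.image_stable[OF d_operator_map[OF assms] assms(2) subset_refl])

lemma B_stable: "stable (K i) (carrier S) (B i)"
  unfolding B_def by (rule d_image_stable) (use module.stable_carrier[OF K_module] in auto)

lemma B_subset_Z: "B i \<subseteq> Z i" unfolding B_def Z_def using d_closed d_d by blast

lemma K_component_stable: "stable (K i) A1 (component (K i) n)"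
proof (rule stableI)
  show "component (K i) n \<subseteq> carrier (K i)" by (auto simp: koszul_simps(5))
  interpret K: module S "K i" by (rule K_module)
  show "\<zero>\<^bsub>K i\<^esub> \<in> component (K i) n"
    using component_props(2) K.M.zero_closed by (auto simp: koszul_simps(2,5))
  fix f assume f: "f \<in> component (K i) n"
  hence fK: "f \<in> carrier (K i)" and fT: "\<And>T. kdeg T \<le> n \<Longrightarrow> f T \<in> component M (n - kdeg T)" "\<And>T. \<not> kdeg T \<le> n \<Longrightarrow> f T = \<zero>"
    by (auto simp: koszul_simps(5) split: if_splits)
  have "\<ominus>\<^bsub>K i\<^esub> f \<in> carrier (K i)" using fK by simp
  thus "\<ominus>\<^bsub>K i\<^esub> f \<in> component (K i) n"
    using fT component_props(4) unfolding koszul_simps(5) by (auto simp: K_inv[OF fK])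
  show "t \<odot>\<^bsub>K i\<^esub> f \<in> component (K i) n" if t: "t \<in> A1" for t
  proof -
    have tS: "t \<in> carrier S" using t scalars_subset by blast
    have "t \<odot>\<^bsub>K i\<^esub> f \<in> carrier (K i)" using fK tS by simp
    thus ?thesis using fT stableD(5)[OF component_stable t] tS unfolding koszul_simps(5) by (auto simp: koszul_simps(4))
  qed
  fix g assume g: "g \<in> component (K i) n"
  hence gK: "g \<in> carrier (K i)" and gT: "\<And>T. kdeg T \<le> n \<Longrightarrow> g T \<in> component M (n - kdeg T)" "\<And>T. \<not> kdeg T \<le> n \<Longrightarrow> g T = \<zero>"
    by (auto simp: koszul_simps(5) split: if_splits)
  have "f \<oplus>\<^bsub>K i\<^esub> g \<in> carrier (K i)" using fK gK by simp
  thus "f \<oplus>\<^bsub>K i\<^esub> g \<in> component (K i) n"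
    using fT gT component_props(3) unfolding koszul_simps(5) by (auto simp: koszul_simps(3))
qed

lemma K_componentI:
  assumes "f \<in> carrier (K i)" "\<And>T. T \<subseteq> D \<Longrightarrow> card T = i \<Longrightarrow> kdeg T \<le> n \<Longrightarrow> f T \<in> component M (n - kdeg T)"
    "\<And>T. T \<subseteq> D \<Longrightarrow> card T = i \<Longrightarrow> \<not> kdeg T \<le> n \<Longrightarrow> f T = \<zero>"
  shows "f \<in> component (K i) n"
  unfolding koszul_simps(5)
proof (intro CollectI conjI allI assms(1))
  fix T
  show "if kdeg T \<le> n then f T \<in> component M (n - kdeg T) else f T = \<zero>"
  proof (cases "T \<subseteq> D \<and> card T = i")
    case True
    thus ?thesis using assms(2,3) by simp
  next
    case False
    thus ?thesis using K_carrierD(2)[OF assms(1) False] component_props(2) by simp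
  qed
qed

lemma K_componentD:
  assumes "f \<in> component (K i) n"
  shows "f \<in> carrier (K i)" "kdeg T \<le> n \<Longrightarrow> f T \<in> component M (n - kdeg T)" "\<not> kdeg T \<le> n \<Longrightarrow> f T = \<zero>"
  using assms unfolding koszul_simps(5) by (simp_all split: if_splits)

text \<open>
  The homogeneous part of degree \<open>n\<close> of an element of a Koszul module.  It commutes with the
  differential (\<open>part_d\<close>), so boundaries of degree \<open>n\<close> come from chains of degree \<open>n\<close>.
\<close>

definition part :: "nat ^ 'd \<Rightarrow> (nat set \<Rightarrow> 'm) \<Rightarrow> nat set \<Rightarrow> 'm" where
  "part n f T = (if kdeg T \<le> n then hcomp M (f T) (n - kdeg T) else \<zero>)"

lemma part_component:
  assumes f: "f \<in> carrier (K i)" shows "part n f \<in> component (K i) n"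
proof (rule K_componentI)
  show "part n f \<in> carrier (K i)"
    by (rule K_carrierI) (use K_carrierD[OF f] in \<open>auto simp: part_def\<close>)
qed (use K_carrierD(1)[OF f] hcomp_spec(1) in \<open>auto simp: part_def\<close>)

lemma part_of_component: "f \<in> component (K i) n \<Longrightarrow> part n f = f"
proof
  fix T assume f: "f \<in> component (K i) n"
  show "part n f T = f T"
    using K_componentD(2,3)[OF f, of T] hcomp_component[of "f T" "n - kdeg T" "n - kdeg T"] by (auto simp: part_def)
qed

lemma part_d:
  assumes f: "f \<in> carrier (K (Suc i))" shows "d (part n f) = part n (d f)"
proof
  fix T
  show "d (part n f) T = part n (d f) T"
  proof (cases "finite T")
    case False
    hence "\<not> (T \<subseteq> D \<and> card T = i)" using finite_subset[of T D] by auto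
    moreover have "part n f \<in> carrier (K (Suc i))" using part_component[OF f] K_componentD(1) by blast
    ultimately show ?thesis using K_carrierD(2)[OF d_closed] f by (simp add: part_def)
  next
    case True
    have kdeg: "kdeg (insert t T) = kdeg T + axis (snd (xs ! t)) 1" if "t \<in> D - T" for t
      using koszul_degree_insert[OF True, of t xs] that by simp
    have pc: "part n f (insert t T) \<in> carrier M" for t
      using part_component[OF f] K_componentD(1) K_carrierD(1) by blast
    show ?thesis
    proof (cases "kdeg T \<le> n")
      case le: True
      have "part n (d f) T = (\<Oplus>t\<in>D - T. hcomp M (coef T t \<odot> f (insert t T)) (n - kdeg T))"
        using le hcomp_finsum[of "D - T" "\<lambda>t. coef T t \<odot> f (insert t T)"] term_closed[OF f] by (simp add: part_def d_eq)
      also have "\<dots> = (\<Oplus>t\<in>D - T. coef T t \<odot> part n f (insert t T))"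
      proof (rule finsum_cong')
        fix t assume t: "t \<in> D - T"
        let ?a = "axis (snd (xs ! t)) 1 :: nat ^ 'd"
        have c: "coef T t \<in> component S ?a" using coef_component t by simp
        have "?a \<le> n - kdeg T \<longleftrightarrow> kdeg (insert t T) \<le> n"
          unfolding kdeg[OF t] using le unfolding less_eq_vec_def by (simp add: Nat.le_diff_conv2 add.commute)
        moreover have "n - kdeg T - ?a = n - kdeg (insert t T)" unfolding kdeg[OF t] by (simp add: vec_eq_iff)
        ultimately show "hcomp M (coef T t \<odot> f (insert t T)) (n - kdeg T) = coef T t \<odot> part n f (insert t T)"
          using hcomp_smult[OF c K_carrierD(1)[OF f], of "insert t T" "n - kdeg T"] SG.component_closed[OF c]
          by (auto simp: part_def)
      qed (use pc coef_closed in auto)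
      finally show ?thesis unfolding d_eq[of "part n f"] by simp
    next
      case False
      have z: "part n f (insert t T) = \<zero>" if t: "t \<in> D - T" for t
      proof -
        have "\<not> kdeg (insert t T) \<le> n" unfolding kdeg[OF t] using False vec_le_add[of "kdeg T"] order_trans by blast
        thus ?thesis by (simp add: part_def)
      qed
      have "d (part n f) T = (\<Oplus>t\<in>D - T. \<zero>)" unfolding d_eq
        by (rule finsum_cong') (use z coef_closed in auto)
      thus ?thesis using False by (simp add: part_def)
    qed
  qed
qed

lemma B_Int_component: "B i \<inter> component (K i) n = d ` component (K (Suc i)) n"
proof (intro equalityI subsetI)
  fix y assume y: "y \<in> B i \<inter> component (K i) n"
  then obtain f where f: "f \<in> carrier (K (Suc i))" "y = d f" unfolding B_def by blast
  have "part n y = y" by (rule part_of_component) (use y in blast)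
  hence "y = part n y" by simp
  also have "\<dots> = d (part n f)" using part_d[OF f(1)] f(2) by simp
  finally show "y \<in> d ` component (K (Suc i)) n" using part_component[OF f(1)] by blast
next
  fix y assume "y \<in> d ` component (K (Suc i)) n"
  then obtain f where f: "f \<in> component (K (Suc i)) n" "y = d f" by blast
  have fK: "f \<in> carrier (K (Suc i))" by (rule K_componentD(1)[OF f(1)])
  have "part n y = d (part n f)" unfolding f(2) by (rule part_d[OF fK, symmetric])
  also have "part n f = f" by (rule part_of_component[OF f(1)])
  finally have "part n y = y" using f(2) by simp
  moreover have "part n y \<in> component (K i) n" by (rule part_component) (use d_closed[OF fK] f(2) in simp)
  ultimately show "y \<in> B i \<inter> component (K i) n" using fK f(2) unfolding B_def by auto
qed

end

section \<open>The Euler--Poincare characteristic\<close>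

context koszul begin

definition k_len :: "nat \<Rightarrow> nat ^ 'd \<Rightarrow> enat" where
  "k_len i n = interval_len (K i) A1 {\<zero>\<^bsub>K i\<^esub>} (component (K i) n)"
definition z_len :: "nat \<Rightarrow> nat ^ 'd \<Rightarrow> enat" where
  "z_len i n = interval_len (K i) A1 {\<zero>\<^bsub>K i\<^esub>} (Z i \<inter> component (K i) n)"
definition b_len :: "nat \<Rightarrow> nat ^ 'd \<Rightarrow> enat" where
  "b_len i n = interval_len (K i) A1 {\<zero>\<^bsub>K i\<^esub>} (B i \<inter> component (K i) n)"
definition h_len :: "nat \<Rightarrow> nat ^ 'd \<Rightarrow> enat" where
  "h_len i n = interval_len (K i) A1 (B i \<inter> component (K i) n) (Z i \<inter> component (K i) n)"

lemma K_stables: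
  "stable (K i) A1 {\<zero>\<^bsub>K i\<^esub>}" "stable (K i) A1 (Z i \<inter> component (K i) n)" "stable (K i) A1 (B i \<inter> component (K i) n)"
  using module.stable_zero[OF K_module scalars_subset]
    stable_Int[OF stable_antimono[OF Z_stable scalars_subset] K_component_stable]
    stable_Int[OF stable_antimono[OF B_stable scalars_subset] K_component_stable] by auto

lemma homology_length: "component_length A S (koszul_homology S M xs i) n = int (the_enat (h_len i n))"
proof -
  let ?G = "graded_sub (K i) (Z i)" and ?C = "component (K i) n"
  have H: "koszul_homology S M xs i = graded_quot ?G (B i)"
    by (simp add: koszul_homology_def Z_def B_def)
  have Zs: "submodule (Z i) S (K i)" using module.submodule_iff_stable[OF K_module] Z_stable by blast
  have G: "module S ?G" by (rule module_graded_sub[OF K_module Zs])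
  have "stable ?G (carrier S) (B i)" using stable_graded_sub_iff[OF K_module Zs B_subset_Z] B_stable by blast
  hence Bs: "submodule (B i) S ?G" using module.submodule_iff_stable[OF G] by blast
  have ZC: "stable ?G A1 (Z i \<inter> ?C)" using stable_graded_sub_iff[OF K_module Zs, of "Z i \<inter> ?C"] K_stables(2) by blast
  have mH: "module S (graded_quot ?G (B i))" by (rule module_graded_quot[OF G Bs])
  have comp: "component (graded_quot ?G (B i)) n = coset_rep ?G (B i) ` (Z i \<inter> ?C)" by simp
  have st: "stable (graded_quot ?G (B i)) A1 (component (graded_quot ?G (B i)) n)"
    unfolding comp by (rule coset_rep_image_stable[OF G Bs scalars_subset ZC])
  have "module_length A (component_module S (graded_quot ?G (B i)) n) =
      interval_len (graded_quot ?G (B i)) A1 {\<zero>\<^bsub>graded_quot ?G (B i)\<^esub>} (coset_rep ?G (B i) ` (Z i \<inter> ?C))"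
    using module_length_stable[OF mH st] unfolding comp .
  also have "\<dots> = interval_len ?G A1 (B i \<inter> (Z i \<inter> ?C)) (Z i \<inter> ?C)"
    by (rule interval_len_quot[OF G Bs scalars_subset ZC])
  also have "B i \<inter> (Z i \<inter> ?C) = B i \<inter> ?C" using B_subset_Z by blast
  also have "interval_len ?G A1 (B i \<inter> ?C) (Z i \<inter> ?C) = h_len i n" unfolding h_len_def
    by (rule interval_len_sub[OF K_module Zs]) blast
  finally show ?thesis unfolding component_length_def H by simp
qed

lemma z_len_split: "z_len i n = b_len i n + h_len i n"
  unfolding z_len_def b_len_def h_len_def
  by (rule module.interval_len_add[OF K_module scalars_subset K_stables(1,3,2)])
    (use B_subset_Z stableD(2)[OF K_stables(3)] in auto)

lemma k_len_split: "k_len (Suc i) n = z_len (Suc i) n + b_len i n"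
proof -
  let ?K = "K (Suc i)" let ?C = "component ?K n"
  interpret f: operator_map S ?K "K i" A1 d ?C by (rule d_operator_map[OF scalars_subset K_component_stable])
  have "k_len (Suc i) n = z_len (Suc i) n + interval_len ?K A1 (Z (Suc i) \<inter> ?C) ?C"
    unfolding k_len_def z_len_def
    by (rule module.interval_len_add[OF K_module scalars_subset K_stables(1,2) K_component_stable])
      (use stableD(2)[OF K_stables(2)] in auto)
  moreover have "interval_len ?K A1 (Z (Suc i) \<inter> ?C) ?C = b_len i n"
    unfolding b_len_def
  proof (rule f.interval_len_iso[OF K_stables(2,1,3)])
    show "{\<zero>\<^bsub>K i\<^esub>} \<subseteq> B i \<inter> component (K i) n" using stableD(2)[OF K_stables(3)] by blast
    show "d f \<in> B i \<inter> component (K i) n" if "f \<in> ?C" for f unfolding B_Int_component using that by blast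
    show "d f \<in> {\<zero>\<^bsub>K i\<^esub>} \<longleftrightarrow> f \<in> Z (Suc i) \<inter> ?C" if "f \<in> ?C" for f
      using that K_componentD(1)[OF that] by (auto simp: Z_def koszul_simps(2))
    fix y assume y: "y \<in> B i \<inter> component (K i) n"
    then obtain f where f: "f \<in> ?C" "y = d f" unfolding B_Int_component by blast
    have "y = d f \<oplus>\<^bsub>K i\<^esub> \<zero>\<^bsub>K i\<^esub>" using f.f_closed[OF f(1)] f(2) by simp
    thus "\<exists>x\<in>?C. \<exists>u\<in>{\<zero>\<^bsub>K i\<^esub>}. y = d x \<oplus>\<^bsub>K i\<^esub> u" using f(1) by blast
  qed auto
  ultimately show ?thesis by simp
qed

lemma k_len_zero: "k_len 0 n = z_len 0 n"
proof -
  have "Z 0 = carrier (K 0)" using d_zero_level by (auto simp: Z_def)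
  hence "Z 0 \<inter> component (K 0) n = component (K 0) n" using K_componentD(1) by blast
  thus ?thesis by (simp add: k_len_def z_len_def)
qed

lemma b_len_top: "b_len (length xs) n = 0"
proof -
  let ?N = "length xs"
  have "f T = \<zero>" if "f \<in> carrier (K (Suc ?N))" for f T
  proof (rule K_carrierD(2)[OF that], rule notI)
    assume "T \<subseteq> D \<and> card T = Suc ?N"
    thus False using card_mono[of D T] by simp
  qed
  hence f0: "f = \<zero>\<^bsub>K (Suc ?N)\<^esub>" if "f \<in> carrier (K (Suc ?N))" for f
    using that unfolding koszul_simps(2) by blast
  interpret f: operator_map S "K (Suc ?N)" "K ?N" "carrier S" d "carrier (K (Suc ?N))"
    by (rule d_operator_map) (use module.stable_carrier[OF K_module] in auto)
  have "B ?N \<subseteq> {\<zero>\<^bsub>K ?N\<^esub>}"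
  proof
    fix y assume "y \<in> B ?N"
    then obtain f where f: "f \<in> carrier (K (Suc ?N))" "y = d f" unfolding B_def by blast
    show "y \<in> {\<zero>\<^bsub>K ?N\<^esub>}" unfolding f(2) f0[OF f(1)] f.f_zero by simp
  qed
  hence "B ?N \<inter> component (K ?N) n = {\<zero>\<^bsub>K ?N\<^esub>}" using stableD(2)[OF K_stables(3)] by blast
  thus ?thesis by (simp add: b_len_def)
qed

lemma evaluation_operator_map:
  assumes V: "stable (K i) A1 V" shows "operator_map S (K i) M A1 (\<lambda>f. f T) V"
proof (intro operator_map.intro operator_map_axioms.intro K_module module_axioms scalars_subset V)
  fix f assume f: "f \<in> V"
  show "f T \<in> carrier M" by (rule K_carrierD(1)[OF stableD(1)[OF V f]])
qed (simp_all add: koszul_simps(3,4))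

text \<open>
  Evaluation at \<open>T\<close> splits off one summand \<open>M(- deg e\<^sub>T)\<close> of the Koszul module at a time.
\<close>

lemma k_len_eq: "k_len i n = (\<Sum>T | T \<subseteq> D \<and> card T = i. if kdeg T \<le> n then clen (n - kdeg T) else 0)"
proof -
  let ?C = "component (K i) n" and ?I = "{T. T \<subseteq> D \<and> card T = i}"
  define L where "L F = {f \<in> ?C. \<forall>T. T \<notin> F \<longrightarrow> f T = \<zero>}" for F
  have L_stable: "stable (K i) A1 (L F)" for F
  proof (rule stableI)
    note C' = stableD[OF K_component_stable[of i n]]
    show "L F \<subseteq> carrier (K i)" unfolding L_def using C'(1) by blast
    show "\<zero>\<^bsub>K i\<^esub> \<in> L F" unfolding L_def using C'(2) by (auto simp: koszul_simps(2))
    fix f assume f: "f \<in> L F"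
    hence fC: "f \<in> ?C" and f0: "\<And>T. T \<notin> F \<Longrightarrow> f T = \<zero>" by (auto simp: L_def)
    have "\<ominus>\<^bsub>K i\<^esub> f = (\<lambda>T. \<ominus> f T)" by (rule K_inv[OF C'(1)[OF fC]])
    thus "\<ominus>\<^bsub>K i\<^esub> f \<in> L F" unfolding L_def using C'(4)[OF fC] f0 by simp
    show "t \<odot>\<^bsub>K i\<^esub> f \<in> L F" if "t \<in> A1" for t
      unfolding L_def using C'(5)[OF that fC] f0 scalars_subset that by (auto simp: koszul_simps(4))
    fix g assume g: "g \<in> L F"
    hence gC: "g \<in> ?C" and g0: "\<And>T. T \<notin> F \<Longrightarrow> g T = \<zero>" by (auto simp: L_def)
    show "f \<oplus>\<^bsub>K i\<^esub> g \<in> L F" unfolding L_def using C'(3)[OF fC gC] f0 g0 by (simp add: koszul_simps(3))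
  qed
  have step: "interval_len (K i) A1 (L F) (L (insert T F)) = (if kdeg T \<le> n then clen (n - kdeg T) else 0)"
    if T: "T \<in> ?I" "T \<notin> F" for T F
  proof -
    let ?V = "L (insert T F)" and ?W = "if kdeg T \<le> n then component M (n - kdeg T) else {\<zero>}"
    interpret f: operator_map S "K i" M A1 "\<lambda>f. f T" ?V by (rule evaluation_operator_map[OF L_stable])
    have "interval_len (K i) A1 (L F) ?V = interval_len M A1 {\<zero>} ?W"
    proof (rule f.interval_len_iso[OF L_stable])
      show "stable M A1 {\<zero>}" by (rule stable_zero[OF scalars_subset])
      show "stable M A1 ?W" using component_stable stable_zero[OF scalars_subset] by simp
      show "L F \<subseteq> ?V" unfolding L_def by blast
      show "{\<zero>} \<subseteq> ?W" using component_props(2) by simp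
      fix f assume f: "f \<in> ?V"
      hence fC: "f \<in> ?C" by (simp add: L_def)
      show "f T \<in> ?W" using K_componentD(2,3)[OF fC] by simp
      show "f T \<in> {\<zero>} \<longleftrightarrow> f \<in> L F" using f T(2) by (auto simp: L_def)
    next
      fix y assume y: "y \<in> ?W"
      have yM: "y \<in> carrier M" using y component_closed by (auto split: if_splits)
      let ?f = "\<lambda>T'. if T' = T then y else \<zero>"
      have "?f \<in> carrier (K i)" by (rule K_carrierI) (use yM T(1) in auto)
      hence "?f \<in> ?C" by (rule K_componentI) (use y component_props(2) in \<open>auto split: if_splits\<close>)
      hence fV: "?f \<in> ?V" by (simp add: L_def)
      show "\<exists>f\<in>?V. \<exists>u\<in>{\<zero>}. y = f T \<oplus> u"
        by (intro bexI[OF _ fV] bexI[of _ "\<zero>"]) (use yM in simp_all)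
    qed
    thus ?thesis by (simp add: clen_def)
  qed
  have sum: "interval_len (K i) A1 {\<zero>\<^bsub>K i\<^esub>} (L F) = (\<Sum>T\<in>F. if kdeg T \<le> n then clen (n - kdeg T) else 0)"
    if "finite F" "F \<subseteq> ?I" for F
    using that
  proof (induction F)
    case empty
    have "L {} = {\<zero>\<^bsub>K i\<^esub>}"
    proof
      show "L {} \<subseteq> {\<zero>\<^bsub>K i\<^esub>}" unfolding L_def koszul_simps(2) by auto
      show "{\<zero>\<^bsub>K i\<^esub>} \<subseteq> L {}" using stableD(2)[OF L_stable] by blast
    qed
    thus ?case by simp
  next
    case (insert T F)
    have "interval_len (K i) A1 {\<zero>\<^bsub>K i\<^esub>} (L (insert T F)) =
        interval_len (K i) A1 {\<zero>\<^bsub>K i\<^esub>} (L F) + interval_len (K i) A1 (L F) (L (insert T F))"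
      by (rule module.interval_len_add[OF K_module scalars_subset K_stables(1) L_stable L_stable])
        (use stableD(2)[OF L_stable] in \<open>auto simp: L_def\<close>)
    thus ?case using insert step[of T F] by (simp add: add.commute)
  qed
  have "f T = \<zero>" if "f \<in> ?C" "T \<notin> ?I" for f T
    by (rule K_carrierD(2)[OF K_componentD(1)[OF that(1)]]) (use that(2) in simp)
  hence "L ?I = ?C" unfolding L_def by blast
  thus ?thesis using sum[of ?I] by (simp add: k_len_def)
qed

lemma lens_finite: "k_len i n < \<infinity>" "z_len i n < \<infinity>" "b_len i n < \<infinity>" "h_len i n < \<infinity>"
proof -
  have fin: "(\<Sum>T\<in>F. if kdeg T \<le> n then clen (n - kdeg T) else 0) < \<infinity>" if "finite F" for F
    using that
  proof (induction F)
    case (insert T F)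
    let ?g = "\<lambda>T. if kdeg T \<le> n then clen (n - kdeg T) else 0"
    have t: "?g T < \<infinity>" using clen_finite[of "n - kdeg T"] by (auto simp: zero_enat_def)
    have "sum ?g (insert T F) = ?g T + sum ?g F" using insert by simp
    thus ?case using t insert.IH by (cases "?g T"; cases "sum ?g F") auto
  qed simp
  have k: "k_len i n < \<infinity>" for i unfolding k_len_eq by (rule fin) simp
  show "k_len i n < \<infinity>" by (rule k)
  have z: "z_len i n \<le> k_len i n"
    by (cases i) (simp_all add: k_len_zero k_len_split)
  thus "z_len i n < \<infinity>" using k by (rule le_less_trans)
  thus "b_len i n < \<infinity>" "h_len i n < \<infinity>" unfolding z_len_split by (auto simp: plus_eq_infty_iff_enat)
qed

lemma koszul_degree_mono: "T \<subseteq> D \<Longrightarrow> kdeg T \<le> kdeg D"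
proof -
  assume T: "T \<subseteq> D"
  have "kdeg D = kdeg T + kdeg (D - T)" unfolding koszul_degree_def
    by (subst sum.subset_diff[OF T]) (simp_all add: add.commute)
  thus ?thesis using vec_le_add by simp
qed

text \<open>
  With \<open>z\<^sub>i\<close> and \<open>b\<^sub>i\<close> the lengths of cycles and boundaries, the \<open>i\<close>-th homology has length
  \<open>z\<^sub>i - b\<^sub>i\<close> and the \<open>i\<close>-th Koszul module has length \<open>z\<^sub>i + b\<^sub>i\<^sub>-\<^sub>1\<close>, so the two alternating sums differ
  only by the last boundary term, which is \<open>0\<close>.
\<close>

lemma alternating_homology:
  assumes n: "kdeg D \<le> n"
  shows "(\<Sum>i\<le>length xs. (- 1) ^ i * component_length A S (koszul_homology S M xs i) n) =
    (\<Sum>T\<in>Pow D. (- 1) ^ card T * component_length A S M (n - kdeg T))"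
proof -
  define kk where "kk i = int (the_enat (k_len i n))" for i
  define zz where "zz i = int (the_enat (z_len i n))" for i
  define bb where "bb i = int (the_enat (b_len i n))" for i
  have h: "component_length A S (koszul_homology S M xs i) n = zz i - bb i" for i
    unfolding homology_length zz_def bb_def z_len_split using alg.the_enat_add[OF lens_finite(3,4)] by simp
  have ks: "kk (Suc i) = zz (Suc i) + bb i" for i
    unfolding kk_def zz_def bb_def k_len_split using alg.the_enat_add[OF lens_finite(2,3)] by simp
  have k0: "kk 0 = zz 0" unfolding kk_def zz_def k_len_zero ..
  have "(\<Sum>i\<le>m. (- 1) ^ i * (zz i - bb i)) = (\<Sum>i\<le>m. (- 1) ^ i * kk i) - (- 1) ^ m * bb m" for m
    by (induction m) (simp_all add: k0 ks algebra_simps)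
  from this[of "length xs"] have "(\<Sum>i\<le>length xs. (- 1) ^ i * (zz i - bb i)) = (\<Sum>i\<le>length xs. (- 1) ^ i * kk i)"
    by (simp add: bb_def b_len_top)
  moreover have "kk i = (\<Sum>T\<in>{T \<in> Pow D. card T = i}. component_length A S M (n - kdeg T))" for i
  proof -
    have fin: "the_enat (\<Sum>T\<in>F. g T) = (\<Sum>T\<in>F. the_enat (g T)) \<and> (\<Sum>T\<in>F. g T) < \<infinity>"
      if "finite F" "\<And>T. T \<in> F \<Longrightarrow> g T < \<infinity>" for F :: "nat set set" and g
      using that
    proof (induction F)
      case (insert T F)
      thus ?case using alg.the_enat_add[of "g T" "sum g F"] by (auto simp: plus_eq_infty_iff_enat)
    qed simp
    have "k_len i n = (\<Sum>T\<in>{T \<in> Pow D. card T = i}. clen (n - kdeg T))"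
      unfolding k_len_eq by (rule sum.cong) (use order_trans[OF koszul_degree_mono n] in auto)
    moreover have "the_enat \<dots> = (\<Sum>T\<in>{T \<in> Pow D. card T = i}. the_enat (clen (n - kdeg T)))"
      by (rule fin[THEN conjunct1]) (use clen_finite in auto)
    ultimately show ?thesis unfolding kk_def component_length_eq by simp
  qed
  hence "(\<Sum>i\<le>length xs. (- 1) ^ i * kk i) =
      (\<Sum>i\<le>length xs. \<Sum>T\<in>{T \<in> Pow D. card T = i}. (- 1) ^ card T * component_length A S M (n - kdeg T))"
    by (simp add: sum_distrib_left)
  also have "\<dots> = (\<Sum>T\<in>Pow D. (- 1) ^ card T * component_length A S M (n - kdeg T))"
  proof (rule sum.group)
    show "card ` Pow D \<subseteq> {..length xs}"
    proof
      fix c assume "c \<in> card ` Pow D"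
      then obtain T where "T \<subseteq> D" "c = card T" by auto
      thus "c \<in> {..length xs}" using card_mono[of D T] by simp
    qed
  qed auto
  ultimately show ?thesis unfolding h by simp
qed

end

lemma koszul_degree_full:
  "koszul_degree xs {..<length xs} $ j = count_list (map snd xs) j"
proof -
  have "koszul_degree xs {..<length xs} $ j = (\<Sum>t<length xs. axis (snd (xs ! t)) 1 $ j)"
    by (simp add: koszul_degree_def)
  also have "\<dots> = (\<Sum>t<length xs. if snd (xs ! t) = j then 1 else 0)"
    by (rule sum.cong) (auto simp: axis_def)
  also have "\<dots> = count_list (map snd xs) j"
  proof (induction xs rule: rev_induct)
    case (snoc x xs)
    have "(\<Sum>t<length xs. if snd ((xs @ [x]) ! t) = j then 1 else 0 :: nat) =
        (\<Sum>t<length xs. if snd (xs ! t) = j then 1 else 0)"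
      by (rule sum.cong) (auto simp: nth_append)
    thus ?case using snoc by (simp add: count_list_append)
  qed simp
  finally show ?thesis .
qed

text \<open>
  A new position splits the sum over its subsets into the old sum and minus the old sum in degree
  \<open>n - e\<^sub>j\<close>, which is a difference and shifts the coefficients by \<open>e\<^sub>j\<close>.
\<close>

lemma represents_koszul:
  fixes xs :: "('s \<times> 'd::finite) list"
  assumes f: "represents e f"
  shows "represents (shift_coeff (koszul_degree xs {..<length xs}) e)
    (\<lambda>n. \<Sum>T\<in>Pow {..<length xs}. (- 1) ^ card T * f (n - koszul_degree xs T))"
proof (induction xs rule: rev_induct)
  case Nil
  have "n - 0 = n" for n :: "nat ^ 'd" by (simp add: vec_eq_iff)
  thus ?case using f by (simp add: koszul_degree_def)
next
  case (snoc x xs)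
  let ?D = "{..<length xs}" and ?a = "axis (snd x) 1 :: nat ^ 'd"
  define g where "g n = (\<Sum>T\<in>Pow ?D. (- 1) ^ card T * f (n - koszul_degree xs T))" for n
  have deg: "koszul_degree (xs @ [x]) T = koszul_degree xs T" if "T \<subseteq> ?D" for T
    unfolding koszul_degree_def by (rule sum.cong) (use that in \<open>auto simp: nth_append\<close>)
  have deg': "koszul_degree (xs @ [x]) (insert (length xs) T) = koszul_degree xs T + ?a" if T: "T \<subseteq> ?D" for T
    using koszul_degree_insert[of T "length xs" "xs @ [x]"] deg[OF T] T finite_subset[OF T] by auto
  have D: "{..<length (xs @ [x])} = insert (length xs) ?D" by auto
  have "(\<Sum>T\<in>Pow {..<length (xs @ [x])}. (- 1) ^ card T * f (n - koszul_degree (xs @ [x]) T)) = g n - g (n - ?a)" for n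
  proof -
    let ?h = "\<lambda>T. (- 1) ^ card T * f (n - koszul_degree (xs @ [x]) T)"
    have inj: "inj_on (insert (length xs)) (Pow ?D)" 
    proof (rule inj_onI)
      fix T T' assume "T \<in> Pow ?D" "T' \<in> Pow ?D" and eq: "insert (length xs) T = insert (length xs) T'"
      hence "length xs \<notin> T" "length xs \<notin> T'" by auto
      thus "T = T'" using eq by (simp add: insert_ident)
    qed
    have "(\<Sum>T\<in>Pow {..<length (xs @ [x])}. ?h T) = (\<Sum>T\<in>Pow ?D. ?h T) + (\<Sum>T\<in>insert (length xs) ` Pow ?D. ?h T)"
      unfolding D Pow_insert by (rule sum.union_disjoint) auto
    also have "(\<Sum>T\<in>insert (length xs) ` Pow ?D. ?h T) = (\<Sum>T\<in>Pow ?D. ?h (insert (length xs) T))"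
      by (rule sum.reindex_cong[OF inj]) auto
    also have "\<dots> = (\<Sum>T\<in>Pow ?D. - ((- 1) ^ card T * f (n - ?a - koszul_degree xs T)))"
    proof (rule sum.cong)
      fix T assume "T \<in> Pow ?D"
      hence T: "T \<subseteq> ?D" by simp
      have "card (insert (length xs) T) = Suc (card T)" using T finite_subset[OF T] by (subst card_insert_disjoint) auto
      moreover have "n - (koszul_degree xs T + ?a) = n - ?a - koszul_degree xs T" by (simp add: vec_eq_iff add.commute)
      ultimately show "?h (insert (length xs) T) = - ((- 1) ^ card T * f (n - ?a - koszul_degree xs T))"
        using deg'[OF T] by simp
    qed simp
    also have "\<dots> = - g (n - ?a)" by (simp add: g_def sum_negf)
    also have "(\<Sum>T\<in>Pow ?D. ?h T) = g n" unfolding g_def by (rule sum.cong) (use deg in auto)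
    finally show ?thesis by simp
  qed
  moreover have "koszul_degree (xs @ [x]) {..<length (xs @ [x])} = koszul_degree xs ?D + ?a"
    unfolding D by (rule deg') simp
  moreover have "represents (\<lambda>h. e (h + ?a + koszul_degree xs ?D)) (\<lambda>n. g n - g (n - ?a))"
    using represents_step[OF snoc[folded g_def], of "snd x"] .
  moreover have "(\<lambda>h. e (h + ?a + koszul_degree xs ?D)) = shift_coeff (koszul_degree xs ?D + ?a) e"
    by (simp add: ac_simps)
  ultimately show ?case by (simp only:)
qed

lemma euler_poincare_eq:
  assumes "fg_std_mod A \<mm> S M" and seq: "sequence_of_type S k xs"
    and top: "\<And>h. h > k \<Longrightarrow> hilbert_coeff A S M h = 0"
  shows "euler_poincare A S xs M = hilbert_coeff A S M k"
proof -
  interpret fg_std_mod A \<mm> S M by (rule assms(1))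
  interpret koszul A \<mm> S M xs
    by (intro koszul.intro koszul_axioms.intro assms(1)) (use seq in \<open>auto simp: sequence_of_type_def\<close>)
  let ?X = "\<lambda>n. \<Sum>i\<le>length xs. (- 1) ^ i * component_length A S (koszul_homology S M xs i) n"
  have k: "koszul_degree xs {..<length xs} = k"
    using seq by (auto simp: vec_eq_iff koszul_degree_full sequence_of_type_def)
  let ?e = "hilbert_coeff A S M"
  have rep: "represents (shift_coeff k ?e) (\<lambda>n. \<Sum>T\<in>Pow D. (- 1) ^ card T * component_length A S M (n - kdeg T))"
    using represents_koszul[OF represents_hilbert_coeff, of xs] unfolding k .
  have "shift_coeff k ?e h = 0" if "h \<noteq> 0" for h
  proof (rule top)
    have "k \<le> h + k" by (rule vec_le_add2)
    moreover have "k \<noteq> h + k" using that by simp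
    ultimately show "h + k > k" by (rule le_neq_trans)
  qed
  hence "{h. shift_coeff k ?e h \<noteq> 0} \<subseteq> {0}" by auto
  hence const: "binomial_sum (shift_coeff k ?e) n = ?e k" for n
    by (subst binomial_sum_superset[of "{0}"]) auto
  have "for_large (\<lambda>n. (\<Sum>T\<in>Pow D. (- 1) ^ card T * component_length A S M (n - kdeg T)) = ?e k)"
    using rep const by (simp add: represents_def)
  hence X: "for_large (\<lambda>n. ?X n = ?e k)"
    using for_large_ge[of "kdeg D"] by (rule for_large_mono2) (simp add: alternating_homology)
  show ?thesis unfolding euler_poincare_def
  proof (rule the_equality)
    show "for_large (\<lambda>n. ?X n = ?e k)" by (rule X)
    fix c assume "for_large (\<lambda>n. ?X n = c)"
    from X this have "for_large (\<lambda>n::nat^'d. c = ?e k)" by (rule for_large_mono2) simp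
    thus "c = ?e k" by simp
  qed
qed

theorem theorem1p2:
  fixes A :: "'a ring" and \<mm> :: "'a set"
    and S :: "('a, 's, nat ^ 'd::finite) graded_module"
    and M :: "('s, 'm, nat ^ 'd) graded_module"
    and k :: "nat ^ 'd"
  assumes "artinian_local_ring A \<mm>"
    and "infinite (carrier (A Quot \<mm>))"
    and "standard_graded_algebra A S"
    and "fg_graded_module S M"
  shows "(mixed_multiplicity_defined A S M k \<longleftrightarrow> (\<exists>xs. mixed_multiplicity_system S M k xs)) \<and>
    (\<forall>xs. mixed_multiplicity_system S M k xs \<longrightarrow>
      euler_poincare A S xs M = mixed_multiplicity_symbol A S xs M \<and>
      mixed_multiplicity_symbol A S xs M = hilbert_coeff A S M k)"
proof -
  interpret AL: artinian_local_ring A \<mm> by (rule assms(1))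
  interpret SA: standard_graded_algebra A S by (rule assms(3))
  interpret FM: fg_graded_module S M by (rule assms(4))
  have fgM: "fg_std_mod A \<mm> S M"
  proof (intro fg_std_mod.intro std_mod.intro graded_mod.intro graded_mod_axioms.intro fg_std_mod_axioms.intro)
    show "\<exists>F. finite F \<and> F \<subseteq> carrier M \<and> (\<forall>N. stable M (carrier S) N \<longrightarrow> F \<subseteq> N \<longrightarrow> N = carrier M)"
      using FM.finitely_generated FM.submodule_iff_stable by auto
  qed (use FM.component_smult SA.component_mult in
      \<open>auto intro: FM.module_axioms FM.graded_group_axioms SA.graded_group_axioms AL.artinian_local_ring_axioms
        SA.standard_graded_algebra_axioms\<close>)
  interpret fg_std_mod A \<mm> S M by (rule fgM)
  have sys: "(\<forall>h>k. hilbert_coeff A S M h = 0) \<and> mixed_multiplicity_symbol A S xs M = hilbert_coeff A S M k"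
    "euler_poincare A S xs M = hilbert_coeff A S M k"
    if "mixed_multiplicity_system S M k xs" for xs
  proof -
    have s: "sequence_of_type S k xs" "alg.no_chain_above (annihilator S M \<union> fst ` set xs)"
      using that mixed_multiplicity_system_iff by auto
    show *: "(\<forall>h>k. hilbert_coeff A S M h = 0) \<and> mixed_multiplicity_symbol A S xs M = hilbert_coeff A S M k"
      by (rule mixed_multiplicity_symbol_eq[OF fgM s])
    show "euler_poincare A S xs M = hilbert_coeff A S M k"
      by (rule euler_poincare_eq[OF fgM s(1)]) (use * in blast)
  qed
  have "mixed_multiplicity_system S M k xs \<Longrightarrow> mixed_multiplicity_defined A S M k" for xs
    using sys(1) by (simp add: mixed_multiplicity_defined_def)
  moreover have "\<exists>xs. mixed_multiplicity_system S M k xs" if "mixed_multiplicity_defined A S M k"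
    using exists_system[OF assms(2) fgM that] mixed_multiplicity_system_iff by blast
  ultimately show ?thesis using sys by auto
qed

end
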